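(* Let $n\ge 2$, let $\mu=(\mu_1,\dots,\mu_m)$ be positive integers with $\mu_1+\cdots+\mu_m=N$, and let $a_1,\dots,a_m$ be distinct complex numbers. Let $\mathcal F_\mu^*$ be the graded tensor product of the symmetric power evaluation modules $\pi_{\mu_1}[a_1],\dots,\pi_{\mu_m}[a_m]$ of $\mathfrak{sl}_n\otimes\mathbb C[t]$. Then, as graded vector spaces and $\mathfrak{sl}_n$-modules, $$\mathcal F_\mu^*\simeq\bigoplus_{\lambda\vdash N,\ \ell(\lambda)\le n}\pi_\lambda\otimes M_{\lambda,\mu},$$ where $M_{\lambda,\mu}$ is the graded multiplicity space of the Specht module $W_\lambda$ in the graded $S_N$-module $R_\mu$.
   Context: Representations. For a partition $\lambda$ with $\ell(\lambda)\le n$ parts, $\pi_\lambda$ is the irreducible $\mathfrak{sl}_n(\mathbb C)$-module of highest weight $\sum_{i=1}^{n-1}(\lambda_i-\lambda_{i+1})\omega_i$ (with $\omega_i$ the fundamental weights). For a positive integer $k$, $\pi_k$ denotes the irreducible module of highest weight $k\omega_1$, i.e. the $k$-th symmetric power of $\mathbb C^n$, with highest weight vector $v_k$. For $a\in\mathbb C$, $\pi_k[a]$ is the evaluation module: the space $\pi_k$ on which $x\otimes f(t)\in\mathfrak{sl}_n\otimes\mathbb C[t]$ acts as $f(a)x$. $\mathfrak n_-\subset\mathfrak{sl}_n$ is the subalgebra of strictly lower triangular matrices. Graded tensor product. Let $V_\mu(\mathcal A)=\pi_{\mu_1}[a_1]\otimes\cdots\otimes\pi_{\mu_m}[a_m]$,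 with the usual coproduct action of $\mathfrak{sl}_n\otimes\mathbb C[t]$, and let $w_\mu=v_{\mu_1}\otimes\cdots\otimes v_{\mu_m}$. Let $U^{(d)}\subset U(\mathfrak n_-\otimes\mathbb C[t])$ be the subspace of elements homogeneous of degree $d$ in $t$. Put $\mathcal F_\mu(\mathcal A)=U(\mathfrak n_-\otimes\mathbb C[t])w_\mu$, filtered by $\mathcal F_\mu^{(\le d)}(\mathcal A)=\sum_{d'\le d}U^{(d')}w_\mu$; these subspaces are $\mathfrak{sl}_n$-submodules. The graded tensor product is the associated graded space $\mathcal F_\mu^*=\mathrm{gr}\,\mathcal F_\mu(\mathcal A)=\bigoplus_d \mathcal F_\mu^{(\le d)}(\mathcal A)/\mathcal F_\mu^{(\le d-1)}(\mathcal A)$. The ring $R_\mu$. Let $\mathcal X=(x_1,\dots,x_N)\in\mathbb C^N$ have its first $\mu_1$ coordinates equal to $a_1$, the next $\mu_2$ equal to $a_2$, etc. $S_N$ acts on $\mathbb C[z_1,\dots,z_N]$ by permuting variables and on $\mathbb C^N$ by permuting coordinates. $I_\mu\subset\mathbb C[z_1,\dots,z_N]$ is the ideal of polynomials vanishing at every point of the $S_N$-orbit of $\mathcal X$; $A_\mu=\mathbb C[z_1,\dots,z_N]/I_\mu$, filtered by degree in the $z_i$ (the $d$-th filtered piece is the image of the polynomials of degree $\le d$), and $R_\mu=\mathrm{gr}\,A_\mu$ is the associated graded space. $R_\mu$ is a graded $S_N$-module, decomposed as $R_\mu\simeq\bigoplus_{\lambda\vdash N}W_\lambda\otimes M_{\lambda,\mu}$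 with $W_\lambda$ the irreducible Specht module of $S_N$ over $\mathbb C$ ($W_{(N)}$ trivial) and $M_{\lambda,\mu}$ graded vector spaces. *)

theory Defs
  imports
    "HOL-Library.Poly_Mapping"
    "HOL-Combinatorics.Permutations"
    "HOL-Computational_Algebra.Polynomial"
    "HOL-Algebra.Module"
    "HOL-Algebra.AbelCoset"
    "Jordan_Normal_Form.Matrix"
begin

section \<open>Complex vector spaces with operators\<close>

definition complex_field :: "complex ring" where
  "complex_field = \<lparr>carrier = UNIV, mult = (*), one = 1, zero = 0, add = (+)\<rparr>"

lemma field_complex_field: "field complex_field"
proof (rule cring.cring_fieldI2)
  show "cring complex_field"
  proof (rule cringI)
    show "abelian_group complex_field"
    proof (rule abelian_groupI)
      fix x assume "x \<in> carrier complex_field"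
      show "\<exists>y\<in>carrier complex_field. y \<oplus>\<^bsub>complex_field\<^esub> x = \<zero>\<^bsub>complex_field\<^esub>"
        by (rule bexI[of _ "- x"]) (auto simp: complex_field_def)
    qed (auto simp: complex_field_def)
    show "comm_monoid complex_field"
      by (rule comm_monoidI) (auto simp: complex_field_def)
  qed (auto simp: complex_field_def algebra_simps)
  show "\<zero>\<^bsub>complex_field\<^esub> \<noteq> \<one>\<^bsub>complex_field\<^esub>"
    by (simp add: complex_field_def)
  fix x assume "x \<in> carrier complex_field" "x \<noteq> \<zero>\<^bsub>complex_field\<^esub>"
  then show "\<exists>y\<in>carrier complex_field. x \<otimes>\<^bsub>complex_field\<^esub> y = \<one>\<^bsub>complex_field\<^esub>"
    by (intro bexI[of _ "inverse x"]) (auto simp: complex_field_def)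
qed

text \<open>A complex vector space on which the elements of a type \<open>'g\<close> (a group, a Lie algebra,
  \<dots>) act by operators. The ring fields \<open>mult\<close> and \<open>one\<close> inherited from the library's module
  record have no meaning and are never used.\<close>

record ('g, 'a) rep = "(complex, 'a) module" +
  act :: "'g \<Rightarrow> 'a \<Rightarrow> 'a"

definition with_act :: "(complex, 'a, 'z) module_scheme \<Rightarrow> ('g \<Rightarrow> 'a \<Rightarrow> 'a) \<Rightarrow> ('g, 'a) rep" where
  "with_act V \<alpha> =
     \<lparr>carrier = carrier V, mult = undefined, one = undefined, zero = \<zero>\<^bsub>V\<^esub>, add = add V,
      smult = module.smult V, act = \<alpha>\<rparr>"

definition lin_span :: "(complex, 'a, 'z) module_scheme \<Rightarrow> 'a set \<Rightarrow> 'a set" where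
  "lin_span V S = \<Inter>{H. submodule H complex_field V \<and> S \<subseteq> H}"

text \<open>\<open>V / U\<close>, with cosets as elements. The scalar multiple and the operators send a coset
  \<open>X = U + x\<close> to \<open>U + {c x' | x' \<in> X}\<close> and \<open>U + {g x' | x' \<in> X}\<close>; if \<open>U\<close> is a stable subspace,
  these are \<open>U + c x\<close> and \<open>U + g x\<close>.\<close>

definition quot_rep :: "('g, 'a) rep \<Rightarrow> 'a set \<Rightarrow> ('g, 'a set) rep" where
  "quot_rep V U =
     \<lparr>carrier = a_rcosets\<^bsub>V\<^esub> U, mult = undefined, one = undefined, zero = U, add = set_add V,
      smult = (\<lambda>c X. U <+>\<^bsub>V\<^esub> ((\<lambda>x. c \<odot>\<^bsub>V\<^esub> x) ` X)),
      act = (\<lambda>g X. U <+>\<^bsub>V\<^esub> (act V g ` X))\<rparr>"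

text \<open>The degree \<open>d\<close> component of the graded space associated with an increasing filtration
  \<open>Fil 0 \<subseteq> Fil 1 \<subseteq> \<dots>\<close>, where \<open>Fil (-1) = 0\<close>.\<close>

definition gr_piece :: "('g, 'a) rep \<Rightarrow> (nat \<Rightarrow> 'a set) \<Rightarrow> nat \<Rightarrow> ('g, 'a set) rep" where
  "gr_piece V Fil d =
     quot_rep (V\<lparr>carrier := Fil d\<rparr>) (case d of 0 \<Rightarrow> {\<zero>\<^bsub>V\<^esub>} | Suc e \<Rightarrow> Fil e)"

definition rep_iso :: "'g set \<Rightarrow> ('g, 'a) rep \<Rightarrow> ('g, 'b) rep \<Rightarrow> bool" where
  "rep_iso G V W \<longleftrightarrow> (\<exists>f. bij_betw f (carrier V) (carrier W)
     \<and> (\<forall>x\<in>carrier V. \<forall>y\<in>carrier V. f (x \<oplus>\<^bsub>V\<^esub> y) = f x \<oplus>\<^bsub>W\<^esub> f y)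
     \<and> (\<forall>c. \<forall>x\<in>carrier V. f (c \<odot>\<^bsub>V\<^esub> x) = c \<odot>\<^bsub>W\<^esub> f x)
     \<and> (\<forall>g\<in>G. \<forall>x\<in>carrier V. f (act V g x) = act W g (f x)))"

text \<open>Graded spaces are given by the sequence of their homogeneous components.\<close>

definition graded_iso :: "'g set \<Rightarrow> (nat \<Rightarrow> ('g, 'a) rep) \<Rightarrow> (nat \<Rightarrow> ('g, 'b) rep) \<Rightarrow> bool" where
  "graded_iso G V W \<longleftrightarrow> (\<forall>d. rep_iso G (V d) (W d))"

text \<open>Only used for finite index sets, where the direct sum is the full product.\<close>

definition direct_sum :: "'i set \<Rightarrow> ('i \<Rightarrow> ('g, 'a) rep) \<Rightarrow> ('g, 'i \<Rightarrow> 'a) rep" where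
  "direct_sum I V =
     \<lparr>carrier = PiE I (\<lambda>i. carrier (V i)), mult = undefined, one = undefined,
      zero = (\<lambda>i\<in>I. \<zero>\<^bsub>V i\<^esub>), add = (\<lambda>x y. \<lambda>i\<in>I. x i \<oplus>\<^bsub>V i\<^esub> y i),
      smult = (\<lambda>c x. \<lambda>i\<in>I. c \<odot>\<^bsub>V i\<^esub> x i), act = (\<lambda>g x. \<lambda>i\<in>I. act (V i) g (x i))\<rparr>"

section \<open>Free vector spaces and tensor products\<close>

text \<open>The vector space with basis \<open>B\<close>, on which \<open>g\<close> acts by the linear extension of \<open>h g\<close>.\<close>

definition free_rep :: "'b set \<Rightarrow> ('g \<Rightarrow> 'b \<Rightarrow> ('b \<Rightarrow>\<^sub>0 complex)) \<Rightarrow> ('g, 'b \<Rightarrow>\<^sub>0 complex) rep" where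
  "free_rep B h =
     \<lparr>carrier = {p. Poly_Mapping.keys p \<subseteq> B}, mult = undefined, one = undefined,
      zero = 0, add = (+), smult = (\<lambda>c. Poly_Mapping.map ((*) c)),
      act = (\<lambda>g p. \<Sum>b\<in>Poly_Mapping.keys p.
                     Poly_Mapping.map ((*) (Poly_Mapping.lookup p b)) (h g b))\<rparr>"

abbreviation basis_vec :: "'b \<Rightarrow> ('b \<Rightarrow>\<^sub>0 complex)" where
  "basis_vec b \<equiv> Poly_Mapping.single b 1"

text \<open>\<open>V \<otimes> M\<close> for a vector space \<open>M\<close> with trivial structure: \<open>g (v \<otimes> m) = g v \<otimes> m\<close>.\<close>

definition mult_free :: "('g, 'a) rep \<Rightarrow> (complex, 'm) module \<Rightarrow> ('g, 'a \<times> 'm \<Rightarrow>\<^sub>0 complex) rep" where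
  "mult_free V M = free_rep (carrier V \<times> carrier M) (\<lambda>g (v, m). basis_vec (act V g v, m))"

definition mult_relations :: "('g, 'a) rep \<Rightarrow> (complex, 'm) module \<Rightarrow> ('a \<times> 'm \<Rightarrow>\<^sub>0 complex) set" where
  "mult_relations V M =
     {basis_vec (u \<oplus>\<^bsub>V\<^esub> v, m) - basis_vec (u, m) - basis_vec (v, m) | u v m.
        u \<in> carrier V \<and> v \<in> carrier V \<and> m \<in> carrier M}
   \<union> {basis_vec (v, l \<oplus>\<^bsub>M\<^esub> m) - basis_vec (v, l) - basis_vec (v, m) | v l m.
        v \<in> carrier V \<and> l \<in> carrier M \<and> m \<in> carrier M}
   \<union> {basis_vec (c \<odot>\<^bsub>V\<^esub> v, m) - Poly_Mapping.single (v, m) c | c v m.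
        v \<in> carrier V \<and> m \<in> carrier M}
   \<union> {basis_vec (v, c \<odot>\<^bsub>M\<^esub> m) - Poly_Mapping.single (v, m) c | c v m.
        v \<in> carrier V \<and> m \<in> carrier M}"

definition mult_tensor ::
  "('g, 'a) rep \<Rightarrow> (complex, 'm) module \<Rightarrow> ('g, ('a \<times> 'm \<Rightarrow>\<^sub>0 complex) set) rep" where
  "mult_tensor V M = quot_rep (mult_free V M) (lin_span (mult_free V M) (mult_relations V M))"

text \<open>The tensor product of finitely many representations of a Lie algebra, with
  \<open>g (v\<^sub>1 \<otimes> \<dots> \<otimes> v\<^sub>m) = (\<Sum>j. v\<^sub>1 \<otimes> \<dots> \<otimes> g v\<^sub>j \<otimes> \<dots> \<otimes> v\<^sub>m)\<close>.\<close>

definition tuples :: "('g, 'a) rep list \<Rightarrow> 'a list set" where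
  "tuples Vs = {vs. length vs = length Vs \<and> (\<forall>j<length Vs. vs ! j \<in> carrier (Vs ! j))}"

definition tensor_free :: "('g, 'a) rep list \<Rightarrow> ('g, 'a list \<Rightarrow>\<^sub>0 complex) rep" where
  "tensor_free Vs = free_rep (tuples Vs)
     (\<lambda>g vs. \<Sum>j<length Vs. basis_vec (vs[j := act (Vs ! j) g (vs ! j)]))"

definition tensor_relations :: "('g, 'a) rep list \<Rightarrow> ('a list \<Rightarrow>\<^sub>0 complex) set" where
  "tensor_relations Vs =
     {basis_vec (vs[j := u \<oplus>\<^bsub>Vs ! j\<^esub> v]) - basis_vec (vs[j := u]) - basis_vec (vs[j := v]) | vs j u v.
        vs \<in> tuples Vs \<and> j < length Vs \<and> u \<in> carrier (Vs ! j) \<and> v \<in> carrier (Vs ! j)}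
   \<union> {basis_vec (vs[j := c \<odot>\<^bsub>Vs ! j\<^esub> v]) - Poly_Mapping.single (vs[j := v]) c | vs j c v.
        vs \<in> tuples Vs \<and> j < length Vs \<and> v \<in> carrier (Vs ! j)}"

definition tensor_null :: "('g, 'a) rep list \<Rightarrow> ('a list \<Rightarrow>\<^sub>0 complex) set" where
  "tensor_null Vs = lin_span (tensor_free Vs) (tensor_relations Vs)"

definition tensor_list :: "('g, 'a) rep list \<Rightarrow> ('g, ('a list \<Rightarrow>\<^sub>0 complex) set) rep" where
  "tensor_list Vs = quot_rep (tensor_free Vs) (tensor_null Vs)"

definition pure_tensor :: "('g, 'a) rep list \<Rightarrow> 'a list \<Rightarrow> ('a list \<Rightarrow>\<^sub>0 complex) set" where
  "pure_tensor Vs vs = tensor_null Vs +>\<^bsub>tensor_free Vs\<^esub> basis_vec vs"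

section \<open>Partitions and irreducible modules of the special linear Lie algebra\<close>

definition partitions :: "nat \<Rightarrow> nat list set" where
  "partitions N = {\<nu>. sorted_wrt (\<ge>) \<nu> \<and> 0 \<notin> set \<nu> \<and> sum_list \<nu> = N}"

text \<open>Parts are indexed from \<open>1\<close>.\<close>

definition part :: "nat list \<Rightarrow> nat \<Rightarrow> nat" where
  "part \<nu> i = (if 1 \<le> i \<and> i \<le> length \<nu> then \<nu> ! (i - 1) else 0)"

definition sl :: "nat \<Rightarrow> complex mat set" where
  "sl n = {A \<in> carrier_mat n n. (\<Sum>i<n. A $$ (i, i)) = 0}"

definition n_minus :: "nat \<Rightarrow> complex mat set" where
  "n_minus n = {A \<in> carrier_mat n n. \<forall>i<n. \<forall>j<n. i \<le> j \<longrightarrow> A $$ (i, j) = 0}"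

definition n_plus :: "nat \<Rightarrow> complex mat set" where
  "n_plus n = {A \<in> carrier_mat n n. \<forall>i<n. \<forall>j<n. j \<le> i \<longrightarrow> A $$ (i, j) = 0}"

definition cartan :: "nat \<Rightarrow> complex mat set" where
  "cartan n = {A \<in> sl n. \<forall>i<n. \<forall>j<n. i \<noteq> j \<longrightarrow> A $$ (i, j) = 0}"

definition fund_weight :: "nat \<Rightarrow> complex mat \<Rightarrow> complex" where
  "fund_weight i A = (\<Sum>j<i. A $$ (j, j))"

definition partition_weight :: "nat \<Rightarrow> nat list \<Rightarrow> complex mat \<Rightarrow> complex" where
  "partition_weight n \<nu> A =
     (\<Sum>i\<in>{1..n-1}. (of_nat (part \<nu> i) - of_nat (part \<nu> (i + 1))) * fund_weight i A)"

definition sl_module :: "nat \<Rightarrow> (complex mat, 'a) rep \<Rightarrow> bool" where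
  "sl_module n V \<longleftrightarrow> module complex_field V
     \<and> (\<forall>A\<in>sl n. \<forall>x\<in>carrier V. act V A x \<in> carrier V)
     \<and> (\<forall>A\<in>sl n. \<forall>x\<in>carrier V. \<forall>y\<in>carrier V.
          act V A (x \<oplus>\<^bsub>V\<^esub> y) = act V A x \<oplus>\<^bsub>V\<^esub> act V A y)
     \<and> (\<forall>A\<in>sl n. \<forall>c. \<forall>x\<in>carrier V. act V A (c \<odot>\<^bsub>V\<^esub> x) = c \<odot>\<^bsub>V\<^esub> act V A x)
     \<and> (\<forall>A\<in>sl n. \<forall>B\<in>sl n. \<forall>x\<in>carrier V. act V (A + B) x = act V A x \<oplus>\<^bsub>V\<^esub> act V B x)
     \<and> (\<forall>A\<in>sl n. \<forall>c. \<forall>x\<in>carrier V. act V (c \<cdot>\<^sub>m A) x = c \<odot>\<^bsub>V\<^esub> act V A x)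
     \<and> (\<forall>A\<in>sl n. \<forall>B\<in>sl n. \<forall>x\<in>carrier V.
          act V (A * B - B * A) x = act V A (act V B x) \<ominus>\<^bsub>V\<^esub> act V B (act V A x))"

definition irreducible_sl_module :: "nat \<Rightarrow> (complex mat, 'a) rep \<Rightarrow> bool" where
  "irreducible_sl_module n V \<longleftrightarrow> sl_module n V \<and> carrier V \<noteq> {\<zero>\<^bsub>V\<^esub>}
     \<and> (\<forall>H. submodule H complex_field V \<and> (\<forall>A\<in>sl n. \<forall>x\<in>H. act V A x \<in> H)
          \<longrightarrow> H = {\<zero>\<^bsub>V\<^esub>} \<or> H = carrier V)"

definition highest_weight_vector ::
  "nat \<Rightarrow> (complex mat \<Rightarrow> complex) \<Rightarrow> (complex mat, 'a) rep \<Rightarrow> 'a \<Rightarrow> bool" where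
  "highest_weight_vector n wt V v \<longleftrightarrow> v \<in> carrier V \<and> v \<noteq> \<zero>\<^bsub>V\<^esub>
     \<and> (\<forall>A\<in>n_plus n. act V A v = \<zero>\<^bsub>V\<^esub>)
     \<and> (\<forall>A\<in>cartan n. act V A v = wt A \<odot>\<^bsub>V\<^esub> v)"

section \<open>The graded tensor product\<close>

text \<open>A representation of \<open>\<ss>\<ll>\<^sub>n \<otimes> \<complex>[t]\<close> is given by the operators of the elements
  \<open>x \<otimes> f\<close>, encoded as pairs \<open>(x, f)\<close>.\<close>

definition eval_module :: "(complex mat, 'a) rep \<Rightarrow> complex \<Rightarrow> (complex mat \<times> complex poly, 'a) rep" where
  "eval_module V a = with_act V (\<lambda>(x, f) u. poly f a \<odot>\<^bsub>V\<^esub> act V x u)"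

definition restrict_to_sl :: "(complex mat \<times> complex poly, 'a) rep \<Rightarrow> (complex mat, 'a) rep" where
  "restrict_to_sl V = with_act V (\<lambda>x. act V (x, 1))"

text \<open>\<open>U\<^sup>(\<^sup>d\<^sup>) w\<close>: the enveloping algebra of \<open>\<nn>\<^sub>- \<otimes> \<complex>[t]\<close> is spanned by the products
  \<open>(x\<^sub>1 \<otimes> t^k\<^sub>1) \<cdots> (x\<^sub>r \<otimes> t^k\<^sub>r)\<close>, and those with \<open>k\<^sub>1 + \<dots> + k\<^sub>r = d\<close> span its part of degree \<open>d\<close>.\<close>

definition U_orbit :: "nat \<Rightarrow> (complex mat \<times> complex poly, 'a) rep \<Rightarrow> 'a \<Rightarrow> nat \<Rightarrow> 'a set" where
  "U_orbit n V w d = lin_span V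
     {foldr (\<lambda>(x, k). act V (x, monom 1 k)) xs w | xs.
        set xs \<subseteq> n_minus n \<times> UNIV \<and> sum_list (map snd xs) = d}"

definition U_filtration :: "nat \<Rightarrow> (complex mat \<times> complex poly, 'a) rep \<Rightarrow> 'a \<Rightarrow> nat \<Rightarrow> 'a set" where
  "U_filtration n V w d = lin_span V (\<Union>d'\<le>d. U_orbit n V w d')"

text \<open>Here \<open>\<pi>\<close> and \<open>v\<close> assign to a partition an irreducible module and its highest weight
  vector; the module \<open>\<pi>\<^sub>k\<close> belongs to the one-row partition \<open>[k]\<close>.\<close>

definition eval_factors :: "(nat list \<Rightarrow> (complex mat, 'a) rep) \<Rightarrow> nat list \<Rightarrow> complex list
    \<Rightarrow> (complex mat \<times> complex poly, 'a) rep list" where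
  "eval_factors \<pi> \<mu> a = map2 (\<lambda>k. eval_module (\<pi> [k])) \<mu> a"

definition graded_tensor_product ::
  "nat \<Rightarrow> (nat list \<Rightarrow> (complex mat, 'a) rep) \<Rightarrow> (nat list \<Rightarrow> 'a) \<Rightarrow> nat list \<Rightarrow> complex list
    \<Rightarrow> nat \<Rightarrow> (complex mat, ('a list \<Rightarrow>\<^sub>0 complex) set set) rep" where
  "graded_tensor_product n \<pi> v \<mu> a =
     (let Vs = eval_factors \<pi> \<mu> a;
          V = tensor_list Vs;
          w = pure_tensor Vs (map (\<lambda>k. v [k]) \<mu>)
      in gr_piece (restrict_to_sl V) (U_filtration n V w))"

section \<open>The graded representation of the symmetric group on the orbit ring\<close>

definition perms :: "nat \<Rightarrow> (nat \<Rightarrow> nat) set" where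
  "perms N = {\<sigma>. \<sigma> permutes {..<N}}"

text \<open>The polynomial ring \<open>\<complex>[z\<^sub>0, \<dots>, z\<^bsub>N-1\<^esub>]\<close> as a vector space with basis the monomials
  (exponent vectors); \<open>\<sigma>\<close> sends \<open>z\<^sub>i\<close> to \<open>z\<^bsub>\<sigma> i\<^esub>\<close>.\<close>

definition poly_rep :: "nat \<Rightarrow> (nat \<Rightarrow> nat, (nat \<Rightarrow>\<^sub>0 nat) \<Rightarrow>\<^sub>0 complex) rep" where
  "poly_rep N = free_rep {m. Poly_Mapping.keys m \<subseteq> {..<N}}
     (\<lambda>\<sigma> m. basis_vec (Poly_Mapping.map_key (inv_into UNIV \<sigma>) m))"

definition poly_eval :: "((nat \<Rightarrow>\<^sub>0 nat) \<Rightarrow>\<^sub>0 complex) \<Rightarrow> (nat \<Rightarrow> complex) \<Rightarrow> complex" where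
  "poly_eval p x = (\<Sum>m\<in>Poly_Mapping.keys p. Poly_Mapping.lookup p m *
     (\<Prod>i\<in>Poly_Mapping.keys m. x i ^ Poly_Mapping.lookup m i))"

definition polys_of_degree_le :: "nat \<Rightarrow> nat \<Rightarrow> ((nat \<Rightarrow>\<^sub>0 nat) \<Rightarrow>\<^sub>0 complex) set" where
  "polys_of_degree_le N d = {p \<in> carrier (poly_rep N).
     \<forall>m\<in>Poly_Mapping.keys p. (\<Sum>i\<in>Poly_Mapping.keys m. Poly_Mapping.lookup m i) \<le> d}"

definition base_point :: "nat list \<Rightarrow> complex list \<Rightarrow> nat \<Rightarrow> complex" where
  "base_point \<mu> a i = concat (map2 replicate \<mu> a) ! i"

definition orbit_ideal :: "nat list \<Rightarrow> complex list \<Rightarrow> ((nat \<Rightarrow>\<^sub>0 nat) \<Rightarrow>\<^sub>0 complex) set" where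
  "orbit_ideal \<mu> a = {p \<in> carrier (poly_rep (sum_list \<mu>)).
     \<forall>\<sigma>\<in>perms (sum_list \<mu>). poly_eval p (base_point \<mu> a \<circ> \<sigma>) = 0}"

definition A_rep :: "nat list \<Rightarrow> complex list
    \<Rightarrow> (nat \<Rightarrow> nat, ((nat \<Rightarrow>\<^sub>0 nat) \<Rightarrow>\<^sub>0 complex) set) rep" where
  "A_rep \<mu> a = quot_rep (poly_rep (sum_list \<mu>)) (orbit_ideal \<mu> a)"

definition A_filtration :: "nat list \<Rightarrow> complex list \<Rightarrow> nat
    \<Rightarrow> ((nat \<Rightarrow>\<^sub>0 nat) \<Rightarrow>\<^sub>0 complex) set set" where
  "A_filtration \<mu> a d =
     (\<lambda>p. orbit_ideal \<mu> a +>\<^bsub>poly_rep (sum_list \<mu>)\<^esub> p) ` polys_of_degree_le (sum_list \<mu>) d"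

definition R_graded :: "nat list \<Rightarrow> complex list \<Rightarrow> nat
    \<Rightarrow> (nat \<Rightarrow> nat, ((nat \<Rightarrow>\<^sub>0 nat) \<Rightarrow>\<^sub>0 complex) set set) rep" where
  "R_graded \<mu> a = gr_piece (A_rep \<mu> a) (A_filtration \<mu> a)"

section \<open>Specht modules and multiplicity spaces\<close>

definition cells :: "nat list \<Rightarrow> (nat \<times> nat) set" where
  "cells \<nu> = {(r, c). r < length \<nu> \<and> c < \<nu> ! r}"

text \<open>A tableau maps each entry to the cell (row, column) containing it; the permutation
  \<open>\<sigma>\<close> turns the tableau \<open>T\<close> into \<open>T \<circ> \<sigma>\<^sup>-\<^sup>1\<close>. A tabloid only records the row of each entry.\<close>

definition tableaux :: "nat list \<Rightarrow> (nat \<Rightarrow> nat \<times> nat) set" where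
  "tableaux \<nu> = {T. bij_betw T {..<sum_list \<nu>} (cells \<nu>)}"

definition tabloid :: "nat list \<Rightarrow> (nat \<Rightarrow> nat \<times> nat) \<Rightarrow> nat \<Rightarrow> nat" where
  "tabloid \<nu> T = (\<lambda>k\<in>{..<sum_list \<nu>}. fst (T k))"

definition tabloid_rep :: "nat list \<Rightarrow> (nat \<Rightarrow> nat, (nat \<Rightarrow> nat) \<Rightarrow>\<^sub>0 complex) rep" where
  "tabloid_rep \<nu> = free_rep (tabloid \<nu> ` tableaux \<nu>) (\<lambda>\<sigma> t. basis_vec (t \<circ> inv_into UNIV \<sigma>))"

definition column_stabilizer :: "nat list \<Rightarrow> (nat \<Rightarrow> nat \<times> nat) \<Rightarrow> (nat \<Rightarrow> nat) set" where
  "column_stabilizer \<nu> T =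
     {\<sigma> \<in> perms (sum_list \<nu>). \<forall>k<sum_list \<nu>. snd (T (\<sigma> k)) = snd (T k)}"

definition polytabloid :: "nat list \<Rightarrow> (nat \<Rightarrow> nat \<times> nat) \<Rightarrow> ((nat \<Rightarrow> nat) \<Rightarrow>\<^sub>0 complex)" where
  "polytabloid \<nu> T = (\<Sum>\<sigma>\<in>column_stabilizer \<nu> T.
     Poly_Mapping.single (tabloid \<nu> T \<circ> inv_into UNIV \<sigma>) (of_int (sign \<sigma>)))"

definition specht :: "nat list \<Rightarrow> (nat \<Rightarrow> nat, (nat \<Rightarrow> nat) \<Rightarrow>\<^sub>0 complex) rep" where
  "specht \<nu> = (tabloid_rep \<nu>)
     \<lparr>carrier := lin_span (tabloid_rep \<nu>) (polytabloid \<nu> ` tableaux \<nu>)\<rparr>"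

text \<open>The decomposition \<open>R \<cong> \<Oplus>\<nu>. W\<^sub>\<nu> \<otimes> M\<^sub>\<nu>\<close> characterizes the graded vector spaces \<open>M\<^sub>\<nu>\<close> up
  to isomorphism, since the Specht modules are irreducible and pairwise non-isomorphic.\<close>

definition graded_multiplicity_spaces :: "nat \<Rightarrow> (nat \<Rightarrow> (nat \<Rightarrow> nat, 'a) rep)
    \<Rightarrow> (nat list \<Rightarrow> nat \<Rightarrow> (complex, 'm) module) \<Rightarrow> bool" where
  "graded_multiplicity_spaces N R M \<longleftrightarrow>
     (\<forall>\<nu>\<in>partitions N. \<forall>d. module complex_field (M \<nu> d))
   \<and> graded_iso (perms N) R
       (\<lambda>d. direct_sum (partitions N) (\<lambda>\<nu>. mult_tensor (specht \<nu>) (M \<nu> d)))"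

end

theory Submission
  imports Defs
begin

text \<open>Embedding every factor \<open>\<pi>\<^sub>k\<close> into the functions on words of length \<open>k\<close> in \<open>n\<close> letters turns the
  tensor product into a space of functions \<open>\<psi>\<close> on words \<open>s\<close> of length \<open>N\<close>, on which \<open>x \<otimes> t\<^sup>k\<close> acts as
  \<open>\<Sum>\<^sub>i X\<^sub>i\<^sup>k x\<^sup>(\<^sup>i\<^sup>)\<close>. Polynomials restricted to the orbit of \<open>X\<close> are functions of \<open>\<sigma> \<in> S\<^sub>N\<close>, and \<open>\<psi>\<close> lies in
  the \<open>d\<close>-th filtered piece if and only if every function \<open>\<sigma> \<mapsto> \<psi> (s \<circ> \<sigma>\<^sup>-\<^sup>1)\<close> comes from a polynomial of
  degree at most \<open>d\<close>: the operators \<open>E\<^bsub>c 0\<^esub> \<otimes> t\<^sup>k\<close> together with multiplication by power sums of \<open>X\<close>,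
  which are constants, produce the symmetrizations of all monomials from the highest weight vector.
  So the degree \<open>d\<close> component consists of the \<open>S\<^sub>N\<close>-equivariant functions from words to the degree \<open>d\<close>
  component of \<open>R\<^sub>\<mu>\<close>. Decomposing the latter and using that the equivariant functions from words to
  \<open>W\<^sub>\<lambda>\<close> form the irreducible module \<open>\<pi>\<^sub>\<lambda>\<close>, or vanish if \<open>\<lambda>\<close> has more than \<open>n\<close> parts, gives the claim.\<close>

text \<open>The operators \<open>E_{c 0} \<otimes> t^k\<close> attach a power of \<open>X\<close>
  only to a place whose letter they change, so alone they never put an exponent on a place that
  keeps the letter \<open>0\<close>. Power sums fill this gap: being symmetric, the sum of the
  \<open>X i ^ k\<close> is one number on the whole orbit, so multiplying by it keeps the filtration
  degree, while on symmetrized monomials it adds \<open>k\<close> to the exponent at each place in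
  turn. Solving this identity trades an exponent at a letter \<open>0\<close> for exponents
  elsewhere. The irreducible modules are given only by their highest weights. Hence the model of
  equivariant functions is proved irreducible with an explicit highest weight vector and compared
  with them through uniqueness. Its irreducibility comes from that of the Specht module by
  symmetrized matrix units, in place of a double centralizer argument. Surjectivity onto equivariant
  functions needs lifts to polynomial functions on the orbit; lifts chosen word by word are not
  equivariant, and averaging over \<open>S_N\<close> repairs this without raising the
  degree.\<close>

abbreviation keys :: "('b \<Rightarrow>\<^sub>0 'c::zero) => 'b set" where "keys \<equiv> Poly_Mapping.keys"
abbreviation lookup :: "('b \<Rightarrow>\<^sub>0 'c::zero) => 'b => 'c" where "lookup \<equiv> Poly_Mapping.lookup"

section \<open>Complex vector spaces and their subspaces\<close>

lemma complex_field_simps [simp]: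
  "carrier complex_field = UNIV" "mult complex_field = (*)" "one complex_field = 1"
  "zero complex_field = 0" "add complex_field = (+)"
  by (simp_all add: complex_field_def)

lemma cring_complex_field: "cring complex_field"
  using field_complex_field by (simp add: field_def domain_def)

lemma a_inv_complex_field [simp]: "\<ominus>\<^bsub>complex_field\<^esub> c = - c"
proof -
  interpret cring complex_field by (rule cring_complex_field)
  show ?thesis
    by (rule minus_equality) simp_all
qed

locale cspace = module complex_field V for V :: "(complex, 'a, 'z) module_scheme" (structure)
begin

lemma smult_in [simp, intro]: "x \<in> carrier V ==> c \<odot> x \<in> carrier V"
  using smult_closed[of c x] by simp

lemma smult_add_left: "x \<in> carrier V ==> (b + c) \<odot> x = b \<odot> x \<oplus> c \<odot> x"
  using smult_l_distr[of b c x] by simp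

lemma smult_add_right: "x \<in> carrier V ==> y \<in> carrier V ==> c \<odot> (x \<oplus> y) = c \<odot> x \<oplus> c \<odot> y"
  using smult_r_distr[of c x y] by simp

lemma smult_smult: "x \<in> carrier V ==> b \<odot> (c \<odot> x) = (b * c) \<odot> x"
  using smult_assoc1[of b c x] by simp

lemma smult_1 [simp]: "x \<in> carrier V ==> 1 \<odot> x = x"
  using smult_one[of x] by simp

lemma smult_0 [simp]: "x \<in> carrier V ==> 0 \<odot> x = \<zero>"
  using smult_l_null[of x] by simp

lemma smult_zero [simp]: "c \<odot> \<zero> = \<zero>"
  using smult_r_null[of c] by simp

lemma smult_minus_1: "x \<in> carrier V ==> (- 1) \<odot> x = \<ominus> x"
  using smult_l_minus[of 1 x] by simp

lemma diff_eq_smult: "x \<in> carrier V ==> y \<in> carrier V ==> x \<ominus> y = x \<oplus> (- 1) \<odot> y"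
  by (simp add: smult_minus_1 minus_eq)

lemma diff_eq_zero_iff: "x \<in> carrier V ==> y \<in> carrier V ==> x \<ominus> y = \<zero> \<longleftrightarrow> x = y"
  by (metis add.inv_closed add.inv_inv add.l_inv minus_equality minus_eq)

lemma subspaceI:
  assumes "H \<subseteq> carrier V" "\<zero> \<in> H" "!!x y. x \<in> H ==> y \<in> H ==> x \<oplus> y \<in> H"
    "!!c x. x \<in> H ==> c \<odot> x \<in> H"
  shows "submodule H complex_field V"
proof (rule submoduleI)
  show "\<ominus> x \<in> H" if "x \<in> H" for x
    using assms(4)[OF that, of "- 1"] assms(1) that by (auto simp: smult_minus_1)
qed (use assms in auto)

lemma subspaceD:
  assumes "submodule H complex_field V"
  shows "H \<subseteq> carrier V" "\<zero> \<in> H" "!!x y. x \<in> H ==> y \<in> H ==> x \<oplus> y \<in> H"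
    "!!c x. x \<in> H ==> c \<odot> x \<in> H" "!!x. x \<in> H ==> \<ominus> x \<in> H"
    "!!x y. x \<in> H ==> y \<in> H ==> x \<ominus> y \<in> H"
proof -
  note E = submoduleE[OF assms]
  show 1: "H \<subseteq> carrier V" "!!x y. x \<in> H ==> y \<in> H ==> x \<oplus> y \<in> H"
    "!!c x. x \<in> H ==> c \<odot> x \<in> H" "!!x. x \<in> H ==> \<ominus> x \<in> H"
    using E by auto
  obtain x where "x \<in> H" using E(2) by auto
  then show "\<zero> \<in> H" using 1(1) 1(3)[of x 0] by auto
  show "!!x y. x \<in> H ==> y \<in> H ==> x \<ominus> y \<in> H"
    using 1 by (simp add: minus_eq)
qed

lemma subspace_carrier: "submodule (carrier V) complex_field V"
  by (rule subspaceI) auto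

lemma lin_span_superset: "S \<subseteq> lin_span V S"
  by (auto simp: lin_span_def)

lemma lin_span_least: "submodule H complex_field V ==> S \<subseteq> H ==> lin_span V S \<subseteq> H"
  by (auto simp: lin_span_def)

lemma subspace_lin_span:
  assumes "S \<subseteq> carrier V"
  shows "submodule (lin_span V S) complex_field V"
proof (rule subspaceI)
  show "lin_span V S \<subseteq> carrier V"
    by (rule lin_span_least[OF subspace_carrier assms])
qed (auto simp: lin_span_def dest: subspaceD)

lemma add_eq_cancel:
  assumes "u \<in> carrier V" "x \<in> carrier V" "y \<in> carrier V"
  shows "u \<oplus> x = y \<longleftrightarrow> u = y \<ominus> x"
  using assms by (metis add.inv_closed add.inv_solve_right' minus_eq)

lemma cspace_restrict:
  assumes "submodule H complex_field V"
  shows "module complex_field (V\<lparr>carrier := H\<rparr>)"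
  using submodule.submodule_is_module[OF assms] by (simp add: module_axioms)

end

lemma cspaceI: "module complex_field V ==> cspace V"
  by (simp add: cspace_def)

section \<open>Linear actions, stable subspaces and quotients\<close>

definition linear_rep :: "'g set => ('g, 'a) rep => bool" where
  "linear_rep G V \<longleftrightarrow> module complex_field V \<and>
     (\<forall>g\<in>G. (\<forall>x\<in>carrier V. act V g x \<in> carrier V) \<and>
       (\<forall>x\<in>carrier V. \<forall>y\<in>carrier V. act V g (x \<oplus>\<^bsub>V\<^esub> y) = act V g x \<oplus>\<^bsub>V\<^esub> act V g y) \<and>
       (\<forall>c. \<forall>x\<in>carrier V. act V g (c \<odot>\<^bsub>V\<^esub> x) = c \<odot>\<^bsub>V\<^esub> act V g x))"

definition stable_subspace :: "'g set => ('g, 'a) rep => 'a set => bool" where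
  "stable_subspace G V U \<longleftrightarrow> submodule U complex_field V \<and> (\<forall>g\<in>G. \<forall>x\<in>U. act V g x \<in> U)"

lemma linear_rep_cspace: "linear_rep G V ==> cspace V"
  by (simp add: linear_rep_def cspace_def)

lemma linear_repD:
  assumes "linear_rep G V" "g \<in> G" "x \<in> carrier V"
  shows "act V g x \<in> carrier V" "y \<in> carrier V ==> act V g (x \<oplus>\<^bsub>V\<^esub> y) = act V g x \<oplus>\<^bsub>V\<^esub> act V g y"
    "act V g (c \<odot>\<^bsub>V\<^esub> x) = c \<odot>\<^bsub>V\<^esub> act V g x"
  using assms by (simp_all add: linear_rep_def)

text \<open>\<open>G\<close> is only an index set of linear operators, without group or Lie
  relations. The same quotient construction thus serves \<open>S_N\<close> on polynomials,
  \<open>sl_n\<close> on filtered pieces and the elements \<open>x \<otimes> f\<close> on tensor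
  products.\<close>

locale stable_quot =
  fixes G :: "'g set" and V :: "('g, 'a) rep" (structure) and U :: "'a set"
  assumes rep: "linear_rep G V" and sub: "stable_subspace G V U"
begin

sublocale cspace V
  using rep by (simp add: linear_rep_def cspace_def)

lemma U_subspace: "submodule U complex_field V"
  using sub by (simp add: stable_subspace_def)

lemmas U_D = subspaceD[OF U_subspace]

lemma act_in: "g \<in> G ==> x \<in> carrier V ==> act V g x \<in> carrier V"
  using rep by (simp add: linear_rep_def)

abbreviation "pr x \<equiv> U +> x"

lemma mem_pr: "y \<in> pr x \<longleftrightarrow> (\<exists>h\<in>U. y = h \<oplus> x)"
  by (auto simp: a_r_coset_def')

lemma mem_pr_iff:
  assumes "x \<in> carrier V" shows "y \<in> pr x \<longleftrightarrow> y \<in> carrier V \<and> y \<ominus> x \<in> U"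
proof
  assume "y \<in> pr x"
  then obtain h where h: "h \<in> U" "y = h \<oplus> x" by (auto simp: mem_pr)
  with U_D(1) have "h \<in> carrier V" by auto
  with h assms show "y \<in> carrier V \<and> y \<ominus> x \<in> U"
    using add_eq_cancel[of h x y] by auto
next
  assume "y \<in> carrier V \<and> y \<ominus> x \<in> U"
  then show "y \<in> pr x" unfolding mem_pr
    using add_eq_cancel[of "y \<ominus> x" x y] assms by (intro bexI[of _ "y \<ominus> x"]) auto
qed

lemma pr_self: "x \<in> carrier V ==> x \<in> pr x"
  using U_D(2) unfolding mem_pr by (intro bexI[of _ \<zero>]) auto

lemma pr_eq_iff:
  assumes "x \<in> carrier V" "y \<in> carrier V" shows "pr x = pr y \<longleftrightarrow> x \<ominus> y \<in> U"
proof
  assume "pr x = pr y"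
  then show "x \<ominus> y \<in> U" using pr_self[OF assms(1)] mem_pr_iff[OF assms(2)] by auto
next
  assume d: "x \<ominus> y \<in> U"
  have "z \<ominus> x \<in> U \<longleftrightarrow> z \<ominus> y \<in> U" if "z \<in> carrier V" for z
  proof -
    have *: "w \<ominus> y \<in> U" if "w \<ominus> x \<in> U" "x \<ominus> y \<in> U" "x \<in> carrier V" "y \<in> carrier V" "w \<in> carrier V" for x y w
    proof -
      have "w \<ominus> y = (w \<ominus> x) \<oplus> (x \<ominus> y)"
        using that by (simp add: minus_eq a_ac r_neg1 r_neg2)
      then show ?thesis using U_D(3) that by simp
    qed
    have "y \<ominus> x = \<ominus> (x \<ominus> y)" using assms by (simp add: minus_eq minus_add a_comm)
    then have "y \<ominus> x \<in> U" using d U_D(5) by simp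
    then show ?thesis using *[of z x y] *[of z y x] d assms that by blast
  qed
  then show "pr x = pr y" using assms by (auto simp: mem_pr_iff)
qed

lemma quot_simps:
  "carrier (quot_rep V U) = pr ` carrier V" "add (quot_rep V U) = set_add V"
  "zero (quot_rep V U) = U"
  by (auto simp: quot_rep_def A_RCOSETS_def')

lemma pr_add:
  assumes "x \<in> carrier V" "y \<in> carrier V"
  shows "pr x \<oplus>\<^bsub>quot_rep V U\<^esub> pr y = pr (x \<oplus> y)"
proof -
  have *: "h \<in> carrier V" if "h \<in> U" for h using that U_D(1) by auto
  have 1: "h \<oplus> x \<oplus> (k \<oplus> y) = (h \<oplus> k) \<oplus> (x \<oplus> y)" if "h \<in> U" "k \<in> U" for h k
    using that[THEN *] assms by (simp add: a_ac)
  show ?thesis unfolding quot_simps set_add_def'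
  proof (intro Set.set_eqI iffI)
    fix z assume "z \<in> (\<Union>h\<in>pr x. \<Union>k\<in>pr y. {h \<oplus> k})"
    then obtain h k where "h \<in> U" "k \<in> U" "z = h \<oplus> x \<oplus> (k \<oplus> y)" by (auto simp: mem_pr)
    then show "z \<in> pr (x \<oplus> y)" using 1 U_D(3) by (auto simp: mem_pr)
  next
    fix z assume "z \<in> pr (x \<oplus> y)"
    then obtain h where h: "h \<in> U" "z = h \<oplus> (x \<oplus> y)" by (auto simp: mem_pr)
    have "z = (h \<oplus> x) \<oplus> y" using h assms * by (simp add: a_assoc)
    moreover have "y \<in> pr y" "h \<oplus> x \<in> pr x" using assms pr_self h by (auto simp: mem_pr)
    ultimately show "z \<in> (\<Union>h\<in>pr x. \<Union>k\<in>pr y. {h \<oplus> k})" by blast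
  qed
qed

text \<open>In \<open>quot_rep\<close> scalars and operators are applied to all elements of a coset
  and \<open>U\<close> is added back. Additivity and stability of \<open>U\<close> make the result
  the single coset of \<open>f x\<close>.\<close>

lemma pr_map:
  assumes f: "!!x. x \<in> carrier V ==> f x \<in> carrier V"
    "!!x y. x \<in> carrier V ==> y \<in> carrier V ==> f (x \<oplus> y) = f x \<oplus> f y"
    "!!x. x \<in> U ==> f x \<in> U" and x: "x \<in> carrier V"
  shows "U <+> f ` pr x = pr (f x)"
proof -
  have *: "h \<in> carrier V" if "h \<in> U" for h using that U_D(1) by auto
  show ?thesis unfolding set_add_def'
  proof (intro Set.set_eqI iffI)
    fix z assume "z \<in> (\<Union>h\<in>U. \<Union>k\<in>f ` pr x. {h \<oplus> k})"
    then obtain h k where "h \<in> U" "k \<in> U" "z = h \<oplus> f (k \<oplus> x)" by (auto simp: mem_pr)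
    then have "z = (h \<oplus> f k) \<oplus> f x" "h \<oplus> f k \<in> U" using f * x U_D(3) by (auto simp: a_assoc)
    then show "z \<in> pr (f x)" by (auto simp: mem_pr)
  next
    fix z assume "z \<in> pr (f x)"
    then obtain h where h: "h \<in> U" "z = h \<oplus> f x" by (auto simp: mem_pr)
    then show "z \<in> (\<Union>h\<in>U. \<Union>k\<in>f ` pr x. {h \<oplus> k})" using pr_self[OF x] by blast
  qed
qed

lemma pr_smult:
  assumes "x \<in> carrier V"
  shows "c \<odot>\<^bsub>quot_rep V U\<^esub> pr x = pr (c \<odot> x)"
proof -
  have "c \<odot>\<^bsub>quot_rep V U\<^esub> pr x = U <+> ((\<lambda>x. c \<odot> x) ` pr x)" by (simp add: quot_rep_def)
  also have "\<dots> = pr (c \<odot> x)"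
    by (rule pr_map) (use assms U_D in \<open>auto simp: smult_add_right\<close>)
  finally show ?thesis .
qed

lemma pr_act:
  assumes "g \<in> G" "x \<in> carrier V"
  shows "act (quot_rep V U) g (pr x) = pr (act V g x)"
proof -
  have "act (quot_rep V U) g (pr x) = U <+> (act V g ` pr x)" by (simp add: quot_rep_def)
  also have "\<dots> = pr (act V g x)"
    by (rule pr_map) (use assms rep sub in \<open>auto simp: linear_rep_def stable_subspace_def\<close>)
  finally show ?thesis .
qed

lemma pr_zero: "pr \<zero> = U"
  using mem_pr_iff[of \<zero>] U_D(1) by (auto simp: minus_eq)

lemma pr_in: "x \<in> carrier V ==> pr x \<in> carrier (quot_rep V U)"
  by (auto simp: quot_simps)

lemma quot_cases:
  assumes "X \<in> carrier (quot_rep V U)" obtains x where "x \<in> carrier V" "X = pr x"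
  using assms by (auto simp: quot_simps)

lemma linear_rep_quot: "linear_rep G (quot_rep V U)"
proof -
  let ?Q = "quot_rep V U"
  have z: "\<zero>\<^bsub>?Q\<^esub> = pr \<zero>" by (simp only: quot_simps pr_zero)
  have ag: "abelian_group ?Q"
  proof (rule abelian_groupI)
    show "\<zero>\<^bsub>?Q\<^esub> \<in> carrier ?Q" unfolding z by (rule pr_in) simp
    fix X assume "X \<in> carrier ?Q"
    then obtain x where x: "x \<in> carrier V" "X = pr x" by (rule quot_cases)
    show "\<zero>\<^bsub>?Q\<^esub> \<oplus>\<^bsub>?Q\<^esub> X = X"
      unfolding z using x by (simp add: pr_add)
    show "\<exists>Y\<in>carrier ?Q. Y \<oplus>\<^bsub>?Q\<^esub> X = \<zero>\<^bsub>?Q\<^esub>"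
      unfolding z using x
      by (intro bexI[of _ "pr (\<ominus> x)"] pr_in) (auto simp: pr_add l_neg)
    fix Y assume "Y \<in> carrier ?Q"
    then obtain y where y: "y \<in> carrier V" "Y = pr y" by (rule quot_cases)
    show "X \<oplus>\<^bsub>?Q\<^esub> Y \<in> carrier ?Q" using x y by (simp add: pr_add pr_in)
    show "X \<oplus>\<^bsub>?Q\<^esub> Y = Y \<oplus>\<^bsub>?Q\<^esub> X" using x y by (simp add: pr_add a_comm)
    fix Z assume "Z \<in> carrier ?Q"
    then obtain z where z: "z \<in> carrier V" "Z = pr z" by (rule quot_cases)
    show "X \<oplus>\<^bsub>?Q\<^esub> Y \<oplus>\<^bsub>?Q\<^esub> Z = X \<oplus>\<^bsub>?Q\<^esub> (Y \<oplus>\<^bsub>?Q\<^esub> Z)"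
      using x y z by (simp add: pr_add a_assoc)
  qed
  have "module complex_field ?Q"
  proof (rule moduleI[OF cring_complex_field ag])
    fix c d X assume "X \<in> carrier ?Q"
    then obtain x where x: "x \<in> carrier V" "X = pr x" by (rule quot_cases)
    show "c \<odot>\<^bsub>?Q\<^esub> X \<in> carrier ?Q" using x by (simp add: pr_smult pr_in)
    show "(c \<oplus>\<^bsub>complex_field\<^esub> d) \<odot>\<^bsub>?Q\<^esub> X = c \<odot>\<^bsub>?Q\<^esub> X \<oplus>\<^bsub>?Q\<^esub> d \<odot>\<^bsub>?Q\<^esub> X"
      using x by (simp add: pr_smult pr_add smult_add_left)
    show "(c \<otimes>\<^bsub>complex_field\<^esub> d) \<odot>\<^bsub>?Q\<^esub> X = c \<odot>\<^bsub>?Q\<^esub> (d \<odot>\<^bsub>?Q\<^esub> X)"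
      using x by (simp add: pr_smult smult_smult)
    show "\<one>\<^bsub>complex_field\<^esub> \<odot>\<^bsub>?Q\<^esub> X = X" using x by (simp add: pr_smult)
    fix Y assume "Y \<in> carrier ?Q"
    then obtain y where y: "y \<in> carrier V" "Y = pr y" by (rule quot_cases)
    show "c \<odot>\<^bsub>?Q\<^esub> (X \<oplus>\<^bsub>?Q\<^esub> Y) = c \<odot>\<^bsub>?Q\<^esub> X \<oplus>\<^bsub>?Q\<^esub> c \<odot>\<^bsub>?Q\<^esub> Y"
      using x y by (simp add: pr_smult pr_add smult_add_right)
  qed
  then show ?thesis unfolding linear_rep_def
    using linear_repD[OF rep] by (auto simp: quot_simps(1) pr_act pr_add pr_smult)
qed

text \<open>An isomorphism specified by a relation between representatives and target vectors.
  Comparing equality in \<open>W\<close> with congruence modulo \<open>U\<close> gives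
  well-definedness and injectivity at once, so no formula for the map in either direction is
  required.\<close>

lemma quot_iso_of_relation:
  assumes tot: "!!x. x \<in> carrier V ==> \<exists>y\<in>carrier W. R x y"
    and sur: "!!y. y \<in> carrier W ==> \<exists>x\<in>carrier V. R x y"
    and eq: "!!x x' y y'. x \<in> carrier V ==> x' \<in> carrier V ==> y \<in> carrier W ==> y' \<in> carrier W ==>
       R x y ==> R x' y' ==> y = y' \<longleftrightarrow> x \<ominus> x' \<in> U"
    and add: "!!x x' y y'. x \<in> carrier V ==> x' \<in> carrier V ==> y \<in> carrier W ==> y' \<in> carrier W ==>
       R x y ==> R x' y' ==> y \<oplus>\<^bsub>W\<^esub> y' \<in> carrier W \<and> R (x \<oplus> x') (y \<oplus>\<^bsub>W\<^esub> y')"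
    and scale: "!!c x y. x \<in> carrier V ==> y \<in> carrier W ==> R x y ==>
       c \<odot>\<^bsub>W\<^esub> y \<in> carrier W \<and> R (c \<odot> x) (c \<odot>\<^bsub>W\<^esub> y)"
    and act: "!!g x y. g \<in> G ==> x \<in> carrier V ==> y \<in> carrier W ==> R x y ==>
       act W g y \<in> carrier W \<and> R (act V g x) (act W g y)"
  shows "rep_iso G (quot_rep V U) W"
proof -
  define f where "f X = (SOME y. y \<in> carrier W \<and> (\<exists>x\<in>carrier V. X = pr x \<and> R x y))" for X
  have f: "f (pr x) = y" if "x \<in> carrier V" "y \<in> carrier W" "R x y" for x y
    unfolding f_def
  proof (rule some_equality)
    show "y \<in> carrier W \<and> (\<exists>x'\<in>carrier V. pr x = pr x' \<and> R x' y)" using that by auto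
    show "y' = y" if "y' \<in> carrier W \<and> (\<exists>x'\<in>carrier V. pr x = pr x' \<and> R x' y')" for y'
      using that \<open>x \<in> carrier V\<close> \<open>y \<in> carrier W\<close> \<open>R x y\<close> eq pr_eq_iff by metis
  qed
  have obt: thesis if "X \<in> carrier (quot_rep V U)"
    "!!x y. x \<in> carrier V ==> X = pr x ==> y \<in> carrier W ==> R x y ==> f X = y ==> thesis" for X thesis
    using that quot_cases tot f by metis
  show ?thesis unfolding rep_iso_def
  proof (intro exI[of _ f] conjI ballI allI)
    show "bij_betw f (carrier (quot_rep V U)) (carrier W)"
    proof (rule bij_betw_imageI)
      show "inj_on f (carrier (quot_rep V U))"
      proof (rule inj_onI)
        fix X X' assume a: "X \<in> carrier (quot_rep V U)" "X' \<in> carrier (quot_rep V U)" "f X = f X'"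
        obtain x y where 1: "x \<in> carrier V" "X = pr x" "y \<in> carrier W" "R x y" "f X = y" using a obt by metis
        obtain x' y' where 2: "x' \<in> carrier V" "X' = pr x'" "y' \<in> carrier W" "R x' y'" "f X' = y'" using a obt by metis
        show "X = X'" using 1 2 a(3) eq[of x x' y y'] pr_eq_iff by auto
      qed
      show "f ` carrier (quot_rep V U) = carrier W"
      proof (intro Set.set_eqI iffI)
        fix y assume "y \<in> f ` carrier (quot_rep V U)"
        then show "y \<in> carrier W" using obt by (metis imageE)
      next
        fix y assume "y \<in> carrier W"
        then show "y \<in> f ` carrier (quot_rep V U)" using sur f pr_in by (metis imageI)
      qed
    qed
    fix X assume "X \<in> carrier (quot_rep V U)"
    then obtain x y where 1: "x \<in> carrier V" "X = pr x" "y \<in> carrier W" "R x y" "f X = y" using obt by metis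
    show "f (c \<odot>\<^bsub>quot_rep V U\<^esub> X) = c \<odot>\<^bsub>W\<^esub> f X" for c
      using 1 scale[of x y c] f[of "c \<odot> x"] by (simp add: pr_smult)
    show "f (act (quot_rep V U) g X) = act W g (f X)" if "g \<in> G" for g
      using 1 act[of g x y] f[of "act V g x"] that by (simp add: pr_act act_in)
    fix X' assume "X' \<in> carrier (quot_rep V U)"
    then obtain x' y' where 2: "x' \<in> carrier V" "X' = pr x'" "y' \<in> carrier W" "R x' y'" "f X' = y'" using obt by metis
    show "f (X \<oplus>\<^bsub>quot_rep V U\<^esub> X') = f X \<oplus>\<^bsub>W\<^esub> f X'"
      using 1 2 add[of x x' y y'] f[of "x \<oplus> x'"] by (simp add: pr_add)
  qed
qed

end

lemma linear_rep_restrict: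
  assumes "linear_rep G V" "stable_subspace G V H"
  shows "linear_rep G (V\<lparr>carrier := H\<rparr>)"
proof -
  interpret cspace V using assms by (simp add: linear_rep_def cspace_def)
  have H: "submodule H complex_field V" using assms by (simp add: stable_subspace_def)
  from cspace_restrict[OF H] subspaceD(1)[OF H] assms show ?thesis
    by (auto simp: linear_rep_def stable_subspace_def subset_eq)
qed

lemma stable_subspace_lin_span:
  assumes "linear_rep G V" "S \<subseteq> carrier V"
    and "!!g x. g \<in> G ==> x \<in> S ==> act V g x \<in> lin_span V S"
  shows "stable_subspace G V (lin_span V S)"
proof -
  interpret cspace V using assms by (simp add: linear_rep_def cspace_def)
  note L = subspaceD[OF subspace_lin_span[OF assms(2)]]
  have "lin_span V S \<subseteq> {x \<in> lin_span V S. act V g x \<in> lin_span V S}" if g: "g \<in> G" for g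
  proof (rule lin_span_least)
    have z: "act V g \<zero>\<^bsub>V\<^esub> = \<zero>\<^bsub>V\<^esub>"
    proof -
      have "act V g (0 \<odot>\<^bsub>V\<^esub> \<zero>\<^bsub>V\<^esub>) = 0 \<odot>\<^bsub>V\<^esub> act V g \<zero>\<^bsub>V\<^esub>" "act V g \<zero>\<^bsub>V\<^esub> \<in> carrier V"
        using assms(1) g unfolding linear_rep_def by blast+
      then show ?thesis by simp
    qed
    have sm: "act V g (c \<odot>\<^bsub>V\<^esub> x) = c \<odot>\<^bsub>V\<^esub> act V g x" if "x \<in> lin_span V S" for c x
      using linear_repD[OF assms(1) g] that L(1) by blast
    have ad: "act V g (x \<oplus>\<^bsub>V\<^esub> y) = act V g x \<oplus>\<^bsub>V\<^esub> act V g y"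
      if "x \<in> lin_span V S" "y \<in> lin_span V S" for x y
      using linear_repD[OF assms(1) g] that L(1) by blast
    show "submodule {x \<in> lin_span V S. act V g x \<in> lin_span V S} complex_field V"
      by (rule subspaceI) (use L z in \<open>auto simp: sm ad\<close>)
    show "S \<subseteq> {x \<in> lin_span V S. act V g x \<in> lin_span V S}"
      using lin_span_superset assms(3) g by auto
  qed
  then show ?thesis unfolding stable_subspace_def using subspace_lin_span[OF assms(2)] by auto
qed

section \<open>Free vector spaces\<close>

abbreviation cscale :: "complex => ('b \<Rightarrow>\<^sub>0 complex) => ('b \<Rightarrow>\<^sub>0 complex)" where
  "cscale c \<equiv> Poly_Mapping.map ((*) c)"

lemma lookup_cscale [simp]: "lookup (cscale c p) b = c * lookup p b"
  by (simp add: Poly_Mapping.map.rep_eq Poly_Mapping.when_def)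

lemma keys_cscale: "keys (cscale c p) \<subseteq> keys p"
  by (auto simp: Poly_Mapping.in_keys_iff)

lemma cscale_simps:
  "cscale c (p + q) = cscale c p + cscale c q" "cscale (b + c) p = cscale b p + cscale c p"
  "cscale b (cscale c p) = cscale (b * c) p" "cscale 1 p = p" "cscale c 0 = 0" "cscale 0 p = 0"
  "cscale c (sum f A) = (\<Sum>a\<in>A. cscale c (f a))"
  by (rule poly_mapping_eqI; simp add: Poly_Mapping.lookup_add algebra_simps Poly_Mapping.lookup_sum sum_distrib_left)+

lemma free_rep_simps [simp]:
  "carrier (free_rep B h) = {p. keys p \<subseteq> B}" "zero (free_rep B h) = 0" "add (free_rep B h) = (+)"
  "module.smult (free_rep B h) = cscale"
  by (simp_all add: free_rep_def)

lemma act_free_rep: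
  "act (free_rep B h) g p = (\<Sum>b\<in>keys p. cscale (lookup p b) (h g b))"
  by (simp add: free_rep_def)

text \<open>The index set \<open>keys p\<close> varies with \<open>p\<close>; summing over a common
  finite superset is what makes the linear extension visibly additive.\<close>

lemma act_free_rep_superset:
  assumes "finite F" "keys p \<subseteq> F"
  shows "act (free_rep B h) g p = (\<Sum>b\<in>F. cscale (lookup p b) (h g b))"
  unfolding act_free_rep
  by (rule sum.mono_neutral_left) (use assms in \<open>auto simp: Poly_Mapping.in_keys_iff cscale_simps\<close>)

lemma keys_sum_cscale:
  assumes "!!b. b \<in> F ==> keys (f b) \<subseteq> B" shows "keys (\<Sum>b\<in>F. cscale (c b) (f b)) \<subseteq> B"
  using Poly_Mapping.keys_sum[of "\<lambda>b. cscale (c b) (f b)" F] keys_cscale assms by fast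

lemma module_free_rep: "module complex_field (free_rep B h)"
proof (rule moduleI[OF cring_complex_field])
  have *: "keys (p + q) \<subseteq> B" if "keys p \<subseteq> B" "keys q \<subseteq> B" for p q :: "'a \<Rightarrow>\<^sub>0 complex"
    using Poly_Mapping.keys_add[of p q] that by blast
  show "abelian_group (free_rep B h)"
  proof (rule abelian_groupI)
    fix x assume "x \<in> carrier (free_rep B h)"
    then show "\<exists>y\<in>carrier (free_rep B h). y \<oplus>\<^bsub>free_rep B h\<^esub> x = \<zero>\<^bsub>free_rep B h\<^esub>"
      by (intro bexI[of _ "- x"]) simp_all
  qed (simp_all add: algebra_simps *)
  fix c x assume "x \<in> carrier (free_rep B h)"
  then show "c \<odot>\<^bsub>free_rep B h\<^esub> x \<in> carrier (free_rep B h)"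
    using keys_cscale[of c x] by simp
qed (simp_all add: cscale_simps)

lemma linear_rep_free:
  assumes "!!g b. g \<in> G ==> b \<in> B ==> keys (h g b) \<subseteq> B"
  shows "linear_rep G (free_rep B h)"
proof -
  have add: "act (free_rep B h) g (p + q) = act (free_rep B h) g p + act (free_rep B h) g q" for g p q
    by (simp add: act_free_rep_superset[of "keys p \<union> keys q"] Poly_Mapping.keys_add[of p q]
        Poly_Mapping.lookup_add cscale_simps sum.distrib)
  have sc: "act (free_rep B h) g (cscale c p) = cscale c (act (free_rep B h) g p)" for g c p
    using act_free_rep_superset[of "keys p" "cscale c p"] keys_cscale[of c p]
    by (simp add: cscale_simps act_free_rep)
  have "keys (act (free_rep B h) g p) \<subseteq> B" if "g \<in> G" "keys p \<subseteq> B" for g p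
    unfolding act_free_rep by (rule keys_sum_cscale) (use assms that in blast)
  then show ?thesis unfolding linear_rep_def
    using module_free_rep[of B h] by (simp add: add sc)
qed

section \<open>Permutations of the first \<open>N\<close> numbers\<close>

abbreviation pinv :: "(nat => nat) => nat => nat" where "pinv \<equiv> inv_into UNIV"

lemma perms_id [simp]: "id \<in> perms N" by (simp add: perms_def permutes_id)
lemma perms_comp [intro]: "\<sigma> \<in> perms N ==> \<tau> \<in> perms N ==> \<sigma> \<circ> \<tau> \<in> perms N"
  by (simp add: perms_def permutes_compose)
lemma perms_inv [intro]: "\<sigma> \<in> perms N ==> pinv \<sigma> \<in> perms N"
  by (simp add: perms_def permutes_inv)
lemma finite_perms [simp]: "finite (perms N)" by (simp add: perms_def finite_permutations)
lemma perms_comp_inv [simp]: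
  assumes "\<sigma> \<in> perms N" shows "\<sigma> \<circ> pinv \<sigma> = id" "pinv \<sigma> \<circ> \<sigma> = id" "\<sigma> (pinv \<sigma> k) = k" "pinv \<sigma> (\<sigma> k) = k"
    "pinv (pinv \<sigma>) = \<sigma>"
  using assms permutes_inv_o[of \<sigma>] permutes_inverses[of \<sigma>] permutes_inv_inv[of \<sigma>] by (auto simp: perms_def)
lemma perms_less_iff: "\<sigma> \<in> perms N ==> \<sigma> k < N \<longleftrightarrow> k < N"
  using permutes_in_image[of \<sigma> "{..<N}" k] by (simp add: perms_def)
lemma perms_not_less: "\<sigma> \<in> perms N ==> \<not> k < N ==> \<sigma> k = k"
  by (simp add: perms_def permutes_def)
lemma perms_inj: "\<sigma> \<in> perms N ==> inj \<sigma>" by (simp add: perms_def permutes_inj)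
lemma perms_bij: "\<sigma> \<in> perms N ==> bij \<sigma>" by (simp add: perms_def permutes_bij)
lemma perms_bij_betw: "\<sigma> \<in> perms N ==> bij_betw \<sigma> {..<N} {..<N}"
  by (simp add: perms_def permutes_imp_bij)
lemma inv_comp_perms: "\<sigma> \<in> perms N ==> \<tau> \<in> perms N ==> pinv (\<sigma> \<circ> \<tau>) = pinv \<tau> \<circ> pinv \<sigma>"
  by (simp add: o_inv_distrib perms_bij)
lemma sign_perms: "\<sigma> \<in> perms N ==> \<tau> \<in> perms N ==> sign (\<sigma> \<circ> \<tau>) = sign \<sigma> * sign \<tau>"
  by (rule sign_compose) (auto simp: perms_def intro: permutation_permutes[THEN iffD2])
lemma sign_perms_inv: "\<sigma> \<in> perms N ==> sign (pinv \<sigma>) = sign \<sigma>"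
  by (rule sign_inverse) (auto simp: perms_def intro: permutation_permutes[THEN iffD2])
lemma transpose_perms: "k < N ==> l < N ==> transpose k l \<in> perms N"
  by (simp add: perms_def permutes_swap_id)

lemma sum_perms_comp_left: "\<tau> \<in> perms N ==> (\<Sum>\<sigma>\<in>perms N. f (\<tau> \<circ> \<sigma>)) = (\<Sum>\<sigma>\<in>perms N. f \<sigma>)"
  by (rule sum.reindex_bij_witness[of _ "\<lambda>\<sigma>. pinv \<tau> \<circ> \<sigma>" "\<lambda>\<sigma>. \<tau> \<circ> \<sigma>"]) (auto simp: comp_assoc[symmetric])
lemma sum_perms_comp_right: "\<tau> \<in> perms N ==> (\<Sum>\<sigma>\<in>perms N. f (\<sigma> \<circ> \<tau>)) = (\<Sum>\<sigma>\<in>perms N. f \<sigma>)"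
  by (rule sum.reindex_bij_witness[of _ "\<lambda>\<sigma>. \<sigma> \<circ> pinv \<tau>" "\<lambda>\<sigma>. \<sigma> \<circ> \<tau>"]) (auto simp: comp_assoc)

section \<open>Specht modules\<close>

text \<open>A tableau is arbitrary outside \<open>{..<N}\<close>, so there are infinitely many of
  them. The extensional ones are finitely many and have the same polytabloids, which allows sums
  over tableaux.\<close>

definition ext_tableaux :: "nat list => (nat => nat \<times> nat) set" where
  "ext_tableaux \<nu> = tableaux \<nu> \<inter> extensional {..<sum_list \<nu>}"

definition polytab :: "nat list => (nat => nat \<times> nat) => (nat => nat) => complex" where
  "polytab \<nu> T t = lookup (polytabloid \<nu> T) t"

text \<open>The Specht module as coefficient functions on tabloids: a permutation then acts by
  composing the argument with it, and the functions can serve directly as values of functions on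
  words.\<close>

definition specht_fun :: "nat list => ((nat => nat) => complex) set" where
  "specht_fun \<nu> = {u. \<exists>c. u = (\<lambda>t. \<Sum>T\<in>ext_tableaux \<nu>. c T * polytab \<nu> T t)}"

abbreviation csign :: "(nat => nat) => complex" where "csign \<sigma> \<equiv> of_int (sign \<sigma>)"

lemma finite_cells [simp]: "finite (cells \<nu>)"
proof -
  have "cells \<nu> = Sigma {..<length \<nu>} (\<lambda>r. {..<\<nu> ! r})" by (auto simp: cells_def)
  then show ?thesis by simp
qed

lemma finite_ext_tableaux [simp]: "finite (ext_tableaux \<nu>)"
proof -
  have "ext_tableaux \<nu> \<subseteq> PiE {..<sum_list \<nu>} (\<lambda>_. cells \<nu>)"
    by (auto simp: ext_tableaux_def tableaux_def PiE_def bij_betw_def)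
  then show ?thesis by (rule finite_subset) (simp add: finite_PiE)
qed

lemma column_stabilizer_perms: "\<sigma> \<in> column_stabilizer \<nu> T ==> \<sigma> \<in> perms (sum_list \<nu>)"
  by (simp add: column_stabilizer_def)

lemma finite_column_stabilizer [simp]: "finite (column_stabilizer \<nu> T)"
  by (rule finite_subset[OF _ finite_perms]) (auto dest: column_stabilizer_perms)

lemma column_stabilizer_comp:
  "\<sigma> \<in> column_stabilizer \<nu> T ==> \<tau> \<in> column_stabilizer \<nu> T ==> \<sigma> \<circ> \<tau> \<in> column_stabilizer \<nu> T"
  by (auto simp: column_stabilizer_def perms_less_iff)

lemma column_stabilizer_inv:
  "\<sigma> \<in> column_stabilizer \<nu> T ==> pinv \<sigma> \<in> column_stabilizer \<nu> T"
  by (auto simp: column_stabilizer_def) (metis perms_inv perms_less_iff perms_comp_inv(3))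

lemma column_stabilizer_id [simp]: "id \<in> column_stabilizer \<nu> T"
  by (simp add: column_stabilizer_def)

lemma comp_inv_eq_iff: "\<sigma> \<in> perms N ==> t \<circ> pinv \<sigma> = s \<longleftrightarrow> s \<circ> \<sigma> = t"
  by (auto simp: comp_assoc)

lemma polytab_eq:
  "polytab \<nu> T t = (\<Sum>\<sigma>\<in>column_stabilizer \<nu> T. if t \<circ> \<sigma> = tabloid \<nu> T then csign \<sigma> else 0)"
  unfolding polytab_def polytabloid_def Poly_Mapping.lookup_sum Poly_Mapping.lookup_single Poly_Mapping.when_def
  by (rule sum.cong) (auto simp: comp_inv_eq_iff dest!: column_stabilizer_perms)

lemma tabloid_comp:
  "\<sigma> \<in> perms (sum_list \<nu>) ==> tabloid \<nu> (T \<circ> \<sigma>) = tabloid \<nu> T \<circ> \<sigma>"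
  by (rule ext) (auto simp: tabloid_def restrict_def perms_less_iff)

lemma tableaux_comp:
  assumes "\<sigma> \<in> perms (sum_list \<nu>)" "T \<in> tableaux \<nu>" shows "T \<circ> \<sigma> \<in> tableaux \<nu>"
  using bij_betw_trans[OF perms_bij_betw[OF assms(1)]] assms(2) by (simp add: tableaux_def)

lemma ext_tableaux_comp:
  assumes "\<sigma> \<in> perms (sum_list \<nu>)" "T \<in> ext_tableaux \<nu>" shows "T \<circ> \<sigma> \<in> ext_tableaux \<nu>"
  using assms tableaux_comp unfolding ext_tableaux_def
  by (auto simp: extensional_def perms_not_less)

lemma tabloid_image_comp:
  assumes "\<sigma> \<in> perms (sum_list \<nu>)"
  shows "t \<circ> \<sigma> \<in> tabloid \<nu> ` tableaux \<nu> \<longleftrightarrow> t \<in> tabloid \<nu> ` tableaux \<nu>"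
proof -
  have *: "t \<circ> \<sigma> \<in> tabloid \<nu> ` tableaux \<nu>" if "\<sigma> \<in> perms (sum_list \<nu>)" "t \<in> tabloid \<nu> ` tableaux \<nu>" for \<sigma> t
    using that tableaux_comp tabloid_comp by (auto intro!: image_eqI[of _ _ "_ \<circ> \<sigma>"] simp: tabloid_comp)
  show ?thesis using *[OF assms, of t] *[OF perms_inv[OF assms], of "t \<circ> \<sigma>"] assms by (auto simp: comp_assoc)
qed

lemma polytab_outside:
  assumes "t \<notin> tabloid \<nu> ` tableaux \<nu>" "T \<in> tableaux \<nu>"
  shows "polytab \<nu> T t = 0"
  unfolding polytab_eq
proof (rule sum.neutral, rule ballI)
  fix \<sigma> assume "\<sigma> \<in> column_stabilizer \<nu> T"
  then show "(if t \<circ> \<sigma> = tabloid \<nu> T then csign \<sigma> else 0) = 0"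
    using tabloid_image_comp[OF column_stabilizer_perms, of \<sigma> \<nu> T t] assms by auto
qed

text \<open>Conjugation by \<open>\<sigma>\<close> matches the column stabilizers of
  \<open>T \<circ> \<sigma>\<close> and \<open>T\<close> and preserves signs.\<close>

lemma polytab_comp:
  assumes "\<sigma> \<in> perms (sum_list \<nu>)"
  shows "polytab \<nu> (T \<circ> \<sigma>) (t \<circ> \<sigma>) = polytab \<nu> T t"
  unfolding polytab_eq
proof (rule sum.reindex_bij_witness[of _ "\<lambda>\<rho>. pinv \<sigma> \<circ> \<rho> \<circ> \<sigma>" "\<lambda>\<tau>. \<sigma> \<circ> \<tau> \<circ> pinv \<sigma>"])
  note s = assms perms_inv[OF assms]
  fix \<tau> assume t: "\<tau> \<in> column_stabilizer \<nu> (T \<circ> \<sigma>)"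
  note tp = column_stabilizer_perms[OF t]
  show "pinv \<sigma> \<circ> (\<sigma> \<circ> \<tau> \<circ> pinv \<sigma>) \<circ> \<sigma> = \<tau>"
    using s by (auto simp: fun_eq_iff)
  show "\<sigma> \<circ> \<tau> \<circ> pinv \<sigma> \<in> column_stabilizer \<nu> T"
    using t s perms_comp tp unfolding column_stabilizer_def
    by (auto simp: perms_less_iff)
  have 1: "t \<circ> (\<sigma> \<circ> \<tau> \<circ> pinv \<sigma>) = tabloid \<nu> T \<longleftrightarrow> t \<circ> \<sigma> \<circ> \<tau> = tabloid \<nu> (T \<circ> \<sigma>)"
    using comp_inv_eq_iff[OF assms, of "t \<circ> \<sigma> \<circ> \<tau>" "tabloid \<nu> T"]
    by (auto simp: tabloid_comp[OF assms] comp_assoc)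
  have 2: "sign (\<sigma> \<circ> \<tau> \<circ> pinv \<sigma>) = sign \<tau>"
    using s tp perms_comp[OF s(1) tp] by (simp add: sign_perms sign_perms_inv algebra_simps sign_idempotent)
  show "(if t \<circ> (\<sigma> \<circ> \<tau> \<circ> pinv \<sigma>) = tabloid \<nu> T then csign (\<sigma> \<circ> \<tau> \<circ> pinv \<sigma>) else 0) =
        (if t \<circ> \<sigma> \<circ> \<tau> = tabloid \<nu> (T \<circ> \<sigma>) then csign \<tau> else 0)"
    unfolding 1 2 by simp
next
  note s = assms perms_inv[OF assms]
  fix \<rho> assume r: "\<rho> \<in> column_stabilizer \<nu> T"
  note rp = column_stabilizer_perms[OF r]
  show "\<sigma> \<circ> (pinv \<sigma> \<circ> \<rho> \<circ> \<sigma>) \<circ> pinv \<sigma> = \<rho>" using s by (auto simp: fun_eq_iff)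
  show "pinv \<sigma> \<circ> \<rho> \<circ> \<sigma> \<in> column_stabilizer \<nu> (T \<circ> \<sigma>)"
    using r s perms_comp rp unfolding column_stabilizer_def
    by (auto simp: perms_less_iff)
qed

text \<open>The signed sum over a column stabilizer is invariant up to sign under translation by a
  transposition of two entries of a column.\<close>

lemma alternating_sum_zero:
  fixes f :: "(nat => nat) => complex"
  assumes kl: "k < sum_list \<nu>" "l < sum_list \<nu>" "k \<noteq> l" "snd (T k) = snd (T l)"
    and f: "(\<forall>\<sigma>. f (\<sigma> \<circ> transpose k l) = f \<sigma>) \<or> (\<forall>\<sigma>. f (transpose k l \<circ> \<sigma>) = f \<sigma>)"
  shows "(\<Sum>\<sigma>\<in>column_stabilizer \<nu> T. csign \<sigma> * f \<sigma>) = 0"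
proof -
  let ?t = "transpose k l" and ?C = "column_stabilizer \<nu> T"
  let ?S = "(\<Sum>\<sigma>\<in>?C. csign \<sigma> * f \<sigma>)"
  have t: "?t \<in> ?C" using kl by (auto simp: column_stabilizer_def transpose_perms transpose_def)
  have tp: "?t \<in> perms (sum_list \<nu>)" by (rule column_stabilizer_perms[OF t])
  have sg: "sign ?t = - 1" using kl(3) by (simp add: sign_swap_id)
  have t1: "(\<sigma> \<circ> ?t) \<circ> ?t = \<sigma>" and t2: "?t \<circ> (?t \<circ> \<sigma>) = \<sigma>" for \<sigma> :: "nat => nat"
    by (simp_all add: fun_eq_iff)
  have "?S = (\<Sum>\<sigma>\<in>?C. csign (\<sigma> \<circ> ?t) * f (\<sigma> \<circ> ?t))"
    by (rule sum.reindex_bij_witness[of _ "\<lambda>\<sigma>. \<sigma> \<circ> ?t" "\<lambda>\<sigma>. \<sigma> \<circ> ?t"])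
       (simp_all only: t1 column_stabilizer_comp t)
  also have "\<dots> = - (\<Sum>\<sigma>\<in>?C. csign \<sigma> * f (\<sigma> \<circ> ?t))"
    unfolding sum_negf[symmetric]
    by (intro sum.cong refl) (simp add: sign_perms[OF column_stabilizer_perms tp] sg)
  finally have 1: "?S = - (\<Sum>\<sigma>\<in>?C. csign \<sigma> * f (\<sigma> \<circ> ?t))" .
  have "?S = (\<Sum>\<sigma>\<in>?C. csign (?t \<circ> \<sigma>) * f (?t \<circ> \<sigma>))"
    by (rule sum.reindex_bij_witness[of _ "\<lambda>\<sigma>. ?t \<circ> \<sigma>" "\<lambda>\<sigma>. ?t \<circ> \<sigma>"])
       (simp_all only: t2 column_stabilizer_comp t)
  also have "\<dots> = - (\<Sum>\<sigma>\<in>?C. csign \<sigma> * f (?t \<circ> \<sigma>))"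
    unfolding sum_negf[symmetric]
    by (intro sum.cong refl) (simp add: sign_perms[OF tp column_stabilizer_perms] sg)
  finally have 2: "?S = - (\<Sum>\<sigma>\<in>?C. csign \<sigma> * f (?t \<circ> \<sigma>))" .
  from f have "?S = - ?S"
  proof
    assume "\<forall>\<sigma>. f (\<sigma> \<circ> ?t) = f \<sigma>" then show ?thesis using 1 by simp
  next
    assume "\<forall>\<sigma>. f (?t \<circ> \<sigma>) = f \<sigma>" then show ?thesis using 2 by simp
  qed
  then show ?thesis by simp
qed

text \<open>The maximum of a set of \<open>n + 1\<close> naturals is at least \<open>n\<close>.
  Removing it gives an induction for the bound and for the case of equality.\<close>

lemma sum_lessThan_card_le:
  fixes A :: "nat set"
  assumes "finite A"
  shows "\<Sum>{..<card A} \<le> \<Sum>A" and "\<Sum>A = \<Sum>{..<card A} ==> A = {..<card A}"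
proof -
  have "\<Sum>{..<card A} \<le> \<Sum>A \<and> (\<Sum>A = \<Sum>{..<card A} --> A = {..<card A})"
    using assms
  proof (induction "card A" arbitrary: A)
    case 0 then show ?case by simp
  next
    case (Suc n)
    define m where "m = Max A"
    have ne: "A \<noteq> {}" using Suc by auto
    have m: "m \<in> A" using ne Suc by (auto simp: m_def)
    have "A \<subseteq> {..m}" using Suc by (auto simp: m_def)
    then have "card A \<le> Suc m" using card_mono[of "{..m}" A] by simp
    then have nm: "n \<le> m" using Suc(2) by simp
    have c: "n = card (A - {m})" using Suc m by simp
    have IH: "\<Sum>{..<n} \<le> \<Sum>(A - {m})" "\<Sum>(A - {m}) = \<Sum>{..<n} ==> A - {m} = {..<n}"
      using Suc(1)[OF c] Suc(3) c by auto
    have sA: "\<Sum>A = m + \<Sum>(A - {m})" using Suc(3) m by (simp add: sum.remove)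
    have sN: "\<Sum>{..<card A} = n + \<Sum>{..<n}" unfolding Suc(2)[symmetric] by simp
    show ?case
    proof (intro conjI impI)
      show "\<Sum>{..<card A} \<le> \<Sum>A" using sA sN nm IH(1) by linarith
      assume "\<Sum>A = \<Sum>{..<card A}"
      then have "m = n" "\<Sum>(A - {m}) = \<Sum>{..<n}" using sA sN nm IH(1) by linarith+
      then have "A = insert n {..<n}" using IH(2) m by auto
      then show "A = {..<card A}" unfolding Suc(2)[symmetric] by auto
    qed
  qed
  then show "\<Sum>{..<card A} \<le> \<Sum>A" "\<Sum>A = \<Sum>{..<card A} ==> A = {..<card A}" by auto
qed

lemma down_closed_eq_lessThan:
  fixes R :: "nat set"
  assumes "finite R" "!!r r'. r \<in> R ==> r' \<le> r ==> r' \<in> R"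
  shows "R = {..<card R}"
proof (cases "R = {}")
  case False
  have "R = {..<Suc (Max R)}" using assms(2)[OF Max_in[OF assms(1) False]] Max_ge[OF assms(1)] by (auto simp: less_Suc_eq_le)
  then show ?thesis by (metis card_lessThan)
qed simp

lemma partition_rows_closed:
  fixes \<nu> :: "nat list"
  assumes "sorted_wrt (\<ge>) \<nu>" "r < length \<nu>" "c < \<nu> ! r" "r' \<le> r"
  shows "r' < length \<nu> \<and> c < \<nu> ! r'"
proof (cases "r' = r")
  case False
  with assms have "\<nu> ! r \<le> \<nu> ! r'" by (intro sorted_wrt_nth_less[OF assms(1), of r' r]) auto
  with assms show ?thesis by linarith
qed (use assms in simp)

text \<open>If a tabloid has distinct rows on every column of a tableau \<open>T\<close>, then comparing the sums of
  its rows over the columns shows that it uses the same rows as \<open>T\<close> on every column.\<close>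

lemma tabloid_column_permutation:
  assumes nu: "sorted_wrt (\<ge>) \<nu>" and T: "T \<in> tableaux \<nu>" and t: "t \<in> tabloid \<nu> ` tableaux \<nu>"
    and inj: "!!k l. k < sum_list \<nu> ==> l < sum_list \<nu> ==> snd (T k) = snd (T l) ==> t k = t l ==> k = l"
  shows "\<exists>\<rho>\<in>column_stabilizer \<nu> T. t = tabloid \<nu> T \<circ> \<rho>"
proof -
  define N where "N = sum_list \<nu>"
  have bT: "bij_betw T {..<N} (cells \<nu>)" using T by (simp add: tableaux_def N_def)
  obtain T' where T': "T' \<in> tableaux \<nu>" "t = tabloid \<nu> T'" using t by auto
  have bT': "bij_betw T' {..<N} (cells \<nu>)" using T' by (simp add: tableaux_def N_def)
  have tT': "t k = fst (T' k)" if "k < N" for k using that T' by (simp add: tabloid_def N_def)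
  define A where "A c = {k. k < N \<and> snd (T k) = c}" for c
  define Cs where "Cs = snd ` cells \<nu>"
  have finA: "finite (A c)" for c by (rule finite_subset[of _ "{..<N}"]) (auto simp: A_def)
  have img: "(\<lambda>k. fst (T k)) ` A c = {r. r < length \<nu> \<and> c < \<nu> ! r}" (is "_ = ?R c") for c
  proof (intro Set.set_eqI iffI)
    fix r assume "r \<in> (\<lambda>k. fst (T k)) ` A c"
    then obtain k where "k < N" "snd (T k) = c" "r = fst (T k)" by (auto simp: A_def)
    moreover from this have "T k \<in> cells \<nu>" using bT by (auto simp: bij_betw_def)
    ultimately show "r \<in> ?R c" by (auto simp: cells_def)
  next
    fix r assume "r \<in> ?R c"
    then have "(r, c) \<in> cells \<nu>" by (simp add: cells_def)
    then have "(r, c) \<in> T ` {..<N}" using bT by (simp add: bij_betw_def)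
    then obtain k where "k < N" "T k = (r, c)" by (metis imageE lessThan_iff)
    then show "r \<in> (\<lambda>k. fst (T k)) ` A c" by (force simp: A_def)
  qed
  have injT: "inj_on (\<lambda>k. fst (T k)) (A c)" for c
    using bT by (auto simp: inj_on_def A_def bij_betw_def prod_eq_iff)
  have injt: "inj_on t (A c)" for c using inj by (auto simp: inj_on_def A_def N_def)
  \<comment> \<open>The rows meeting a column of a Young diagram form an initial segment, so
    \<open>T\<close> has the least possible row sum on every column.\<close>
  have R: "?R c = {..<card (A c)}" for c
  proof -
    define S where "S = ?R c"
    have "finite S" by (rule finite_subset[of _ "{..<length \<nu>}"]) (auto simp: S_def)
    moreover have "r' \<in> S" if "r \<in> S" "r' \<le> r" for r r'
      using that unfolding S_def mem_Collect_eq by (elim conjE) (rule partition_rows_closed[OF nu])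
    ultimately have "S = {..<card S}" using down_closed_eq_lessThan[of S] by blast
    moreover have "card S = card (A c)" using card_image[OF injT, of c] unfolding img S_def .
    ultimately show ?thesis unfolding S_def by simp
  qed
  have sT: "(\<Sum>k\<in>A c. fst (T k)) = \<Sum>{..<card (A c)}" for c
    using sum.reindex[OF injT, of "\<lambda>x. x"] img R by (simp add: comp_def)
  have st: "(\<Sum>k\<in>A c. t k) = \<Sum>(t ` A c)" for c
    using sum.reindex[OF injt, of "\<lambda>x. x" c] by (simp add: comp_def)
  have ct: "card (t ` A c) = card (A c)" for c using card_image[OF injt] .
  have dec: "(\<Sum>k<N. f k) = (\<Sum>c\<in>Cs. \<Sum>k\<in>A c. f k)" for f :: "nat => nat"
  proof -
    have "(\<Sum>k<N. f k) = (\<Sum>c\<in>Cs. \<Sum>k\<in>{k \<in> {..<N}. snd (T k) = c}. f k)"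
      by (rule sum.group[symmetric]) (use bT in \<open>auto simp: Cs_def bij_betw_def\<close>)
    then show ?thesis by (simp add: A_def)
  qed
  \<comment> \<open>\<open>t\<close> comes from a tableau of the same shape, so its rows summed over
    all entries give the same total over the cells as those of \<open>T\<close>.\<close>
  have "(\<Sum>k<N. t k) = (\<Sum>k<N. fst (T' k))" using tT' by simp
  also have "\<dots> = (\<Sum>x\<in>cells \<nu>. fst x)" using sum.reindex_bij_betw[OF bT', of fst] by simp
  also have "\<dots> = (\<Sum>k<N. fst (T k))" using sum.reindex_bij_betw[OF bT, of fst] by simp
  finally have eq: "(\<Sum>c\<in>Cs. \<Sum>{..<card (A c)}) = (\<Sum>c\<in>Cs. \<Sum>(t ` A c))"
    unfolding dec sT st by simp
  \<comment> \<open>The rows of \<open>t\<close> on a column are distinct, so their sum is at least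
    the minimum attained by \<open>T\<close>. As the totals agree, every column attains its minimum,
    and minimal sets are initial segments.\<close>
  have all: "t ` A c = {..<card (A c)}" if "c \<in> Cs" for c
  proof -
    have "\<Sum>{..<card (A c)} = \<Sum>(t ` A c)"
      by (rule sum_mono_inv[OF eq _ that])
         (use sum_lessThan_card_le(1)[OF finite_imageI[OF finA], of t] ct in \<open>auto simp: Cs_def\<close>)
    then show ?thesis using sum_lessThan_card_le(2)[OF finite_imageI[OF finA], of t c] unfolding ct by simp
  qed
  have cell: "(t k, snd (T k)) \<in> cells \<nu>" if "k < N" for k
  proof -
    have "snd (T k) \<in> Cs" using that bT by (auto simp: Cs_def bij_betw_def)
    moreover have "k \<in> A (snd (T k))" using that by (simp add: A_def)
    ultimately have "t k \<in> ?R (snd (T k))" unfolding R using all[of "snd (T k)"] by (metis imageI)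
    then show ?thesis by (simp add: cells_def)
  qed
  \<comment> \<open>\<open>\<rho> k\<close> is the entry that \<open>T\<close> places in the column
    of \<open>k\<close> and in the row that \<open>t\<close> assigns to \<open>k\<close>.\<close>
  define \<rho> where "\<rho> k = (if k < N then inv_into {..<N} T (t k, snd (T k)) else k)" for k
  have TiN: "(t k, snd (T k)) \<in> T ` {..<N}" if "k < N" for k
    using cell[OF that] bT by (simp add: bij_betw_def)
  have \<rho>: "\<rho> k < N" "T (\<rho> k) = (t k, snd (T k))" if "k < N" for k
    using that inv_into_into[OF TiN[OF that]] f_inv_into_f[OF TiN[OF that]] by (auto simp: \<rho>_def)
  have "inj_on \<rho> {..<N}"
  proof (rule inj_onI)
    fix k l assume "k \<in> {..<N}" "l \<in> {..<N}" "\<rho> k = \<rho> l"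
    then have "(t k, snd (T k)) = (t l, snd (T l))" using \<rho>(2)[of k] \<rho>(2)[of l] by simp
    then show "k = l" using inj \<open>k \<in> _\<close> \<open>l \<in> _\<close> by (simp add: N_def)
  qed
  moreover have "\<rho> ` {..<N} \<subseteq> {..<N}" using \<rho>(1) by auto
  ultimately have "bij_betw \<rho> {..<N} {..<N}"
    by (simp add: bij_betw_def endo_inj_surj)
  then have "\<rho> \<in> perms N" unfolding perms_def
    by (auto intro!: bij_imp_permutes) (auto simp: \<rho>_def split: if_splits)
  then have "\<rho> \<in> column_stabilizer \<nu> T" using \<rho>(2) by (simp add: column_stabilizer_def N_def)
  moreover have "t = tabloid \<nu> T \<circ> \<rho>"
  proof
    fix k show "t k = (tabloid \<nu> T \<circ> \<rho>) k"
    proof (cases "k < N")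
      case True then show ?thesis using \<rho> by (simp add: tabloid_def N_def)
    next
      case False then show ?thesis using T' by (simp add: \<rho>_def tabloid_def N_def)
    qed
  qed
  ultimately show ?thesis by blast
qed

section \<open>Pairing with polytabloids and irreducibility of the Specht module\<close>

lemma specht_fun_outside:
  assumes "u \<in> specht_fun \<nu>" "t \<notin> tabloid \<nu> ` tableaux \<nu>" shows "u t = 0"
  using assms polytab_outside by (auto simp: specht_fun_def ext_tableaux_def)

lemma specht_fun_zero: "(\<lambda>t. 0) \<in> specht_fun \<nu>"
  unfolding specht_fun_def by (rule CollectI, rule exI[of _ "\<lambda>_. 0"]) simp

lemma specht_fun_add: "u \<in> specht_fun \<nu> ==> u' \<in> specht_fun \<nu> ==> (\<lambda>t. u t + u' t) \<in> specht_fun \<nu>"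
proof -
  assume "u \<in> specht_fun \<nu>" "u' \<in> specht_fun \<nu>"
  then obtain c c' where "u = (\<lambda>t. \<Sum>T\<in>ext_tableaux \<nu>. c T * polytab \<nu> T t)"
    "u' = (\<lambda>t. \<Sum>T\<in>ext_tableaux \<nu>. c' T * polytab \<nu> T t)" by (auto simp: specht_fun_def)
  then show ?thesis unfolding specht_fun_def
    by (intro CollectI exI[of _ "\<lambda>T. c T + c' T"]) (simp add: sum.distrib algebra_simps)
qed

lemma specht_fun_scale: "u \<in> specht_fun \<nu> ==> (\<lambda>t. a * u t) \<in> specht_fun \<nu>"
proof -
  assume "u \<in> specht_fun \<nu>"
  then obtain c where "u = (\<lambda>t. \<Sum>T\<in>ext_tableaux \<nu>. c T * polytab \<nu> T t)" by (auto simp: specht_fun_def)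
  then show ?thesis unfolding specht_fun_def
    by (intro CollectI exI[of _ "\<lambda>T. a * c T"]) (simp add: sum_distrib_left algebra_simps)
qed

lemma specht_fun_sum:
  "(!!i. i \<in> I ==> f i \<in> specht_fun \<nu>) ==> (\<lambda>t. \<Sum>i\<in>I. c i * f i t) \<in> specht_fun \<nu>"
  by (induction I rule: infinite_finite_induct)
     (auto simp: specht_fun_zero intro!: specht_fun_add specht_fun_scale)

lemma polytab_in_specht_fun: "T \<in> ext_tableaux \<nu> ==> polytab \<nu> T \<in> specht_fun \<nu>"
  unfolding specht_fun_def
  by (intro CollectI exI[of _ "\<lambda>T'. if T' = T then 1 else 0"]) (simp add: if_distrib[of "\<lambda>x. x * _"] cong: if_cong)

lemma specht_fun_comp:
  assumes "u \<in> specht_fun \<nu>" "\<sigma> \<in> perms (sum_list \<nu>)"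
  shows "(\<lambda>t. u (t \<circ> \<sigma>)) \<in> specht_fun \<nu>"
proof -
  obtain c where u: "u = (\<lambda>t. \<Sum>T\<in>ext_tableaux \<nu>. c T * polytab \<nu> T t)" using assms by (auto simp: specht_fun_def)
  have "polytab \<nu> T (t \<circ> \<sigma>) = polytab \<nu> (T \<circ> pinv \<sigma>) t" for T t
    using polytab_comp[OF perms_inv[OF assms(2)], of T "t \<circ> \<sigma>"] assms(2) by (simp add: comp_assoc)
  then have eq: "(\<lambda>t. u (t \<circ> \<sigma>)) = (\<lambda>t. \<Sum>T\<in>ext_tableaux \<nu>. c T * polytab \<nu> (T \<circ> pinv \<sigma>) t)"
    by (simp add: u)
  show ?thesis unfolding eq
    by (intro specht_fun_sum polytab_in_specht_fun ext_tableaux_comp[OF perms_inv[OF assms(2)]])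
qed

lemma finite_tabloids [simp]: "finite (tabloid \<nu> ` tableaux \<nu>)"
proof -
  have "tabloid \<nu> ` tableaux \<nu> \<subseteq> PiE {..<sum_list \<nu>} (\<lambda>_. {..<length \<nu>})"
  proof (clarsimp simp: tabloid_def tableaux_def)
    fix k T assume "bij_betw T {..<sum_list \<nu>} (cells \<nu>)" "k < sum_list \<nu>"
    then have "T k \<in> cells \<nu>" by (auto simp: bij_betw_def)
    then show "fst (T k) < length \<nu>" by (auto simp: cells_def)
  qed
  then show ?thesis by (rule finite_subset) (simp add: finite_PiE)
qed

text \<open>James's bilinear form: pairing \<open>u\<close> with a polytabloid evaluates the column
  antisymmetrizer of \<open>u\<close> at the tabloid of \<open>T\<close>, since inversion preserves
  the stabilizer and the signs.\<close>

lemma specht_pairing: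
  assumes "u \<in> specht_fun \<nu>" "T \<in> ext_tableaux \<nu>"
  shows "(\<Sum>t\<in>tabloid \<nu> ` tableaux \<nu>. u t * polytab \<nu> T t)
       = (\<Sum>\<sigma>\<in>column_stabilizer \<nu> T. csign \<sigma> * u (tabloid \<nu> T \<circ> \<sigma>))"
proof -
  let ?B = "tabloid \<nu> ` tableaux \<nu>"
  have "(\<Sum>t\<in>?B. u t * polytab \<nu> T t)
      = (\<Sum>\<sigma>\<in>column_stabilizer \<nu> T. \<Sum>t\<in>?B. if t = tabloid \<nu> T \<circ> pinv \<sigma> then csign \<sigma> * u t else 0)"
    unfolding polytab_eq sum_distrib_left
    by (subst sum.swap, intro sum.cong refl)
       (auto simp: comp_inv_eq_iff[symmetric] dest!: column_stabilizer_perms)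
  also have "\<dots> = (\<Sum>\<sigma>\<in>column_stabilizer \<nu> T. csign \<sigma> * u (tabloid \<nu> T \<circ> pinv \<sigma>))"
  proof (intro sum.cong refl)
    fix \<sigma> assume s: "\<sigma> \<in> column_stabilizer \<nu> T"
    have "tabloid \<nu> T \<circ> pinv \<sigma> \<in> ?B"
      using tabloid_image_comp[OF perms_inv[OF column_stabilizer_perms[OF s]]] assms(2) by (auto simp: ext_tableaux_def)
    then show "(\<Sum>t\<in>?B. if t = tabloid \<nu> T \<circ> pinv \<sigma> then csign \<sigma> * u t else 0) = csign \<sigma> * u (tabloid \<nu> T \<circ> pinv \<sigma>)"
      by (simp add: sum.delta')
  qed
  also have "\<dots> = (\<Sum>\<sigma>\<in>column_stabilizer \<nu> T. csign \<sigma> * u (tabloid \<nu> T \<circ> \<sigma>))"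
    by (rule sum.reindex_bij_witness[of _ pinv pinv])
       (auto simp: column_stabilizer_inv sign_perms_inv[OF column_stabilizer_perms]
             dest: column_stabilizer_perms)
  finally show ?thesis .
qed

lemma cnj_polytab: "cnj (polytab \<nu> T t) = polytab \<nu> T t"
  unfolding polytab_eq cnj_sum by (intro sum.cong refl) simp

text \<open>Polytabloids have real coefficients, so a function \<open>u\<close> in their span that
  pairs to zero with all of them is orthogonal to itself for the positive definite Hermitian form on
  tabloids.\<close>

lemma specht_pairing_nondegenerate:
  assumes u: "u \<in> specht_fun \<nu>"
    and z: "!!T. T \<in> ext_tableaux \<nu> ==> (\<Sum>\<sigma>\<in>column_stabilizer \<nu> T. csign \<sigma> * u (tabloid \<nu> T \<circ> \<sigma>)) = 0"
  shows "u = (\<lambda>t. 0)"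
proof
  fix t
  let ?B = "tabloid \<nu> ` tableaux \<nu>"
  obtain c where c: "u = (\<lambda>t. \<Sum>T\<in>ext_tableaux \<nu>. c T * polytab \<nu> T t)" using u by (auto simp: specht_fun_def)
  have "(\<Sum>t\<in>?B. u t * cnj (u t)) = (\<Sum>T\<in>ext_tableaux \<nu>. cnj (c T) * (\<Sum>t\<in>?B. u t * polytab \<nu> T t))"
    by (subst (2) c) (simp add: cnj_polytab sum_distrib_left sum.swap[of _ _ ?B] mult.left_commute)
  also have "\<dots> = 0" using z specht_pairing[OF u] by simp
  finally have "(\<Sum>t\<in>?B. complex_of_real ((cmod (u t))\<^sup>2)) = 0" by (simp only: complex_norm_square)
  then have "complex_of_real (\<Sum>t\<in>?B. (cmod (u t))\<^sup>2) = 0" by simp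
  then have "(\<Sum>t\<in>?B. (cmod (u t))\<^sup>2) = 0" by (simp only: of_real_eq_0_iff)
  then have "\<forall>t\<in>?B. u t = 0" by (subst (asm) sum_nonneg_eq_0_iff) auto
  then show "u t = 0" using specht_fun_outside[OF u] by blast
qed

lemma tableau_stabilizers_meet:
  assumes "T \<in> tableaux \<nu>" "\<sigma> \<in> column_stabilizer \<nu> T" "tabloid \<nu> T \<circ> \<sigma> = tabloid \<nu> T"
  shows "\<sigma> = id"
proof
  fix k
  have p: "\<sigma> \<in> perms (sum_list \<nu>)" by (rule column_stabilizer_perms[OF assms(2)])
  show "\<sigma> k = id k"
  proof (cases "k < sum_list \<nu>")
    case True
    then have "\<sigma> k < sum_list \<nu>" using p by (simp add: perms_less_iff)
    moreover from this have "fst (T (\<sigma> k)) = fst (T k)" using fun_cong[OF assms(3), of k] True by (simp add: tabloid_def)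
    moreover have "snd (T (\<sigma> k)) = snd (T k)" using assms(2) True by (simp add: column_stabilizer_def)
    ultimately show ?thesis using assms(1) True
      by (auto simp: tableaux_def bij_betw_def prod_eq_iff intro: inj_onD[of T "{..<sum_list \<nu>}"])
  next
    case False then show ?thesis using p by (simp add: perms_not_less)
  qed
qed

lemma polytab_self:
  assumes "T \<in> tableaux \<nu>" shows "polytab \<nu> T (tabloid \<nu> T) = 1"
proof -
  have "polytab \<nu> T (tabloid \<nu> T) = (\<Sum>\<sigma>\<in>column_stabilizer \<nu> T. if \<sigma> = id then 1 else 0)"
    unfolding polytab_eq by (intro sum.cong refl) (use tableau_stabilizers_meet[OF assms] in \<open>auto simp: sign_id\<close>)
  then show ?thesis by simp
qed

text \<open>Either two entries of a column of \<open>T\<close> lie in the same row of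
  \<open>t\<close>, and both sides cancel by a transposition, or \<open>t\<close> arises from the
  tabloid of \<open>T\<close> by a column permutation, which contributes only its sign.\<close>

lemma column_antisymmetrizer_specht:
  assumes nu: "sorted_wrt (\<ge>) \<nu>" and u: "u \<in> specht_fun \<nu>" and T: "T \<in> ext_tableaux \<nu>"
  shows "(\<Sum>\<sigma>\<in>column_stabilizer \<nu> T. csign \<sigma> * u (t \<circ> \<sigma>))
       = (\<Sum>\<sigma>\<in>column_stabilizer \<nu> T. csign \<sigma> * u (tabloid \<nu> T \<circ> \<sigma>)) * polytab \<nu> T t"
proof (cases "t \<in> tabloid \<nu> ` tableaux \<nu>")
  case False
  then have "u (t \<circ> \<sigma>) = 0" if "\<sigma> \<in> column_stabilizer \<nu> T" for \<sigma>
    using specht_fun_outside[OF u] tabloid_image_comp[OF column_stabilizer_perms[OF that]] by blast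
  then show ?thesis using polytab_outside[OF False] T by (simp add: ext_tableaux_def)
next
  case t: True
  have T': "T \<in> tableaux \<nu>" using T by (simp add: ext_tableaux_def)
  show ?thesis
  proof (cases "\<exists>k l. k < sum_list \<nu> \<and> l < sum_list \<nu> \<and> snd (T k) = snd (T l) \<and> t k = t l \<and> k \<noteq> l")
    case True
    then obtain k l where kl: "k < sum_list \<nu>" "l < sum_list \<nu>" "k \<noteq> l" "snd (T k) = snd (T l)" and e: "t k = t l" by blast
    have tt: "t \<circ> transpose k l = t" using e by (auto simp: fun_eq_iff transpose_def)
    have *: "(\<Sum>\<sigma>\<in>column_stabilizer \<nu> T. csign \<sigma> * f (t \<circ> \<sigma>)) = 0" for f
      by (rule alternating_sum_zero[OF kl], rule disjI2) (simp add: comp_assoc[symmetric] tt)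
    have "polytab \<nu> T t = (\<Sum>\<sigma>\<in>column_stabilizer \<nu> T. csign \<sigma> * (if t \<circ> \<sigma> = tabloid \<nu> T then 1 else 0))"
      unfolding polytab_eq by (intro sum.cong refl) simp
    then show ?thesis using *[of u] *[of "\<lambda>s. if s = tabloid \<nu> T then 1 else 0"] by simp
  next
    case False
    then obtain \<rho> where \<rho>: "\<rho> \<in> column_stabilizer \<nu> T" "t = tabloid \<nu> T \<circ> \<rho>"
      using tabloid_column_permutation[OF nu T' t] by metis
    note rp = column_stabilizer_perms[OF \<rho>(1)]
    have *: "(\<Sum>\<sigma>\<in>column_stabilizer \<nu> T. csign \<sigma> * f (t \<circ> \<sigma>)) =
      csign \<rho> * (\<Sum>\<sigma>\<in>column_stabilizer \<nu> T. csign \<sigma> * f (tabloid \<nu> T \<circ> \<sigma>))" for f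
      unfolding sum_distrib_left
    proof (rule sum.reindex_bij_witness[of _ "\<lambda>\<sigma>. pinv \<rho> \<circ> \<sigma>" "\<lambda>\<sigma>. \<rho> \<circ> \<sigma>"])
      fix \<sigma> assume s: "\<sigma> \<in> column_stabilizer \<nu> T"
      show "csign \<rho> * (csign (\<rho> \<circ> \<sigma>) * f (tabloid \<nu> T \<circ> (\<rho> \<circ> \<sigma>))) = csign \<sigma> * f (t \<circ> \<sigma>)"
        using sign_perms[OF rp column_stabilizer_perms[OF s]] \<rho>(2)
        by (simp add: comp_assoc mult.assoc[symmetric] of_int_mult[symmetric] sign_idempotent del: of_int_mult)
    qed (use \<rho> rp in \<open>auto simp: comp_assoc[symmetric] column_stabilizer_comp column_stabilizer_inv\<close>)
    have p: "polytab \<nu> T s = (\<Sum>\<sigma>\<in>column_stabilizer \<nu> T. csign \<sigma> * (if s \<circ> \<sigma> = tabloid \<nu> T then 1 else 0))" for s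
      unfolding polytab_eq by (intro sum.cong refl) simp
    have "polytab \<nu> T t = csign \<rho> * polytab \<nu> T (tabloid \<nu> T)"
      unfolding p using *[of "\<lambda>s. if s = tabloid \<nu> T then 1 else 0"] by simp
    then show ?thesis using *[of u] polytab_self[OF T'] by simp
  qed
qed

text \<open>James's argument: a nonzero vector of a Specht module pairs nontrivially with some
  polytabloid, and the corresponding column antisymmetrizer maps it to a multiple of that polytabloid.\<close>

lemma specht_fun_irreducible:
  assumes nu: "sorted_wrt (\<ge>) \<nu>" and H: "H \<subseteq> specht_fun \<nu>"
    and add: "!!u v. u \<in> H ==> v \<in> H ==> (\<lambda>t. u t + v t) \<in> H"
    and scale: "!!c u. u \<in> H ==> (\<lambda>t. c * u t) \<in> H"
    and act: "!!\<sigma> u. \<sigma> \<in> perms (sum_list \<nu>) ==> u \<in> H ==> (\<lambda>t. u (t \<circ> \<sigma>)) \<in> H"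
    and u: "u \<in> H" "u \<noteq> (\<lambda>t. 0)"
  shows "specht_fun \<nu> \<subseteq> H"
proof -
  have zero: "(\<lambda>t. 0) \<in> H" using scale[OF u(1), of 0] by simp
  have sum: "(\<lambda>t. \<Sum>i\<in>I. c i * f i t) \<in> H" if "finite I" "!!i. i \<in> I ==> f i \<in> H" for c and f :: "'i => _" and I
    using that by (induction I) (auto simp: zero intro!: add scale)
  obtain T where T: "T \<in> ext_tableaux \<nu>"
    "(\<Sum>\<sigma>\<in>column_stabilizer \<nu> T. csign \<sigma> * u (tabloid \<nu> T \<circ> \<sigma>)) \<noteq> 0" (is "?c \<noteq> 0")
    using specht_pairing_nondegenerate[of u \<nu>] u H by blast
  have "(\<lambda>t. \<Sum>\<sigma>\<in>column_stabilizer \<nu> T. csign \<sigma> * u (t \<circ> \<sigma>)) \<in> H"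
    by (rule sum) (auto intro!: act u dest: column_stabilizer_perms)
  then have "(\<lambda>t. ?c * polytab \<nu> T t) \<in> H"
    using column_antisymmetrizer_specht[OF nu _ T(1)] u H by (metis (no_types, lifting) subsetD ext)
  from scale[OF this, of "inverse ?c"] have e: "polytab \<nu> T \<in> H" using T(2) by (simp add: mult.assoc[symmetric])
  \<comment> \<open>Any two extensional tableaux differ by a permutation of the entries, so one
    polytabloid in \<open>H\<close> brings all others with it.\<close>
  have all: "polytab \<nu> T' \<in> H" if T': "T' \<in> ext_tableaux \<nu>" for T'
  proof -
    define N where "N = sum_list \<nu>"
    have b: "bij_betw T {..<N} (cells \<nu>)" "bij_betw T' {..<N} (cells \<nu>)"
      using T(1) T' by (auto simp: ext_tableaux_def tableaux_def N_def)
    define \<sigma> where "\<sigma> k = (if k < N then inv_into {..<N} T (T' k) else k)" for k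
    have "bij_betw (inv_into {..<N} T \<circ> T') {..<N} {..<N}"
      using bij_betw_trans[OF b(2) bij_betw_inv_into[OF b(1)]] .
    then have "bij_betw \<sigma> {..<N} {..<N}" by (rule bij_betw_cong[THEN iffD1, rotated]) (simp add: \<sigma>_def)
    then have s: "\<sigma> \<in> perms N" unfolding perms_def by (auto intro!: bij_imp_permutes) (auto simp: \<sigma>_def split: if_splits)
    have eT: "T \<circ> \<sigma> = T'"
    proof
      fix k show "(T \<circ> \<sigma>) k = T' k"
      proof (cases "k < N")
        case True
        then have "T' k \<in> T ` {..<N}" using b by (auto simp: bij_betw_def)
        then show ?thesis using True by (simp add: \<sigma>_def f_inv_into_f)
      next
        case False then show ?thesis using T(1) T' by (simp add: \<sigma>_def ext_tableaux_def extensional_def N_def)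
      qed
    qed
    have "polytab \<nu> T' t = polytab \<nu> T (t \<circ> pinv \<sigma>)" for t
      using polytab_comp[of \<sigma> \<nu> T "t \<circ> pinv \<sigma>"] s by (simp add: eT comp_assoc N_def)
    then have "polytab \<nu> T' = (\<lambda>t. polytab \<nu> T (t \<circ> pinv \<sigma>))" by blast
    then show ?thesis using act[OF perms_inv e, of \<sigma>] s by (simp add: N_def)
  qed
  show ?thesis unfolding specht_fun_def using sum[OF finite_ext_tableaux all] by auto
qed

section \<open>The span of the polytabloids identified with the function space\<close>

lemma ext_tableau_of_tableau:
  assumes "T \<in> tableaux \<nu>"
  shows "restrict T {..<sum_list \<nu>} \<in> ext_tableaux \<nu>"
    "polytabloid \<nu> (restrict T {..<sum_list \<nu>}) = polytabloid \<nu> T"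
proof -
  show "restrict T {..<sum_list \<nu>} \<in> ext_tableaux \<nu>"
    using assms bij_betw_cong[of "{..<sum_list \<nu>}" "restrict T {..<sum_list \<nu>}" T "cells \<nu>"]
    by (simp add: ext_tableaux_def tableaux_def)
  have "tabloid \<nu> (restrict T {..<sum_list \<nu>}) = tabloid \<nu> T" by (auto simp: tabloid_def)
  moreover have "column_stabilizer \<nu> (restrict T {..<sum_list \<nu>}) = column_stabilizer \<nu> T"
    by (auto simp: column_stabilizer_def perms_less_iff)
  ultimately show "polytabloid \<nu> (restrict T {..<sum_list \<nu>}) = polytabloid \<nu> T"
    by (simp add: polytabloid_def)
qed

lemma linear_rep_tabloid: "linear_rep (perms (sum_list \<nu>)) (tabloid_rep \<nu>)"
  unfolding tabloid_rep_def
  by (rule linear_rep_free) (auto simp: tabloid_image_comp[OF perms_inv] )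

lemma act_tabloid_rep:
  assumes "\<sigma> \<in> perms (sum_list \<nu>)"
  shows "lookup (act (tabloid_rep \<nu>) \<sigma> p) t = lookup p (t \<circ> \<sigma>)"
proof -
  have "lookup (act (tabloid_rep \<nu>) \<sigma> p) t = (\<Sum>b\<in>keys p. if b = t \<circ> \<sigma> then lookup p b else 0)"
    unfolding tabloid_rep_def act_free_rep Poly_Mapping.lookup_sum
    by (intro sum.cong refl) (use assms in \<open>auto simp: Poly_Mapping.lookup_single Poly_Mapping.when_def comp_assoc\<close>)
  then show ?thesis by (simp add: Poly_Mapping.in_keys_iff)
qed

lemma polytabloid_in:
  assumes "T \<in> tableaux \<nu>" shows "polytabloid \<nu> T \<in> carrier (tabloid_rep \<nu>)"
  using polytab_outside[OF _ assms] by (auto simp: tabloid_rep_def polytab_def Poly_Mapping.in_keys_iff)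

text \<open>Restricting a tableau to \<open>{..<N}\<close> does not change its polytabloid, so the
  finite family indexed by \<open>ext_tableaux\<close> already spans.\<close>

lemma carrier_specht:
  "carrier (specht \<nu>) = {p. lookup p \<in> specht_fun \<nu>}"
proof -
  interpret cspace "tabloid_rep \<nu>" by (rule linear_rep_cspace[OF linear_rep_tabloid])
  have sub: "polytabloid \<nu> ` tableaux \<nu> \<subseteq> carrier (tabloid_rep \<nu>)" using polytabloid_in by auto
  let ?H = "{p. lookup p \<in> specht_fun \<nu>}"
  have "submodule ?H complex_field (tabloid_rep \<nu>)"
  proof (rule subspaceI)
    show "?H \<subseteq> carrier (tabloid_rep \<nu>)"
      using specht_fun_outside[of _ \<nu>] by (fastforce simp: tabloid_rep_def Poly_Mapping.in_keys_iff)
    have *: "lookup (p + q) = (\<lambda>t. lookup p t + lookup q t)" "lookup (cscale c p) = (\<lambda>t. c * lookup p t)"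
      "lookup (0 :: 'x \<Rightarrow>\<^sub>0 complex) = (\<lambda>t. 0)" for p q :: "'x \<Rightarrow>\<^sub>0 complex" and c
      by (auto simp: Poly_Mapping.lookup_add)
    show "\<zero>\<^bsub>tabloid_rep \<nu>\<^esub> \<in> ?H" using specht_fun_zero by (simp add: tabloid_rep_def *)
    show "x \<oplus>\<^bsub>tabloid_rep \<nu>\<^esub> y \<in> ?H" if "x \<in> ?H" "y \<in> ?H" for x y
      using that specht_fun_add by (simp add: tabloid_rep_def *)
    show "c \<odot>\<^bsub>tabloid_rep \<nu>\<^esub> x \<in> ?H" if "x \<in> ?H" for x c
      using that specht_fun_scale by (simp add: tabloid_rep_def *)
  qed
  moreover have "polytabloid \<nu> ` tableaux \<nu> \<subseteq> ?H"
    using ext_tableau_of_tableau polytab_in_specht_fun unfolding polytab_def[abs_def] by fastforce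
  ultimately have 1: "lin_span (tabloid_rep \<nu>) (polytabloid \<nu> ` tableaux \<nu>) \<subseteq> ?H"
    by (rule lin_span_least)
  have 2: "p \<in> lin_span (tabloid_rep \<nu>) (polytabloid \<nu> ` tableaux \<nu>)" if p: "p \<in> ?H" for p
  proof -
    note L = subspaceD[OF subspace_lin_span[OF sub]]
    obtain c where c: "lookup p = (\<lambda>t. \<Sum>T\<in>ext_tableaux \<nu>. c T * polytab \<nu> T t)" using p by (auto simp: specht_fun_def)
    have "p = (\<Sum>T\<in>ext_tableaux \<nu>. cscale (c T) (polytabloid \<nu> T))"
      by (rule poly_mapping_eqI) (simp add: c Poly_Mapping.lookup_sum polytab_def)
    moreover have "(\<Sum>T\<in>I. cscale (c T) (polytabloid \<nu> T)) \<in> lin_span (tabloid_rep \<nu>) (polytabloid \<nu> ` tableaux \<nu>)"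
      if "finite I" "I \<subseteq> ext_tableaux \<nu>" for I
      using that
    proof (induction I)
      case empty then show ?case using L(2) by (simp add: tabloid_rep_def)
    next
      case (insert T I)
      have "polytabloid \<nu> T \<in> lin_span (tabloid_rep \<nu>) (polytabloid \<nu> ` tableaux \<nu>)"
        using lin_span_superset insert by (fastforce simp: ext_tableaux_def)
      then show ?case using L(3)[OF L(4)] insert by (simp add: tabloid_rep_def)
    qed
    ultimately show ?thesis by simp
  qed
  show ?thesis using 1 2 by (auto simp: specht_def)
qed

lemma specht_fun_eq_lookup: "u \<in> specht_fun \<nu> ==> \<exists>p\<in>carrier (specht \<nu>). lookup p = u"
proof -
  assume u: "u \<in> specht_fun \<nu>"
  have "finite {t. u t \<noteq> 0}"
    by (rule finite_subset[OF _ finite_tabloids]) (use specht_fun_outside[OF u] in auto)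
  then have "lookup (Abs_poly_mapping u) = u" by simp
  then show ?thesis using u carrier_specht by (metis mem_Collect_eq)
qed

lemma specht_simps:
  "zero (specht \<nu>) = 0" "add (specht \<nu>) = (+)" "module.smult (specht \<nu>) = cscale"
  "act (specht \<nu>) = act (tabloid_rep \<nu>)"
  by (simp_all add: specht_def) (simp_all add: tabloid_rep_def)

lemma linear_rep_specht: "linear_rep (perms (sum_list \<nu>)) (specht \<nu>)"
proof -
  have c: "carrier (specht \<nu>) = lin_span (tabloid_rep \<nu>) (polytabloid \<nu> ` tableaux \<nu>)" by (simp add: specht_def)
  have "stable_subspace (perms (sum_list \<nu>)) (tabloid_rep \<nu>) (carrier (specht \<nu>))"
  proof -
    interpret cspace "tabloid_rep \<nu>" by (rule linear_rep_cspace[OF linear_rep_tabloid])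
    have "submodule (carrier (specht \<nu>)) complex_field (tabloid_rep \<nu>)" unfolding c
      by (rule subspace_lin_span) (use polytabloid_in in auto)
    moreover have "lookup (act (tabloid_rep \<nu>) \<sigma> p) = (\<lambda>t. lookup p (t \<circ> \<sigma>))" if "\<sigma> \<in> perms (sum_list \<nu>)" for \<sigma> p
      using act_tabloid_rep[OF that] by auto
    ultimately show ?thesis unfolding stable_subspace_def
      using specht_fun_comp by (simp add: carrier_specht)
  qed
  from linear_rep_restrict[OF linear_rep_tabloid this] show ?thesis by (simp add: specht_def)
qed

lemma exists_ext_tableau: "\<exists>T. T \<in> ext_tableaux \<nu>"
proof -
  have "card (cells \<nu>) = (\<Sum>r<length \<nu>. \<nu> ! r)"
  proof -
    have "cells \<nu> = Sigma {..<length \<nu>} (\<lambda>r. {..<\<nu> ! r})" by (auto simp: cells_def)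
    then show ?thesis by simp
  qed
  also have "\<dots> = sum_list \<nu>" by (simp add: sum_list_sum_nth atLeast0LessThan)
  finally have "card {..<sum_list \<nu>} = card (cells \<nu>)" by simp
  then obtain T where "bij_betw T {..<sum_list \<nu>} (cells \<nu>)"
    using finite_same_card_bij[of "{..<sum_list \<nu>}" "cells \<nu>"] by auto
  then show ?thesis using ext_tableau_of_tableau(1)[of T] by (auto simp: tableaux_def)
qed

section \<open>Functions on words\<close>

definition words :: "nat => nat => (nat => nat) set" where
  "words n N = PiE {..<N} (\<lambda>_. {..<n})"

text \<open>The action of \<open>gl_n\<close> on the \<open>N\<close>-th tensor power of the
  standard module, on the coefficient functions of the basis indexed by words.\<close>

definition word_act :: "nat => nat => complex mat => ((nat => nat) => complex) => (nat => nat) => complex" where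
  "word_act n N A f s = (\<Sum>k<N. \<Sum>j<n. A $$ (s k, j) * f (s(k := j)))"

lemma finite_words [simp]: "finite (words n N)"
  by (simp add: words_def finite_PiE)

lemma words_less: "s \<in> words n N ==> k < N ==> s k < n"
  by (auto simp: words_def PiE_def)

lemma words_upd: "s \<in> words n N ==> k < N ==> j < n ==> s(k := j) \<in> words n N"
  by (auto simp: words_def PiE_def extensional_def)

lemma words_comp: "s \<in> words n N ==> \<sigma> \<in> perms N ==> s \<circ> \<sigma> \<in> words n N"
  by (auto simp: words_def PiE_def extensional_def perms_less_iff perms_not_less)

lemma words_comp_iff: "\<sigma> \<in> perms N ==> s \<circ> \<sigma> \<in> words n N \<longleftrightarrow> s \<in> words n N"
  using words_comp[of "s \<circ> \<sigma>" n N "pinv \<sigma>"] words_comp[of s n N \<sigma>] by (auto simp: comp_assoc)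

lemma words_eqI: "s \<in> words n N ==> r \<in> words n N ==> (!!k. k < N ==> s k = r k) ==> s = r"
  unfolding words_def by (rule PiE_ext) auto

lemma fun_upd_comp_perm: "\<sigma> \<in> perms N ==> (s \<circ> \<sigma>)(k := j) = (s(\<sigma> k := j)) \<circ> \<sigma>"
  using perms_inj[of \<sigma> N] by (auto simp: fun_eq_iff inj_eq)

lemma sum_perm: "\<sigma> \<in> perms N ==> (\<Sum>k<N. f (\<sigma> k)) = (\<Sum>k<N. f k)"
  using sum.reindex_bij_betw[OF perms_bij_betw] .

lemma sum_swap3: "(\<Sum>a\<in>A. \<Sum>b\<in>B. \<Sum>c\<in>C. g a b c) = (\<Sum>c\<in>C. \<Sum>a\<in>A. \<Sum>b\<in>B. g a b c)"
proof -
  have "(\<Sum>a\<in>A. \<Sum>b\<in>B. \<Sum>c\<in>C. g a b c) = (\<Sum>a\<in>A. \<Sum>c\<in>C. \<Sum>b\<in>B. g a b c)"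
    by (rule sum.cong[OF refl], rule sum.swap)
  then show ?thesis by (simp only: sum.swap[of _ C A])
qed

text \<open>The commuting half of Schur-Weyl duality: a permutation of the places merely relabels
  the sum over the tensor factors.\<close>

lemma word_act_comp:
  assumes "\<sigma> \<in> perms N"
  shows "word_act n N A f (s \<circ> \<sigma>) = word_act n N A (\<lambda>s. f (s \<circ> \<sigma>)) s"
  unfolding word_act_def fun_upd_comp_perm[OF assms]
  using sum_perm[OF assms, of "\<lambda>k. \<Sum>j<n. A $$ (s k, j) * f (s(k := j) \<circ> \<sigma>)"] by simp

lemma word_act_cong:
  assumes "s \<in> words n N" "!!s. s \<in> words n N ==> f s = g s"
  shows "word_act n N A f s = word_act n N A g s"
  unfolding word_act_def by (intro sum.cong refl) (use assms words_upd in auto)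

lemma word_act_linear:
  "word_act n N A (\<lambda>s. f s + g s) s = word_act n N A f s + word_act n N A g s"
  "word_act n N A (\<lambda>s. c * f s) s = c * word_act n N A f s"
  by (simp_all add: word_act_def sum.distrib sum_distrib_left algebra_simps)

lemma word_act_mat_linear:
  assumes "A \<in> carrier_mat n n" "s \<in> words n N"
  shows "B \<in> carrier_mat n n ==> word_act n N (A + B) f s = word_act n N A f s + word_act n N B f s"
    and "word_act n N (c \<cdot>\<^sub>m A) f s = c * word_act n N A f s"
proof -
  have *: "B \<in> carrier_mat n n ==> (A + B) $$ (s k, j) = A $$ (s k, j) + B $$ (s k, j)"
    "(c \<cdot>\<^sub>m A) $$ (s k, j) = c * A $$ (s k, j)" if "k < N" "j < n" for k j
    using assms words_less[OF assms(2) that(1)] that by auto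
  show "word_act n N (A + B) f s = word_act n N A f s + word_act n N B f s" if "B \<in> carrier_mat n n"
    unfolding word_act_def sum.distrib[symmetric]
    by (intro sum.cong refl) (simp add: * that distrib_right)
  show "word_act n N (c \<cdot>\<^sub>m A) f s = c * word_act n N A f s"
    unfolding word_act_def sum_distrib_left by (intro sum.cong refl) (simp add: * mult.assoc)
qed

text \<open>Two operators acting on the same factor multiply as matrices; the remaining terms, where
  they act on different factors \<open>k\<close> and \<open>l\<close>, form the double sum.\<close>

lemma word_act_mult:
  assumes A: "A \<in> carrier_mat n n" "B \<in> carrier_mat n n" and s: "s \<in> words n N"
  shows "word_act n N A (word_act n N B f) s = word_act n N (A * B) f s +
    (\<Sum>k<N. \<Sum>l\<in>{..<N} - {k}. \<Sum>i<n. \<Sum>j<n. A $$ (s k, i) * B $$ (s l, j) * f (s(k := i, l := j)))"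
proof -
  have *: "word_act n N B f (s(k := i)) = (\<Sum>j<n. B $$ (i, j) * f (s(k := j))) +
     (\<Sum>l\<in>{..<N} - {k}. \<Sum>j<n. B $$ (s l, j) * f (s(k := i, l := j)))" if "k < N" for k i
    unfolding word_act_def by (subst sum.remove[of _ k]) (use that in auto)
  have AB: "(A * B) $$ (s k, j) = (\<Sum>i<n. A $$ (s k, i) * B $$ (i, j))" if "k < N" "j < n" for k j
    using words_less[OF s that(1)] that A by (auto simp: scalar_prod_def atLeast0LessThan)
  have "word_act n N A (word_act n N B f) s = (\<Sum>k<N. \<Sum>i<n. A $$ (s k, i) * (\<Sum>j<n. B $$ (i, j) * f (s(k := j))))
    + (\<Sum>k<N. \<Sum>i<n. A $$ (s k, i) * (\<Sum>l\<in>{..<N} - {k}. \<Sum>j<n. B $$ (s l, j) * f (s(k := i, l := j))))"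
    unfolding word_act_def[of n N A] by (simp add: * distrib_left sum.distrib)
  also have "(\<Sum>k<N. \<Sum>i<n. A $$ (s k, i) * (\<Sum>j<n. B $$ (i, j) * f (s(k := j)))) = word_act n N (A * B) f s"
  proof -
    have "(\<Sum>i<n. A $$ (s k, i) * (\<Sum>j<n. B $$ (i, j) * f (s(k := j)))) = (\<Sum>j<n. (A * B) $$ (s k, j) * f (s(k := j)))"
      if "k < N" for k
      unfolding sum_distrib_left by (subst sum.swap) (simp add: AB that sum_distrib_right mult.assoc)
    then show ?thesis by (simp add: word_act_def)
  qed
  also have "(\<Sum>k<N. \<Sum>i<n. A $$ (s k, i) * (\<Sum>l\<in>{..<N} - {k}. \<Sum>j<n. B $$ (s l, j) * f (s(k := i, l := j))))
    = (\<Sum>k<N. \<Sum>l\<in>{..<N} - {k}. \<Sum>i<n. \<Sum>j<n. A $$ (s k, i) * B $$ (s l, j) * f (s(k := i, l := j)))"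
    unfolding sum_distrib_left by (subst (2) sum.swap) (simp add: mult.assoc)
  finally show ?thesis .
qed

text \<open>Operators on different factors commute, so exchanging \<open>k\<close> and
  \<open>l\<close> identifies the two double sums of \<open>word_act_mult\<close> and only the
  matrix products survive.\<close>

lemma word_act_commutator:
  assumes A: "A \<in> carrier_mat n n" "B \<in> carrier_mat n n" and s: "s \<in> words n N"
  shows "word_act n N (A * B - B * A) f s
       = word_act n N A (word_act n N B f) s - word_act n N B (word_act n N A f) s"
proof -
  let ?D = "\<lambda>A B. (\<Sum>k<N. \<Sum>l\<in>{..<N} - {k}. \<Sum>i<n. \<Sum>j<n. A $$ (s k, i) * B $$ (s l, j) * f (s(k := i, l := j)))"
  have sw: "(\<Sum>k<N. \<Sum>l\<in>{..<N} - {k}. h k l) = (\<Sum>k<N. \<Sum>l\<in>{..<N} - {k}. h l k)" for h :: "nat => nat => complex"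
    unfolding sum.Sigma[OF finite_lessThan ballI[OF finite_Diff[OF finite_lessThan]]]
    by (rule sum.reindex_bij_witness[of _ "\<lambda>(k, l). (l, k)" "\<lambda>(k, l). (l, k)"]) auto
  have "?D A B = (\<Sum>k<N. \<Sum>l\<in>{..<N} - {k}. \<Sum>i<n. \<Sum>j<n. A $$ (s l, i) * B $$ (s k, j) * f (s(l := i, k := j)))"
    by (rule sw)
  also have "\<dots> = ?D B A"
  proof (rule sum.cong[OF refl], rule sum.cong[OF refl])
    fix k l assume "k \<in> {..<N}" "l \<in> {..<N} - {k}"
    then have tw: "s(l := i, k := j) = s(k := j, l := i)" for i j by (auto simp: fun_upd_twist)
    show "(\<Sum>i<n. \<Sum>j<n. A $$ (s l, i) * B $$ (s k, j) * f (s(l := i, k := j))) =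
          (\<Sum>i<n. \<Sum>j<n. B $$ (s k, i) * A $$ (s l, j) * f (s(k := i, l := j)))"
      by (subst sum.swap) (simp add: tw mult_ac)
  qed
  finally have "?D A B = ?D B A" .
  moreover have "word_act n N (A * B - B * A) f s = word_act n N (A * B) f s - word_act n N (B * A) f s"
  proof -
    have "(A * B - B * A) $$ (s k, j) = (A * B) $$ (s k, j) - (B * A) $$ (s k, j)" if "k < N" "j < n" for k j
      using A words_less[OF s that(1)] that by auto
    then show ?thesis unfolding word_act_def sum_subtractf[symmetric]
      by (intro sum.cong refl) (simp add: left_diff_distrib)
  qed
  ultimately show ?thesis unfolding word_act_mult[OF A s] word_act_mult[OF A(2,1) s] by simp
qed

lemma word_act_one:
  assumes "s \<in> words n N"
  shows "word_act n N (1\<^sub>m n) f s = of_nat N * f s"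
proof -
  have "(\<Sum>j<n. 1\<^sub>m n $$ (s k, j) * f (s(k := j))) = f s" if "k < N" for k
  proof -
    have "(\<Sum>j<n. 1\<^sub>m n $$ (s k, j) * f (s(k := j))) = (\<Sum>j<n. if j = s k then f s else 0)"
      by (intro sum.cong refl) (use words_less[OF assms that] in auto)
    then show ?thesis using words_less[OF assms that] by simp
  qed
  then show ?thesis by (simp add: word_act_def)
qed

definition elem_mat :: "nat => nat => nat => complex mat" where
  "elem_mat n c j = mat n n (\<lambda>(a, b). if a = c \<and> b = j then 1 else 0)"

lemma elem_mat_carrier [simp]: "elem_mat n c j \<in> carrier_mat n n"
  by (simp add: elem_mat_def)

lemma elem_mat_index: "a < n ==> b < n ==> elem_mat n c j $$ (a, b) = (if a = c \<and> b = j then 1 else 0)"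
  by (simp add: elem_mat_def)

lemma word_act_elem_mat:
  assumes "s \<in> words n N" "j < n"
  shows "word_act n N (elem_mat n c j) f s = (\<Sum>k<N. if s k = c then f (s(k := j)) else 0)"
  unfolding word_act_def
proof (rule sum.cong[OF refl])
  fix k assume "k \<in> {..<N}"
  then have "(\<Sum>i<n. elem_mat n c j $$ (s k, i) * f (s(k := i))) = (\<Sum>i<n. if i = j then (if s k = c then f (s(k := j)) else 0) else 0)"
    by (intro sum.cong refl) (use words_less[OF assms(1)] in \<open>auto simp: elem_mat_index\<close>)
  then show "(\<Sum>i<n. elem_mat n c j $$ (s k, i) * f (s(k := i))) = (if s k = c then f (s(k := j)) else 0)"
    using assms(2) by simp
qed

section \<open>Schur modules\<close>

definition fun_rep :: "('b => 'j => complex) set => ('g => ('b => 'j => complex) => 'b => 'j => complex)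
    => ('g, 'b => 'j => complex) rep" where
  "fun_rep C \<alpha> = \<lparr>carrier = C, mult = undefined, one = undefined, zero = (\<lambda>b j. 0),
     add = (\<lambda>f g b j. f b j + g b j), smult = (\<lambda>c f b j. c * f b j), act = \<alpha>\<rparr>"

lemma fun_rep_simps [simp]:
  "carrier (fun_rep C \<alpha>) = C" "zero (fun_rep C \<alpha>) = (\<lambda>b j. 0)"
  "add (fun_rep C \<alpha>) = (\<lambda>f g b j. f b j + g b j)"
  "module.smult (fun_rep C \<alpha>) = (\<lambda>c f b j. c * f b j)" "act (fun_rep C \<alpha>) = \<alpha>"
  by (simp_all add: fun_rep_def)

lemma module_fun_rep:
  assumes "(\<lambda>b j. 0) \<in> C" "!!f g. f \<in> C ==> g \<in> C ==> (\<lambda>b j. f b j + g b j) \<in> C"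
    "!!c f. f \<in> C ==> (\<lambda>b j. c * f b j) \<in> C"
  shows "module complex_field (fun_rep C \<alpha>)"
proof (rule moduleI[OF cring_complex_field])
  show "abelian_group (fun_rep C \<alpha>)"
  proof (rule abelian_groupI)
    fix f assume "f \<in> carrier (fun_rep C \<alpha>)"
    then show "\<exists>g\<in>carrier (fun_rep C \<alpha>). g \<oplus>\<^bsub>fun_rep C \<alpha>\<^esub> f = \<zero>\<^bsub>fun_rep C \<alpha>\<^esub>"
      using assms(3)[of f "-1"] by (intro bexI[of _ "\<lambda>b j. (-1) * f b j"]) auto
  qed (auto simp: assms algebra_simps)
qed (auto simp: assms algebra_simps)

text \<open>A model of the Schur functor: the \<open>S_N\<close>-invariants in the tensor product of
  the \<open>N\<close>-th tensor power of the standard module with the Specht module. Prescribing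
  zero off the words makes equality of elements equality of functions.\<close>

definition schur_space :: "nat => nat list => ((nat => nat) => (nat => nat) => complex) set" where
  "schur_space n \<nu> = {\<phi>. (\<forall>s. s \<notin> words n (sum_list \<nu>) --> \<phi> s = (\<lambda>t. 0))
     \<and> (\<forall>s\<in>words n (sum_list \<nu>). \<phi> s \<in> specht_fun \<nu>)
     \<and> (\<forall>\<sigma>\<in>perms (sum_list \<nu>). \<forall>s\<in>words n (sum_list \<nu>). \<forall>t. \<phi> (s \<circ> \<sigma>) (t \<circ> \<sigma>) = \<phi> s t)}"

definition schur_act :: "nat => nat => complex mat => ((nat => nat) => 'j => complex)
    => (nat => nat) => 'j => complex" where
  "schur_act n N A \<phi> = (\<lambda>s t. if s \<in> words n N then word_act n N A (\<lambda>s. \<phi> s t) s else 0)"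

definition schur_rep :: "nat => nat list => (complex mat, (nat => nat) => (nat => nat) => complex) rep" where
  "schur_rep n \<nu> = fun_rep (schur_space n \<nu>) (schur_act n (sum_list \<nu>))"

lemma schur_act_in:
  assumes "\<phi> \<in> schur_space n \<nu>"
  shows "schur_act n (sum_list \<nu>) A \<phi> \<in> schur_space n \<nu>"
proof -
  let ?N = "sum_list \<nu>"
  have 1: "schur_act n ?N A \<phi> s \<in> specht_fun \<nu>" if s: "s \<in> words n ?N" for s
  proof -
    have *: "(\<lambda>t. \<Sum>p\<in>{..<?N} \<times> {..<n}. A $$ (s (fst p), snd p) * \<phi> (s(fst p := snd p)) t) \<in> specht_fun \<nu>"
      by (rule specht_fun_sum) (use assms words_upd[OF s] in \<open>auto simp: schur_space_def\<close>)
    have "schur_act n ?N A \<phi> s = (\<lambda>t. \<Sum>p\<in>{..<?N} \<times> {..<n}. A $$ (s (fst p), snd p) * \<phi> (s(fst p := snd p)) t)"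
      using s by (auto simp: schur_act_def word_act_def sum.cartesian_product case_prod_unfold)
    with * show ?thesis by simp
  qed
  have 2: "schur_act n ?N A \<phi> (s \<circ> \<sigma>) (t \<circ> \<sigma>) = schur_act n ?N A \<phi> s t"
    if "s \<in> words n ?N" "\<sigma> \<in> perms ?N" for s \<sigma> t
    using that assms unfolding schur_act_def
    by (auto simp: words_comp_iff word_act_comp schur_space_def intro!: word_act_cong)
  show ?thesis unfolding schur_space_def using 1 2 by (auto simp: schur_act_def)
qed

lemma schur_space_zero: "(\<lambda>s t. 0) \<in> schur_space n \<nu>"
  by (auto simp: schur_space_def specht_fun_zero)
lemma schur_space_add: "\<phi> \<in> schur_space n \<nu> ==> \<psi> \<in> schur_space n \<nu> ==> (\<lambda>s t. \<phi> s t + \<psi> s t) \<in> schur_space n \<nu>"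
  by (auto simp: schur_space_def specht_fun_add)
lemma schur_space_scale: "\<phi> \<in> schur_space n \<nu> ==> (\<lambda>s t. c * \<phi> s t) \<in> schur_space n \<nu>"
  by (auto simp: schur_space_def specht_fun_scale)

lemma module_schur_rep: "module complex_field (schur_rep n \<nu>)"
  unfolding schur_rep_def
  by (rule module_fun_rep) (auto intro: schur_space_zero schur_space_add schur_space_scale)

lemma a_minus_fun_rep:
  assumes "module complex_field (fun_rep C \<alpha>)" "f \<in> C" "g \<in> C"
  shows "f \<ominus>\<^bsub>fun_rep C \<alpha>\<^esub> g = (\<lambda>b j. f b j - g b j)"
proof -
  interpret cspace "fun_rep C \<alpha>" using assms(1) by (rule cspaceI)
  show ?thesis using diff_eq_smult[of f g] assms(2,3) by simp
qed

lemma sl_module_schur_rep: "sl_module n (schur_rep n \<nu>)"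
proof -
  let ?N = "sum_list \<nu>"
  have sl: "A \<in> carrier_mat n n" if "A \<in> sl n" for A using that by (simp add: sl_def)
  have comm: "schur_act n ?N (A * B - B * A) \<phi> =
     schur_act n ?N A (schur_act n ?N B \<phi>) \<ominus>\<^bsub>schur_rep n \<nu>\<^esub> schur_act n ?N B (schur_act n ?N A \<phi>)"
    if "A \<in> sl n" "B \<in> sl n" "\<phi> \<in> schur_space n \<nu>" for A B \<phi>
  proof -
    have *: "word_act n ?N A (\<lambda>s. schur_act n ?N B \<phi> s t) s = word_act n ?N A (word_act n ?N B (\<lambda>s. \<phi> s t)) s"
      if "s \<in> words n ?N" for A B s t
      by (rule word_act_cong[OF that]) (simp add: schur_act_def)
    show ?thesis
      unfolding schur_rep_def a_minus_fun_rep[OF module_schur_rep[unfolded schur_rep_def] schur_act_in[OF schur_act_in[OF that(3)]] schur_act_in[OF schur_act_in[OF that(3)]]]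
      by (auto simp: schur_act_def fun_eq_iff *[unfolded schur_act_def] word_act_commutator[OF sl[OF that(1)] sl[OF that(2)]])
  qed
  have S: "carrier (schur_rep n \<nu>) = schur_space n \<nu>" "act (schur_rep n \<nu>) = schur_act n ?N"
    "add (schur_rep n \<nu>) = (\<lambda>f g b j. f b j + g b j)" "module.smult (schur_rep n \<nu>) = (\<lambda>c f b j. c * f b j)"
    by (simp_all add: schur_rep_def)
  have lin: "schur_act n ?N A (\<lambda>s t. \<phi> s t + \<psi> s t) = (\<lambda>s t. schur_act n ?N A \<phi> s t + schur_act n ?N A \<psi> s t)"
    "schur_act n ?N A (\<lambda>s t. c * \<phi> s t) = (\<lambda>s t. c * schur_act n ?N A \<phi> s t)" for A c and \<phi> \<psi> :: "_ => (nat => nat) => _"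
    by (auto simp: schur_act_def fun_eq_iff word_act_linear)
  have mat: "schur_act n ?N (A + B) \<phi> = (\<lambda>s t. schur_act n ?N A \<phi> s t + schur_act n ?N B \<phi> s t)"
    "schur_act n ?N (c \<cdot>\<^sub>m A) \<phi> = (\<lambda>s t. c * schur_act n ?N A \<phi> s t)"
    if "A \<in> sl n" "B \<in> sl n" for A B c and \<phi> :: "_ => (nat => nat) => _"
    using sl[OF that(1)] sl[OF that(2)] by (auto simp: schur_act_def fun_eq_iff word_act_mat_linear)
  show ?thesis unfolding sl_module_def S using module_schur_rep schur_act_in lin mat comm by simp
qed

subsection \<open>Irreducibility\<close>

text \<open>The identity matrix acts on words by the scalar \<open>N\<close>. Splitting off the
  trace therefore turns stability under \<open>sl_n\<close> into stability under all matrices, in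
  particular under diagonal matrix units.\<close>

lemma elem_mat_trace_decomp:
  assumes A: "A \<in> carrier_mat n n" and n: "0 < n"
  defines "\<tau> \<equiv> (\<Sum>i<n. A $$ (i, i)) / of_nat n"
  shows "A + (- \<tau>) \<cdot>\<^sub>m 1\<^sub>m n \<in> sl n" "A = (A + (- \<tau>) \<cdot>\<^sub>m 1\<^sub>m n) + \<tau> \<cdot>\<^sub>m 1\<^sub>m n"
proof -
  have "(\<Sum>i<n. (A + (- \<tau>) \<cdot>\<^sub>m 1\<^sub>m n) $$ (i, i)) = (\<Sum>i<n. A $$ (i, i) - \<tau>)"
    by (intro sum.cong refl) (use A in auto)
  also have "\<dots> = 0" using n by (simp add: sum_subtractf \<tau>_def)
  finally show "A + (- \<tau>) \<cdot>\<^sub>m 1\<^sub>m n \<in> sl n" using A by (simp add: sl_def)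
  show "A = (A + (- \<tau>) \<cdot>\<^sub>m 1\<^sub>m n) + \<tau> \<cdot>\<^sub>m 1\<^sub>m n" using A by (intro eq_matI) auto
qed

text \<open>The operator on equivariant \<open>\<phi>\<close> that, symmetrized over all placements of the index set \<open>K\<close>,
  applies the matrix units \<open>E\<^bsub>c i, j i\<^esub>\<close>, \<open>i \<in> K\<close>, to distinct tensor factors.\<close>

definition sym_op :: "nat => nat => nat set => (nat => nat) => (nat => nat)
    => ((nat => nat) => (nat => nat) => complex) => (nat => nat) => (nat => nat) => complex" where
  "sym_op n N K c j \<phi> = (\<lambda>s t. if s \<in> words n N then \<Sum>\<sigma>\<in>perms N.
     if \<forall>i\<in>K. s (\<sigma> i) = c i then \<phi> (\<lambda>i. if i \<in> K then j i else s (\<sigma> i)) (t \<circ> \<sigma>) else 0 else 0)"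

text \<open>Reindexing the sum over \<open>\<sigma>\<close> by the transposition of \<open>k\<close>
  and \<open>k'\<close> moves the additional index from one place to the other; equivariance of
  \<open>\<phi>\<close> absorbs the transposition.\<close>

lemma sym_op_swap:
  assumes phi: "!!\<sigma> s t. \<sigma> \<in> perms N ==> s \<in> words n N ==> \<phi> (s \<circ> \<sigma>) (t \<circ> \<sigma>) = \<phi> s t"
    and k: "k < N" "k' < N" "k \<notin> K" "k' \<notin> K" and K: "K \<subseteq> {..<N}" and j: "!!i. i \<in> K ==> j i < n" "j0 < n"
  shows "sym_op n N (insert k K) (c(k := c0)) (j(k := j0)) \<phi> = sym_op n N (insert k' K) (c(k' := c0)) (j(k' := j0)) \<phi>"
proof (intro ext)
  fix s t :: "nat => nat"
  let ?\<tau> = "transpose k k'"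
  have tau: "?\<tau> \<in> perms N" using k by (simp add: transpose_perms)
  let ?P = "\<lambda>k \<sigma>. \<forall>i\<in>insert k K. s (\<sigma> i) = (c(k := c0)) i"
  let ?f = "\<lambda>k \<sigma> i. if i \<in> insert k K then (j(k := j0)) i else s (\<sigma> i)"
  show "sym_op n N (insert k K) (c(k := c0)) (j(k := j0)) \<phi> s t = sym_op n N (insert k' K) (c(k' := c0)) (j(k' := j0)) \<phi> s t"
  proof (cases "s \<in> words n N")
    case s: True
    have 1: "?P k (\<sigma> \<circ> ?\<tau>) = ?P k' \<sigma>" for \<sigma>
    proof -
      have "?\<tau> i = i" if "i \<in> K" for i using that k by (auto simp: transpose_def)
      then show ?thesis using k by auto
    qed
    have 2: "?f k (\<sigma> \<circ> ?\<tau>) = ?f k' \<sigma> \<circ> ?\<tau>" for \<sigma>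
    proof
      fix i show "?f k (\<sigma> \<circ> ?\<tau>) i = (?f k' \<sigma> \<circ> ?\<tau>) i"
        using k by (cases "i = k"; cases "i = k'"; cases "i \<in> K") (auto simp: transpose_def)
    qed
    have 3: "?f k' \<sigma> \<in> words n N" if "\<sigma> \<in> perms N" for \<sigma>
    proof -
      have "s \<circ> \<sigma> \<in> words n N" using words_comp[OF s that] .
      then show ?thesis using k K j by (auto simp: words_def PiE_def extensional_def)
    qed
    have "(\<Sum>\<sigma>\<in>perms N. if ?P k \<sigma> then \<phi> (?f k \<sigma>) (t \<circ> \<sigma>) else 0) =
      (\<Sum>\<sigma>\<in>perms N. if ?P k (\<sigma> \<circ> ?\<tau>) then \<phi> (?f k (\<sigma> \<circ> ?\<tau>)) (t \<circ> (\<sigma> \<circ> ?\<tau>)) else 0)"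
      by (rule sum_perms_comp_right[OF tau, symmetric])
    also have "\<dots> = (\<Sum>\<sigma>\<in>perms N. if ?P k' \<sigma> then \<phi> (?f k' \<sigma>) (t \<circ> \<sigma>) else 0)"
    proof (rule sum.cong[OF refl])
      fix \<sigma> assume sg: "\<sigma> \<in> perms N"
      show "(if ?P k (\<sigma> \<circ> ?\<tau>) then \<phi> (?f k (\<sigma> \<circ> ?\<tau>)) (t \<circ> (\<sigma> \<circ> ?\<tau>)) else 0) =
        (if ?P k' \<sigma> then \<phi> (?f k' \<sigma>) (t \<circ> \<sigma>) else 0)"
        unfolding 1 2 using phi[OF tau 3[OF sg], of "t \<circ> \<sigma>"] by (simp only: comp_assoc)
    qed
    finally show ?thesis using s by (simp add: sym_op_def)
  qed (simp add: sym_op_def)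
qed

text \<open>The extra matrix unit acts either on a factor outside \<open>K\<close>, which extends
  the operator, or on a factor \<open>k\<close> in \<open>K\<close>, where the product of
  \<open>E_{c k, j k}\<close> and \<open>E_{c0, j0}\<close> is \<open>E_{c k, j0}\<close> if
  \<open>j k = c0\<close> and zero otherwise.\<close>

lemma sym_op_word_act:
  assumes K: "K \<subseteq> {..<N}" and j: "!!i. i \<in> K ==> j i < n" and j0: "j0 < n"
  shows "sym_op n N K c j (schur_act n N (elem_mat n c0 j0) \<phi>) s t =
    (\<Sum>k\<in>{..<N} - K. sym_op n N (insert k K) (c(k := c0)) (j(k := j0)) \<phi> s t) +
    (\<Sum>k\<in>K. if j k = c0 then sym_op n N K c (j(k := j0)) \<phi> s t else 0)"
proof (cases "s \<in> words n N")
  case s: True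
  have finK: "finite K" using K finite_subset by blast
  let ?x = "\<lambda>\<sigma> i. if i \<in> K then j i else s (\<sigma> i)"
  have inner: "(if \<forall>i\<in>K. s (\<sigma> i) = c i then schur_act n N (elem_mat n c0 j0) \<phi> (?x \<sigma>) (t \<circ> \<sigma>) else 0) =
    (\<Sum>k\<in>{..<N} - K. if \<forall>i\<in>insert k K. s (\<sigma> i) = (c(k := c0)) i
        then \<phi> (\<lambda>i. if i \<in> insert k K then (j(k := j0)) i else s (\<sigma> i)) (t \<circ> \<sigma>) else 0) +
    (\<Sum>k\<in>K. if j k = c0 then (if \<forall>i\<in>K. s (\<sigma> i) = c i
        then \<phi> (\<lambda>i. if i \<in> K then (j(k := j0)) i else s (\<sigma> i)) (t \<circ> \<sigma>) else 0) else 0)"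
    (is "?L = ?R1 + ?R2") if sg: "\<sigma> \<in> perms N" for \<sigma>
  proof -
    have x: "?x \<sigma> \<in> words n N"
      using words_comp[OF s sg] K j by (auto simp: words_def PiE_def extensional_def)
    have u1: "(?x \<sigma>)(k := j0) = (\<lambda>i. if i \<in> insert k K then (j(k := j0)) i else s (\<sigma> i))" if "k \<notin> K" for k
      by auto
    have u2: "(?x \<sigma>)(k := j0) = (\<lambda>i. if i \<in> K then (j(k := j0)) i else s (\<sigma> i))" if "k \<in> K" for k
      using that by auto
    have "schur_act n N (elem_mat n c0 j0) \<phi> (?x \<sigma>) (t \<circ> \<sigma>) =
      (\<Sum>k<N. if ?x \<sigma> k = c0 then \<phi> ((?x \<sigma>)(k := j0)) (t \<circ> \<sigma>) else 0)"
      using x by (simp add: schur_act_def word_act_elem_mat[OF x j0])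
    also have "\<dots> = (\<Sum>k\<in>{..<N} - K. if ?x \<sigma> k = c0 then \<phi> ((?x \<sigma>)(k := j0)) (t \<circ> \<sigma>) else 0) +
       (\<Sum>k\<in>K. if ?x \<sigma> k = c0 then \<phi> ((?x \<sigma>)(k := j0)) (t \<circ> \<sigma>) else 0)"
      by (rule sum.subset_diff[OF K]) simp
    finally have e: "schur_act n N (elem_mat n c0 j0) \<phi> (?x \<sigma>) (t \<circ> \<sigma>) = \<dots>" .
    show ?thesis
    proof (cases "\<forall>i\<in>K. s (\<sigma> i) = c i")
      case True
      have "?R1 = (\<Sum>k\<in>{..<N} - K. if ?x \<sigma> k = c0 then \<phi> ((?x \<sigma>)(k := j0)) (t \<circ> \<sigma>) else 0)"
        by (intro sum.cong refl) (use True u1 in auto)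
      moreover have "?R2 = (\<Sum>k\<in>K. if ?x \<sigma> k = c0 then \<phi> ((?x \<sigma>)(k := j0)) (t \<circ> \<sigma>) else 0)"
        by (intro sum.cong refl) (use True u2 in auto)
      ultimately show ?thesis using True e by simp
    next
      case False
      then have "?R1 = 0" by (intro sum.neutral) auto
      moreover have "?R2 = 0" using False by (intro sum.neutral) auto
      ultimately show ?thesis using False by auto
    qed
  qed
  have "sym_op n N K c j (schur_act n N (elem_mat n c0 j0) \<phi>) s t =
    (\<Sum>\<sigma>\<in>perms N. if \<forall>i\<in>K. s (\<sigma> i) = c i then schur_act n N (elem_mat n c0 j0) \<phi> (?x \<sigma>) (t \<circ> \<sigma>) else 0)"
    using s by (simp add: sym_op_def)
  also have "\<dots> =
    (\<Sum>\<sigma>\<in>perms N. \<Sum>k\<in>{..<N} - K. if \<forall>i\<in>insert k K. s (\<sigma> i) = (c(k := c0)) i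
        then \<phi> (\<lambda>i. if i \<in> insert k K then (j(k := j0)) i else s (\<sigma> i)) (t \<circ> \<sigma>) else 0) +
    (\<Sum>\<sigma>\<in>perms N. \<Sum>k\<in>K. if j k = c0 then (if \<forall>i\<in>K. s (\<sigma> i) = c i
        then \<phi> (\<lambda>i. if i \<in> K then (j(k := j0)) i else s (\<sigma> i)) (t \<circ> \<sigma>) else 0) else 0)"
    unfolding sum.distrib[symmetric] by (rule sum.cong[OF refl inner])
  also have "(\<Sum>\<sigma>\<in>perms N. \<Sum>k\<in>{..<N} - K. if \<forall>i\<in>insert k K. s (\<sigma> i) = (c(k := c0)) i
        then \<phi> (\<lambda>i. if i \<in> insert k K then (j(k := j0)) i else s (\<sigma> i)) (t \<circ> \<sigma>) else 0) =
     (\<Sum>k\<in>{..<N} - K. sym_op n N (insert k K) (c(k := c0)) (j(k := j0)) \<phi> s t)"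
    unfolding sym_op_def using s by (subst sum.swap) simp
  also have "(\<Sum>\<sigma>\<in>perms N. \<Sum>k\<in>K. if j k = c0 then (if \<forall>i\<in>K. s (\<sigma> i) = c i
        then \<phi> (\<lambda>i. if i \<in> K then (j(k := j0)) i else s (\<sigma> i)) (t \<circ> \<sigma>) else 0) else 0) =
     (\<Sum>k\<in>K. if j k = c0 then sym_op n N K c (j(k := j0)) \<phi> s t else 0)"
    unfolding sym_op_def using s by (subst sum.swap, intro sum.cong[OF refl]) simp
  finally show ?thesis .
next
  case False then show ?thesis by (simp add: sym_op_def cong: if_cong)
qed

locale schur_submodule =
  fixes n :: nat and \<nu> :: "nat list" and H
  assumes n: "0 < n" and H: "H \<subseteq> schur_space n \<nu>"
    and add: "!!\<phi> \<psi>. \<phi> \<in> H ==> \<psi> \<in> H ==> (\<lambda>s t. \<phi> s t + \<psi> s t) \<in> H"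
    and scale: "!!c \<phi>. \<phi> \<in> H ==> (\<lambda>s t. c * \<phi> s t) \<in> H"
    and sl_act: "!!A \<phi>. A \<in> sl n ==> \<phi> \<in> H ==> schur_act n (sum_list \<nu>) A \<phi> \<in> H"
    and nonempty: "H \<noteq> {}"
begin

abbreviation "N \<equiv> sum_list \<nu>"

lemma zero: "(\<lambda>s t. 0) \<in> H"
  using nonempty scale[of _ 0] by auto

lemma sum: "finite I ==> (!!i. i \<in> I ==> f i \<in> H) ==> (\<lambda>s t. \<Sum>i\<in>I. f i s t) \<in> H"
  by (induction I rule: finite_induct) (auto simp: zero intro!: add)

lemma equivariant: "\<phi> \<in> H ==> \<sigma> \<in> perms N ==> s \<in> words n N ==> \<phi> (s \<circ> \<sigma>) (t \<circ> \<sigma>) = \<phi> s t"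
  using H by (auto simp: schur_space_def)

lemma mat_act:
  assumes A: "A \<in> carrier_mat n n" and phi: "\<phi> \<in> H"
  shows "schur_act n N A \<phi> \<in> H"
proof -
  define \<tau> where "\<tau> = (\<Sum>i<n. A $$ (i, i)) / of_nat n"
  define B where "B = A + (- \<tau>) \<cdot>\<^sub>m 1\<^sub>m n"
  have B: "B \<in> sl n" "A = B + \<tau> \<cdot>\<^sub>m 1\<^sub>m n" "B \<in> carrier_mat n n"
    using elem_mat_trace_decomp[OF A n] A by (auto simp: B_def \<tau>_def)
  have "schur_act n N A \<phi> = (\<lambda>s t. schur_act n N B \<phi> s t + (\<tau> * of_nat N) * \<phi> s t)"
  proof (intro ext)
    fix s t
    have "\<phi> s t = 0" if "s \<notin> words n N" using that phi H by (auto simp: schur_space_def)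
    then show "schur_act n N A \<phi> s t = schur_act n N B \<phi> s t + (\<tau> * of_nat N) * \<phi> s t"
      unfolding B(2) schur_act_def using B(3)
      by (auto simp: word_act_mat_linear[of _ n] word_act_one)
  qed
  then show ?thesis using add[OF sl_act[OF B(1) phi] scale[OF phi]] by simp
qed

text \<open>Induction on \<open>K\<close>: applying the operator for \<open>K\<close> to a
  one-factor action gives the enlarged operator once for every place outside \<open>K\<close>, all
  equal by \<open>sym_op_swap\<close>, plus operators for \<open>K\<close> that lie in
  \<open>H\<close> already. Dividing by the positive number of these places isolates the enlarged
  operator.\<close>

lemma sym_op_in:
  assumes "K \<subseteq> {..<N}" "!!i. i \<in> K ==> j i < n" "!!i. i \<in> K ==> c i < n" "\<phi> \<in> H"
  shows "sym_op n N K c j \<phi> \<in> H"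
proof -
  have "finite K" using assms finite_subset by blast
  then show ?thesis using assms
  proof (induction K arbitrary: c j \<phi>)
    case empty
    have "sym_op n N {} c j \<phi> = (\<lambda>s t. of_nat (card (perms N)) * \<phi> s t)"
    proof (intro ext)
      fix s t
      have "\<phi> s t = 0" if "s \<notin> words n N" using that empty(4) H by (auto simp: schur_space_def)
      then show "sym_op n N {} c j \<phi> s t = of_nat (card (perms N)) * \<phi> s t"
        using equivariant[OF empty(4), of _ s t] by (auto simp: sym_op_def comp_def)
    qed
    then show ?case using scale empty by simp
  next
    case (insert k K)
    have K: "K \<subseteq> {..<N}" and jK: "!!i. i \<in> K ==> j i < n" and cK: "!!i. i \<in> K ==> c i < n"
      and k: "k < N" "j k < n" "c k < n" using insert by auto
    let ?E = "elem_mat n (c k) (j k)"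
    have IH: "sym_op n N K c' j' \<psi> \<in> H" if "\<psi> \<in> H" "!!i. i \<in> K ==> j' i < n" "!!i. i \<in> K ==> c' i < n" for c' j' \<psi>
      using insert.IH[OF K that(2,3,1)] .
    define m where "m = card ({..<N} - K)"
    have m: "m \<noteq> 0" using k(1) insert(2) by (auto simp: m_def)
    have same: "sym_op n N (insert l K) (c(l := c k)) (j(l := j k)) \<phi> = sym_op n N (insert k K) c j \<phi>"
      if "l \<in> {..<N} - K" for l
      using sym_op_swap[of N n \<phi> l k K j "j k" c "c k"] equivariant[OF insert.prems(4)] that k insert(2) K jK by auto
    have e: "sym_op n N K c j (schur_act n N ?E \<phi>) s t = of_nat m * sym_op n N (insert k K) c j \<phi> s t +
      (\<Sum>l\<in>K. if j l = c k then sym_op n N K c (j(l := j k)) \<phi> s t else 0)" for s t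
    proof -
      have "(\<Sum>l\<in>{..<N} - K. sym_op n N (insert l K) (c(l := c k)) (j(l := j k)) \<phi> s t) =
        (\<Sum>l\<in>{..<N} - K. sym_op n N (insert k K) c j \<phi> s t)"
        by (rule sum.cong[OF refl]) (simp only: same)
      then show ?thesis using sym_op_word_act[of K N j n "j k" c "c k" \<phi> s t, OF K jK k(2)] by (simp add: m_def)
    qed
    have "sym_op n N (insert k K) c j \<phi> = (\<lambda>s t. inverse (of_nat m) *
       (sym_op n N K c j (schur_act n N ?E \<phi>) s t +
        (\<Sum>l\<in>K. (if j l = c k then - 1 else 0) * sym_op n N K c (j(l := j k)) \<phi> s t)))"
    proof (intro ext)
      fix s t
      have "(\<Sum>l\<in>K. (if j l = c k then - 1 else 0) * sym_op n N K c (j(l := j k)) \<phi> s t) =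
        - (\<Sum>l\<in>K. if j l = c k then sym_op n N K c (j(l := j k)) \<phi> s t else 0)"
        unfolding sum_negf[symmetric] by (intro sum.cong) auto
      then show "sym_op n N (insert k K) c j \<phi> s t = inverse (of_nat m) *
       (sym_op n N K c j (schur_act n N ?E \<phi>) s t +
        (\<Sum>l\<in>K. (if j l = c k then - 1 else 0) * sym_op n N K c (j(l := j k)) \<phi> s t))"
        using m unfolding e by simp
    qed
    also have "\<dots> \<in> H"
      by (intro scale add sum IH mat_act insert) (use jK cK k in auto)
    finally show ?case .
  qed
qed

text \<open>The values of a nonzero \<open>\<phi>\<close> span a stable subspace of the irreducible
  Specht module, hence all of it. So each value of \<open>\<psi>\<close> is a combination of values
  of \<open>\<phi>\<close>, and symmetrized operators that replace one word by another rebuild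
  \<open>\<psi>\<close> from these combinations.\<close>

lemma stable_subspace_whole:
  assumes nu: "sorted_wrt (\<ge>) \<nu>" and phi: "\<phi> \<in> H" "\<phi> \<noteq> (\<lambda>s t. 0)"
  shows "schur_space n \<nu> \<subseteq> H"
proof
  fix \<psi> assume psi: "\<psi> \<in> schur_space n \<nu>"
  \<comment> \<open>The span of all values of \<open>\<phi>\<close>; equivariance of
    \<open>\<phi>\<close> makes it stable, because permuting the tabloid amounts to permuting the
    word.\<close>
  define U where "U = {u. \<exists>\<alpha>. u = (\<lambda>t. \<Sum>j\<in>words n N. \<alpha> j * \<phi> j t)}"
  obtain s0 where s0: "s0 \<in> words n N" "\<phi> s0 \<noteq> (\<lambda>t. 0)"
  proof -
    obtain s t where "\<phi> s t \<noteq> 0" using phi(2) by (auto simp: fun_eq_iff)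
    moreover have "\<phi> \<in> schur_space n \<nu>" using phi(1) H by blast
    then have "s \<in> words n N" using calculation by (auto simp: schur_space_def)
    ultimately show thesis using that[of s] by metis
  qed
  have SU: "specht_fun \<nu> \<subseteq> U"
  proof (rule specht_fun_irreducible[OF nu])
    show "U \<subseteq> specht_fun \<nu>"
      using phi(1) H by (auto simp: U_def schur_space_def intro!: specht_fun_sum)
    show "(\<lambda>t. u t + v t) \<in> U" if "u \<in> U" "v \<in> U" for u v
    proof -
      obtain \<alpha> \<beta> where "u = (\<lambda>t. \<Sum>j\<in>words n N. \<alpha> j * \<phi> j t)" "v = (\<lambda>t. \<Sum>j\<in>words n N. \<beta> j * \<phi> j t)"
        using \<open>u \<in> U\<close> \<open>v \<in> U\<close> by (auto simp: U_def)
      then show ?thesis unfolding U_def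
        by (intro CollectI exI[of _ "\<lambda>j. \<alpha> j + \<beta> j"]) (simp add: sum.distrib distrib_right)
    qed
    show "(\<lambda>t. c * u t) \<in> U" if u: "u \<in> U" for c u
    proof -
      obtain \<alpha> where "u = (\<lambda>t. \<Sum>j\<in>words n N. \<alpha> j * \<phi> j t)" using u by (auto simp: U_def)
      then show ?thesis unfolding U_def
        by (intro CollectI exI[of _ "\<lambda>j. c * \<alpha> j"]) (simp add: sum_distrib_left mult.assoc)
    qed
    show "(\<lambda>t. u (t \<circ> \<sigma>)) \<in> U" if s: "\<sigma> \<in> perms N" and u: "u \<in> U" for \<sigma> u
    proof -
      obtain \<alpha> where al: "u = (\<lambda>t. \<Sum>j\<in>words n N. \<alpha> j * \<phi> j t)" using u by (auto simp: U_def)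
      have "u (t \<circ> \<sigma>) = (\<Sum>j\<in>words n N. \<alpha> (j \<circ> \<sigma>) * \<phi> j t)" for t
      proof -
        have "(\<Sum>j\<in>words n N. \<alpha> j * \<phi> j (t \<circ> \<sigma>)) = (\<Sum>j\<in>words n N. \<alpha> (j \<circ> \<sigma>) * \<phi> (j \<circ> \<sigma>) (t \<circ> \<sigma>))"
          by (rule sum.reindex_bij_witness[of _ "\<lambda>j. j \<circ> \<sigma>" "\<lambda>j. j \<circ> pinv \<sigma>"])
             (use s in \<open>auto simp: words_comp comp_assoc perms_inv\<close>)
        then show ?thesis using equivariant[OF phi(1) s] by (simp add: al)
      qed
      then show ?thesis unfolding U_def by (intro CollectI exI[of _ "\<lambda>j. \<alpha> (j \<circ> \<sigma>)"]) simp
    qed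
    show "\<phi> s0 \<in> U" unfolding U_def
      by (intro CollectI exI[of _ "\<lambda>j. if j = s0 then 1 else 0"])
         (use s0 in \<open>simp add: if_distrib[of "\<lambda>x. x * _"] cong: if_cong\<close>)
    show "\<phi> s0 \<noteq> (\<lambda>t. 0)" by (rule s0)
  qed
  have "\<exists>\<alpha>. \<psi> c = (\<lambda>t. \<Sum>j\<in>words n N. \<alpha> j * \<phi> j t)" if c: "c \<in> words n N" for c
  proof -
    have "\<psi> c \<in> specht_fun \<nu>" using psi c by (simp add: schur_space_def)
    with SU have "\<psi> c \<in> U" by (rule subsetD)
    then show ?thesis by (simp add: U_def)
  qed
  then have "\<forall>c\<in>words n N. \<exists>\<alpha>. \<psi> c = (\<lambda>t. \<Sum>j\<in>words n N. \<alpha> j * \<phi> j t)" by (rule ballI)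
  from bchoice[OF this] obtain \<alpha>
    where \<alpha>: "\<forall>c\<in>words n N. \<psi> c = (\<lambda>t. \<Sum>j\<in>words n N. \<alpha> c j * \<phi> j t)" by (rule exE)
  \<comment> \<open>With \<open>K\<close> all of \<open>{..<N}\<close> every letter is prescribed:
    the operator reads off \<open>\<phi> j\<close> at the rearrangements of \<open>c\<close> and
    gives zero on all other words.\<close>
  have op: "sym_op n N {..<N} c j \<phi> s t = (\<Sum>\<sigma>\<in>perms N. if s \<circ> \<sigma> = c then \<phi> j (t \<circ> \<sigma>) else 0)"
    if "s \<in> words n N" "c \<in> words n N" "j \<in> words n N" for s t c j
  proof -
    have "(\<lambda>i. if i \<in> {..<N} then j i else s (\<sigma> i)) = j" if "\<sigma> \<in> perms N" for \<sigma>
      using words_comp[OF \<open>s \<in> words n N\<close> that] \<open>j \<in> words n N\<close>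
      by (auto simp: words_def PiE_def extensional_def fun_eq_iff)
    moreover have "(\<forall>i\<in>{..<N}. s (\<sigma> i) = c i) = (s \<circ> \<sigma> = c)" if "\<sigma> \<in> perms N" for \<sigma>
    proof
      assume "\<forall>i\<in>{..<N}. s (\<sigma> i) = c i"
      then show "s \<circ> \<sigma> = c"
        by (intro words_eqI[OF words_comp[OF \<open>s \<in> words n N\<close> that] \<open>c \<in> words n N\<close>]) simp
    qed (simp add: fun_eq_iff)
    ultimately have "(\<Sum>\<sigma>\<in>perms N. if \<forall>i\<in>{..<N}. s (\<sigma> i) = c i
        then \<phi> (\<lambda>i. if i \<in> {..<N} then j i else s (\<sigma> i)) (t \<circ> \<sigma>) else 0) =
      (\<Sum>\<sigma>\<in>perms N. if s \<circ> \<sigma> = c then \<phi> j (t \<circ> \<sigma>) else 0)"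
      by (intro sum.cong[OF refl]) (simp only:)
    then show ?thesis unfolding sym_op_def using that(1) by (simp only: if_True)
  qed
  define m where "m = complex_of_nat (card (perms N))"
  have m: "m \<noteq> 0" using perms_id[of N] finite_perms[of N] unfolding m_def
    by (metis card_0_eq empty_iff of_nat_eq_0_iff)
  \<comment> \<open>In the sum over \<open>\<sigma>\<close> only
    \<open>c = s \<circ> \<sigma>\<close> survives, and by equivariance each of the \<open>m\<close>
    terms equals \<open>\<psi> s t\<close>.\<close>
  have "(\<lambda>s t. m * \<psi> s t) =
    (\<lambda>s t. \<Sum>c\<in>words n N. \<Sum>j\<in>words n N. \<alpha> c j * sym_op n N {..<N} c j \<phi> s t)"
  proof (intro ext)
    fix s t
    show "m * \<psi> s t = (\<Sum>c\<in>words n N. \<Sum>j\<in>words n N. \<alpha> c j * sym_op n N {..<N} c j \<phi> s t)"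
    proof (cases "s \<in> words n N")
      case s: True
      have "(\<Sum>c\<in>words n N. \<Sum>j\<in>words n N. \<alpha> c j * sym_op n N {..<N} c j \<phi> s t) =
        (\<Sum>c\<in>words n N. \<Sum>j\<in>words n N. \<Sum>\<sigma>\<in>perms N. if c = s \<circ> \<sigma> then \<alpha> c j * \<phi> j (t \<circ> \<sigma>) else 0)"
        by (intro sum.cong refl) (auto simp: op[OF s] sum_distrib_left intro!: sum.cong)
      also have "\<dots> = (\<Sum>\<sigma>\<in>perms N. \<Sum>c\<in>words n N. \<Sum>j\<in>words n N. if c = s \<circ> \<sigma> then \<alpha> c j * \<phi> j (t \<circ> \<sigma>) else 0)"
        by (rule sum_swap3)
      also have "\<dots> = (\<Sum>\<sigma>\<in>perms N. \<Sum>c\<in>words n N. if c = s \<circ> \<sigma> then \<psi> c (t \<circ> \<sigma>) else 0)"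
        by (intro sum.cong refl) (auto simp: \<alpha>)
      also have "\<dots> = (\<Sum>\<sigma>\<in>perms N. \<psi> (s \<circ> \<sigma>) (t \<circ> \<sigma>))"
        by (intro sum.cong refl) (simp add: words_comp[OF s])
      also have "\<dots> = (\<Sum>\<sigma>\<in>perms N. \<psi> s t)"
        by (intro sum.cong refl) (use psi s in \<open>auto simp: schur_space_def\<close>)
      finally show ?thesis by (simp add: m_def)
    next
      case False
      then have "\<psi> s t = 0" using psi by (auto simp: schur_space_def)
      with False show ?thesis by (simp add: sym_op_def)
    qed
  qed
  also have "\<dots> \<in> H"
    by (intro sum scale sym_op_in finite_words phi order_refl) (auto dest: words_less)
  finally have "(\<lambda>s t. inverse m * (m * \<psi> s t)) \<in> H"
    by (rule scale)
  then show "\<psi> \<in> H" using m by (simp add: mult.assoc[symmetric])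
qed

end

subsection \<open>The highest weight vector\<close>

text \<open>The sum over \<open>T\<close> of \<open>e_T \<otimes> e_T\<close> for the polytabloids
  \<open>e_T\<close>. Reading a tabloid as the word of its row numbers places the first factor among
  the words of weight \<open>\<nu>\<close>; simultaneous permutation of both factors permutes the
  summands.\<close>

definition schur_hwv :: "nat => nat list => (nat => nat) => (nat => nat) => complex" where
  "schur_hwv n \<nu> = (\<lambda>s t. if s \<in> words n (sum_list \<nu>)
     then \<Sum>T\<in>ext_tableaux \<nu>. polytab \<nu> T s * polytab \<nu> T t else 0)"

lemma tabloid_in_words:
  assumes "length \<nu> \<le> n" "t \<in> tabloid \<nu> ` tableaux \<nu>" shows "t \<in> words n (sum_list \<nu>)"
proof -
  obtain T where T: "bij_betw T {..<sum_list \<nu>} (cells \<nu>)" "t = tabloid \<nu> T" using assms(2) by (auto simp: tableaux_def)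
  have "fst (T k) < n" if "k < sum_list \<nu>" for k
  proof -
    have "T k \<in> cells \<nu>" using T(1) that by (auto simp: bij_betw_def)
    then show ?thesis using assms(1) by (auto simp: cells_def)
  qed
  then show ?thesis using T(2) by (auto simp: words_def tabloid_def)
qed

lemma schur_hwv_in: "schur_hwv n \<nu> \<in> schur_space n \<nu>"
proof -
  let ?N = "sum_list \<nu>"
  have "(\<lambda>t. \<Sum>T\<in>ext_tableaux \<nu>. polytab \<nu> T s * polytab \<nu> T t) \<in> specht_fun \<nu>" for s
    by (auto simp: specht_fun_def)
  moreover have "(\<Sum>T\<in>ext_tableaux \<nu>. polytab \<nu> T (s \<circ> \<sigma>) * polytab \<nu> T (t \<circ> \<sigma>)) =
     (\<Sum>T\<in>ext_tableaux \<nu>. polytab \<nu> T s * polytab \<nu> T t)" if s: "\<sigma> \<in> perms ?N" for s t \<sigma>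
  proof -
    have "polytab \<nu> (T \<circ> pinv \<sigma>) r = polytab \<nu> T (r \<circ> \<sigma>)" for T r
      using polytab_comp[OF s, of "T \<circ> pinv \<sigma>" r] s by (simp add: comp_assoc)
    then show ?thesis
      by (intro sum.reindex_bij_witness[of _ "\<lambda>T. T \<circ> \<sigma>" "\<lambda>T. T \<circ> pinv \<sigma>"])
         (use s in \<open>auto simp: ext_tableaux_comp comp_assoc perms_inv\<close>)
  qed
  ultimately show ?thesis by (auto simp: schur_space_def schur_hwv_def words_comp_iff)
qed

text \<open>At a tabloid taken as both word and argument the value is a sum of squares of real
  numbers, one of which is \<open>1\<close>. The length bound makes the tabloid a word in
  \<open>n\<close> letters.\<close>

lemma schur_hwv_nonzero:
  assumes "length \<nu> \<le> n" shows "schur_hwv n \<nu> \<noteq> (\<lambda>s t. 0)"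
proof
  assume z: "schur_hwv n \<nu> = (\<lambda>s t. 0)"
  obtain T where T: "T \<in> ext_tableaux \<nu>" using exists_ext_tableau by auto
  then have T': "T \<in> tableaux \<nu>" by (simp add: ext_tableaux_def)
  let ?t = "tabloid \<nu> T"
  have "(\<Sum>T'\<in>ext_tableaux \<nu>. complex_of_real ((cmod (polytab \<nu> T' ?t))\<^sup>2)) =
    (\<Sum>T'\<in>ext_tableaux \<nu>. polytab \<nu> T' ?t * polytab \<nu> T' ?t)"
    by (simp only: complex_norm_square cnj_polytab)
  also have "\<dots> = schur_hwv n \<nu> ?t ?t"
    using tabloid_in_words[OF assms, of ?t] T' by (simp add: schur_hwv_def)
  also have "\<dots> = 0" using z by simp
  finally have "complex_of_real (\<Sum>T'\<in>ext_tableaux \<nu>. (cmod (polytab \<nu> T' ?t))\<^sup>2) = 0" by simp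
  then have "(\<Sum>T'\<in>ext_tableaux \<nu>. (cmod (polytab \<nu> T' ?t))\<^sup>2) = 0" by (simp only: of_real_eq_0_iff)
  then have "polytab \<nu> T ?t = 0" using T by (subst (asm) sum_nonneg_eq_0_iff) auto
  then show False using polytab_self[OF T'] by simp
qed

text \<open>The raising operator \<open>E_{i j}\<close> kills a polytabloid: after it turns the
  letter \<open>j\<close> of an entry \<open>k\<close> into \<open>i\<close>, the entry
  \<open>l\<close> in row \<open>i\<close> of the same column carries the same letter, and the
  transposition of \<open>k\<close> and \<open>l\<close> cancels the signed sum.\<close>

lemma polytab_raise:
  assumes nu: "sorted_wrt (\<ge>) \<nu>" and T: "T \<in> tableaux \<nu>" and ij: "i < j"
  shows "(\<Sum>k<sum_list \<nu>. if s k = i then polytab \<nu> T (s(k := j)) else 0) = 0"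
proof -
  let ?N = "sum_list \<nu>" and ?C = "column_stabilizer \<nu> T" and ?t = "tabloid \<nu> T"
  have "(\<Sum>k<?N. if s k = i then polytab \<nu> T (s(k := j)) else 0) =
     (\<Sum>\<sigma>\<in>?C. \<Sum>k<?N. if s k = i \<and> s(k := j) \<circ> \<sigma> = ?t then csign \<sigma> else 0)"
    unfolding polytab_eq by (subst sum.swap) (auto intro!: sum.cong)
  also have "\<dots> = (\<Sum>\<sigma>\<in>?C. \<Sum>k<?N. if ?t k = j \<and> s \<circ> \<sigma> = ?t(k := i) then csign \<sigma> else 0)"
  proof (rule sum.cong[OF refl])
    fix \<sigma> assume sC: "\<sigma> \<in> ?C"
    note s = column_stabilizer_perms[OF sC]
    have "(\<Sum>k<?N. if s k = i \<and> s(k := j) \<circ> \<sigma> = ?t then csign \<sigma> else 0) =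
      (\<Sum>k<?N. if s (\<sigma> k) = i \<and> s(\<sigma> k := j) \<circ> \<sigma> = ?t then csign \<sigma> else 0)"
      by (rule sum_perm[OF s, symmetric])
    also have "\<dots> = (\<Sum>k<?N. if ?t k = j \<and> s \<circ> \<sigma> = ?t(k := i) then csign \<sigma> else 0)"
    proof (rule sum.cong[OF refl])
      fix k
      have "(s (\<sigma> k) = i \<and> (s \<circ> \<sigma>)(k := j) = ?t) = (?t k = j \<and> s \<circ> \<sigma> = ?t(k := i))"
        by (auto simp: fun_eq_iff)
      then show "(if s (\<sigma> k) = i \<and> s(\<sigma> k := j) \<circ> \<sigma> = ?t then csign \<sigma> else 0) =
        (if ?t k = j \<and> s \<circ> \<sigma> = ?t(k := i) then csign \<sigma> else 0)"
        unfolding fun_upd_comp_perm[OF s] by simp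
    qed
    finally show "(\<Sum>k<?N. if s k = i \<and> s(k := j) \<circ> \<sigma> = ?t then csign \<sigma> else 0) = \<dots>" .
  qed
  also have "\<dots> = (\<Sum>k<?N. \<Sum>\<sigma>\<in>?C. if ?t k = j \<and> s \<circ> \<sigma> = ?t(k := i) then csign \<sigma> else 0)"
    by (rule sum.swap)
  also have "\<dots> = 0"
  proof (rule sum.neutral, rule ballI)
    fix k assume k: "k \<in> {..<?N}"
    show "(\<Sum>\<sigma>\<in>?C. if ?t k = j \<and> s \<circ> \<sigma> = ?t(k := i) then csign \<sigma> else 0) = 0"
    proof (cases "?t k = j")
      case True
      have b: "bij_betw T {..<?N} (cells \<nu>)" using T by (simp add: tableaux_def)
      have "T k \<in> cells \<nu>" using b k by (auto simp: bij_betw_def)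
      moreover have "fst (T k) = j" using True k by (simp add: tabloid_def)
      \<comment> \<open>Rows of a partition weakly decrease, so the column of \<open>k\<close> also
        meets the higher row \<open>i < j\<close>.\<close>
      ultimately have "(i, snd (T k)) \<in> cells \<nu>"
        using partition_rows_closed[OF nu, of j "snd (T k)" i] ij by (auto simp: cells_def)
      then have "(i, snd (T k)) \<in> T ` {..<?N}" using b by (simp add: bij_betw_def)
      then obtain l where "l \<in> {..<?N}" "(i, snd (T k)) = T l" by (rule imageE)
      then have l: "l < ?N" "T l = (i, snd (T k))" by simp_all
      have kl: "k \<noteq> l"
      proof
        assume "k = l"
        then have "fst (T k) = fst (i, snd (T k))" using l(2) by (simp only:)
        then show False using \<open>fst (T k) = j\<close> ij by simp
      qed
      let ?u = "?t(k := i)"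
      have ul: "?u l = i" using l kl by (simp add: tabloid_def)
      have uk: "?u k = i" by simp
      have tr: "?u \<circ> transpose k l = ?u"
      proof
        fix x show "(?u \<circ> transpose k l) x = ?u x"
          by (cases "x = k"; cases "x = l") (use uk ul in \<open>simp_all add: transpose_def del: fun_upd_apply\<close>)
      qed
      have "(s \<circ> (\<sigma> \<circ> transpose k l) = ?u) = (s \<circ> \<sigma> = ?u)" for \<sigma>
      proof
        assume A: "s \<circ> (\<sigma> \<circ> transpose k l) = ?u"
        have "s \<circ> \<sigma> = s \<circ> (\<sigma> \<circ> transpose k l) \<circ> transpose k l" by (simp add: fun_eq_iff)
        then show "s \<circ> \<sigma> = ?u" by (simp only: A tr)
      next
        assume A: "s \<circ> \<sigma> = ?u"
        have "s \<circ> (\<sigma> \<circ> transpose k l) = s \<circ> \<sigma> \<circ> transpose k l" by (simp only: comp_assoc)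
        then show "s \<circ> (\<sigma> \<circ> transpose k l) = ?u" by (simp only: A tr)
      qed
      then have "(\<Sum>\<sigma>\<in>?C. csign \<sigma> * (if s \<circ> \<sigma> = ?u then 1 else 0)) = 0"
        by (intro alternating_sum_zero[of k _ l]) (use k l kl in auto)
      then show ?thesis using True by (simp add: if_distrib[of "\<lambda>x. _ * x"] cong: if_cong)
    qed simp
  qed
  finally show ?thesis .
qed

lemma fund_weight_abel_summation:
  fixes p :: "nat => complex"
  assumes "1 \<le> n"
  shows "(\<Sum>i\<in>{1..n-1}. (p i - p (i + 1)) * (\<Sum>j<i. a j)) = (\<Sum>j<n. p (j + 1) * a j) - p n * (\<Sum>j<n. a j)"
  using assms
proof (induction n rule: dec_induct)
  case (step n)
  have "{1..Suc n - 1} = insert n {1..n - 1}" using step by auto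
  then have "(\<Sum>i\<in>{1..Suc n - 1}. (p i - p (i + 1)) * (\<Sum>j<i. a j)) =
     (p n - p (n + 1)) * (\<Sum>j<n. a j) + (\<Sum>i\<in>{1..n - 1}. (p i - p (i + 1)) * (\<Sum>j<i. a j))"
    using step by simp
  then show ?case using step by (simp add: algebra_simps)
qed simp

text \<open>Summation by parts rewrites the fundamental weights in diagonal entries; the boundary
  term is a multiple of the trace. Rows are counted from \<open>0\<close>, parts from
  \<open>1\<close>.\<close>

lemma partition_weight_eq:
  assumes A: "A \<in> cartan n" and n: "1 \<le> n" and len: "length \<nu> \<le> n"
  shows "partition_weight n \<nu> A = (\<Sum>r<length \<nu>. of_nat (\<nu> ! r) * A $$ (r, r))"
proof -
  have tr: "(\<Sum>j<n. A $$ (j, j)) = 0" using A by (simp add: cartan_def sl_def)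
  have "partition_weight n \<nu> A = (\<Sum>j<n. of_nat (part \<nu> (j + 1)) * A $$ (j, j))"
    unfolding partition_weight_def fund_weight_def
    using fund_weight_abel_summation[OF n, of "\<lambda>i. of_nat (part \<nu> i)" "\<lambda>j. A $$ (j, j)"] by (simp add: tr)
  also have "\<dots> = (\<Sum>j<length \<nu>. of_nat (part \<nu> (j + 1)) * A $$ (j, j))"
    by (rule sum.mono_neutral_right) (use len in \<open>auto simp: part_def\<close>)
  finally show ?thesis by (simp add: part_def)
qed

lemma sum_tabloid:
  fixes a :: "nat => complex"
  assumes "t \<in> tabloid \<nu> ` tableaux \<nu>"
  shows "(\<Sum>k<sum_list \<nu>. a (t k)) = (\<Sum>r<length \<nu>. of_nat (\<nu> ! r) * a r)"
proof -
  obtain T where T: "bij_betw T {..<sum_list \<nu>} (cells \<nu>)" "t = tabloid \<nu> T" using assms by (auto simp: tableaux_def)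
  have "(\<Sum>k<sum_list \<nu>. a (t k)) = (\<Sum>k<sum_list \<nu>. a (fst (T k)))" using T(2) by (simp add: tabloid_def)
  also have "\<dots> = (\<Sum>x\<in>cells \<nu>. a (fst x))" using sum.reindex_bij_betw[OF T(1), of "\<lambda>x. a (fst x)"] .
  also have "cells \<nu> = Sigma {..<length \<nu>} (\<lambda>r. {..<\<nu> ! r})" by (auto simp: cells_def)
  also have "(\<Sum>x\<in>\<dots>. a (fst x)) = (\<Sum>r<length \<nu>. \<Sum>c<\<nu> ! r. a r)"
    by (subst sum.Sigma) (auto simp: case_prod_unfold)
  finally show ?thesis by simp
qed

lemma schur_highest_weight_vector:
  assumes nu: "sorted_wrt (\<ge>) \<nu>" and len: "length \<nu> \<le> n" and n: "1 \<le> n"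
  shows "highest_weight_vector n (partition_weight n \<nu>) (schur_rep n \<nu>) (schur_hwv n \<nu>)"
proof -
  let ?N = "sum_list \<nu>" and ?h = "schur_hwv n \<nu>"
  have plus: "schur_act n ?N A ?h = (\<lambda>s t. 0)" if A: "A \<in> n_plus n" for A
  proof (intro ext)
    fix s t
    show "schur_act n ?N A ?h s t = 0"
    proof (cases "s \<in> words n ?N")
      case s: True
      have "word_act n ?N A (\<lambda>s. ?h s t) s = (\<Sum>k<?N. \<Sum>j<n. \<Sum>T\<in>ext_tableaux \<nu>. \<Sum>i<n.
          (if i = s k then A $$ (i, j) * polytab \<nu> T (s(k := j)) * polytab \<nu> T t else 0))"
        unfolding word_act_def by (intro sum.cong refl)
          (use words_upd[OF s] words_less[OF s] in \<open>simp add: schur_hwv_def sum_distrib_left mult.assoc\<close>)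
      also have "\<dots> = (\<Sum>j<n. \<Sum>T\<in>ext_tableaux \<nu>. \<Sum>i<n. A $$ (i, j) * polytab \<nu> T t *
          (\<Sum>k<?N. if s k = i then polytab \<nu> T (s(k := j)) else 0))"
        unfolding sum_distrib_left
        by (rule trans[OF sum.swap], rule sum.cong[OF refl], rule trans[OF sum.swap], rule sum.cong[OF refl],
            rule trans[OF sum.swap], intro sum.cong refl) auto
      also have "\<dots> = 0"
      proof (intro sum.neutral ballI)
        fix j T i assume "j \<in> {..<n}" "T \<in> ext_tableaux \<nu>" "i \<in> {..<n}"
        then show "A $$ (i, j) * polytab \<nu> T t * (\<Sum>k<?N. if s k = i then polytab \<nu> T (s(k := j)) else 0) = 0"
          using A polytab_raise[OF nu, of T i j s] by (cases "i < j") (auto simp: n_plus_def ext_tableaux_def)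
      qed
      finally show ?thesis by (simp add: schur_act_def s)
    qed (simp add: schur_act_def)
  qed
  have cartan: "schur_act n ?N A ?h = (\<lambda>s t. partition_weight n \<nu> A * ?h s t)" if A: "A \<in> cartan n" for A
  proof (intro ext)
    fix s t
    show "schur_act n ?N A ?h s t = partition_weight n \<nu> A * ?h s t"
    proof (cases "s \<in> words n ?N")
      case s: True
      have "word_act n ?N A (\<lambda>s. ?h s t) s = (\<Sum>k<?N. \<Sum>j<n. if j = s k then A $$ (s k, s k) * ?h s t else 0)"
        unfolding word_act_def by (intro sum.cong refl) (use A words_less[OF s] in \<open>auto simp: cartan_def\<close>)
      also have "\<dots> = (\<Sum>k<?N. A $$ (s k, s k)) * ?h s t"
        using words_less[OF s] by (simp add: sum_distrib_right)
      also have "\<dots> = partition_weight n \<nu> A * ?h s t"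
      proof (cases "s \<in> tabloid \<nu> ` tableaux \<nu>")
        case True
        then show ?thesis using sum_tabloid[OF True, of "\<lambda>r. A $$ (r, r)"] partition_weight_eq[OF A n len] by simp
      next
        case False
        then show ?thesis using polytab_outside[OF False] by (simp add: schur_hwv_def ext_tableaux_def)
      qed
      finally show ?thesis by (simp add: schur_act_def s)
    qed (simp add: schur_act_def schur_hwv_def)
  qed
  show ?thesis unfolding highest_weight_vector_def
    using schur_hwv_in schur_hwv_nonzero[OF len] plus cartan by (simp add: schur_rep_def)
qed

lemma irreducible_schur_rep:
  assumes nu: "sorted_wrt (\<ge>) \<nu>" and len: "length \<nu> \<le> n" and n: "1 \<le> n"
  shows "irreducible_sl_module n (schur_rep n \<nu>)"
  unfolding irreducible_sl_module_def
proof (intro conjI allI impI)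
  show "sl_module n (schur_rep n \<nu>)" by (rule sl_module_schur_rep)
  show "carrier (schur_rep n \<nu>) \<noteq> {\<zero>\<^bsub>schur_rep n \<nu>\<^esub>}"
    using schur_hwv_in[of n \<nu>] schur_hwv_nonzero[OF len] by (auto simp: schur_rep_def)
  fix H assume H: "submodule H complex_field (schur_rep n \<nu>) \<and> (\<forall>A\<in>sl n. \<forall>x\<in>H. act (schur_rep n \<nu>) A x \<in> H)"
  interpret cspace "schur_rep n \<nu>" by (rule cspaceI[OF module_schur_rep])
  note D = subspaceD[OF conjunct1[OF H]]
  have S: "carrier (schur_rep n \<nu>) = schur_space n \<nu>" "act (schur_rep n \<nu>) = schur_act n (sum_list \<nu>)"
    "add (schur_rep n \<nu>) = (\<lambda>f g b j. f b j + g b j)" "module.smult (schur_rep n \<nu>) = (\<lambda>c f b j. c * f b j)"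
    "zero (schur_rep n \<nu>) = (\<lambda>s t. 0)"
    by (simp_all add: schur_rep_def)
  note D = D[unfolded S]
  have "schur_submodule n \<nu> H"
  proof
    show "0 < n" using n by simp
    show "H \<subseteq> schur_space n \<nu>" by (rule D(1))
    show "(\<lambda>s t. \<phi> s t + \<psi> s t) \<in> H" if "\<phi> \<in> H" "\<psi> \<in> H" for \<phi> \<psi> by (rule D(3)[OF that])
    show "(\<lambda>s t. c * \<phi> s t) \<in> H" if "\<phi> \<in> H" for \<phi> c by (rule D(4)[OF that])
    show "schur_act n (sum_list \<nu>) A \<phi> \<in> H" if "A \<in> sl n" "\<phi> \<in> H" for A \<phi>
      using H that unfolding S by simp
    show "H \<noteq> {}" using D(2) by auto
  qed
  then interpret schur_submodule n \<nu> H .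
  show "H = {\<zero>\<^bsub>schur_rep n \<nu>\<^esub>} \<or> H = carrier (schur_rep n \<nu>)" unfolding S
  proof (cases "H \<subseteq> {\<lambda>s t. 0}")
    case True
    then show "H = {\<lambda>s t. 0} \<or> H = schur_space n \<nu>" using D(2) by blast
  next
    case False
    then obtain \<phi> where "\<phi> \<in> H" "\<phi> \<noteq> (\<lambda>s t. 0)" by blast
    then show "H = {\<lambda>s t. 0} \<or> H = schur_space n \<nu>" using stable_subspace_whole[OF nu] D(1) by blast
  qed
qed

text \<open>A word in \<open>n\<close> letters repeats a letter in the first column of a tableau with more than
  \<open>n\<close> rows.\<close>

lemma schur_space_long:
  assumes nu: "sorted_wrt (\<ge>) \<nu>" "0 \<notin> set \<nu>" and len: "n < length \<nu>"
    and phi: "\<phi> \<in> schur_space n \<nu>"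
  shows "\<phi> = (\<lambda>s t. 0)"
proof (rule ext)
  fix s
  let ?N = "sum_list \<nu>"
  show "\<phi> s = (\<lambda>t. 0)"
  proof (cases "s \<in> words n ?N")
    case s: True
    show ?thesis
    proof (rule specht_pairing_nondegenerate)
      show "\<phi> s \<in> specht_fun \<nu>" using phi s by (auto simp: schur_space_def)
      fix T assume "T \<in> ext_tableaux \<nu>"
      then have b: "bij_betw T {..<?N} (cells \<nu>)" by (simp add: ext_tableaux_def tableaux_def)
      \<comment> \<open>\<open>e r\<close> is the entry of \<open>T\<close> in row \<open>r\<close>
        of the first column; that cell exists because no part is zero.\<close>
      define e where "e r = inv_into {..<?N} T (r, 0)" for r
      have "(r, 0) \<in> T ` {..<?N}" if "r < length \<nu>" for r
      proof -
        have "\<nu> ! r \<noteq> 0" using nu(2) nth_mem[OF that] by metis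
        then show ?thesis using b that by (simp add: cells_def bij_betw_def)
      qed
      then have e: "e r < ?N" "T (e r) = (r, 0)" if "r < length \<nu>" for r
        using that inv_into_into[of "(r, 0)" T "{..<?N}"] f_inv_into_f[of "(r, 0)" T "{..<?N}"] by (auto simp: e_def)
      have "\<not> inj_on (\<lambda>r. s (e r)) {..<length \<nu>}"
      proof
        assume "inj_on (\<lambda>r. s (e r)) {..<length \<nu>}"
        then have "card {..<length \<nu>} \<le> card {..<n}"
          by (rule card_inj_on_le) (use words_less[OF s e(1)] in auto)
        then show False using len by simp
      qed
      then obtain r r' where r: "r < length \<nu>" "r' < length \<nu>" "r \<noteq> r'" "s (e r) = s (e r')"
        by (auto simp: inj_on_def)
      have ne: "e r \<noteq> e r'" using e(2)[OF r(1)] e(2)[OF r(2)] r(3) by auto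
      have tr: "s \<circ> transpose (e r) (e r') = s" using r(4) by (auto simp: fun_eq_iff transpose_def)
      \<comment> \<open>Equivariance shifts the permutation from the tabloid to the word
        \<open>s\<close>, where the repeated letter makes a transposition invisible.\<close>
      have "(\<Sum>\<sigma>\<in>column_stabilizer \<nu> T. csign \<sigma> * \<phi> s (tabloid \<nu> T \<circ> \<sigma>)) =
        (\<Sum>\<sigma>\<in>column_stabilizer \<nu> T. csign \<sigma> * \<phi> (s \<circ> \<sigma>) (tabloid \<nu> T))"
      proof (rule sum.reindex_bij_witness[of _ pinv pinv])
        fix \<sigma> assume sC: "\<sigma> \<in> column_stabilizer \<nu> T"
        note sp = column_stabilizer_perms[OF sC]
        have "\<phi> (s \<circ> pinv \<sigma> \<circ> \<sigma>) (tabloid \<nu> T \<circ> \<sigma>) = \<phi> (s \<circ> pinv \<sigma>) (tabloid \<nu> T)"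
          using phi sp words_comp[OF s perms_inv[OF sp]] by (auto simp: schur_space_def)
        then show "csign (pinv \<sigma>) * \<phi> (s \<circ> pinv \<sigma>) (tabloid \<nu> T) = csign \<sigma> * \<phi> s (tabloid \<nu> T \<circ> \<sigma>)"
          using sp by (simp add: sign_perms_inv comp_assoc)
      qed (auto simp: column_stabilizer_inv dest: column_stabilizer_perms)
      also have "\<dots> = 0"
      proof (rule alternating_sum_zero[of "e r" _ "e r'"])
        have "s \<circ> (transpose (e r) (e r') \<circ> \<sigma>) = s \<circ> \<sigma>" for \<sigma> by (simp add: comp_assoc[symmetric] tr)
        then show "(\<forall>\<sigma>. \<phi> (s \<circ> (\<sigma> \<circ> transpose (e r) (e r'))) (tabloid \<nu> T) = \<phi> (s \<circ> \<sigma>) (tabloid \<nu> T)) \<or>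
          (\<forall>\<sigma>. \<phi> (s \<circ> (transpose (e r) (e r') \<circ> \<sigma>)) (tabloid \<nu> T) = \<phi> (s \<circ> \<sigma>) (tabloid \<nu> T))"
          by (intro disjI2 allI) (rule arg_cong[where f = "\<lambda>s. \<phi> s (tabloid \<nu> T)"])
      qed (use e r ne in auto)
      finally show "(\<Sum>\<sigma>\<in>column_stabilizer \<nu> T. csign \<sigma> * \<phi> s (tabloid \<nu> T \<circ> \<sigma>)) = 0" .
    qed
  qed (use phi in \<open>auto simp: schur_space_def\<close>)
qed

section \<open>Uniqueness of irreducible highest weight modules\<close>

locale sl_rep = cspace V for n :: nat and V :: "(complex mat, 'a) rep" (structure) +
  assumes sl_mod: "sl_module n V"
begin

lemma act_in: "A \<in> sl n ==> x \<in> carrier V ==> act V A x \<in> carrier V"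
  and act_add: "A \<in> sl n ==> x \<in> carrier V ==> y \<in> carrier V ==> act V A (x \<oplus> y) = act V A x \<oplus> act V A y"
  and act_smult: "A \<in> sl n ==> x \<in> carrier V ==> act V A (c \<odot> x) = c \<odot> act V A x"
  and act_mat_add: "A \<in> sl n ==> B \<in> sl n ==> x \<in> carrier V ==> act V (A + B) x = act V A x \<oplus> act V B x"
  and act_mat_smult: "A \<in> sl n ==> x \<in> carrier V ==> act V (c \<cdot>\<^sub>m A) x = c \<odot> act V A x"
  using sl_mod by (simp_all add: sl_module_def)

lemma act_commutator:
  assumes "A \<in> sl n" "B \<in> sl n" "x \<in> carrier V"
  shows "act V A (act V B x) = act V (A * B - B * A) x \<oplus> act V B (act V A x)"
proof -
  have "act V (A * B - B * A) x = act V A (act V B x) \<ominus> act V B (act V A x)"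
    using sl_mod assms by (simp add: sl_module_def)
  moreover have "act V A (act V B x) \<in> carrier V" "act V B (act V A x) \<in> carrier V"
    using assms by (simp_all add: act_in)
  ultimately show ?thesis
    using add_eq_cancel[of "act V (A * B - B * A) x" "act V B (act V A x)" "act V A (act V B x)"] by simp
qed

lemma act_zero: "A \<in> sl n ==> act V A \<zero> = \<zero>"
  using act_smult[of A \<zero> 0] act_in[of A \<zero>] by simp

end

lemma sl_repI: "sl_module n V ==> sl_rep n V"
  by (simp add: sl_rep_def sl_rep_axioms_def cspace_def sl_module_def)

lemma elem_mat_sl: "i \<noteq> j ==> elem_mat n i j \<in> sl n"
  by (auto simp: sl_def elem_mat_def intro!: sum.neutral)

lemma commutator_sl: assumes "A \<in> sl n" "B \<in> sl n" shows "A * B - B * A \<in> sl n"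
proof -
  have c: "A \<in> carrier_mat n n" "B \<in> carrier_mat n n" using assms by (auto simp: sl_def)
  have "(\<Sum>i<n. (A * B) $$ (i, i)) = (\<Sum>i<n. \<Sum>j<n. A $$ (i, j) * B $$ (j, i))"
    by (rule sum.cong[OF refl]) (use c in \<open>auto simp: scalar_prod_def atLeast0LessThan\<close>)
  also have "\<dots> = (\<Sum>j<n. \<Sum>i<n. B $$ (j, i) * A $$ (i, j))" by (subst sum.swap) (simp add: mult.commute)
  also have "\<dots> = (\<Sum>i<n. (B * A) $$ (i, i))"
    by (rule sum.cong[OF refl]) (use c in \<open>auto simp: scalar_prod_def atLeast0LessThan\<close>)
  finally have tr: "(\<Sum>i<n. (A * B) $$ (i, i)) = (\<Sum>i<n. (B * A) $$ (i, i))" .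
  have "(\<Sum>i<n. (A * B - B * A) $$ (i, i)) = (\<Sum>i<n. (A * B) $$ (i, i) - (B * A) $$ (i, i))"
    by (rule sum.cong[OF refl]) (use c in auto)
  moreover have "A * B - B * A \<in> carrier_mat n n" using c by (meson minus_carrier_mat mult_carrier_mat)
  ultimately show ?thesis using tr by (simp only: sl_def sum_subtractf mem_Collect_eq) simp
qed

text \<open>Half the sum of the positive coroots. Its commutator with \<open>elem_mat n i j\<close>
  is \<open>j - i\<close> times that matrix, so one diagonal operator measures the depth below the
  highest weight.\<close>

definition rho_mat :: "nat => complex mat" where
  "rho_mat n = mat n n (\<lambda>(i, j). if i = j then (of_nat n - 1) / 2 - of_nat i else 0)"

lemma rho_mat_cartan: "rho_mat n \<in> cartan n" and rho_mat_sl: "rho_mat n \<in> sl n"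
proof -
  have "(\<Sum>i<m. c - of_nat i) = of_nat m * c - of_nat m * (of_nat m - 1) / (2 :: complex)" for m c
    by (induction m) (simp_all add: field_simps)
  from this[where m = n and c = "(of_nat n - 1) / 2"] show "rho_mat n \<in> sl n"
    by (simp add: sl_def rho_mat_def)
  then show "rho_mat n \<in> cartan n" by (simp add: cartan_def rho_mat_def)
qed

lemma rho_mat_commutator:
  assumes "j < i" "i < n"
  shows "rho_mat n * elem_mat n i j - elem_mat n i j * rho_mat n = (- of_nat (i - j)) \<cdot>\<^sub>m elem_mat n i j"
proof (rule eq_matI)
  fix a b assume "a < dim_row ((- of_nat (i - j)) \<cdot>\<^sub>m elem_mat n i j)" "b < dim_col ((- of_nat (i - j)) \<cdot>\<^sub>m elem_mat n i j)"
  then have ab: "a < n" "b < n" by (simp_all add: elem_mat_def)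
  have 1: "(rho_mat n * elem_mat n i j) $$ (a, b) = (\<Sum>c<n. if c = a then rho_mat n $$ (a, a) * elem_mat n i j $$ (a, b) else 0)"
  proof -
    have "(rho_mat n * elem_mat n i j) $$ (a, b) = (\<Sum>c<n. rho_mat n $$ (a, c) * elem_mat n i j $$ (c, b))"
      using ab by (simp add: scalar_prod_def atLeast0LessThan rho_mat_def elem_mat_def)
    also have "\<dots> = (\<Sum>c<n. if c = a then rho_mat n $$ (a, a) * elem_mat n i j $$ (a, b) else 0)"
      by (rule sum.cong[OF refl]) (use ab in \<open>auto simp: rho_mat_def elem_mat_def\<close>)
    finally show ?thesis .
  qed
  have 2: "(elem_mat n i j * rho_mat n) $$ (a, b) = (\<Sum>c<n. if c = b then rho_mat n $$ (b, b) * elem_mat n i j $$ (a, b) else 0)"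
  proof -
    have "(elem_mat n i j * rho_mat n) $$ (a, b) = (\<Sum>c<n. elem_mat n i j $$ (a, c) * rho_mat n $$ (c, b))"
      using ab by (simp add: scalar_prod_def atLeast0LessThan rho_mat_def elem_mat_def)
    also have "\<dots> = (\<Sum>c<n. if c = b then rho_mat n $$ (b, b) * elem_mat n i j $$ (a, b) else 0)"
      by (rule sum.cong[OF refl]) (use ab in \<open>auto simp: rho_mat_def elem_mat_def\<close>)
    finally show ?thesis .
  qed
  have "(rho_mat n * elem_mat n i j - elem_mat n i j * rho_mat n) $$ (a, b) =
    (rho_mat n * elem_mat n i j) $$ (a, b) - (elem_mat n i j * rho_mat n) $$ (a, b)"
    using ab by (simp add: rho_mat_def elem_mat_def)
  also have "\<dots> = (rho_mat n $$ (a, a) - rho_mat n $$ (b, b)) * elem_mat n i j $$ (a, b)"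
    unfolding 1 2 using ab by (simp add: left_diff_distrib)
  also have "\<dots> = ((- of_nat (i - j)) \<cdot>\<^sub>m elem_mat n i j) $$ (a, b)"
    using ab assms by (auto simp: elem_mat_def rho_mat_def of_nat_diff)
  finally show "(rho_mat n * elem_mat n i j - elem_mat n i j * rho_mat n) $$ (a, b) = \<dots>" .
qed (simp_all add: elem_mat_def rho_mat_def)

text \<open>The same product of lowering operators applied to \<open>v\<close> and to
  \<open>w\<close>. The index is its total depth, by which the eigenvalue of \<open>rho_mat\<close>
  drops.\<close>

inductive hw_pair :: "nat => (complex mat, 'a) rep => (complex mat, 'b) rep => 'a => 'b => nat => 'a => 'b => bool"
  for n V W v w where
  base: "hw_pair n V W v w 0 v w"
| step: "hw_pair n V W v w k x y ==> j < i ==> i < n ==>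
    hw_pair n V W v w (k + (i - j)) (act V (elem_mat n i j) x) (act W (elem_mat n i j) y)"

text \<open>The span of these pairs. It turns out to be the submodule of the direct sum generated by
  \<open>(v, w)\<close> and, for irreducible modules, the graph of an isomorphism.\<close>

inductive hw_rel :: "nat => (complex mat, 'a) rep => (complex mat, 'b) rep => 'a => 'b => 'a => 'b => bool"
  for n V W v w where
  zero: "hw_rel n V W v w \<zero>\<^bsub>V\<^esub> \<zero>\<^bsub>W\<^esub>"
| add: "hw_rel n V W v w x y ==> hw_pair n V W v w k x' y' ==>
    hw_rel n V W v w (x \<oplus>\<^bsub>V\<^esub> c \<odot>\<^bsub>V\<^esub> x') (y \<oplus>\<^bsub>W\<^esub> c \<odot>\<^bsub>W\<^esub> y')"

text \<open>The product of the operators \<open>h - a + l\<close> for \<open>l = 1, ..., K\<close>: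
  it annihilates the eigenvalues \<open>a - 1, ..., a - K\<close> of \<open>h\<close> and multiplies
  the eigenvalue \<open>a\<close> by the factorial of \<open>K\<close>.\<close>

primrec weight_op :: "(complex mat, 'a) rep => complex mat => complex => nat => 'a => 'a" where
  "weight_op V h a 0 x = x"
| "weight_op V h a (Suc K) x = act V h (weight_op V h a K x) \<oplus>\<^bsub>V\<^esub> (of_nat (Suc K) - a) \<odot>\<^bsub>V\<^esub> weight_op V h a K x"

context sl_rep begin

lemma weight_op_in: "h \<in> sl n ==> x \<in> carrier V ==> weight_op V h a K x \<in> carrier V"
  by (induction K) (simp_all add: act_in)

lemma weight_op_add:
  "h \<in> sl n ==> x \<in> carrier V ==> y \<in> carrier V ==>
   weight_op V h a K (x \<oplus> y) = weight_op V h a K x \<oplus> weight_op V h a K y"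
  by (induction K) (simp_all add: act_in act_add weight_op_in smult_add_right a_ac)

lemma weight_op_smult:
  "h \<in> sl n ==> x \<in> carrier V ==> weight_op V h a K (c \<odot> x) = c \<odot> weight_op V h a K x"
  by (induction K) (simp_all add: act_in act_smult weight_op_in smult_add_right smult_smult mult.commute)

lemma weight_op_eigen:
  assumes "h \<in> sl n" "x \<in> carrier V" "act V h x = (a - of_nat k) \<odot> x"
  shows "weight_op V h a K x = (\<Prod>l\<in>{1..K}. of_nat l - of_nat k) \<odot> x"
proof (induction K)
  case (Suc K)
  have "weight_op V h a (Suc K) x = (\<Prod>l\<in>{1..K}. of_nat l - of_nat k) \<odot> ((a - of_nat k) \<odot> x) \<oplus>
     (of_nat (Suc K) - a) \<odot> ((\<Prod>l\<in>{1..K}. of_nat l - of_nat k) \<odot> x)"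
    using assms by (simp add: Suc act_smult)
  also have "\<dots> = ((\<Prod>l\<in>{1..K}. of_nat l - of_nat k) * (a - of_nat k) + (of_nat (Suc K) - a) * (\<Prod>l\<in>{1..K}. of_nat l - of_nat k)) \<odot> x"
    using assms by (simp only: smult_smult smult_add_left)
  also have "(\<Prod>l\<in>{1..K}. of_nat l - of_nat k) * (a - of_nat k) + (of_nat (Suc K) - a) * (\<Prod>l\<in>{1..K}. of_nat l - of_nat k) =
     (\<Prod>l\<in>{1..Suc K}. of_nat l - of_nat k)"
    by (simp add: algebra_simps)
  finally show ?case .
qed (use assms in simp)

end

locale hw_module_pair = V: sl_rep n V + W: sl_rep n W
  for n :: nat and V :: "(complex mat, 'a) rep" and W :: "(complex mat, 'b) rep" +
  fixes wt :: "complex mat => complex" and v :: 'a and w :: 'b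
  assumes hv: "highest_weight_vector n wt V v" and hw: "highest_weight_vector n wt W w"
begin

abbreviation "P \<equiv> hw_pair n V W v w"
abbreviation "R \<equiv> hw_rel n V W v w"

lemma hv_in: "v \<in> carrier V" "w \<in> carrier W" "v \<noteq> \<zero>\<^bsub>V\<^esub>" "w \<noteq> \<zero>\<^bsub>W\<^esub>"
  using hv hw by (auto simp: highest_weight_vector_def)

lemma P_in: "P k x y ==> x \<in> carrier V \<and> y \<in> carrier W"
  by (induction rule: hw_pair.induct) (auto simp: hv_in V.act_in W.act_in elem_mat_sl)

lemma R_in: "R x y ==> x \<in> carrier V \<and> y \<in> carrier W"
  by (induction rule: hw_rel.induct) (auto dest: P_in)

lemma R_P: "P k x y ==> R x y"
  using hw_rel.add[OF hw_rel.zero, of n V W v w k x y 1] P_in[of k x y] by simp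

lemma R_add: "R x' y' ==> R x y ==> R (x \<oplus>\<^bsub>V\<^esub> x') (y \<oplus>\<^bsub>W\<^esub> y')"
proof (induction rule: hw_rel.induct)
  case zero
  then show ?case using R_in by simp
next
  case (add x1 y1 k x2 y2 c)
  have i: "x \<in> carrier V" "y \<in> carrier W" "x1 \<in> carrier V" "y1 \<in> carrier W" "x2 \<in> carrier V" "y2 \<in> carrier W"
    using add R_in P_in by blast+
  have "R (x \<oplus>\<^bsub>V\<^esub> x1 \<oplus>\<^bsub>V\<^esub> c \<odot>\<^bsub>V\<^esub> x2) (y \<oplus>\<^bsub>W\<^esub> y1 \<oplus>\<^bsub>W\<^esub> c \<odot>\<^bsub>W\<^esub> y2)"
    using hw_rel.add[OF add.IH[OF add.prems] add.hyps(2)] .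
  then show ?case using i by (simp add: V.a_assoc W.a_assoc)
qed

lemma R_smult: "R x y ==> R (c \<odot>\<^bsub>V\<^esub> x) (c \<odot>\<^bsub>W\<^esub> y)"
proof (induction rule: hw_rel.induct)
  case zero
  then show ?case using hw_rel.zero by simp
next
  case (add x1 y1 k x2 y2 d)
  have i: "x1 \<in> carrier V" "y1 \<in> carrier W" "x2 \<in> carrier V" "y2 \<in> carrier W"
    using add R_in P_in by blast+
  show ?case using hw_rel.add[OF add.IH add.hyps(2), of "c * d"] i
    by (simp add: V.smult_add_right W.smult_add_right V.smult_smult W.smult_smult)
qed

lemma R_elem:
  assumes "R x y" "j < i" "i < n"
  shows "R (act V (elem_mat n i j) x) (act W (elem_mat n i j) y)"
  using assms(1)
proof (induction rule: hw_rel.induct)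
  have E: "elem_mat n i j \<in> sl n" using assms elem_mat_sl by simp
  case zero
  then show ?case using hw_rel.zero V.act_zero[OF E] W.act_zero[OF E] by simp
next
  have E: "elem_mat n i j \<in> sl n" using assms elem_mat_sl by simp
  case (add x1 y1 k x2 y2 c)
  have i: "x1 \<in> carrier V" "y1 \<in> carrier W" "x2 \<in> carrier V" "y2 \<in> carrier W"
    using add R_in P_in by blast+
  show ?case using hw_rel.add[OF add.IH hw_pair.step[OF add.hyps(2) assms(2,3)], of c] i E
    by (simp add: V.act_add W.act_add V.act_smult W.act_smult)
qed

lemma R_n_minus:
  assumes L: "L \<in> n_minus n" and xy: "R x y"
  shows "L \<in> sl n" "R (act V L x) (act W L y)"
proof -
  \<comment> \<open>The matrix \<open>L\<close> truncated to the entries in \<open>S\<close>; adding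
    one strictly lower entry at a time reduces the claim to matrix units.\<close>
  define M where "M S = mat n n (\<lambda>p. if p \<in> S then L $$ p else 0)" for S
  let ?low = "{(i, j). j < i \<and> i < n}"
  have i: "x \<in> carrier V" "y \<in> carrier W" using R_in[OF xy] by auto
  have low_fin: "finite ?low" by (rule finite_subset[of _ "{..<n} \<times> {..<n}"]) auto
  have main: "M S \<in> sl n \<and> R (act V (M S) x) (act W (M S) y)" if "finite S" "S \<subseteq> ?low" for S
    using that
  proof (induction S)
    case empty
    \<comment> \<open>Writing the zero matrix as a zero multiple of an element of
      \<open>sl n\<close> lets homogeneity in the matrix show that it acts as zero.\<close>
    have z: "M {} = 0 \<cdot>\<^sub>m elem_mat n 1 0" by (rule eq_matI) (auto simp: M_def elem_mat_def)
    have E: "elem_mat n 1 0 \<in> sl n" by (rule elem_mat_sl) simp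
    have "act V (M {}) x = \<zero>\<^bsub>V\<^esub>" "act W (M {}) y = \<zero>\<^bsub>W\<^esub>"
      unfolding z using i E by (simp_all add: V.act_mat_smult W.act_mat_smult V.act_in W.act_in)
    moreover have "M {} \<in> sl n" by (simp add: M_def sl_def)
    ultimately show ?case using hw_rel.zero by simp
  next
    case (insert p S)
    obtain a b where p: "p = (a, b)" "b < a" "a < n" using insert by (cases p) auto
    have E: "elem_mat n a b \<in> sl n" using p elem_mat_sl by simp
    have IH: "M S \<in> sl n" "R (act V (M S) x) (act W (M S) y)" using insert by auto
    have e: "M (insert p S) = M S + (L $$ p) \<cdot>\<^sub>m elem_mat n a b"
      by (rule eq_matI) (use insert p in \<open>auto simp: M_def elem_mat_def\<close>)
    have cE: "(L $$ p) \<cdot>\<^sub>m elem_mat n a b \<in> sl n"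
      using E by (auto simp: sl_def elem_mat_def p intro!: sum.neutral)
    have "M (insert p S) \<in> sl n"
    proof -
      have "(\<Sum>i<n. M (insert p S) $$ (i, i)) = 0"
        by (rule sum.neutral) (use insert in \<open>auto simp: M_def\<close>)
      then show ?thesis by (simp add: sl_def M_def)
    qed
    moreover have "R (act V (M (insert p S)) x) (act W (M (insert p S)) y)"
      unfolding e using R_add[OF R_smult[OF R_elem[OF xy p(2,3)]] IH(2)] i IH(1) cE E
      by (simp add: V.act_mat_add W.act_mat_add V.act_mat_smult W.act_mat_smult)
    ultimately show ?case by simp
  qed
  have "M ?low = L"
    by (rule eq_matI) (use L in \<open>auto simp: M_def n_minus_def not_less\<close>)
  then show "L \<in> sl n" "R (act V L x) (act W L y)" using main[OF low_fin order_refl] by simp_all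
qed

text \<open>For the generating pair, decompose \<open>A\<close> into lower, diagonal and upper
  parts: the upper part kills both vectors and the diagonal part acts by the same scalar on both.
  Deeper pairs follow by moving \<open>A\<close> past the last lowering operator, at the cost of a
  commutator in \<open>sl n\<close>.\<close>

lemma R_act_P: "P k x y ==> A \<in> sl n ==> R (act V A x) (act W A y)"
proof (induction arbitrary: A rule: hw_pair.induct)
  case base
  let ?L = "mat n n (\<lambda>(i, j). if j < i then A $$ (i, j) else 0)"
  let ?D = "mat n n (\<lambda>(i, j). if j = i then A $$ (i, j) else 0)"
  let ?U = "mat n n (\<lambda>(i, j). if i < j then A $$ (i, j) else 0)"
  have A: "A = ?L + (?D + ?U)" by (rule eq_matI) (use base in \<open>auto simp: sl_def\<close>)
  have sl: "?D \<in> sl n" "?U \<in> sl n" "?D + ?U \<in> sl n" using base by (auto simp: sl_def)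
  have L: "?L \<in> n_minus n" and D: "?D \<in> cartan n" and U: "?U \<in> n_plus n"
    using sl by (auto simp: n_minus_def cartan_def n_plus_def)
  have vw: "R v w" by (rule R_P[OF hw_pair.base])
  note L' = R_n_minus[OF L vw]
  have "act V A v = act V ?L v \<oplus>\<^bsub>V\<^esub> wt ?D \<odot>\<^bsub>V\<^esub> v"
    by (subst A, subst V.act_mat_add, (use L' sl hv_in in simp_all)[3], subst V.act_mat_add)
       (use sl hv_in hv D U in \<open>auto simp: highest_weight_vector_def\<close>)
  moreover have "act W A w = act W ?L w \<oplus>\<^bsub>W\<^esub> wt ?D \<odot>\<^bsub>W\<^esub> w"
    by (subst A, subst W.act_mat_add, (use L' sl hv_in in simp_all)[3], subst W.act_mat_add)
       (use sl hv_in hw D U in \<open>auto simp: highest_weight_vector_def\<close>)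
  ultimately show ?case using R_add[OF R_smult[OF vw] L'(2)] by simp
next
  case (step k x y j i)
  have E: "elem_mat n i j \<in> sl n" using step elem_mat_sl by simp
  have xy: "x \<in> carrier V" "y \<in> carrier W" using step P_in by blast+
  have "R (act V (A * elem_mat n i j - elem_mat n i j * A) x \<oplus>\<^bsub>V\<^esub> act V (elem_mat n i j) (act V A x))
    (act W (A * elem_mat n i j - elem_mat n i j * A) y \<oplus>\<^bsub>W\<^esub> act W (elem_mat n i j) (act W A y))"
    by (intro R_add R_elem step commutator_sl E)
  then show ?case using V.act_commutator[OF step.prems E xy(1)] W.act_commutator[OF step.prems E xy(2)] by simp
qed

lemma R_act:
  assumes "R x y" "A \<in> sl n" shows "R (act V A x) (act W A y)"
  using assms(1)
proof (induction rule: hw_rel.induct)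
  case zero
  then show ?case using hw_rel.zero V.act_zero W.act_zero assms(2) by simp
next
  case (add x1 y1 k x2 y2 c)
  have i: "x1 \<in> carrier V" "y1 \<in> carrier W" "x2 \<in> carrier V" "y2 \<in> carrier W"
    using add R_in P_in by blast+
  show ?case using R_add[OF R_smult[OF R_act_P[OF add.hyps(2) assms(2)], of c] add.IH] i assms(2)
    by (simp add: V.act_add W.act_add V.act_smult W.act_smult)
qed

abbreviation "h \<equiv> rho_mat n"

lemma P_weight:
  "P k x y ==> act V h x = (wt h - of_nat k) \<odot>\<^bsub>V\<^esub> x \<and> act W h y = (wt h - of_nat k) \<odot>\<^bsub>W\<^esub> y \<and> (k = 0 --> x = v \<and> y = w)"
proof (induction rule: hw_pair.induct)
  case base
  then show ?case using hv hw rho_mat_cartan by (auto simp: highest_weight_vector_def)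
next
  case (step k x y j i)
  have E: "elem_mat n i j \<in> sl n" using step elem_mat_sl by simp
  have xy: "x \<in> carrier V" "y \<in> carrier W" using step P_in by blast+
  note c = rho_mat_commutator[OF step.hyps(2,3)]
  have "act V h (act V (elem_mat n i j) x) = (- of_nat (i - j)) \<odot>\<^bsub>V\<^esub> act V (elem_mat n i j) x \<oplus>\<^bsub>V\<^esub> (wt h - of_nat k) \<odot>\<^bsub>V\<^esub> act V (elem_mat n i j) x"
    using V.act_commutator[OF rho_mat_sl E xy(1)] step.IH E xy by (simp add: c V.act_mat_smult V.act_smult)
  also have "\<dots> = (- of_nat (i - j) + (wt h - of_nat k)) \<odot>\<^bsub>V\<^esub> act V (elem_mat n i j) x"
    using V.act_in[OF E xy(1)] by (simp only: V.smult_add_left)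
  finally have 1: "act V h (act V (elem_mat n i j) x) = (wt h - of_nat (k + (i - j))) \<odot>\<^bsub>V\<^esub> act V (elem_mat n i j) x"
    by (simp add: algebra_simps)
  have "act W h (act W (elem_mat n i j) y) = (- of_nat (i - j)) \<odot>\<^bsub>W\<^esub> act W (elem_mat n i j) y \<oplus>\<^bsub>W\<^esub> (wt h - of_nat k) \<odot>\<^bsub>W\<^esub> act W (elem_mat n i j) y"
    using W.act_commutator[OF rho_mat_sl E xy(2)] step.IH E xy by (simp add: c W.act_mat_smult W.act_smult)
  also have "\<dots> = (- of_nat (i - j) + (wt h - of_nat k)) \<odot>\<^bsub>W\<^esub> act W (elem_mat n i j) y"
    using W.act_in[OF E xy(2)] by (simp only: W.smult_add_left)
  finally have 2: "act W h (act W (elem_mat n i j) y) = (wt h - of_nat (k + (i - j))) \<odot>\<^bsub>W\<^esub> act W (elem_mat n i j) y"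
    by (simp add: algebra_simps)
  show ?case using 1 2 step.hyps by auto
qed

text \<open>Applying \<open>\<Prod>\<^sub>l (h - wt h + l)\<close> for \<open>l = 1, \<dots>, K\<close> with \<open>K\<close> large kills all components below
  the highest weight.\<close>

lemma R_top_component:
  assumes "R x y"
  shows "\<exists>c K0. \<forall>K\<ge>K0. weight_op V h (wt h) K x = (c * (\<Prod>l\<in>{1..K}. of_nat l)) \<odot>\<^bsub>V\<^esub> v \<and>
    weight_op W h (wt h) K y = (c * (\<Prod>l\<in>{1..K}. of_nat l)) \<odot>\<^bsub>W\<^esub> w"
  using assms
proof (induction rule: hw_rel.induct)
  case zero
  have "weight_op V h (wt h) K \<zero>\<^bsub>V\<^esub> = \<zero>\<^bsub>V\<^esub>" "weight_op W h (wt h) K \<zero>\<^bsub>W\<^esub> = \<zero>\<^bsub>W\<^esub>" for K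
    using V.weight_op_smult[OF rho_mat_sl V.zero_closed, of "wt h" K 0] V.weight_op_in[OF rho_mat_sl V.zero_closed, of "wt h" K]
      W.weight_op_smult[OF rho_mat_sl W.zero_closed, of "wt h" K 0] W.weight_op_in[OF rho_mat_sl W.zero_closed, of "wt h" K]
    by simp_all
  then show ?case by (intro exI[of _ 0]) (use hv_in in simp)
next
  case (add x y k x' y' d)
  let ?f = "\<lambda>K. \<Prod>l\<in>{1..K}. of_nat l :: complex"
  have i: "x \<in> carrier V" "y \<in> carrier W" "x' \<in> carrier V" "y' \<in> carrier W"
    using add R_in P_in by blast+
  obtain c K0 where c: "!!K. K \<ge> K0 ==> weight_op V h (wt h) K x = (c * ?f K) \<odot>\<^bsub>V\<^esub> v \<and>
    weight_op W h (wt h) K y = (c * ?f K) \<odot>\<^bsub>W\<^esub> w" using add.IH by blast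
  note w = P_weight[OF add.hyps(2)]
  \<comment> \<open>Only a pair of depth \<open>0\<close>, which is \<open>(v, w)\<close> itself,
    contributes to the top component.\<close>
  define e where "e = (if k = 0 then d else 0)"
  have x': "d \<odot>\<^bsub>V\<^esub> weight_op V h (wt h) K x' = (e * ?f K) \<odot>\<^bsub>V\<^esub> v \<and> d \<odot>\<^bsub>W\<^esub> weight_op W h (wt h) K y' = (e * ?f K) \<odot>\<^bsub>W\<^esub> w"
    if "K \<ge> k" for K
  proof -
    have wx: "weight_op V h (wt h) K x' = (\<Prod>l\<in>{1..K}. of_nat l - of_nat k) \<odot>\<^bsub>V\<^esub> x'"
      by (rule V.weight_op_eigen[OF rho_mat_sl i(3)]) (use w in blast)
    have wy: "weight_op W h (wt h) K y' = (\<Prod>l\<in>{1..K}. of_nat l - of_nat k) \<odot>\<^bsub>W\<^esub> y'"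
      by (rule W.weight_op_eigen[OF rho_mat_sl i(4)]) (use w in blast)
    show ?thesis
    proof (cases "k = 0")
      case True
      then show ?thesis unfolding wx wy e_def using w hv_in by (simp add: V.smult_smult W.smult_smult)
    next
      case False
      have z: "(\<Prod>l\<in>{1..K}. of_nat l - of_nat k) = (0 :: complex)" using that False by (intro prod_zero) auto
      show ?thesis unfolding wx wy e_def z using False hv_in i by simp
    qed
  qed
  show ?case
  proof (intro exI allI impI)
    fix K assume K: "max K0 k \<le> K"
    have "weight_op V h (wt h) K (x \<oplus>\<^bsub>V\<^esub> d \<odot>\<^bsub>V\<^esub> x') = (c * ?f K) \<odot>\<^bsub>V\<^esub> v \<oplus>\<^bsub>V\<^esub> (e * ?f K) \<odot>\<^bsub>V\<^esub> v"
      using K c[of K] x'[of K] i by (simp add: V.weight_op_add V.weight_op_smult rho_mat_sl)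
    moreover have "weight_op W h (wt h) K (y \<oplus>\<^bsub>W\<^esub> d \<odot>\<^bsub>W\<^esub> y') = (c * ?f K) \<odot>\<^bsub>W\<^esub> w \<oplus>\<^bsub>W\<^esub> (e * ?f K) \<odot>\<^bsub>W\<^esub> w"
      using K c[of K] x'[of K] i by (simp add: W.weight_op_add W.weight_op_smult rho_mat_sl)
    ultimately show "weight_op V h (wt h) K (x \<oplus>\<^bsub>V\<^esub> d \<odot>\<^bsub>V\<^esub> x') = ((c + e) * ?f K) \<odot>\<^bsub>V\<^esub> v \<and>
      weight_op W h (wt h) K (y \<oplus>\<^bsub>W\<^esub> d \<odot>\<^bsub>W\<^esub> y') = ((c + e) * ?f K) \<odot>\<^bsub>W\<^esub> w"
      using hv_in by (simp only: distrib_right V.smult_add_left W.smult_add_left)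
  qed
qed

text \<open>By \<open>R_top_component\<close> the two members of a related pair have the same
  coefficient along \<open>v\<close> and \<open>w\<close>. It would have to vanish because of the
  zero member, and yet be nonzero because of the highest weight vector.\<close>

lemma R_not_half: "\<not> R v \<zero>\<^bsub>W\<^esub>" "\<not> R \<zero>\<^bsub>V\<^esub> w"
proof -
  let ?f = "\<lambda>K. \<Prod>l\<in>{1..K}. of_nat l :: complex"
  have f: "?f K \<noteq> 0" for K by simp
  have v: "weight_op V h (wt h) K v = ?f K \<odot>\<^bsub>V\<^esub> v" "weight_op W h (wt h) K w = ?f K \<odot>\<^bsub>W\<^esub> w" for K
    using V.weight_op_eigen[OF rho_mat_sl hv_in(1), of "wt h" 0 K] W.weight_op_eigen[OF rho_mat_sl hv_in(2), of "wt h" 0 K]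
      P_weight[OF hw_pair.base] by simp_all
  have z: "weight_op V h (wt h) K \<zero>\<^bsub>V\<^esub> = \<zero>\<^bsub>V\<^esub>" "weight_op W h (wt h) K \<zero>\<^bsub>W\<^esub> = \<zero>\<^bsub>W\<^esub>" for K
    using V.weight_op_smult[OF rho_mat_sl V.zero_closed, of "wt h" K 0] V.weight_op_in[OF rho_mat_sl V.zero_closed, of "wt h" K]
      W.weight_op_smult[OF rho_mat_sl W.zero_closed, of "wt h" K 0] W.weight_op_in[OF rho_mat_sl W.zero_closed, of "wt h" K]
    by simp_all
  have V0: "c = 0" if "c \<odot>\<^bsub>V\<^esub> v = \<zero>\<^bsub>V\<^esub>" for c
  proof (rule ccontr)
    assume c: "c \<noteq> 0"
    have "inverse c \<odot>\<^bsub>V\<^esub> (c \<odot>\<^bsub>V\<^esub> v) = v" using c hv_in by (simp add: V.smult_smult)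
    then show False using that hv_in by simp
  qed
  have W0: "c = 0" if "c \<odot>\<^bsub>W\<^esub> w = \<zero>\<^bsub>W\<^esub>" for c
  proof (rule ccontr)
    assume c: "c \<noteq> 0"
    have "inverse c \<odot>\<^bsub>W\<^esub> (c \<odot>\<^bsub>W\<^esub> w) = w" using c hv_in by (simp add: W.smult_smult)
    then show False using that hv_in by simp
  qed
  show "\<not> R v \<zero>\<^bsub>W\<^esub>"
  proof
    assume "R v \<zero>\<^bsub>W\<^esub>"
    then obtain c K where e: "?f K \<odot>\<^bsub>V\<^esub> v = (c * ?f K) \<odot>\<^bsub>V\<^esub> v" "\<zero>\<^bsub>W\<^esub> = (c * ?f K) \<odot>\<^bsub>W\<^esub> w"
      using R_top_component[of v "\<zero>\<^bsub>W\<^esub>"] unfolding v z by (metis order_refl)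
    have "?f K \<odot>\<^bsub>V\<^esub> v = 0 \<odot>\<^bsub>V\<^esub> v" using e(1) by (simp only: W0[OF e(2)[symmetric]])
    then have "?f K \<odot>\<^bsub>V\<^esub> v = \<zero>\<^bsub>V\<^esub>" using hv_in by (simp only: V.smult_0)
    from V0[OF this] show False using f by simp
  qed
  show "\<not> R \<zero>\<^bsub>V\<^esub> w"
  proof
    assume "R \<zero>\<^bsub>V\<^esub> w"
    then obtain c K where e: "\<zero>\<^bsub>V\<^esub> = (c * ?f K) \<odot>\<^bsub>V\<^esub> v" "?f K \<odot>\<^bsub>W\<^esub> w = (c * ?f K) \<odot>\<^bsub>W\<^esub> w"
      using R_top_component[of "\<zero>\<^bsub>V\<^esub>" w] unfolding v z by (metis order_refl)
    have "?f K \<odot>\<^bsub>W\<^esub> w = 0 \<odot>\<^bsub>W\<^esub> w" using e(2) by (simp only: V0[OF e(1)[symmetric]])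
    then have "?f K \<odot>\<^bsub>W\<^esub> w = \<zero>\<^bsub>W\<^esub>" using hv_in by (simp only: W.smult_0)
    from W0[OF this] show False using f by simp
  qed
qed

end

lemma irreducible_sl_moduleD:
  assumes "irreducible_sl_module n V" "submodule H complex_field V" "!!A x. A \<in> sl n ==> x \<in> H ==> act V A x \<in> H"
  shows "H = {\<zero>\<^bsub>V\<^esub>} \<or> H = carrier V"
  using assms by (simp add: irreducible_sl_module_def)

text \<open>Goursat's argument: domain, range and the two kernels of \<open>R\<close> are submodules
  of irreducible modules. The pair \<open>(v, w)\<close> makes domain and range everything and
  \<open>R_not_half\<close> makes the kernels zero, so \<open>R\<close> is the graph of an
  isomorphism.\<close>

theorem irreducible_highest_weight_unique:
  fixes V :: "(complex mat, 'a) rep" and W :: "(complex mat, 'b) rep"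
  assumes iV: "irreducible_sl_module n V" and iW: "irreducible_sl_module n W"
    and hv: "highest_weight_vector n wt V v" and hw: "highest_weight_vector n wt W w"
  obtains f where "bij_betw f (carrier V) (carrier W)"
    "!!x y. x \<in> carrier V ==> y \<in> carrier V ==> f (x \<oplus>\<^bsub>V\<^esub> y) = f x \<oplus>\<^bsub>W\<^esub> f y"
    "!!c x. x \<in> carrier V ==> f (c \<odot>\<^bsub>V\<^esub> x) = c \<odot>\<^bsub>W\<^esub> f x"
    "!!A x. A \<in> sl n ==> x \<in> carrier V ==> f (act V A x) = act W A (f x)" "f v = w"
proof -
  interpret V: sl_rep n V using iV by (intro sl_repI) (simp add: irreducible_sl_module_def)
  interpret W: sl_rep n W using iW by (intro sl_repI) (simp add: irreducible_sl_module_def)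
  interpret hw_module_pair n V W wt v w by unfold_locales (rule hv hw)+
  have vw: "R v w" by (rule R_P[OF hw_pair.base])
  have z: "R \<zero>\<^bsub>V\<^esub> \<zero>\<^bsub>W\<^esub>" by (rule hw_rel.zero)
  have "{x. \<exists>y. R x y} = {\<zero>\<^bsub>V\<^esub>} \<or> {x. \<exists>y. R x y} = carrier V"
  proof (rule irreducible_sl_moduleD[OF iV])
    show "submodule {x. \<exists>y. R x y} complex_field V"
    proof (rule V.subspaceI)
      show "{x. \<exists>y. R x y} \<subseteq> carrier V" using R_in by blast
      show "\<zero>\<^bsub>V\<^esub> \<in> {x. \<exists>y. R x y}" using z by blast
      show "x1 \<oplus>\<^bsub>V\<^esub> x2 \<in> {x. \<exists>y. R x y}" if "x1 \<in> {x. \<exists>y. R x y}" "x2 \<in> {x. \<exists>y. R x y}" for x1 x2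
        using that by (auto dest: R_add)
      show "c \<odot>\<^bsub>V\<^esub> x1 \<in> {x. \<exists>y. R x y}" if "x1 \<in> {x. \<exists>y. R x y}" for c x1
        using that by (auto dest: R_smult)
    qed
    show "act V A x1 \<in> {x. \<exists>y. R x y}" if "A \<in> sl n" "x1 \<in> {x. \<exists>y. R x y}" for A x1
      using that(2) by (auto dest: R_act[OF _ that(1)])
  qed
  then have dom: "\<exists>y. R x y" if "x \<in> carrier V" for x using that vw hv_in by blast
  have "{y. \<exists>x. R x y} = {\<zero>\<^bsub>W\<^esub>} \<or> {y. \<exists>x. R x y} = carrier W"
  proof (rule irreducible_sl_moduleD[OF iW])
    show "submodule {y. \<exists>x. R x y} complex_field W"
    proof (rule W.subspaceI)
      show "{y. \<exists>x. R x y} \<subseteq> carrier W" using R_in by blast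
      show "\<zero>\<^bsub>W\<^esub> \<in> {y. \<exists>x. R x y}" using z by blast
      show "x1 \<oplus>\<^bsub>W\<^esub> x2 \<in> {y. \<exists>x. R x y}" if "x1 \<in> {y. \<exists>x. R x y}" "x2 \<in> {y. \<exists>x. R x y}" for x1 x2
        using that by (auto dest: R_add)
      show "c \<odot>\<^bsub>W\<^esub> x1 \<in> {y. \<exists>x. R x y}" if "x1 \<in> {y. \<exists>x. R x y}" for c x1
        using that by (auto dest: R_smult)
    qed
    show "act W A x1 \<in> {y. \<exists>x. R x y}" if "A \<in> sl n" "x1 \<in> {y. \<exists>x. R x y}" for A x1
      using that(2) by (auto dest: R_act[OF _ that(1)])
  qed
  then have ran: "\<exists>x. R x y" if "y \<in> carrier W" for y using that vw hv_in by blast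
  have "{x. R x \<zero>\<^bsub>W\<^esub>} = {\<zero>\<^bsub>V\<^esub>} \<or> {x. R x \<zero>\<^bsub>W\<^esub>} = carrier V"
  proof (rule irreducible_sl_moduleD[OF iV])
    show "submodule {x. R x \<zero>\<^bsub>W\<^esub>} complex_field V"
    proof (rule V.subspaceI)
      show "x \<oplus>\<^bsub>V\<^esub> y \<in> {x. R x \<zero>\<^bsub>W\<^esub>}" if "x \<in> {x. R x \<zero>\<^bsub>W\<^esub>}" "y \<in> {x. R x \<zero>\<^bsub>W\<^esub>}" for x y
        using R_add[of y "\<zero>\<^bsub>W\<^esub>" x "\<zero>\<^bsub>W\<^esub>"] that by simp
      show "c \<odot>\<^bsub>V\<^esub> x \<in> {x. R x \<zero>\<^bsub>W\<^esub>}" if "x \<in> {x. R x \<zero>\<^bsub>W\<^esub>}" for c x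
        using R_smult[of x "\<zero>\<^bsub>W\<^esub>" c] that by simp
    qed (use R_in z in blast)+
    show "act V A x \<in> {x. R x \<zero>\<^bsub>W\<^esub>}" if "A \<in> sl n" "x \<in> {x. R x \<zero>\<^bsub>W\<^esub>}" for A x
      using R_act[of x "\<zero>\<^bsub>W\<^esub>" A] W.act_zero[OF that(1)] that by simp
  qed
  then have kV: "x = \<zero>\<^bsub>V\<^esub>" if "R x \<zero>\<^bsub>W\<^esub>" for x using that R_not_half hv_in by blast
  have "{y. R \<zero>\<^bsub>V\<^esub> y} = {\<zero>\<^bsub>W\<^esub>} \<or> {y. R \<zero>\<^bsub>V\<^esub> y} = carrier W"
  proof (rule irreducible_sl_moduleD[OF iW])
    show "submodule {y. R \<zero>\<^bsub>V\<^esub> y} complex_field W"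
    proof (rule W.subspaceI)
      show "x \<oplus>\<^bsub>W\<^esub> y \<in> {y. R \<zero>\<^bsub>V\<^esub> y}" if "x \<in> {y. R \<zero>\<^bsub>V\<^esub> y}" "y \<in> {y. R \<zero>\<^bsub>V\<^esub> y}" for x y
        using R_add[of "\<zero>\<^bsub>V\<^esub>" y "\<zero>\<^bsub>V\<^esub>" x] that by simp
      show "c \<odot>\<^bsub>W\<^esub> x \<in> {y. R \<zero>\<^bsub>V\<^esub> y}" if "x \<in> {y. R \<zero>\<^bsub>V\<^esub> y}" for c x
        using R_smult[of "\<zero>\<^bsub>V\<^esub>" x c] that by simp
    qed (use R_in z in blast)+
    show "act W A x \<in> {y. R \<zero>\<^bsub>V\<^esub> y}" if "A \<in> sl n" "x \<in> {y. R \<zero>\<^bsub>V\<^esub> y}" for A x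
      using R_act[of "\<zero>\<^bsub>V\<^esub>" x A] V.act_zero[OF that(1)] that by simp
  qed
  then have kW: "y = \<zero>\<^bsub>W\<^esub>" if "R \<zero>\<^bsub>V\<^esub> y" for y using that R_not_half hv_in by blast
  have uniq: "x = x' \<longleftrightarrow> y = y'" if "R x y" "R x' y'" for x x' y y'
  proof -
    have i: "x \<in> carrier V" "x' \<in> carrier V" "y \<in> carrier W" "y' \<in> carrier W" using that R_in by blast+
    have d: "R (x \<ominus>\<^bsub>V\<^esub> x') (y \<ominus>\<^bsub>W\<^esub> y')"
      using R_add[OF R_smult[OF that(2), of "-1"] that(1)] i by (simp add: V.diff_eq_smult W.diff_eq_smult)
    show ?thesis
    proof
      assume "x = x'"
      then have "x \<ominus>\<^bsub>V\<^esub> x' = \<zero>\<^bsub>V\<^esub>" using V.diff_eq_zero_iff[OF i(1,2)] by simp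
      then show "y = y'" using d kW W.diff_eq_zero_iff[OF i(3,4)] by simp
    next
      assume "y = y'"
      then have "y \<ominus>\<^bsub>W\<^esub> y' = \<zero>\<^bsub>W\<^esub>" using W.diff_eq_zero_iff[OF i(3,4)] by simp
      then show "x = x'" using d kV V.diff_eq_zero_iff[OF i(1,2)] by simp
    qed
  qed
  define f where "f x = (SOME y. R x y)" for x
  have f: "R x (f x)" if "x \<in> carrier V" for x unfolding f_def by (rule someI_ex[OF dom[OF that]])
  have fe: "f x = y" if "R x y" for x y using uniq[OF f that] R_in[OF that] by blast
  show thesis
  proof (rule that[of f])
    show "bij_betw f (carrier V) (carrier W)"
    proof (rule bij_betw_imageI)
      show "inj_on f (carrier V)"
      proof (rule inj_onI)
        fix x y assume "x \<in> carrier V" "y \<in> carrier V" "f x = f y"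
        then show "x = y" using uniq[OF f f, of x y] by simp
      qed
      show "f ` carrier V = carrier W"
      proof (intro equalityI subsetI)
        fix y assume "y \<in> f ` carrier V" then show "y \<in> carrier W" using f R_in by blast
      next
        fix y assume "y \<in> carrier W"
        then obtain x where "R x y" using ran by blast
        then show "y \<in> f ` carrier V" using fe R_in by blast
      qed
    qed
    show "f (x \<oplus>\<^bsub>V\<^esub> y) = f x \<oplus>\<^bsub>W\<^esub> f y" if "x \<in> carrier V" "y \<in> carrier V" for x y
      by (rule fe[OF R_add[OF f f]]) (use that in auto)
    show "f (c \<odot>\<^bsub>V\<^esub> x) = c \<odot>\<^bsub>W\<^esub> f x" if "x \<in> carrier V" for c x
      by (rule fe[OF R_smult[OF f]]) (use that in auto)
    show "f (act V A x) = act W A (f x)" if "A \<in> sl n" "x \<in> carrier V" for A x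
      by (rule fe[OF R_act[OF f]]) (use that in auto)
    show "f v = w" by (rule fe[OF vw])
  qed
qed

section \<open>Coordinates and tensor products with multiplicity spaces\<close>

definition lin_ext :: "('b \<Rightarrow>\<^sub>0 complex) => ('b => complex) => complex" where
  "lin_ext p f = (\<Sum>k\<in>keys p. lookup p k * f k)"

lemma lin_ext_superset: "finite F ==> keys p \<subseteq> F ==> lin_ext p f = (\<Sum>k\<in>F. lookup p k * f k)"
  unfolding lin_ext_def by (rule sum.mono_neutral_left) (auto simp: Poly_Mapping.in_keys_iff)

lemma lin_ext_add: "lin_ext (p + q) f = lin_ext p f + lin_ext q f"
  using Poly_Mapping.keys_add[of p q]
  by (simp add: lin_ext_superset[of "keys p \<union> keys q"] Poly_Mapping.lookup_add distrib_right sum.distrib)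

lemma lin_ext_cscale: "lin_ext (cscale c p) f = c * lin_ext p f"
  using keys_cscale[of c p]
  by (simp add: lin_ext_superset[of "keys p"] sum_distrib_left mult.assoc)

lemma lin_ext_zero [simp]: "lin_ext 0 f = 0"
  by (simp add: lin_ext_def)

lemma lin_ext_single [simp]: "lin_ext (Poly_Mapping.single k c) f = c * f k"
  by (subst lin_ext_superset[of "{k}"]) auto

lemma cscale_minus_one: "cscale (- 1) p = - p"
  by (rule poly_mapping_eqI) simp

lemma lin_ext_diff: "lin_ext (p - q) f = lin_ext p f - lin_ext q f"
  using lin_ext_add[of p "cscale (- 1) q" f] unfolding lin_ext_cscale by (simp add: cscale_minus_one)

lemma lin_ext_sum: "lin_ext (sum g I) f = (\<Sum>i\<in>I. lin_ext (g i) f)"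
  by (induction I rule: infinite_finite_induct) (simp_all add: lin_ext_add)

lemma cscale_single [simp]: "cscale c (Poly_Mapping.single k d) = Poly_Mapping.single k (c * d)"
  by (rule poly_mapping_eqI) (simp add: Poly_Mapping.lookup_single Poly_Mapping.when_def)

lemma poly_mapping_expansion: "(p :: 'b \<Rightarrow>\<^sub>0 complex) = (\<Sum>k\<in>keys p. Poly_Mapping.single k (lookup p k))"
  by (rule poly_mapping_eqI)
     (simp add: Poly_Mapping.lookup_sum Poly_Mapping.lookup_single Poly_Mapping.when_def Poly_Mapping.in_keys_iff)

text \<open>Induction over sums of single terms with keys in \<open>B\<close>, the counterpart of
  extending a statement linearly from the basis.\<close>

lemma free_induct [consumes 1, case_names zero single add]:
  fixes p :: "'b \<Rightarrow>\<^sub>0 complex"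
  assumes "keys p \<subseteq> B" "Q 0" "!!k c. k \<in> B ==> Q (Poly_Mapping.single k c)"
    "!!p q. keys p \<subseteq> B ==> keys q \<subseteq> B ==> Q p ==> Q q ==> Q (p + q)"
  shows "Q p"
proof -
  have "Q (\<Sum>k\<in>F. Poly_Mapping.single k (lookup p k)) \<and> keys (\<Sum>k\<in>F. Poly_Mapping.single k (lookup p k)) \<subseteq> B"
    if "finite F" "F \<subseteq> B" for F
    using that
  proof (induction F)
    case (insert k F)
    have "keys (Poly_Mapping.single k (lookup p k)) \<subseteq> B" using insert by simp
    moreover have "keys (Poly_Mapping.single k (lookup p k) + (\<Sum>k\<in>F. Poly_Mapping.single k (lookup p k))) \<subseteq> B"
      using Poly_Mapping.keys_add[of "Poly_Mapping.single k (lookup p k)"] insert calculation by fast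
    ultimately show ?case using insert assms(3,4) by simp
  qed (simp add: assms(2))
  from this[OF _ assms(1)] show ?thesis using poly_mapping_expansion[of p] by simp
qed

section \<open>Bases of vector spaces of arbitrary dimension\<close>

context cspace begin

definition comb :: "('a \<Rightarrow>\<^sub>0 complex) => 'a" where
  "comb p = (\<Oplus>m\<in>keys p. lookup p m \<odot> m)"

lemma comb_superset:
  assumes "finite F" "keys p \<subseteq> F" "F \<subseteq> carrier V"
  shows "comb p = (\<Oplus>m\<in>F. lookup p m \<odot> m)"
  unfolding comb_def
  by (rule add.finprod_mono_neutral_cong_left) (use assms in \<open>auto simp: Poly_Mapping.in_keys_iff\<close>)

lemma comb_in: "keys p \<subseteq> carrier V ==> comb p \<in> carrier V"
  unfolding comb_def by (rule finsum_closed) auto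

lemma comb_add:
  assumes "keys p \<subseteq> carrier V" "keys q \<subseteq> carrier V"
  shows "comb (p + q) = comb p \<oplus> comb q"
proof -
  let ?F = "keys p \<union> keys q"
  have F: "finite ?F" "?F \<subseteq> carrier V" using assms by auto
  have c: "m \<in> carrier V" if "m \<in> ?F" for m using that F by auto
  have "comb (p + q) = (\<Oplus>m\<in>?F. lookup p m \<odot> m \<oplus> lookup q m \<odot> m)"
    unfolding comb_superset[OF F(1) Poly_Mapping.keys_add F(2)]
    by (rule finsum_cong') (use c in \<open>auto simp: Poly_Mapping.lookup_add smult_add_left\<close>)
  also have "\<dots> = comb p \<oplus> comb q"
    using finsum_addf[of "\<lambda>m. lookup p m \<odot> m" ?F "\<lambda>m. lookup q m \<odot> m"] c
    by (simp add: comb_superset[OF F(1) Un_upper1 F(2)] comb_superset[OF F(1) Un_upper2 F(2)] Pi_def)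
  finally show ?thesis .
qed

lemma comb_single: "m \<in> carrier V ==> comb (Poly_Mapping.single m c) = c \<odot> m"
  by (subst comb_superset[of "{m}"]) auto

lemma comb_zero [simp]: "comb 0 = \<zero>"
  by (simp add: comb_def)

lemma comb_cscale:
  assumes "keys p \<subseteq> carrier V" shows "comb (cscale c p) = c \<odot> comb p"
  using assms
proof (induction p rule: free_induct)
  case (single k d)
  then show ?case by (simp add: comb_single smult_smult)
next
  case (add p q)
  have k: "keys (cscale c p) \<subseteq> carrier V" "keys (cscale c q) \<subseteq> carrier V"
    by (rule order_trans[OF keys_cscale add.hyps(1)], rule order_trans[OF keys_cscale add.hyps(2)])
  show ?case
    by (simp only: cscale_simps(1) comb_add[OF k] comb_add[OF add.hyps] add.IH smult_add_right[OF comb_in comb_in] add.hyps)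
qed (simp add: cscale_simps)

lemma comb_in_subspace:
  assumes H: "submodule H complex_field V" and p: "keys p \<subseteq> H" shows "comb p \<in> H"
proof -
  have HV: "H \<subseteq> carrier V" by (rule subspaceD(1)[OF H])
  show ?thesis using p
  proof (induction p rule: free_induct)
    case zero
    show ?case unfolding comb_zero by (rule subspaceD(2)[OF H])
  next
    case (single k c)
    then have "k \<in> carrier V" using HV by (rule subsetD[rotated])
    then show ?case using subspaceD(4)[OF H single] by (simp only: comb_single)
  next
    case (add p q)
    have "keys p \<subseteq> carrier V" "keys q \<subseteq> carrier V" using add.hyps HV by (meson order_trans)+
    then show ?case using subspaceD(3)[OF H add.IH] by (simp only: comb_add)
  qed
qed

definition independent_set :: "'a set => bool" where
  "independent_set B \<longleftrightarrow> B \<subseteq> carrier V \<and> (\<forall>p. keys p \<subseteq> B --> comb p = \<zero> --> p = 0)"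

text \<open>Zorn's lemma: the multiplicity spaces are arbitrary vector spaces, with no finiteness
  stated. A linear dependence involves finitely many vectors and hence takes place in one member of
  a chain.\<close>

lemma exists_maximal_independent:
  obtains B where "independent_set B" "!!C. independent_set C ==> B \<subseteq> C ==> C = B"
proof -
  have "\<exists>B\<in>Collect independent_set. \<forall>C\<in>Collect independent_set. B \<subseteq> C --> C = B"
  proof (rule subset_Zorn_nonempty)
    show "Collect independent_set \<noteq> {}" by (auto simp: independent_set_def intro!: exI[of _ "{}"])
    fix C assume C: "C \<noteq> {}" "subset.chain (Collect independent_set) C"
    have "independent_set (\<Union> C)" unfolding independent_set_def
    proof (intro conjI allI impI)
      show "\<Union> C \<subseteq> carrier V" using C(2) unfolding subset.chain_def independent_set_def by blast
      fix p assume p: "keys p \<subseteq> \<Union> C" "comb p = \<zero>"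
      obtain D where "D \<in> C" "keys p \<subseteq> D"
        using finite_subset_Union_chain[OF finite_keys p(1) C] by blast
      moreover have "independent_set D" using C(2) \<open>D \<in> C\<close> by (auto simp: subset.chain_def)
      ultimately show "p = 0" using p(2) by (simp add: independent_set_def)
    qed
    then show "\<Union> C \<in> Collect independent_set" by simp
  qed
  then show thesis using that by auto
qed

lemma maximal_independent_spans:
  assumes B: "independent_set B" "!!C. independent_set C ==> B \<subseteq> C ==> C = B" and m: "m \<in> carrier V"
  shows "\<exists>p. keys p \<subseteq> B \<and> comb p = m"
proof (cases "m \<in> B")
  case True
  then show ?thesis using m by (intro exI[of _ "basis_vec m"]) (simp add: comb_single)
next
  case False
  have BV: "B \<subseteq> carrier V" using B(1) by (simp add: independent_set_def)
  have "\<not> independent_set (insert m B)" using B(2)[of "insert m B"] False by auto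
  then obtain p where p: "keys p \<subseteq> insert m B" "comb p = \<zero>" "p \<noteq> 0"
    using BV m by (auto simp: independent_set_def)
  define c where "c = lookup p m"
  define q where "q = p - Poly_Mapping.single m c"
  have "lookup q k = (if k = m then 0 else lookup p k)" for k
    by (simp add: q_def c_def Poly_Mapping.lookup_minus Poly_Mapping.lookup_single Poly_Mapping.when_def)
  then have q: "keys q \<subseteq> B" using p(1) by (auto simp: Poly_Mapping.in_keys_iff split: if_splits)
  have qV: "keys q \<subseteq> carrier V" using q BV by auto
  have "comb p = c \<odot> m \<oplus> comb q"
    using comb_add[of "Poly_Mapping.single m c" q] qV m by (simp add: q_def comb_single)
  then have e: "c \<odot> m \<oplus> comb q = \<zero>" using p(2) by simp
  have c0: "c \<noteq> 0"
  proof
    assume "c = 0"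
    then have "comb q = \<zero>" "q = p" using e m qV comb_in by (auto simp: q_def)
    then show False using q p(3) B(1) by (auto simp: independent_set_def)
  qed
  have "comb (cscale (- inverse c) q) = m"
  proof -
    have "comb q = \<ominus> (c \<odot> m)" using e m comb_in[OF qV] by (metis a_comm minus_equality smult_in)
    then have "comb q = (- c) \<odot> m" using m by (simp add: smult_minus_1[symmetric] smult_smult)
    then show ?thesis using m c0 by (simp add: comb_cscale[OF qV] smult_smult)
  qed
  then show ?thesis using q keys_cscale[of "- inverse c" q] by blast
qed

text \<open>The last property expresses spanning as an induction principle: a subspace containing
  \<open>B\<close> is everything. It is the form needed to reduce tensors to basis vectors of the
  second factor.\<close>

lemma exists_coordinates:
  obtains B and crd :: "'a => 'a \<Rightarrow>\<^sub>0 complex" where "B \<subseteq> carrier V"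
    "!!m. m \<in> carrier V ==> keys (crd m) \<subseteq> B"
    "!!l m. l \<in> carrier V ==> m \<in> carrier V ==> crd (l \<oplus> m) = crd l + crd m"
    "!!c m. m \<in> carrier V ==> crd (c \<odot> m) = cscale c (crd m)"
    "!!b. b \<in> B ==> crd b = basis_vec b"
    "!!H. submodule H complex_field V ==> B \<subseteq> H ==> carrier V \<subseteq> H"
proof -
  obtain B where B: "independent_set B" "!!C. independent_set C ==> B \<subseteq> C ==> C = B"
    using exists_maximal_independent by blast
  have BV: "B \<subseteq> carrier V" using B(1) by (simp add: independent_set_def)
  define crd where "crd m = (SOME p. keys p \<subseteq> B \<and> comb p = m)" for m
  have crd: "keys (crd m) \<subseteq> B" "comb (crd m) = m" if "m \<in> carrier V" for m
    using someI_ex[OF maximal_independent_spans[OF B that]] by (auto simp: crd_def)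
  have uniq: "p = q" if "keys p \<subseteq> B" "keys q \<subseteq> B" "comb p = comb q" for p q
  proof -
    have k: "keys (cscale (- 1) q) \<subseteq> B" using keys_cscale that by fast
    have "keys (p + cscale (- 1) q) \<subseteq> B" using Poly_Mapping.keys_add that k by fast
    moreover have "comb (p + cscale (- 1) q) = \<zero>"
      using that k BV comb_in[of q] by (simp add: comb_add comb_cscale smult_minus_1 r_neg order_trans[OF _ BV])
    ultimately have "p + cscale (- 1) q = 0" using B(1) by (simp add: independent_set_def)
    then show ?thesis by (simp add: cscale_minus_one)
  qed
  show thesis
  proof (rule that[OF BV])
    show "keys (crd m) \<subseteq> B" if "m \<in> carrier V" for m by (rule crd(1)[OF that])
    show "crd (l \<oplus> m) = crd l + crd m" if "l \<in> carrier V" "m \<in> carrier V" for l m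
    proof (rule uniq)
      show "keys (crd (l \<oplus> m)) \<subseteq> B" using that by (intro crd) simp
      show "keys (crd l + crd m) \<subseteq> B" using Poly_Mapping.keys_add crd(1) that by fast
      show "comb (crd (l \<oplus> m)) = comb (crd l + crd m)"
        using that crd BV by (simp add: comb_add order_trans[OF _ BV])
    qed
    show "crd (c \<odot> m) = cscale c (crd m)" if "m \<in> carrier V" for c m
    proof (rule uniq)
      show "keys (crd (c \<odot> m)) \<subseteq> B" using that by (intro crd) simp
      show "keys (cscale c (crd m)) \<subseteq> B" using keys_cscale crd(1) that by fast
      show "comb (crd (c \<odot> m)) = comb (cscale c (crd m))"
        using that crd BV by (simp add: comb_cscale order_trans[OF _ BV])
    qed
    show "crd b = basis_vec b" if "b \<in> B" for b
    proof (rule uniq)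
      have b: "b \<in> carrier V" using that BV by auto
      show "keys (crd b) \<subseteq> B" by (rule crd(1)[OF b])
      show "keys (basis_vec b) \<subseteq> B" using that by simp
      show "comb (crd b) = comb (basis_vec b)" using crd(2)[OF b] comb_single[OF b] b by simp
    qed
    show "carrier V \<subseteq> H" if "submodule H complex_field V" "B \<subseteq> H" for H
    proof
      fix m assume "m \<in> carrier V"
      then show "m \<in> H" using comb_in_subspace[OF that(1), of "crd m"] crd that(2) by auto
    qed
  qed
qed

end

lemma (in stable_quot) quot_map:
  assumes "!!x y. x \<in> carrier V ==> y \<in> carrier V ==> \<Psi> x = \<Psi> y \<longleftrightarrow> x \<ominus> y \<in> U"
  shows "\<exists>h. (\<forall>x\<in>carrier V. h (pr x) = \<Psi> x) \<and> bij_betw h (carrier (quot_rep V U)) (\<Psi> ` carrier V)"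
proof -
  define h where "h X = \<Psi> (SOME x. x \<in> carrier V \<and> X = pr x)" for X
  have h: "h (pr x) = \<Psi> x" if x: "x \<in> carrier V" for x
  proof -
    have "\<exists>x'. x' \<in> carrier V \<and> pr x = pr x'" using x by blast
    then have s: "(SOME x'. x' \<in> carrier V \<and> pr x = pr x') \<in> carrier V \<and>
        pr x = pr (SOME x'. x' \<in> carrier V \<and> pr x = pr x')" by (rule someI_ex)
    show ?thesis unfolding h_def
      using assms[OF x conjunct1[OF s]] pr_eq_iff[OF x conjunct1[OF s]] conjunct2[OF s] by simp
  qed
  show ?thesis
  proof (intro exI[of _ h] conjI ballI)
    show "bij_betw h (carrier (quot_rep V U)) (\<Psi> ` carrier V)"
    proof (rule bij_betw_imageI)
      show "inj_on h (carrier (quot_rep V U))"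
      proof (rule inj_onI)
        fix X Y assume "X \<in> carrier (quot_rep V U)" "Y \<in> carrier (quot_rep V U)" and e: "h X = h Y"
        then obtain x y where x: "x \<in> carrier V" "X = pr x" and y: "y \<in> carrier V" "Y = pr y"
          by (elim quot_cases)
        show "X = Y" using e assms[OF x(1) y(1)] pr_eq_iff[OF x(1) y(1)] by (simp add: x y h)
      qed
      show "h ` carrier (quot_rep V U) = \<Psi> ` carrier V"
        unfolding quot_simps(1) image_image by (rule image_cong[OF refl]) (rule h)
    qed
  qed (rule h)
qed

text \<open>\<open>\<theta>\<close> realizes \<open>V\<close> by functions and \<open>B\<close> is a
  basis of \<open>M\<close> with coordinates \<open>crd\<close>. The tensor product then becomes the
  space of finitely supported families, indexed by \<open>B\<close>, of functions from the image of
  \<open>\<theta>\<close>. This is used both for Specht modules and for irreducible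
  \<open>sl_n\<close>-modules.\<close>

locale mult_space =
  fixes G :: "'g set" and V :: "('g, 'v) rep" and M :: "(complex, 'm) module"
    and \<theta> :: "'v => 'j => complex" and B :: "'m set" and crd :: "'m => 'm \<Rightarrow>\<^sub>0 complex"
  assumes V: "linear_rep G V" and M: "module complex_field M"
    and theta_add: "!!x y. x \<in> carrier V ==> y \<in> carrier V ==> \<theta> (x \<oplus>\<^bsub>V\<^esub> y) = (\<lambda>j. \<theta> x j + \<theta> y j)"
    and theta_scale: "!!c x. x \<in> carrier V ==> \<theta> (c \<odot>\<^bsub>V\<^esub> x) = (\<lambda>j. c * \<theta> x j)"
    and theta_inj: "!!x. x \<in> carrier V ==> \<theta> x = (\<lambda>j. 0) ==> x = \<zero>\<^bsub>V\<^esub>"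
    and B: "B \<subseteq> carrier M"
    and crd_keys: "!!m. m \<in> carrier M ==> keys (crd m) \<subseteq> B"
    and crd_add: "!!l m. l \<in> carrier M ==> m \<in> carrier M ==> crd (l \<oplus>\<^bsub>M\<^esub> m) = crd l + crd m"
    and crd_scale: "!!c m. m \<in> carrier M ==> crd (c \<odot>\<^bsub>M\<^esub> m) = cscale c (crd m)"
    and crd_basis: "!!b. b \<in> B ==> crd b = basis_vec b"
    and spans: "!!H. submodule H complex_field M ==> B \<subseteq> H ==> carrier M \<subseteq> H"
begin

sublocale V: cspace V using V by (rule linear_rep_cspace)
sublocale M: cspace M using M by (rule cspaceI)

abbreviation "Fr \<equiv> mult_free V M"
abbreviation "Rel \<equiv> mult_relations V M"
abbreviation "U \<equiv> lin_span Fr Rel"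

lemma Fr_simps: "carrier Fr = {p. keys p \<subseteq> carrier V \<times> carrier M}" "zero Fr = 0" "add Fr = (+)"
  "module.smult Fr = cscale"
  by (simp_all add: mult_free_def)

lemma linear_rep_Fr: "linear_rep G Fr"
  unfolding mult_free_def by (rule linear_rep_free) (auto simp: linear_repD[OF V])

sublocale Fr: cspace Fr using linear_rep_Fr by (rule linear_rep_cspace)

lemma act_Fr_single: "act Fr g (Poly_Mapping.single (v, m) c) = Poly_Mapping.single (act V g v, m) c"
  by (simp add: mult_free_def act_free_rep)

lemma act_Fr_add: "g \<in> G ==> p \<in> carrier Fr ==> q \<in> carrier Fr ==> act Fr g (p + q) = act Fr g p + act Fr g q"
  using linear_repD(2)[OF linear_rep_Fr, of g p q] by (simp add: Fr_simps)

lemma act_Fr_diff: "g \<in> G ==> p \<in> carrier Fr ==> q \<in> carrier Fr ==> act Fr g (p - q) = act Fr g p - act Fr g q"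
proof -
  assume a: "g \<in> G" "p \<in> carrier Fr" "q \<in> carrier Fr"
  have "act Fr g (cscale (- 1) q) = cscale (- 1) (act Fr g q)"
    using linear_repD(3)[OF linear_rep_Fr a(1,3)] by (simp add: Fr_simps)
  moreover have "cscale (- 1) q \<in> carrier Fr" using a(3) keys_cscale by (fastforce simp: Fr_simps)
  ultimately show ?thesis using act_Fr_add[OF a(1,2), of "cscale (- 1) q"] by (simp add: cscale_minus_one)
qed

lemma Fr_single: "v \<in> carrier V ==> m \<in> carrier M ==> Poly_Mapping.single (v, m) c \<in> carrier Fr"
  by (simp add: Fr_simps)

lemma Fr_diff: "p \<in> carrier Fr ==> q \<in> carrier Fr ==> p - q \<in> carrier Fr"
  using Poly_Mapping.keys_add[of p "- q"] by (fastforce simp: Fr_simps)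

lemma Rel_sub: "Rel \<subseteq> carrier Fr"
  unfolding mult_relations_def by (auto intro!: Fr_diff Fr_single)

lemma U_D: "U \<subseteq> carrier Fr" "0 \<in> U" "p \<in> U ==> q \<in> U ==> p + q \<in> U" "p \<in> U ==> cscale c p \<in> U"
  "p \<in> U ==> q \<in> U ==> p - q \<in> U"
proof -
  note D = Fr.subspaceD[OF Fr.subspace_lin_span[OF Rel_sub], unfolded Fr_simps]
  show 1: "U \<subseteq> carrier Fr" "0 \<in> U" "p \<in> U ==> q \<in> U ==> p + q \<in> U" "p \<in> U ==> cscale c p \<in> U" for p q c
    using D(1-4) by (simp_all add: Fr_simps)
  show "p \<in> U ==> q \<in> U ==> p - q \<in> U"
    using 1(3)[of p "cscale (- 1) q"] 1(4)[of q "- 1"] by (simp add: cscale_minus_one)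
qed

lemma U_sum: "(!!i. i \<in> I ==> f i \<in> U) ==> (\<Sum>i\<in>I. f i) \<in> U"
  by (induction I rule: infinite_finite_induct) (auto simp: U_D)

lemma stable_U: "stable_subspace G Fr U"
proof (rule stable_subspace_lin_span[OF linear_rep_Fr Rel_sub])
  fix g x assume g: "g \<in> G" and x: "x \<in> Rel"
  note V' = linear_repD[OF V g]
  have "act Fr g x \<in> Rel"
    using x[unfolded mult_relations_def]
  proof (elim UnE)
    assume "x \<in> {basis_vec (u \<oplus>\<^bsub>V\<^esub> v, m) - basis_vec (u, m) - basis_vec (v, m) | u v m.
        u \<in> carrier V \<and> v \<in> carrier V \<and> m \<in> carrier M}"
    then obtain u v m where c: "u \<in> carrier V" "v \<in> carrier V" "m \<in> carrier M"
      "x = basis_vec (u \<oplus>\<^bsub>V\<^esub> v, m) - basis_vec (u, m) - basis_vec (v, m)" by blast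
    have "act Fr g x = basis_vec (act V g u \<oplus>\<^bsub>V\<^esub> act V g v, m) - basis_vec (act V g u, m) - basis_vec (act V g v, m)"
      using c by (simp add: act_Fr_diff[OF g] Fr_single Fr_diff act_Fr_single V')
    then show "act Fr g x \<in> mult_relations V M" unfolding mult_relations_def using c V' by blast
  next
    assume "x \<in> {basis_vec (v, l \<oplus>\<^bsub>M\<^esub> m) - basis_vec (v, l) - basis_vec (v, m) | v l m.
        v \<in> carrier V \<and> l \<in> carrier M \<and> m \<in> carrier M}"
    then obtain v l m where c: "v \<in> carrier V" "l \<in> carrier M" "m \<in> carrier M"
      "x = basis_vec (v, l \<oplus>\<^bsub>M\<^esub> m) - basis_vec (v, l) - basis_vec (v, m)" by blast
    have "act Fr g x = basis_vec (act V g v, l \<oplus>\<^bsub>M\<^esub> m) - basis_vec (act V g v, l) - basis_vec (act V g v, m)"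
      using c by (simp add: act_Fr_diff[OF g] Fr_single Fr_diff act_Fr_single)
    then show "act Fr g x \<in> mult_relations V M" unfolding mult_relations_def using c V' by blast
  next
    assume "x \<in> {basis_vec (c \<odot>\<^bsub>V\<^esub> v, m) - Poly_Mapping.single (v, m) c | c v m.
        v \<in> carrier V \<and> m \<in> carrier M}"
    then obtain a v m where c: "v \<in> carrier V" "m \<in> carrier M"
      "x = basis_vec (a \<odot>\<^bsub>V\<^esub> v, m) - Poly_Mapping.single (v, m) a" by blast
    have "act Fr g x = basis_vec (a \<odot>\<^bsub>V\<^esub> act V g v, m) - Poly_Mapping.single (act V g v, m) a"
      using c by (simp add: act_Fr_diff[OF g] Fr_single Fr_diff act_Fr_single V')
    then show "act Fr g x \<in> mult_relations V M" unfolding mult_relations_def using c V' by blast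
  next
    assume "x \<in> {basis_vec (v, c \<odot>\<^bsub>M\<^esub> m) - Poly_Mapping.single (v, m) c | c v m.
        v \<in> carrier V \<and> m \<in> carrier M}"
    then obtain a v m where c: "v \<in> carrier V" "m \<in> carrier M"
      "x = basis_vec (v, a \<odot>\<^bsub>M\<^esub> m) - Poly_Mapping.single (v, m) a" by blast
    have "act Fr g x = basis_vec (act V g v, a \<odot>\<^bsub>M\<^esub> m) - Poly_Mapping.single (act V g v, m) a"
      using c by (simp add: act_Fr_diff[OF g] Fr_single Fr_diff act_Fr_single)
    then show "act Fr g x \<in> mult_relations V M" unfolding mult_relations_def using c V' by blast
  qed
  then show "act Fr g x \<in> U" using Fr.lin_span_superset by blast
qed

sublocale Q: stable_quot G Fr U
  by unfold_locales (rule linear_rep_Fr, rule stable_U)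

definition coords :: "('v \<times> 'm \<Rightarrow>\<^sub>0 complex) => 'm => 'j => complex" where
  "coords p b j = lin_ext p (\<lambda>(v, m). lookup (crd m) b * \<theta> v j)"

lemma coords_linear: "coords (p + q) b j = coords p b j + coords q b j" "coords (p - q) b j = coords p b j - coords q b j"
  "coords (cscale c p) b j = c * coords p b j" "coords 0 b j = 0"
  "coords (Poly_Mapping.single (v, m) c) b j = c * (lookup (crd m) b * \<theta> v j)"
  "coords (sum f I) b j = (\<Sum>i\<in>I. coords (f i) b j)"
  by (simp_all add: coords_def lin_ext_add lin_ext_diff lin_ext_cscale lin_ext_sum)

lemma coords_U: "p \<in> U ==> coords p = (\<lambda>b j. 0)"
proof -
  have "U \<subseteq> {p \<in> carrier Fr. coords p = (\<lambda>b j. 0)}"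
  proof (rule Fr.lin_span_least)
    show "submodule {p \<in> carrier Fr. coords p = (\<lambda>b j. 0)} complex_field Fr"
    proof (rule Fr.subspaceI)
      show "\<zero>\<^bsub>Fr\<^esub> \<in> {p \<in> carrier Fr. coords p = (\<lambda>b j. 0)}"
        using Fr.zero_closed by (simp add: Fr_simps(2) coords_linear fun_eq_iff)
      show "p \<oplus>\<^bsub>Fr\<^esub> q \<in> {p \<in> carrier Fr. coords p = (\<lambda>b j. 0)}"
        if "p \<in> {p \<in> carrier Fr. coords p = (\<lambda>b j. 0)}" "q \<in> {p \<in> carrier Fr. coords p = (\<lambda>b j. 0)}" for p q
        using that Fr.a_closed[of p q] by (simp add: Fr_simps(3) coords_linear fun_eq_iff)
      show "c \<odot>\<^bsub>Fr\<^esub> p \<in> {p \<in> carrier Fr. coords p = (\<lambda>b j. 0)}"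
        if "p \<in> {p \<in> carrier Fr. coords p = (\<lambda>b j. 0)}" for c p
        using that Fr.smult_in[of p c] by (simp add: Fr_simps(4) coords_linear fun_eq_iff)
    qed auto
    have "coords x = (\<lambda>b j. 0)" if "x \<in> Rel" for x
      using that unfolding mult_relations_def
      by (elim UnE; clarify; simp add: coords_linear fun_eq_iff theta_add theta_scale crd_add crd_scale
          Poly_Mapping.lookup_add algebra_simps)
    then show "Rel \<subseteq> {p \<in> carrier Fr. coords p = (\<lambda>b j. 0)}" using Rel_sub by auto
  qed
  then show "p \<in> U ==> coords p = (\<lambda>b j. 0)" by auto
qed

definition normal_form :: "'m set => ('m => 'v) => 'v \<times> 'm \<Rightarrow>\<^sub>0 complex" where
  "normal_form F u = (\<Sum>b\<in>F. basis_vec (u b, b))"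

text \<open>Congruent modulo the relations to a finite sum of tensors \<open>u b \<otimes> b\<close>
  with \<open>b\<close> in \<open>B\<close>. Requiring \<open>u b\<close> to be zero off
  \<open>F\<close> lets two such sums be brought to a common index set.\<close>

definition has_nf :: "('v \<times> 'm \<Rightarrow>\<^sub>0 complex) => bool" where
  "has_nf p \<longleftrightarrow> (\<exists>F u. finite F \<and> F \<subseteq> B \<and> (\<forall>b. u b \<in> carrier V) \<and> (\<forall>b. b \<notin> F --> u b = \<zero>\<^bsub>V\<^esub>) \<and> p - normal_form F u \<in> U)"

lemma Rel_U: "x \<in> Rel ==> x \<in> U" using Fr.lin_span_superset by blast

lemma Rel_mem:
  "u \<in> carrier V ==> v \<in> carrier V ==> m \<in> carrier M ==> basis_vec (u \<oplus>\<^bsub>V\<^esub> v, m) - basis_vec (u, m) - basis_vec (v, m) \<in> Rel"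
  "v \<in> carrier V ==> l \<in> carrier M ==> m \<in> carrier M ==> basis_vec (v, l \<oplus>\<^bsub>M\<^esub> m) - basis_vec (v, l) - basis_vec (v, m) \<in> Rel"
  "v \<in> carrier V ==> m \<in> carrier M ==> basis_vec (c \<odot>\<^bsub>V\<^esub> v, m) - Poly_Mapping.single (v, m) c \<in> Rel"
  "v \<in> carrier V ==> m \<in> carrier M ==> basis_vec (v, c \<odot>\<^bsub>M\<^esub> m) - Poly_Mapping.single (v, m) c \<in> Rel"
  unfolding mult_relations_def by blast+

lemma U_rel:
  "u \<in> carrier V ==> v \<in> carrier V ==> m \<in> carrier M ==> basis_vec (u \<oplus>\<^bsub>V\<^esub> v, m) - basis_vec (u, m) - basis_vec (v, m) \<in> U"
  "v \<in> carrier V ==> l \<in> carrier M ==> m \<in> carrier M ==> basis_vec (v, l \<oplus>\<^bsub>M\<^esub> m) - basis_vec (v, l) - basis_vec (v, m) \<in> U"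
  "v \<in> carrier V ==> m \<in> carrier M ==> basis_vec (c \<odot>\<^bsub>V\<^esub> v, m) - Poly_Mapping.single (v, m) c \<in> U"
  "v \<in> carrier V ==> m \<in> carrier M ==> basis_vec (v, c \<odot>\<^bsub>M\<^esub> m) - Poly_Mapping.single (v, m) c \<in> U"
  by (blast intro: Rel_U Rel_mem)+

lemma U_zero_vec: "m \<in> carrier M ==> basis_vec (\<zero>\<^bsub>V\<^esub>, m) \<in> U"
  using U_rel(3)[OF V.zero_closed, of m 0] by simp

lemma normal_form_extend:
  assumes "finite F'" "F \<subseteq> F'" "F' \<subseteq> B" "!!b. b \<notin> F ==> u b = \<zero>\<^bsub>V\<^esub>"
  shows "normal_form F' u - normal_form F u \<in> U"
proof -
  have "normal_form F' u - normal_form F u = (\<Sum>b\<in>F' - F. basis_vec (u b, b))"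
    unfolding normal_form_def using sum.subset_diff[OF assms(2,1), of "\<lambda>b. basis_vec (u b, b)"] by simp
  also have "\<dots> \<in> U" by (rule U_sum) (use assms B U_zero_vec in auto)
  finally show ?thesis .
qed

lemma U_diff_trans: "p - q \<in> U ==> q - r \<in> U ==> p - r \<in> U"
  using U_D(3)[of "p - q" "q - r"] by simp

lemma U_diff_sym: "p - q \<in> U ==> q - p \<in> U"
  using U_D(5)[OF U_D(2), of "p - q"] by simp

lemma has_nf_cong:
  assumes "p - q \<in> U" "has_nf q" shows "has_nf p"
proof -
  obtain F u where u: "finite F" "F \<subseteq> B" "\<forall>b. u b \<in> carrier V" "\<forall>b. b \<notin> F --> u b = \<zero>\<^bsub>V\<^esub>" "q - normal_form F u \<in> U"
    using assms(2) unfolding has_nf_def by (elim exE conjE) (rule that; assumption)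
  show ?thesis unfolding has_nf_def
    by (intro exI[of _ F] exI[of _ u] conjI u(1-4) U_diff_trans[OF assms(1) u(5)])
qed

lemma has_nf_add:
  assumes "has_nf p" "has_nf q" shows "has_nf (p + q)"
proof -
  obtain F u where p: "finite F" "F \<subseteq> B" "!!b. u b \<in> carrier V" "!!b. b \<notin> F ==> u b = \<zero>\<^bsub>V\<^esub>" "p - normal_form F u \<in> U"
    using assms(1) unfolding has_nf_def by blast
  obtain F' u' where q: "finite F'" "F' \<subseteq> B" "!!b. u' b \<in> carrier V" "!!b. b \<notin> F' ==> u' b = \<zero>\<^bsub>V\<^esub>" "q - normal_form F' u' \<in> U"
    using assms(2) unfolding has_nf_def by blast
  let ?F = "F \<union> F'" and ?u = "\<lambda>b. u b \<oplus>\<^bsub>V\<^esub> u' b"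
  have F: "finite ?F" "?F \<subseteq> B" using p q by auto
  have 1: "p - normal_form ?F u \<in> U"
    using U_diff_trans[OF p(5) U_diff_sym[OF normal_form_extend[OF F(1) Un_upper1 F(2) p(4)]]] .
  have 2: "q - normal_form ?F u' \<in> U"
    using U_diff_trans[OF q(5) U_diff_sym[OF normal_form_extend[OF F(1) Un_upper2 F(2) q(4)]]] .
  have "normal_form ?F ?u - normal_form ?F u - normal_form ?F u' =
     (\<Sum>b\<in>?F. basis_vec (?u b, b) - basis_vec (u b, b) - basis_vec (u' b, b))"
    by (simp add: normal_form_def sum_subtractf)
  also have "\<dots> \<in> U" by (rule U_sum, rule U_rel(1)) (use p q B in auto)
  finally have 3: "normal_form ?F ?u - normal_form ?F u - normal_form ?F u' \<in> U" .
  have "p + q - normal_form ?F ?u = (p - normal_form ?F u) + (q - normal_form ?F u') -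
     (normal_form ?F ?u - normal_form ?F u - normal_form ?F u')" by simp
  then have "p + q - normal_form ?F ?u \<in> U" using U_D(5)[OF U_D(3)[OF 1 2] 3] by simp
  then show ?thesis unfolding has_nf_def using F p q by (intro exI[of _ ?F] exI[of _ ?u]) auto
qed

text \<open>The vectors \<open>m\<close> such that every \<open>v \<otimes> m\<close> has a normal
  form are a subspace containing \<open>B\<close>, hence all of \<open>M\<close>. Scalars are moved
  from \<open>m\<close> to \<open>v\<close>, which is why \<open>v\<close> is quantified
  inside.\<close>

lemma has_nf_basis:
  assumes v: "v \<in> carrier V" and m: "m \<in> carrier M" shows "has_nf (basis_vec (v, m))"
proof -
  let ?H = "{m \<in> carrier M. \<forall>v\<in>carrier V. has_nf (basis_vec (v, m))}"
  have z: "has_nf 0" unfolding has_nf_def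
    by (intro exI[of _ "{}"] exI[of _ "\<lambda>_. \<zero>\<^bsub>V\<^esub>"]) (simp add: normal_form_def U_D)
  have "carrier M \<subseteq> ?H"
  proof (rule spans)
    show "submodule ?H complex_field M"
    proof (rule M.subspaceI)
      show "\<zero>\<^bsub>M\<^esub> \<in> ?H"
      proof (intro CollectI conjI ballI)
        fix v assume "v \<in> carrier V"
        then show "has_nf (basis_vec (v, \<zero>\<^bsub>M\<^esub>))"
          using U_rel(4)[of v "\<zero>\<^bsub>M\<^esub>" 0] by (intro has_nf_cong[OF _ z]) simp
      qed simp
      show "l \<oplus>\<^bsub>M\<^esub> m \<in> ?H" if "l \<in> ?H" "m \<in> ?H" for l m
      proof (intro CollectI conjI ballI)
        fix v assume v: "v \<in> carrier V"
        have l: "l \<in> carrier M" "has_nf (basis_vec (v, l))" and m: "m \<in> carrier M" "has_nf (basis_vec (v, m))"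
          using that v by simp_all
        show "has_nf (basis_vec (v, l \<oplus>\<^bsub>M\<^esub> m))"
          by (rule has_nf_cong[OF U_rel(2)[OF v l(1) m(1), unfolded diff_diff_eq] has_nf_add[OF l(2) m(2)]])
      qed (use that in simp)
      show "c \<odot>\<^bsub>M\<^esub> m \<in> ?H" if "m \<in> ?H" for c m
      proof (intro CollectI conjI ballI)
        fix v assume v: "v \<in> carrier V"
        have m: "m \<in> carrier M" and nf: "has_nf (basis_vec (c \<odot>\<^bsub>V\<^esub> v, m))" using that v by simp_all
        show "has_nf (basis_vec (v, c \<odot>\<^bsub>M\<^esub> m))"
          by (rule has_nf_cong[OF U_diff_trans[OF U_rel(4)[OF v m] U_diff_sym[OF U_rel(3)[OF v m]]] nf])
      qed (use that in simp)
    qed auto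
    show "B \<subseteq> ?H"
    proof
      fix b assume b: "b \<in> B"
      have "has_nf (basis_vec (v, b))" if "v \<in> carrier V" for v
        unfolding has_nf_def
        by (intro exI[of _ "{b}"] exI[of _ "\<lambda>x. if x = b then v else \<zero>\<^bsub>V\<^esub>"]) (use b that U_D in \<open>simp add: normal_form_def\<close>)
      then show "b \<in> ?H" using b B by auto
    qed
  qed
  then show ?thesis using v m by auto
qed

lemma has_nf_all: assumes "p \<in> carrier Fr" shows "has_nf p"
proof -
  have z: "has_nf 0" unfolding has_nf_def
    by (intro exI[of _ "{}"] exI[of _ "\<lambda>_. \<zero>\<^bsub>V\<^esub>"]) (simp add: normal_form_def U_D)
  have "keys p \<subseteq> carrier V \<times> carrier M" using assms by (simp add: Fr_simps)
  then show ?thesis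
  proof (induction p rule: free_induct)
    case (single k c)
    obtain v m where k: "k = (v, m)" "v \<in> carrier V" "m \<in> carrier M" using single by auto
    have "Poly_Mapping.single k c - basis_vec (c \<odot>\<^bsub>V\<^esub> v, m) \<in> U"
      using U_diff_sym[OF U_rel(3)[OF k(2,3)]] k by simp
    then show ?case by (rule has_nf_cong[OF _ has_nf_basis[OF V.smult_in[OF k(2)] k(3)]])
  qed (auto simp: z intro: has_nf_add)
qed

lemma theta_zero: "\<theta> \<zero>\<^bsub>V\<^esub> = (\<lambda>j. 0)"
  using theta_scale[OF V.zero_closed, of 0] by simp

lemma coords_normal_form:
  assumes "finite F" "F \<subseteq> B" "!!b. b \<notin> F ==> u b = \<zero>\<^bsub>V\<^esub>"
  shows "coords (normal_form F u) = (\<lambda>b. \<theta> (u b))"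
proof (intro ext)
  fix b j
  have "coords (normal_form F u) b j = (\<Sum>b'\<in>F. if b' = b then \<theta> (u b) j else 0)"
    unfolding normal_form_def coords_linear(6)
    by (rule sum.cong[OF refl]) (use assms(2) in \<open>auto simp: coords_linear crd_basis subset_iff Poly_Mapping.lookup_single Poly_Mapping.when_def\<close>)
  then show "coords (normal_form F u) b j = \<theta> (u b) j"
    using assms(1,3) theta_zero by simp
qed

lemma nf_exists:
  assumes "p \<in> carrier Fr"
  shows "\<exists>F u. finite F \<and> F \<subseteq> B \<and> (\<forall>b. u b \<in> carrier V) \<and> (\<forall>b. b \<notin> F --> u b = \<zero>\<^bsub>V\<^esub>)
    \<and> p - normal_form F u \<in> U \<and> coords p = (\<lambda>b. \<theta> (u b))"
proof -
  obtain F u where p: "finite F" "F \<subseteq> B" "\<forall>b. u b \<in> carrier V" "\<forall>b. b \<notin> F --> u b = \<zero>\<^bsub>V\<^esub>" "p - normal_form F u \<in> U"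
    using has_nf_all[OF assms] unfolding has_nf_def by (elim exE conjE) (rule that; assumption)
  have "coords p = coords (normal_form F u)"
    using coords_U[OF p(5)] by (simp add: coords_linear fun_eq_iff)
  also have "\<dots> = (\<lambda>b. \<theta> (u b))"
    by (rule coords_normal_form[OF p(1,2)]) (use p(4) in simp)
  finally show ?thesis by (intro exI[of _ F] exI[of _ u] conjI p)
qed

text \<open>The coordinates of a normal form are the functions \<open>\<theta> (u b)\<close>. If
  they vanish, so do all \<open>u b\<close>, and tensors with a zero factor are relations.\<close>

lemma coords_kernel:
  assumes "p \<in> carrier Fr" "coords p = (\<lambda>b j. 0)" shows "p \<in> U"
proof -
  obtain F u where p: "finite F" "F \<subseteq> B" "\<forall>b. u b \<in> carrier V" "p - normal_form F u \<in> U" "coords p = (\<lambda>b. \<theta> (u b))"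
    using nf_exists[OF assms(1)] by (elim exE conjE) (rule that; assumption)
  have z: "u b = \<zero>\<^bsub>V\<^esub>" for b
  proof (rule theta_inj)
    show "u b \<in> carrier V" using p(3) by simp
    show "\<theta> (u b) = (\<lambda>j. 0)" using fun_cong[OF p(5), of b] assms(2) by simp
  qed
  have "normal_form F u \<in> U" unfolding normal_form_def z
    by (rule U_sum, rule U_zero_vec) (use p(2) B in auto)
  from U_D(3)[OF p(4) this] show ?thesis by simp
qed

lemma Fr_minus: "p \<in> carrier Fr ==> q \<in> carrier Fr ==> p \<ominus>\<^bsub>Fr\<^esub> q = p - q"
  using Fr.diff_eq_smult[of p q] by (simp add: Fr_simps cscale_minus_one)

definition finite_coords :: "('m => 'j => complex) set" where
  "finite_coords = {q. finite {b. q b \<noteq> (\<lambda>j. 0)} \<and> (\<forall>b. q b \<in> \<theta> ` carrier V) \<and> (\<forall>b. b \<notin> B --> q b = (\<lambda>j. 0))}"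

lemma coords_image: "coords ` carrier Fr = finite_coords"
proof (intro equalityI subsetI)
  fix q assume "q \<in> coords ` carrier Fr"
  then obtain x where x: "x \<in> carrier Fr" "q = coords x" by auto
  obtain F u where p': "finite F" "F \<subseteq> B" "\<forall>b. u b \<in> carrier V" "\<forall>b. b \<notin> F --> u b = \<zero>\<^bsub>V\<^esub>"
    "coords x = (\<lambda>b. \<theta> (u b))"
    using nf_exists[OF x(1)] by (elim exE conjE) (rule that; assumption)
  note p = p'(1-4) trans[OF x(2) p'(5)]
  have qF: "q b = (\<lambda>j. 0)" if "b \<notin> F" for b using p(4) that theta_zero by (simp add: p(5))
  then have "{b. q b \<noteq> (\<lambda>j. 0)} \<subseteq> F" by blast
  then have "finite {b. q b \<noteq> (\<lambda>j. 0)}" using p(1) by (rule finite_subset)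
  moreover have "q b = (\<lambda>j. 0)" if "b \<notin> B" for b by (rule qF) (use p(2) that in blast)
  moreover have "q b \<in> \<theta> ` carrier V" for b using p(3) by (simp add: p(5))
  ultimately show "q \<in> finite_coords" by (simp add: finite_coords_def)
next
  fix q assume q: "q \<in> finite_coords"
  define F where "F = {b. q b \<noteq> (\<lambda>j. 0)}"
  have F: "finite F" "F \<subseteq> B" using q by (auto simp: F_def finite_coords_def)
  have "\<forall>b. \<exists>x. x \<in> carrier V \<and> \<theta> x = q b"
  proof
    fix b
    have "q b \<in> \<theta> ` carrier V" using q by (simp add: finite_coords_def)
    then obtain x where "q b = \<theta> x" "x \<in> carrier V" by (rule imageE)
    then show "\<exists>x. x \<in> carrier V \<and> \<theta> x = q b" by (intro exI[of _ x]) simp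
  qed
  from choice[OF this] obtain u where "\<forall>b. u b \<in> carrier V \<and> \<theta> (u b) = q b" by (rule exE)
  then have u: "!!b. u b \<in> carrier V" "!!b. \<theta> (u b) = q b" by simp_all
  have z: "u b = \<zero>\<^bsub>V\<^esub>" if "b \<notin> F" for b
    by (rule theta_inj[OF u(1)]) (use that u(2) in \<open>simp add: F_def\<close>)
  have "coords (normal_form F u) = q" using coords_normal_form[OF F z] u(2) by simp
  moreover have "normal_form F u \<in> carrier Fr"
  proof -
    have "keys (normal_form F u) \<subseteq> (\<Union>b\<in>F. keys (basis_vec (u b, b) :: ('v \<times> 'm) \<Rightarrow>\<^sub>0 complex))"
      unfolding normal_form_def by (rule Poly_Mapping.keys_sum)
    also have "\<dots> \<subseteq> carrier V \<times> carrier M"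
    proof (rule UN_least)
      fix b assume "b \<in> F"
      then have "b \<in> carrier M" using F(2) B by (meson subsetD)
      then show "keys (basis_vec (u b, b) :: ('v \<times> 'm) \<Rightarrow>\<^sub>0 complex) \<subseteq> carrier V \<times> carrier M" using u(1) by simp
    qed
    finally show ?thesis by (simp add: Fr_simps)
  qed
  ultimately show "q \<in> coords ` carrier Fr" by blast
qed

text \<open>Operators act on each coefficient of a normal form separately, and injectivity of
  \<open>\<theta>\<close> identifies \<open>v\<close> with the coefficient at
  \<open>b\<close>.\<close>

lemma act_coords:
  assumes g: "g \<in> G" and p: "p \<in> carrier Fr" and v: "v \<in> carrier V" "coords p b = \<theta> v"
  shows "coords (act Fr g p) b = \<theta> (act V g v)"
proof -
  note V' = linear_repD[OF V g]
  have inj: "x = y" if "x \<in> carrier V" "y \<in> carrier V" "\<theta> x = \<theta> y" for x y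
  proof -
    have "\<theta> (x \<ominus>\<^bsub>V\<^esub> y) = (\<lambda>j. 0)" using that by (simp add: V.diff_eq_smult theta_add theta_scale)
    then show ?thesis using theta_inj[of "x \<ominus>\<^bsub>V\<^esub> y"] V.diff_eq_zero_iff that by simp
  qed
  obtain F u where u': "finite F" "F \<subseteq> B" "\<forall>b. u b \<in> carrier V" "\<forall>b. b \<notin> F --> u b = \<zero>\<^bsub>V\<^esub>"
    "p - normal_form F u \<in> U" "coords p = (\<lambda>b. \<theta> (u b))"
    using nf_exists[OF p] by (elim exE conjE) (rule that; assumption)
  note u = u'(1,2) spec[OF u'(3)] mp[OF spec[OF u'(4)]] u'(5,6)
  have uv: "u b = v" by (rule inj[OF u(3) v(1)]) (use u(6) v(2) in \<open>simp add: fun_eq_iff\<close>)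
  have nf: "normal_form F u \<in> carrier Fr"
  proof -
    have "p - (p - normal_form F u) \<in> carrier Fr" by (intro Fr_diff p subsetD[OF U_D(1) u(5)])
    then show ?thesis by simp
  qed
  have anf: "act Fr g (normal_form F' u) = normal_form F' (\<lambda>b. act V g (u b)) \<and> normal_form F' u \<in> carrier Fr"
    if "finite F'" "F' \<subseteq> B" for F'
    using that
  proof (induction F')
    case empty
    have "act Fr g 0 = 0" by (simp add: mult_free_def act_free_rep)
    then show ?case using Fr.zero_closed by (simp add: normal_form_def Fr_simps(2))
  next
    case (insert c F')
    have c: "basis_vec (u c, c) \<in> carrier Fr" by (rule Fr_single[OF u(3)]) (use insert.prems B in auto)
    have IH: "act Fr g (normal_form F' u) = normal_form F' (\<lambda>b. act V g (u b))" "normal_form F' u \<in> carrier Fr"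
      using insert by simp_all
    have e: "normal_form (insert c F') w = basis_vec (w c, c) + normal_form F' w" for w
      using insert.hyps by (simp add: normal_form_def)
    show ?case unfolding e act_Fr_add[OF g c IH(2)] act_Fr_single IH(1)
      using Fr.a_closed[OF c IH(2)] by (simp add: Fr_simps(3))
  qed
  have gz: "act V g \<zero>\<^bsub>V\<^esub> = \<zero>\<^bsub>V\<^esub>" using V'(3)[OF V.zero_closed, of 0] V'(1)[OF V.zero_closed] by simp
  have "act Fr g (p - normal_form F u) \<in> U"
    using stable_U g u(5) unfolding stable_subspace_def by simp
  then have "act Fr g p - normal_form F (\<lambda>b. act V g (u b)) \<in> U"
    by (simp only: act_Fr_diff[OF g p nf] anf[OF u(1,2)])
  from coords_U[OF this] have "coords (act Fr g p) = coords (normal_form F (\<lambda>b. act V g (u b)))"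
    by (simp add: coords_linear fun_eq_iff)
  also have "\<dots> = (\<lambda>b. \<theta> (act V g (u b)))"
    by (rule coords_normal_form[OF u(1,2)]) (simp add: u(4) gz)
  finally show ?thesis by (simp only: uv)
qed

lemma mult_tensor_coordinates:
  obtains h where "bij_betw h (carrier (mult_tensor V M)) finite_coords"
    "!!X Y. X \<in> carrier (mult_tensor V M) ==> Y \<in> carrier (mult_tensor V M) ==>
       X \<oplus>\<^bsub>mult_tensor V M\<^esub> Y \<in> carrier (mult_tensor V M) \<and> h (X \<oplus>\<^bsub>mult_tensor V M\<^esub> Y) = (\<lambda>b j. h X b j + h Y b j)"
    "!!c X. X \<in> carrier (mult_tensor V M) ==>
       c \<odot>\<^bsub>mult_tensor V M\<^esub> X \<in> carrier (mult_tensor V M) \<and> h (c \<odot>\<^bsub>mult_tensor V M\<^esub> X) = (\<lambda>b j. c * h X b j)"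
    "!!g X. g \<in> G ==> X \<in> carrier (mult_tensor V M) ==> act (mult_tensor V M) g X \<in> carrier (mult_tensor V M)"
    "!!g X b v. g \<in> G ==> X \<in> carrier (mult_tensor V M) ==> v \<in> carrier V ==> h X b = \<theta> v ==>
       h (act (mult_tensor V M) g X) b = \<theta> (act V g v)"
proof -
  have T: "mult_tensor V M = quot_rep Fr U" by (simp add: mult_tensor_def)
  have ker: "coords x = coords y \<longleftrightarrow> x \<ominus>\<^bsub>Fr\<^esub> y \<in> U" if "x \<in> carrier Fr" "y \<in> carrier Fr" for x y
  proof
    assume e: "coords x = coords y"
    have "x - y \<in> U" by (rule coords_kernel[OF Fr_diff[OF that]]) (simp add: coords_linear e fun_eq_iff)
    then show "x \<ominus>\<^bsub>Fr\<^esub> y \<in> U" by (simp only: Fr_minus[OF that])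
  next
    assume "x \<ominus>\<^bsub>Fr\<^esub> y \<in> U"
    then have "x - y \<in> U" by (simp only: Fr_minus[OF that])
    from coords_U[OF this] show "coords x = coords y" by (simp add: coords_linear fun_eq_iff)
  qed
  obtain h where h: "!!x. x \<in> carrier Fr ==> h (Q.pr x) = coords x"
    "bij_betw h (carrier (quot_rep Fr U)) (coords ` carrier Fr)"
  proof -
    have "\<exists>h. (\<forall>x\<in>carrier Fr. h (Q.pr x) = coords x) \<and> bij_betw h (carrier (quot_rep Fr U)) (coords ` carrier Fr)"
      by (rule Q.quot_map) (rule ker)
    then show ?thesis by (elim exE conjE) (rule that; simp)
  qed
  show thesis
  proof (rule that[of h])
    show "bij_betw h (carrier (mult_tensor V M)) finite_coords" using h(2) by (simp only: T coords_image)
    fix X assume "X \<in> carrier (mult_tensor V M)"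
    then obtain x where x: "x \<in> carrier Fr" "X = Q.pr x" unfolding T by (rule Q.quot_cases)
    show "c \<odot>\<^bsub>mult_tensor V M\<^esub> X \<in> carrier (mult_tensor V M) \<and> h (c \<odot>\<^bsub>mult_tensor V M\<^esub> X) = (\<lambda>b j. c * h X b j)" for c
      using Fr.smult_in[OF x(1), of c] unfolding T x(2) Q.pr_smult[OF x(1)]
      by (simp add: Q.pr_in h(1) x(1)) (simp add: Fr_simps coords_linear fun_eq_iff)
    show "act (mult_tensor V M) g X \<in> carrier (mult_tensor V M)" if "g \<in> G" for g
      unfolding T x(2) Q.pr_act[OF that x(1)] by (rule Q.pr_in[OF Q.act_in[OF that x(1)]])
    show "h (act (mult_tensor V M) g X) b = \<theta> (act V g v)" if "g \<in> G" "v \<in> carrier V" "h X b = \<theta> v" for g b v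
      unfolding T x(2) Q.pr_act[OF that(1) x(1)] h(1)[OF Q.act_in[OF that(1) x(1)]]
      by (rule act_coords[OF that(1) x(1) that(2)]) (use that(3) in \<open>simp only: x(2) h(1)[OF x(1)]\<close>)
    fix Y assume "Y \<in> carrier (mult_tensor V M)"
    then obtain y where y: "y \<in> carrier Fr" "Y = Q.pr y" unfolding T by (rule Q.quot_cases)
    show "X \<oplus>\<^bsub>mult_tensor V M\<^esub> Y \<in> carrier (mult_tensor V M) \<and> h (X \<oplus>\<^bsub>mult_tensor V M\<^esub> Y) = (\<lambda>b j. h X b j + h Y b j)"
      using Fr.a_closed[OF x(1) y(1)] unfolding T x(2) y(2) Q.pr_add[OF x(1) y(1)]
      by (simp add: Q.pr_in h(1) x(1) y(1)) (simp add: Fr_simps coords_linear fun_eq_iff)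
  qed
qed

end

section \<open>The orbit ring and its multiplicity spaces\<close>

text \<open>A polynomial is only seen through its values on the orbit of \<open>X\<close>, as the function
  \<open>\<sigma> \<mapsto> p (X \<circ> \<sigma>)\<close>; \<open>pol_fun N X d\<close> are the functions given by polynomials of degree \<open>< d\<close>.\<close>

definition mono_fun :: "nat => (nat => complex) => (nat => nat) => (nat => nat) => complex" where
  "mono_fun N X m \<sigma> = (\<Prod>i<N. X (\<sigma> i) ^ m i)"

text \<open>With the strict bound, index \<open>0\<close> gives the zero space, which plays the role
  of the filtration piece of degree \<open>-1\<close>.\<close>

definition exponents :: "nat => nat => (nat => nat) set" where
  "exponents N d = {m. (\<forall>i\<ge>N. m i = 0) \<and> (\<Sum>i<N. m i) < d}"

definition pol_fun :: "nat => (nat => complex) => nat => ((nat => nat) => complex) set" where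
  "pol_fun N X d = {F. \<exists>c. \<forall>\<sigma>\<in>perms N. F \<sigma> = (\<Sum>m\<in>exponents N d. c m * mono_fun N X m \<sigma>)}"

lemma finite_exponents [simp]: "finite (exponents N d)"
proof -
  have "inj_on (\<lambda>m. restrict m {..<N}) (exponents N d)"
  proof (rule inj_onI)
    fix m m' assume m: "m \<in> exponents N d" "m' \<in> exponents N d" "restrict m {..<N} = restrict m' {..<N}"
    show "m = m'"
    proof
      fix i show "m i = m' i"
        using m(1,2) fun_cong[OF m(3), of i] by (cases "i < N") (auto simp: exponents_def)
    qed
  qed
  moreover have "(\<lambda>m. restrict m {..<N}) ` exponents N d \<subseteq> PiE {..<N} (\<lambda>_. {..<d})"
  proof (clarsimp simp: exponents_def)
    fix m :: "nat => nat" and i assume "sum m {..<N} < d" "i < N"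
    moreover have "m i \<le> sum m {..<N}" by (rule member_le_sum) (use \<open>i < N\<close> in auto)
    ultimately show "m i < d" by simp
  qed
  ultimately show ?thesis by (meson finite_PiE finite_imageD finite_lessThan finite_subset)
qed

lemma pol_fun_cong: "F \<in> pol_fun N X d ==> (!!\<sigma>. \<sigma> \<in> perms N ==> F' \<sigma> = F \<sigma>) ==> F' \<in> pol_fun N X d"
  by (auto simp: pol_fun_def)

lemma pol_fun_0: "F \<in> pol_fun N X 0 \<longleftrightarrow> (\<forall>\<sigma>\<in>perms N. F \<sigma> = 0)"
  by (simp add: pol_fun_def exponents_def)

lemma pol_fun_zero: "(\<lambda>\<sigma>. 0) \<in> pol_fun N X d"
  unfolding pol_fun_def by (intro CollectI exI[of _ "\<lambda>_. 0"]) simp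

lemma pol_fun_add: "F \<in> pol_fun N X d ==> F' \<in> pol_fun N X d ==> (\<lambda>\<sigma>. F \<sigma> + F' \<sigma>) \<in> pol_fun N X d"
proof -
  assume "F \<in> pol_fun N X d" "F' \<in> pol_fun N X d"
  then obtain c c' where "\<forall>\<sigma>\<in>perms N. F \<sigma> = (\<Sum>m\<in>exponents N d. c m * mono_fun N X m \<sigma>)"
    "\<forall>\<sigma>\<in>perms N. F' \<sigma> = (\<Sum>m\<in>exponents N d. c' m * mono_fun N X m \<sigma>)" by (auto simp: pol_fun_def)
  then show ?thesis unfolding pol_fun_def
    by (intro CollectI exI[of _ "\<lambda>m. c m + c' m"]) (simp add: sum.distrib distrib_right)
qed

lemma pol_fun_scale: "F \<in> pol_fun N X d ==> (\<lambda>\<sigma>. a * F \<sigma>) \<in> pol_fun N X d"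
proof -
  assume "F \<in> pol_fun N X d"
  then obtain c where "\<forall>\<sigma>\<in>perms N. F \<sigma> = (\<Sum>m\<in>exponents N d. c m * mono_fun N X m \<sigma>)" by (auto simp: pol_fun_def)
  then show ?thesis unfolding pol_fun_def
    by (intro CollectI exI[of _ "\<lambda>m. a * c m"]) (simp add: sum_distrib_left mult.assoc)
qed

lemma pol_fun_diff: "F \<in> pol_fun N X d ==> F' \<in> pol_fun N X d ==> (\<lambda>\<sigma>. F \<sigma> - F' \<sigma>) \<in> pol_fun N X d"
  using pol_fun_add[of F N X d "\<lambda>\<sigma>. (- 1) * F' \<sigma>"] pol_fun_scale[of F' N X d "- 1"] by simp

lemma pol_fun_sum: "(!!i. i \<in> I ==> f i \<in> pol_fun N X d) ==> (\<lambda>\<sigma>. \<Sum>i\<in>I. f i \<sigma>) \<in> pol_fun N X d"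
  by (induction I rule: infinite_finite_induct) (auto simp: pol_fun_zero intro!: pol_fun_add)

lemma mono_fun_in: "m \<in> exponents N d ==> mono_fun N X m \<in> pol_fun N X d"
  unfolding pol_fun_def
  by (intro CollectI exI[of _ "\<lambda>m'. if m' = m then 1 else 0"]) (simp add: if_distrib[of "\<lambda>x. x * _"] cong: if_cong)

lemma pol_fun_mono: "d \<le> e ==> F \<in> pol_fun N X d ==> F \<in> pol_fun N X e"
proof -
  assume de: "d \<le> e" and "F \<in> pol_fun N X d"
  then obtain c where c: "\<forall>\<sigma>\<in>perms N. F \<sigma> = (\<Sum>m\<in>exponents N d. c m * mono_fun N X m \<sigma>)" by (auto simp: pol_fun_def)
  have "exponents N d \<subseteq> exponents N e" using de by (auto simp: exponents_def)
  then have "(\<lambda>\<sigma>. \<Sum>m\<in>exponents N d. c m * mono_fun N X m \<sigma>) \<in> pol_fun N X e"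
    by (intro pol_fun_sum pol_fun_scale mono_fun_in) auto
  then show ?thesis by (rule pol_fun_cong) (use c in auto)
qed

lemma mono_fun_comp:
  assumes "\<tau> \<in> perms N" shows "mono_fun N X m (\<sigma> \<circ> \<tau>) = mono_fun N X (m \<circ> pinv \<tau>) \<sigma>"
  unfolding mono_fun_def
  by (rule prod.reindex_bij_witness[of _ "pinv \<tau>" \<tau>])
     (use assms perms_inv[OF assms] in \<open>auto simp: perms_less_iff\<close>)

lemma pol_fun_comp:
  assumes "\<tau> \<in> perms N" "F \<in> pol_fun N X d" shows "(\<lambda>\<sigma>. F (\<sigma> \<circ> \<tau>)) \<in> pol_fun N X d"
proof -
  obtain c where c: "\<forall>\<sigma>\<in>perms N. F \<sigma> = (\<Sum>m\<in>exponents N d. c m * mono_fun N X m \<sigma>)" using assms by (auto simp: pol_fun_def)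
  have e: "m \<circ> pinv \<tau> \<in> exponents N d" if "m \<in> exponents N d" for m
  proof -
    have "(\<Sum>i<N. m (pinv \<tau> i)) = (\<Sum>i<N. m i)" by (rule sum_perm[OF perms_inv[OF assms(1)]])
    then show ?thesis using that perms_not_less[OF perms_inv[OF assms(1)]] by (auto simp: exponents_def)
  qed
  have "(\<lambda>\<sigma>. \<Sum>m\<in>exponents N d. c m * mono_fun N X (m \<circ> pinv \<tau>) \<sigma>) \<in> pol_fun N X d"
    by (intro pol_fun_sum pol_fun_scale mono_fun_in e)
  then show ?thesis
  proof (rule pol_fun_cong)
    show "F (\<sigma> \<circ> \<tau>) = (\<Sum>m\<in>exponents N d. c m * mono_fun N X (m \<circ> pinv \<tau>) \<sigma>)" if "\<sigma> \<in> perms N" for \<sigma>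
      using bspec[OF c perms_comp[OF that assms(1)]] by (simp only: mono_fun_comp[OF assms(1)])
  qed
qed

definition orbit_fun :: "(nat => complex) => ((nat \<Rightarrow>\<^sub>0 nat) \<Rightarrow>\<^sub>0 complex) => (nat => nat) => complex" where
  "orbit_fun X p \<sigma> = poly_eval p (X \<circ> \<sigma>)"

lemma orbit_fun_lin_ext: "orbit_fun X p \<sigma> = lin_ext p (\<lambda>m. \<Prod>i\<in>keys m. X (\<sigma> i) ^ lookup m i)"
  by (simp add: orbit_fun_def poly_eval_def lin_ext_def)

lemma orbit_fun_linear: "orbit_fun X (p + q) = (\<lambda>\<sigma>. orbit_fun X p \<sigma> + orbit_fun X q \<sigma>)"
  "orbit_fun X (p - q) = (\<lambda>\<sigma>. orbit_fun X p \<sigma> - orbit_fun X q \<sigma>)"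
  "orbit_fun X (cscale c p) = (\<lambda>\<sigma>. c * orbit_fun X p \<sigma>)" "orbit_fun X 0 = (\<lambda>\<sigma>. 0)"
  by (simp_all add: orbit_fun_lin_ext lin_ext_add lin_ext_diff lin_ext_cscale fun_eq_iff)

lemma monomial_mono_fun:
  assumes "keys m \<subseteq> {..<N}"
  shows "(\<Prod>i\<in>keys m. X (\<sigma> i) ^ lookup m i) = mono_fun N X (lookup m) \<sigma>"
  unfolding mono_fun_def
  by (rule prod.mono_neutral_left) (use assms in \<open>auto simp: Poly_Mapping.in_keys_iff\<close>)

lemma lookup_exponents:
  assumes "keys m \<subseteq> {..<N}" "(\<Sum>i\<in>keys m. lookup m i) \<le> d" shows "lookup m \<in> exponents N (Suc d)"
proof -
  have "(\<Sum>i<N. lookup m i) = (\<Sum>i\<in>keys m. lookup m i)"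
    by (rule sum.mono_neutral_right) (use assms(1) in \<open>auto simp: Poly_Mapping.in_keys_iff\<close>)
  moreover have "lookup m i = 0" if "i \<ge> N" for i using assms(1) that by (auto simp: Poly_Mapping.in_keys_iff)
  ultimately show ?thesis using assms(2) by (simp add: exponents_def)
qed

lemma orbit_fun_in_pol_fun:
  assumes "p \<in> polys_of_degree_le N d" shows "orbit_fun X p \<in> pol_fun N X (Suc d)"
proof -
  have k: "keys m \<subseteq> {..<N}" "(\<Sum>i\<in>keys m. lookup m i) \<le> d" if "m \<in> keys p" for m
    using assms that by (auto simp: polys_of_degree_le_def poly_rep_def)
  have "(\<lambda>\<sigma>. \<Sum>m\<in>keys p. lookup p m * mono_fun N X (lookup m) \<sigma>) \<in> pol_fun N X (Suc d)"
    by (intro pol_fun_sum pol_fun_scale mono_fun_in lookup_exponents k)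
  moreover have "orbit_fun X p = (\<lambda>\<sigma>. \<Sum>m\<in>keys p. lookup p m * mono_fun N X (lookup m) \<sigma>)"
    unfolding orbit_fun_lin_ext[abs_def] lin_ext_def using monomial_mono_fun[OF k(1)] by simp
  ultimately show ?thesis by simp
qed

lemma polys_add: "p \<in> polys_of_degree_le N d ==> q \<in> polys_of_degree_le N d ==> p + q \<in> polys_of_degree_le N d"
proof -
  assume "p \<in> polys_of_degree_le N d" "q \<in> polys_of_degree_le N d"
  then show ?thesis using Poly_Mapping.keys_add[of p q] unfolding polys_of_degree_le_def poly_rep_def by fastforce
qed

lemma polys_cscale: "p \<in> polys_of_degree_le N d ==> cscale c p \<in> polys_of_degree_le N d"
  using keys_cscale[of c p] unfolding polys_of_degree_le_def poly_rep_def by fastforce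

lemma polys_zero: "0 \<in> polys_of_degree_le N d"
  by (simp add: polys_of_degree_le_def poly_rep_def)

lemma polys_diff: "p \<in> polys_of_degree_le N d ==> q \<in> polys_of_degree_le N d ==> p - q \<in> polys_of_degree_le N d"
  using polys_add[of p N d "cscale (- 1) q"] polys_cscale[of q N d "- 1"] by (simp add: cscale_minus_one)

text \<open>Turns exponent functions, which vanish from \<open>N\<close> on, into finitely supported
  monomials. It provides the polynomial representatives through which functions on the orbit are
  sent to the quotient ring.\<close>

lemma pol_fun_is_orbit_fun:
  assumes "F \<in> pol_fun N X (Suc d)"
  shows "\<exists>p\<in>polys_of_degree_le N d. \<forall>\<sigma>\<in>perms N. F \<sigma> = orbit_fun X p \<sigma>"
proof -
  obtain c where c: "!!\<sigma>. \<sigma> \<in> perms N ==> F \<sigma> = (\<Sum>m\<in>exponents N (Suc d). c m * mono_fun N X m \<sigma>)"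
    using assms by (auto simp: pol_fun_def)
  define mon where "mon f = Abs_poly_mapping f" for f :: "nat => nat"
  have supp: "{i. f i \<noteq> 0} \<subseteq> {..<N}" if "f \<in> exponents N (Suc d)" for f
  proof
    fix i assume "i \<in> {i. f i \<noteq> 0}"
    then show "i \<in> {..<N}" using that by (cases "i < N") (auto simp: exponents_def)
  qed
  have lk: "lookup (mon f) = f" if "f \<in> exponents N (Suc d)" for f
    using finite_subset[OF supp[OF that]] by (simp add: mon_def)
  have ks: "keys (mon f) \<subseteq> {..<N}" if "f \<in> exponents N (Suc d)" for f
    using supp[OF that] by (simp add: Poly_Mapping.keys.rep_eq lk[OF that])
  have mm: "(\<Prod>i\<in>keys (mon f). X (\<sigma> i) ^ f i) = mono_fun N X f \<sigma>" if "f \<in> exponents N (Suc d)" for f \<sigma>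
    using monomial_mono_fun[OF ks[OF that], of X \<sigma>] by (simp only: lk[OF that])
  define q where "q I = (\<Sum>f\<in>I. Poly_Mapping.single (mon f) (c f))" for I
  have "q I \<in> polys_of_degree_le N d \<and> orbit_fun X (q I) = (\<lambda>\<sigma>. \<Sum>m\<in>I. c m * mono_fun N X m \<sigma>)"
    if "finite I" "I \<subseteq> exponents N (Suc d)" for I
    using that
  proof (induction I)
    case empty then show ?case by (simp add: q_def polys_zero orbit_fun_linear)
  next
    case (insert f I)
    have f: "f \<in> exponents N (Suc d)" using insert by simp
    have "(\<Sum>i\<in>keys (mon f). lookup (mon f) i) = (\<Sum>i<N. f i)"
      unfolding lk[OF f] by (rule sum.mono_neutral_left) (use ks[OF f] in \<open>auto simp: Poly_Mapping.in_keys_iff lk[OF f]\<close>)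
    then have "Poly_Mapping.single (mon f) (c f) \<in> polys_of_degree_le N d"
      using ks[OF f] f by (auto simp: polys_of_degree_le_def poly_rep_def exponents_def)
    moreover have "orbit_fun X (Poly_Mapping.single (mon f) (c f)) = (\<lambda>\<sigma>. c f * mono_fun N X f \<sigma>)"
      by (simp add: orbit_fun_lin_ext fun_eq_iff mm[OF f] lk[OF f])
    moreover have "q (insert f I) = Poly_Mapping.single (mon f) (c f) + q I"
      using insert by (simp add: q_def)
    ultimately show ?case using insert by (simp add: polys_add orbit_fun_linear)
  qed
  from this[OF finite_exponents order_refl] c show ?thesis by (intro bexI[of _ "q (exponents N (Suc d))"]) auto
qed

lemma linear_rep_poly: "linear_rep (perms N) (poly_rep N)"
  unfolding poly_rep_def
proof (rule linear_rep_free)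
  fix \<sigma> m assume s: "\<sigma> \<in> perms N" and m: "m \<in> {m :: nat \<Rightarrow>\<^sub>0 nat. keys m \<subseteq> {..<N}}"
  have "i < N" if "lookup (Poly_Mapping.map_key (pinv \<sigma>) m) i \<noteq> 0" for i
  proof -
    have "lookup m (pinv \<sigma> i) \<noteq> 0" using that perms_inj[OF perms_inv[OF s]] by (simp add: Poly_Mapping.map_key.rep_eq)
    then have "pinv \<sigma> i \<in> keys m" by (simp add: Poly_Mapping.in_keys_iff)
    then have "pinv \<sigma> i < N" using m by blast
    then show ?thesis using perms_less_iff[OF perms_inv[OF s]] by simp
  qed
  then show "keys (basis_vec (Poly_Mapping.map_key (pinv \<sigma>) m)) \<subseteq> {m. keys m \<subseteq> {..<N}}"
    by (auto simp: Poly_Mapping.in_keys_iff)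
qed

lemma lookup_map_key: "\<sigma> \<in> perms N ==> lookup (Poly_Mapping.map_key (pinv \<sigma>) m) = lookup m \<circ> pinv \<sigma>"
  using perms_inj[OF perms_inv, of \<sigma> N] by (simp add: Poly_Mapping.map_key.rep_eq)

lemma keys_map_key_perm:
  assumes "\<sigma> \<in> perms N" "keys m \<subseteq> {..<N}" shows "keys (Poly_Mapping.map_key (pinv \<sigma>) m) \<subseteq> {..<N}"
proof
  fix i assume "i \<in> keys (Poly_Mapping.map_key (pinv \<sigma>) m)"
  then have "pinv \<sigma> i \<in> keys m" by (simp add: Poly_Mapping.in_keys_iff lookup_map_key[OF assms(1)])
  then show "i \<in> {..<N}" using assms perms_less_iff[OF perms_inv[OF assms(1)]] by auto
qed

text \<open>The variable \<open>i\<close> is sent to the variable \<open>\<tau> i\<close>, so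
  evaluating the transformed polynomial at \<open>X \<circ> \<sigma>\<close> reads the coordinate
  \<open>X (\<sigma> (\<tau> i))\<close>: the action is right translation on functions of
  \<open>\<sigma>\<close>.\<close>

lemma orbit_fun_act:
  assumes s: "\<tau> \<in> perms N" and p: "p \<in> carrier (poly_rep N)"
  shows "orbit_fun X (act (poly_rep N) \<tau> p) \<sigma> = orbit_fun X p (\<sigma> \<circ> \<tau>)"
proof -
  have k: "keys m \<subseteq> {..<N}" if "m \<in> keys p" for m using p that by (auto simp: poly_rep_def)
  have "orbit_fun X (act (poly_rep N) \<tau> p) \<sigma> = (\<Sum>m\<in>keys p. lookup p m * mono_fun N X (lookup m \<circ> pinv \<tau>) \<sigma>)"
    unfolding orbit_fun_lin_ext poly_rep_def act_free_rep lin_ext_sum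
  proof (rule sum.cong[OF refl])
    fix m assume m: "m \<in> keys p"
    let ?m = "Poly_Mapping.map_key (pinv \<tau>) m"
    have "(\<Prod>i\<in>keys ?m. X (\<sigma> i) ^ lookup ?m i) = mono_fun N X (lookup m \<circ> pinv \<tau>) \<sigma>"
      using monomial_mono_fun[OF keys_map_key_perm[OF s k[OF m]], of X \<sigma>] by (simp only: lookup_map_key[OF s])
    then show "lin_ext (cscale (lookup p m) (basis_vec ?m)) (\<lambda>m. \<Prod>i\<in>keys m. X (\<sigma> i) ^ lookup m i) =
        lookup p m * mono_fun N X (lookup m \<circ> pinv \<tau>) \<sigma>"
      by (simp only: lin_ext_cscale lin_ext_single mult_1)
  qed
  also have "\<dots> = orbit_fun X p (\<sigma> \<circ> \<tau>)"
    unfolding orbit_fun_lin_ext lin_ext_def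
  proof (rule sum.cong[OF refl])
    fix m assume m: "m \<in> keys p"
    show "lookup p m * mono_fun N X (lookup m \<circ> pinv \<tau>) \<sigma> = lookup p m * (\<Prod>i\<in>keys m. X ((\<sigma> \<circ> \<tau>) i) ^ lookup m i)"
      by (simp only: monomial_mono_fun[OF k[OF m], of X "\<sigma> \<circ> \<tau>"] mono_fun_comp[OF s])
  qed
  finally show ?thesis .
qed

lemma polys_act:
  assumes s: "\<tau> \<in> perms N" and p: "p \<in> polys_of_degree_le N d"
  shows "act (poly_rep N) \<tau> p \<in> polys_of_degree_le N d"
proof -
  have "keys (act (poly_rep N) \<tau> p) \<subseteq> {m. keys m \<subseteq> {..<N} \<and> (\<Sum>i\<in>keys m. lookup m i) \<le> d}"
    unfolding poly_rep_def act_free_rep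
  proof (rule keys_sum_cscale)
    fix m assume "m \<in> keys p"
    then have m: "keys m \<subseteq> {..<N}" "(\<Sum>i\<in>keys m. lookup m i) \<le> d"
      using p by (auto simp: polys_of_degree_le_def poly_rep_def)
    let ?m = "Poly_Mapping.map_key (pinv \<tau>) m"
    have k: "keys ?m \<subseteq> {..<N}" by (rule keys_map_key_perm[OF s m(1)])
    have "(\<Sum>i\<in>keys ?m. lookup ?m i) = (\<Sum>i<N. lookup ?m i)"
      by (rule sum.mono_neutral_left) (use k in \<open>auto simp: Poly_Mapping.in_keys_iff\<close>)
    also have "\<dots> = (\<Sum>i<N. lookup m i)"
      using sum_perm[OF perms_inv[OF s], of "lookup m"] by (simp add: lookup_map_key[OF s])
    also have "\<dots> = (\<Sum>i\<in>keys m. lookup m i)"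
      by (rule sum.mono_neutral_right) (use m(1) in \<open>auto simp: Poly_Mapping.in_keys_iff\<close>)
    finally show "keys (basis_vec ?m) \<subseteq> {m. keys m \<subseteq> {..<N} \<and> (\<Sum>i\<in>keys m. lookup m i) \<le> d}"
      using k m(2) by simp
  qed
  then show ?thesis by (auto simp: polys_of_degree_le_def poly_rep_def)
qed

lemma poly_rep_simps: "zero (poly_rep N) = 0" "add (poly_rep N) = (+)" "module.smult (poly_rep N) = cscale"
  by (simp_all add: poly_rep_def)

section \<open>The graded components of the orbit ring\<close>

locale orbit_ring =
  fixes \<mu> :: "nat list" and a :: "complex list"
begin

abbreviation "N \<equiv> sum_list \<mu>"
abbreviation "X \<equiv> base_point \<mu> a"
abbreviation "PV \<equiv> poly_rep N"
abbreviation "I \<equiv> orbit_ideal \<mu> a"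

sublocale PV: cspace PV by (rule linear_rep_cspace[OF linear_rep_poly])

lemma I_iff: "p \<in> I \<longleftrightarrow> p \<in> carrier PV \<and> orbit_fun X p \<in> pol_fun N X 0"
  by (simp add: orbit_ideal_def pol_fun_0 orbit_fun_def)

lemma stable_I: "stable_subspace (perms N) PV I"
  unfolding stable_subspace_def
proof (intro conjI ballI)
  show "submodule I complex_field PV"
  proof (rule PV.subspaceI)
    show "\<zero>\<^bsub>PV\<^esub> \<in> I" using PV.zero_closed by (simp add: I_iff poly_rep_simps orbit_fun_linear pol_fun_zero)
    show "p \<oplus>\<^bsub>PV\<^esub> q \<in> I" if "p \<in> I" "q \<in> I" for p q
      using that PV.a_closed[of p q] by (simp add: I_iff poly_rep_simps orbit_fun_linear pol_fun_add)
    show "c \<odot>\<^bsub>PV\<^esub> p \<in> I" if "p \<in> I" for c p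
      using that PV.smult_in[of p c] by (simp add: I_iff poly_rep_simps orbit_fun_linear pol_fun_scale)
  qed (auto simp: I_iff)
  fix \<tau> p assume t: "\<tau> \<in> perms N" and p: "p \<in> I"
  then have "orbit_fun X (act PV \<tau> p) = (\<lambda>\<sigma>. orbit_fun X p (\<sigma> \<circ> \<tau>))"
    using orbit_fun_act[OF t] by (auto simp: I_iff)
  then show "act PV \<tau> p \<in> I"
    using p linear_repD(1)[OF linear_rep_poly t] pol_fun_comp[OF t] by (simp add: I_iff)
qed

sublocale Q: stable_quot "perms N" PV I
  by unfold_locales (rule linear_rep_poly, rule stable_I)

abbreviation "AR \<equiv> A_rep \<mu> a"

lemma AR_eq: "AR = quot_rep PV I" by (simp add: A_rep_def)

lemma linear_rep_AR: "linear_rep (perms N) AR"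
  unfolding AR_eq by (rule Q.linear_rep_quot)

sublocale AR: cspace AR by (rule linear_rep_cspace[OF linear_rep_AR])

lemma polys_PV: "p \<in> polys_of_degree_le N d ==> p \<in> carrier PV"
  by (simp add: polys_of_degree_le_def)

lemma A_filtration_eq: "A_filtration \<mu> a d = Q.pr ` polys_of_degree_le N d"
  by (simp add: A_filtration_def)

lemma stable_A_filtration: "stable_subspace (perms N) AR (A_filtration \<mu> a d)"
  unfolding stable_subspace_def
proof (intro conjI ballI)
  show "submodule (A_filtration \<mu> a d) complex_field AR"
  proof (rule AR.subspaceI)
    show "A_filtration \<mu> a d \<subseteq> carrier AR"
      unfolding A_filtration_eq AR_eq using Q.pr_in polys_PV by auto
    have "Q.pr 0 = \<zero>\<^bsub>AR\<^esub>" using Q.pr_zero by (simp add: AR_eq Q.quot_simps poly_rep_simps)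
    then show "\<zero>\<^bsub>AR\<^esub> \<in> A_filtration \<mu> a d" unfolding A_filtration_eq using polys_zero by (metis imageI)
    show "x \<oplus>\<^bsub>AR\<^esub> y \<in> A_filtration \<mu> a d" if "x \<in> A_filtration \<mu> a d" "y \<in> A_filtration \<mu> a d" for x y
      using that unfolding A_filtration_eq AR_eq
      by (auto simp: Q.pr_add polys_PV poly_rep_simps intro!: imageI polys_add)
    show "c \<odot>\<^bsub>AR\<^esub> x \<in> A_filtration \<mu> a d" if "x \<in> A_filtration \<mu> a d" for c x
      using that unfolding A_filtration_eq AR_eq
      by (auto simp: Q.pr_smult polys_PV poly_rep_simps intro!: imageI polys_cscale)
  qed
  fix \<tau> x assume "\<tau> \<in> perms N" "x \<in> A_filtration \<mu> a d"
  then show "act AR \<tau> x \<in> A_filtration \<mu> a d"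
    unfolding A_filtration_eq AR_eq by (auto simp: Q.pr_act polys_PV intro!: imageI polys_act)
qed

definition lower :: "nat => ((nat \<Rightarrow>\<^sub>0 nat) \<Rightarrow>\<^sub>0 complex) set set" where
  "lower d = (case d of 0 => {\<zero>\<^bsub>AR\<^esub>} | Suc e => A_filtration \<mu> a e)"

abbreviation "AF d \<equiv> AR\<lparr>carrier := A_filtration \<mu> a d\<rparr>"

lemma R_eq: "R_graded \<mu> a d = quot_rep (AF d) (lower d)"
  by (simp add: R_graded_def gr_piece_def lower_def)

text \<open>Membership in \<open>I\<close> is vanishing on the orbit. So a class drops in degree
  exactly when \<open>p\<close> agrees on the orbit with a polynomial of smaller degree, or with
  zero if \<open>d = 0\<close>.\<close>

lemma lower_iff:
  assumes "p \<in> polys_of_degree_le N d"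
  shows "Q.pr p \<in> lower d \<longleftrightarrow> orbit_fun X p \<in> pol_fun N X d"
proof (cases d)
  case 0
  have "Q.pr p \<in> lower d \<longleftrightarrow> Q.pr p = Q.pr 0"
    using Q.pr_zero 0 by (simp add: lower_def AR_eq Q.quot_simps poly_rep_simps)
  also have "\<dots> \<longleftrightarrow> p \<ominus>\<^bsub>PV\<^esub> 0 \<in> I"
    by (rule Q.pr_eq_iff[OF polys_PV[OF assms] polys_PV[OF polys_zero]])
  also have "p \<ominus>\<^bsub>PV\<^esub> 0 = p" using PV.diff_eq_smult[OF polys_PV[OF assms], of 0] PV.zero_closed by (simp add: poly_rep_simps cscale_simps)
  finally show ?thesis using 0 polys_PV[OF assms] by (simp add: I_iff)
next
  case (Suc e)
  have mono: "q \<in> carrier PV" if "q \<in> polys_of_degree_le N e" for q using that by (rule polys_PV)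
  have m: "p \<ominus>\<^bsub>PV\<^esub> q = p - q" if "q \<in> polys_of_degree_le N e" for q
    using PV.diff_eq_smult[OF polys_PV[OF assms] mono[OF that]] by (simp add: poly_rep_simps cscale_minus_one)
  have "Q.pr p \<in> lower d \<longleftrightarrow> (\<exists>q\<in>polys_of_degree_le N e. Q.pr p = Q.pr q)"
    by (auto simp: Suc lower_def A_filtration_eq)
  also have "\<dots> \<longleftrightarrow> (\<exists>q\<in>polys_of_degree_le N e. p - q \<in> I)"
    using Q.pr_eq_iff[OF polys_PV[OF assms] mono] m by auto
  also have "\<dots> \<longleftrightarrow> (\<exists>q\<in>polys_of_degree_le N e. \<forall>\<sigma>\<in>perms N. orbit_fun X p \<sigma> = orbit_fun X q \<sigma>)"
  proof -
    have "p - q \<in> I \<longleftrightarrow> (\<forall>\<sigma>\<in>perms N. orbit_fun X p \<sigma> = orbit_fun X q \<sigma>)" if "q \<in> polys_of_degree_le N e" for q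
      using PV.minus_closed[OF polys_PV[OF assms] mono[OF that]] m[OF that] by (simp add: I_iff orbit_fun_linear pol_fun_0)
    then show ?thesis by auto
  qed
  also have "\<dots> \<longleftrightarrow> orbit_fun X p \<in> pol_fun N X d"
    unfolding Suc using pol_fun_is_orbit_fun pol_fun_cong[OF orbit_fun_in_pol_fun] by blast
  finally show ?thesis .
qed

lemma polys_mono: "d \<le> e ==> polys_of_degree_le N d \<subseteq> polys_of_degree_le N e"
  by (auto simp: polys_of_degree_le_def)

lemma stable_lower: "stable_subspace (perms N) (AF d) (lower d)"
proof -
  have st: "stable_subspace (perms N) AR (lower d)"
  proof (cases d)
    case 0
    have "act AR \<tau> \<zero>\<^bsub>AR\<^esub> = \<zero>\<^bsub>AR\<^esub>" if "\<tau> \<in> perms N" for \<tau>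
      using linear_repD(3)[OF linear_rep_AR that AR.zero_closed, of 0] linear_repD(1)[OF linear_rep_AR that AR.zero_closed] by simp
    then show ?thesis unfolding stable_subspace_def lower_def using 0
      by (auto intro!: AR.subspaceI)
  next
    case (Suc e) then show ?thesis using stable_A_filtration by (simp add: lower_def)
  qed
  have sub: "lower d \<subseteq> A_filtration \<mu> a d"
  proof (cases d)
    case 0
    then show ?thesis using AR.subspaceD(2)[OF conjunct1[OF stable_A_filtration[unfolded stable_subspace_def]]] by (simp add: lower_def)
  next
    case (Suc e) then show ?thesis using polys_mono[of e d] by (auto simp: lower_def A_filtration_eq)
  qed
  interpret F: cspace "AF d"
    by (rule linear_rep_cspace[OF linear_rep_restrict[OF linear_rep_AR stable_A_filtration]])
  note D = AR.subspaceD[OF conjunct1[OF st[unfolded stable_subspace_def]]]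
  show ?thesis unfolding stable_subspace_def
    using st sub D by (auto simp: stable_subspace_def intro!: F.subspaceI)
qed

sublocale QR: stable_quot "perms N" "AF d" "lower d" for d
  by unfold_locales (rule linear_rep_restrict[OF linear_rep_AR stable_A_filtration], rule stable_lower)

definition cls :: "nat => ((nat \<Rightarrow>\<^sub>0 nat) \<Rightarrow>\<^sub>0 complex) => ((nat \<Rightarrow>\<^sub>0 nat) \<Rightarrow>\<^sub>0 complex) set set" where
  "cls d p = lower d +>\<^bsub>AF d\<^esub> Q.pr p"

lemma pr_AF: "p \<in> polys_of_degree_le N d ==> Q.pr p \<in> carrier (AF d)"
  by (simp add: A_filtration_eq)

lemma cls_props:
  assumes p: "p \<in> polys_of_degree_le N d"
  shows "cls d p \<in> carrier (R_graded \<mu> a d)"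
    and "q \<in> polys_of_degree_le N d ==> cls d (p + q) = cls d p \<oplus>\<^bsub>R_graded \<mu> a d\<^esub> cls d q"
    and "cls d (cscale c p) = c \<odot>\<^bsub>R_graded \<mu> a d\<^esub> cls d p"
    and "\<tau> \<in> perms N ==> cls d (act PV \<tau> p) = act (R_graded \<mu> a d) \<tau> (cls d p)"
    and "q \<in> polys_of_degree_le N d ==> cls d p = cls d q \<longleftrightarrow> orbit_fun X (p - q) \<in> pol_fun N X d"
proof -
  show "cls d p \<in> carrier (R_graded \<mu> a d)"
    unfolding R_eq cls_def by (rule QR.pr_in[OF pr_AF[OF p]])
  show "cls d (p + q) = cls d p \<oplus>\<^bsub>R_graded \<mu> a d\<^esub> cls d q" if q: "q \<in> polys_of_degree_le N d"
    unfolding R_eq cls_def QR.pr_add[OF pr_AF[OF p] pr_AF[OF q]]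
    using Q.pr_add[OF polys_PV[OF p] polys_PV[OF q]] by (simp add: AR_eq poly_rep_simps)
  show "cls d (cscale c p) = c \<odot>\<^bsub>R_graded \<mu> a d\<^esub> cls d p"
    unfolding R_eq cls_def QR.pr_smult[OF pr_AF[OF p]]
    using Q.pr_smult[OF polys_PV[OF p], of c] by (simp add: AR_eq poly_rep_simps)
  show "cls d (act PV \<tau> p) = act (R_graded \<mu> a d) \<tau> (cls d p)" if t: "\<tau> \<in> perms N"
    unfolding R_eq cls_def QR.pr_act[OF t pr_AF[OF p]]
    using Q.pr_act[OF t polys_PV[OF p]] by (simp add: AR_eq)
  show "cls d p = cls d q \<longleftrightarrow> orbit_fun X (p - q) \<in> pol_fun N X d" if q: "q \<in> polys_of_degree_le N d"
  proof -
    have "Q.pr p \<ominus>\<^bsub>AF d\<^esub> Q.pr q = Q.pr p \<oplus>\<^bsub>AR\<^esub> (- 1) \<odot>\<^bsub>AR\<^esub> Q.pr q"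
      using QR.diff_eq_smult[OF pr_AF[OF p] pr_AF[OF q]] by simp
    also have "\<dots> = Q.pr (p - q)"
      using Q.pr_smult[OF polys_PV[OF q], of "- 1"] Q.pr_add[OF polys_PV[OF p] polys_PV[OF polys_cscale[OF q, of "- 1"]]]
      by (simp add: AR_eq poly_rep_simps cscale_minus_one)
    finally show ?thesis unfolding cls_def QR.pr_eq_iff[OF pr_AF[OF p] pr_AF[OF q]]
      using lower_iff[OF polys_diff[OF p q]] by simp
  qed
qed

lemma cls_surj:
  assumes "x \<in> carrier (R_graded \<mu> a d)" shows "\<exists>p\<in>polys_of_degree_le N d. cls d p = x"
proof -
  obtain y where y: "y \<in> carrier (AF d)" "x = lower d +>\<^bsub>AF d\<^esub> y"
    using assms unfolding R_eq by (rule QR.quot_cases)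
  then show ?thesis by (auto simp: A_filtration_eq cls_def)
qed

end

section \<open>Coordinates for the decomposition into Specht modules\<close>

definition coords_space :: "('j => complex) set => 'm set => ('m => 'j => complex) set" where
  "coords_space S B = {q. finite {b. q b \<noteq> (\<lambda>j. 0)} \<and> (\<forall>b. q b \<in> S) \<and> (\<forall>b. b \<notin> B --> q b = (\<lambda>j. 0))}"

definition is_coords :: "(complex, 'm) module => 'm set => ('m => 'm \<Rightarrow>\<^sub>0 complex) => bool" where
  "is_coords M B crd \<longleftrightarrow> B \<subseteq> carrier M \<and> (\<forall>m\<in>carrier M. keys (crd m) \<subseteq> B)
     \<and> (\<forall>l\<in>carrier M. \<forall>m\<in>carrier M. crd (l \<oplus>\<^bsub>M\<^esub> m) = crd l + crd m)
     \<and> (\<forall>c. \<forall>m\<in>carrier M. crd (c \<odot>\<^bsub>M\<^esub> m) = cscale c (crd m))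
     \<and> (\<forall>b\<in>B. crd b = basis_vec b)
     \<and> (\<forall>H. submodule H complex_field M --> B \<subseteq> H --> carrier M \<subseteq> H)"

lemma exists_is_coords: "module complex_field M ==> \<exists>B crd. is_coords M B crd"
proof -
  assume "module complex_field M"
  then interpret cspace M by (rule cspaceI)
  show ?thesis
  proof (rule exists_coordinates, goal_cases)
    case (1 B crd)
    then show ?thesis unfolding is_coords_def
      by (intro exI[of _ B] exI[of _ crd] conjI ballI allI impI)
  qed
qed

text \<open>The action on \<open>T\<close> is described only for coordinates written as
  \<open>\<theta> v\<close>. Every coordinate has this form, since \<open>h\<close> maps onto
  families with values in the image of \<open>\<theta>\<close>.\<close>

definition mult_iso :: "'g set => ('g, 'v) rep => (complex, 'm) module => ('v => 'j => complex) => 'm set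
    => (('v \<times> 'm \<Rightarrow>\<^sub>0 complex) set => 'm => 'j => complex) => bool" where
  "mult_iso G V M \<theta> B h \<longleftrightarrow> (let T = mult_tensor V M in
     bij_betw h (carrier T) (coords_space (\<theta> ` carrier V) B)
     \<and> (\<forall>X\<in>carrier T. \<forall>Y\<in>carrier T. X \<oplus>\<^bsub>T\<^esub> Y \<in> carrier T \<and> h (X \<oplus>\<^bsub>T\<^esub> Y) = (\<lambda>b j. h X b j + h Y b j))
     \<and> (\<forall>c. \<forall>X\<in>carrier T. c \<odot>\<^bsub>T\<^esub> X \<in> carrier T \<and> h (c \<odot>\<^bsub>T\<^esub> X) = (\<lambda>b j. c * h X b j))
     \<and> (\<forall>g\<in>G. \<forall>X\<in>carrier T. act T g X \<in> carrier T \<and>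
          (\<forall>b. \<forall>v\<in>carrier V. h X b = \<theta> v --> h (act T g X) b = \<theta> (act V g v))))"

lemma exists_mult_iso:
  assumes "linear_rep G V" "module complex_field M" "is_coords M B crd"
    and "!!x y. x \<in> carrier V ==> y \<in> carrier V ==> \<theta> (x \<oplus>\<^bsub>V\<^esub> y) = (\<lambda>j. \<theta> x j + \<theta> y j)"
    and "!!c x. x \<in> carrier V ==> \<theta> (c \<odot>\<^bsub>V\<^esub> x) = (\<lambda>j. c * \<theta> x j)"
    and "!!x. x \<in> carrier V ==> \<theta> x = (\<lambda>j. 0) ==> x = \<zero>\<^bsub>V\<^esub>"
  shows "\<exists>h. mult_iso G V M \<theta> B h"
proof -
  interpret mult_space G V M \<theta> B crd
  proof (rule mult_space.intro)
    note c = assms(3)[unfolded is_coords_def]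
    show "linear_rep G V" "module complex_field M" by (rule assms)+
    show "\<theta> (x \<oplus>\<^bsub>V\<^esub> y) = (\<lambda>j. \<theta> x j + \<theta> y j)" if "x \<in> carrier V" "y \<in> carrier V" for x y by (rule assms(4)[OF that])
    show "\<theta> (c \<odot>\<^bsub>V\<^esub> x) = (\<lambda>j. c * \<theta> x j)" if "x \<in> carrier V" for c x by (rule assms(5)[OF that])
    show "x = \<zero>\<^bsub>V\<^esub>" if "x \<in> carrier V" "\<theta> x = (\<lambda>j. 0)" for x by (rule assms(6)[OF that])
    show "carrier M \<subseteq> H" if "submodule H complex_field M" "B \<subseteq> H" for H using c that by simp
  qed (use assms(3) in \<open>simp_all add: is_coords_def\<close>)
  have "finite_coords = coords_space (\<theta> ` carrier V) B" by (simp add: finite_coords_def coords_space_def)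
  note c = this
  show ?thesis
  proof (rule mult_tensor_coordinates, goal_cases)
    case (1 h)
    then show ?thesis unfolding mult_iso_def Let_def c by (intro exI[of _ h]) simp
  qed
qed

definition mult_family_space :: "nat => (nat list => 'm set) => (nat list => 'm => (nat => nat) => complex) set" where
  "mult_family_space N B = {q. (\<forall>\<nu>\<in>partitions N. q \<nu> \<in> coords_space (specht_fun \<nu>) (B \<nu>)) \<and> (\<forall>\<nu>. \<nu> \<notin> partitions N --> q \<nu> = (\<lambda>b t. 0))}"

text \<open>\<open>\<gamma>\<close> sends a polynomial function on the orbit to the coordinates of
  its class in the degree \<open>d\<close> component, indexed by a partition, a basis vector of its
  multiplicity space and a tabloid. The given decomposition enters the main argument through these
  properties of \<open>\<gamma>\<close>.\<close>

lemma (in orbit_ring) multiplicity_coordinates: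
  assumes M: "graded_multiplicity_spaces N (R_graded \<mu> a) M"
  obtains B crd \<gamma> where
    "!!\<nu>. \<nu> \<in> partitions N ==> is_coords (M \<nu> d) (B \<nu>) (crd \<nu>)"
    "!!F F'. F \<in> pol_fun N X (Suc d) ==> F' \<in> pol_fun N X (Suc d) ==>
       \<gamma> (\<lambda>\<sigma>. F \<sigma> + F' \<sigma>) = (\<lambda>\<nu> b t. \<gamma> F \<nu> b t + \<gamma> F' \<nu> b t)"
    "!!c F. F \<in> pol_fun N X (Suc d) ==> \<gamma> (\<lambda>\<sigma>. c * F \<sigma>) = (\<lambda>\<nu> b t. c * \<gamma> F \<nu> b t)"
    "!!F. F \<in> pol_fun N X (Suc d) ==> \<gamma> F = (\<lambda>\<nu> b t. 0) \<longleftrightarrow> F \<in> pol_fun N X d"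
    "!!\<tau> F \<nu> b t. \<tau> \<in> perms N ==> F \<in> pol_fun N X (Suc d) ==> \<gamma> (\<lambda>\<sigma>. F (\<sigma> \<circ> \<tau>)) \<nu> b t = \<gamma> F \<nu> b (t \<circ> \<tau>)"
    "\<gamma> ` pol_fun N X (Suc d) = mult_family_space N B"
proof -
  define T where "T \<nu> = mult_tensor (specht \<nu>) (M \<nu> d)" for \<nu>
  have modM: "module complex_field (M \<nu> d)" if "\<nu> \<in> partitions N" for \<nu>
    using M that by (simp add: graded_multiplicity_spaces_def)
  have "rep_iso (perms N) (R_graded \<mu> a d) (direct_sum (partitions N) T)"
    using M by (simp add: graded_multiplicity_spaces_def graded_iso_def T_def[abs_def])
  then obtain g where g: "bij_betw g (carrier (R_graded \<mu> a d)) (carrier (direct_sum (partitions N) T))"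
    "\<forall>x\<in>carrier (R_graded \<mu> a d). \<forall>y\<in>carrier (R_graded \<mu> a d).
      g (x \<oplus>\<^bsub>R_graded \<mu> a d\<^esub> y) = g x \<oplus>\<^bsub>direct_sum (partitions N) T\<^esub> g y"
    "\<forall>c. \<forall>x\<in>carrier (R_graded \<mu> a d). g (c \<odot>\<^bsub>R_graded \<mu> a d\<^esub> x) = c \<odot>\<^bsub>direct_sum (partitions N) T\<^esub> g x"
    "\<forall>\<tau>\<in>perms N. \<forall>x\<in>carrier (R_graded \<mu> a d).
      g (act (R_graded \<mu> a d) \<tau> x) = act (direct_sum (partitions N) T) \<tau> (g x)"
    unfolding rep_iso_def by (elim exE conjE) (rule that; assumption)
  have g_bij: "bij_betw g (carrier (R_graded \<mu> a d)) (PiE (partitions N) (\<lambda>\<nu>. carrier (T \<nu>)))"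
    using g(1) by (simp add: direct_sum_def)
  have g_add: "g (x \<oplus>\<^bsub>R_graded \<mu> a d\<^esub> y) = (\<lambda>\<nu>\<in>partitions N. g x \<nu> \<oplus>\<^bsub>T \<nu>\<^esub> g y \<nu>)"
    if "x \<in> carrier (R_graded \<mu> a d)" "y \<in> carrier (R_graded \<mu> a d)" for x y
    using bspec[OF bspec[OF g(2) that(1)] that(2)] by (simp add: direct_sum_def)
  have g_scale: "g (c \<odot>\<^bsub>R_graded \<mu> a d\<^esub> x) = (\<lambda>\<nu>\<in>partitions N. c \<odot>\<^bsub>T \<nu>\<^esub> g x \<nu>)"
    if "x \<in> carrier (R_graded \<mu> a d)" for c x
    using bspec[OF spec[OF g(3), of c] that] by (simp add: direct_sum_def)
  have g_act: "g (act (R_graded \<mu> a d) \<tau> x) = (\<lambda>\<nu>\<in>partitions N. act (T \<nu>) \<tau> (g x \<nu>))"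
    if "\<tau> \<in> perms N" "x \<in> carrier (R_graded \<mu> a d)" for \<tau> x
    using bspec[OF bspec[OF g(4) that(1)] that(2)] by (simp add: direct_sum_def)
  have "\<forall>\<nu>\<in>partitions N. \<exists>Bc. is_coords (M \<nu> d) (fst Bc) (snd Bc)"
    using exists_is_coords[OF modM] by simp
  from bchoice[OF this] obtain Bc where "\<forall>\<nu>\<in>partitions N. is_coords (M \<nu> d) (fst (Bc \<nu>)) (snd (Bc \<nu>))" by (rule exE)
  note Bc = bspec[OF this]
  define B where "B \<nu> = fst (Bc \<nu>)" for \<nu>
  define crd where "crd \<nu> = snd (Bc \<nu>)" for \<nu>
  have crd: "is_coords (M \<nu> d) (B \<nu>) (crd \<nu>)" if "\<nu> \<in> partitions N" for \<nu> using Bc[OF that] by (simp add: B_def crd_def)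
  have sumN: "sum_list \<nu> = N" if "\<nu> \<in> partitions N" for \<nu> using that by (simp add: partitions_def)
  have im: "lookup ` carrier (specht \<nu>) = specht_fun \<nu>" for \<nu>

  proof (intro equalityI subsetI)
    show "u \<in> specht_fun \<nu>" if "u \<in> lookup ` carrier (specht \<nu>)" for u
      using that by (auto simp: carrier_specht)
    show "u \<in> lookup ` carrier (specht \<nu>)" if u: "u \<in> specht_fun \<nu>" for u
    proof -
      obtain p where "p \<in> carrier (specht \<nu>)" "lookup p = u" using specht_fun_eq_lookup[OF u] by (rule bexE)
      then show ?thesis by (rule rev_image_eqI[OF _ sym])
    qed
  qed
  have "\<forall>\<nu>\<in>partitions N. \<exists>h. mult_iso (perms N) (specht \<nu>) (M \<nu> d) lookup (B \<nu>) h"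
  proof
    fix \<nu> assume nu: "\<nu> \<in> partitions N"
    show "\<exists>h. mult_iso (perms N) (specht \<nu>) (M \<nu> d) lookup (B \<nu>) h"
    proof (rule exists_mult_iso[OF _ modM[OF nu] crd[OF nu]])
      show "linear_rep (perms N) (specht \<nu>)" using linear_rep_specht[of \<nu>] sumN[OF nu] by simp
      show "x = \<zero>\<^bsub>specht \<nu>\<^esub>" if "lookup x = (\<lambda>t. 0)" for x
        unfolding specht_simps by (rule poly_mapping_eqI) (simp add: that)
    qed (simp_all add: specht_simps Poly_Mapping.lookup_add fun_eq_iff)
  qed
  from bchoice[OF this] obtain h where "\<forall>\<nu>\<in>partitions N. mult_iso (perms N) (specht \<nu>) (M \<nu> d) lookup (B \<nu>) (h \<nu>)"
    by (rule exE)
  note h = bspec[OF this]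
  have h_bij: "bij_betw (h \<nu>) (carrier (T \<nu>)) (coords_space (specht_fun \<nu>) (B \<nu>))"
    and h_add: "!!x y. x \<in> carrier (T \<nu>) ==> y \<in> carrier (T \<nu>) ==> h \<nu> (x \<oplus>\<^bsub>T \<nu>\<^esub> y) = (\<lambda>b j. h \<nu> x b j + h \<nu> y b j)"
    and h_scale: "!!c x. x \<in> carrier (T \<nu>) ==> h \<nu> (c \<odot>\<^bsub>T \<nu>\<^esub> x) = (\<lambda>b j. c * h \<nu> x b j)"
    and h_act': "!!\<tau> x b v. \<tau> \<in> perms N ==> x \<in> carrier (T \<nu>) ==> v \<in> carrier (specht \<nu>) ==> h \<nu> x b = lookup v ==>
      h \<nu> (act (T \<nu>) \<tau> x) b = lookup (act (specht \<nu>) \<tau> v)"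
 if "\<nu> \<in> partitions N" for \<nu>
    using h[OF that] unfolding mult_iso_def Let_def T_def[symmetric] im by simp_all
  have h_act: "h \<nu> (act (T \<nu>) \<tau> x) b t = h \<nu> x b (t \<circ> \<tau>)"
    if "\<nu> \<in> partitions N" "\<tau> \<in> perms N" "x \<in> carrier (T \<nu>)" for \<nu> \<tau> x b t
  proof -
    have "h \<nu> x b \<in> specht_fun \<nu>" using h_bij[OF that(1)] that(3) by (auto simp: bij_betw_def coords_space_def)
    then obtain v where v: "v \<in> carrier (specht \<nu>)" "lookup v = h \<nu> x b"
      by (rule bexE[OF specht_fun_eq_lookup])
    have "h \<nu> (act (T \<nu>) \<tau> x) b t = lookup (act (tabloid_rep \<nu>) \<tau> v) t"
      using h_act'[OF that v(1), of b] v(2) by (simp add: specht_simps)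
    also have "\<dots> = lookup v (t \<circ> \<tau>)" using act_tabloid_rep[of \<tau> \<nu> v t] that(2) sumN[OF that(1)] by simp
    finally show ?thesis using v(2) by simp
  qed
  \<comment> \<open>The composite of the class map, the given isomorphism \<open>g\<close> and the
    coordinates \<open>h \<nu>\<close> of the tensor products, still defined on polynomials.\<close>
  define \<gamma>0 where "\<gamma>0 p = (\<lambda>\<nu> b t. if \<nu> \<in> partitions N then h \<nu> (g (cls d p) \<nu>) b t else 0)" for p
  have gc: "g x \<nu> \<in> carrier (T \<nu>)" if "x \<in> carrier (R_graded \<mu> a d)" "\<nu> \<in> partitions N" for x \<nu>
    using bij_betwE[OF g_bij] that by (auto simp: PiE_def Pi_def)
  note C = cls_props
  have \<gamma>0_add: "\<gamma>0 (p + q) = (\<lambda>\<nu> b t. \<gamma>0 p \<nu> b t + \<gamma>0 q \<nu> b t)"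
    if "p \<in> polys_of_degree_le N d" "q \<in> polys_of_degree_le N d" for p q
    unfolding \<gamma>0_def C(2)[OF that] g_add[OF C(1)[OF that(1)] C(1)[OF that(2)]]
    by (intro ext) (simp add: h_add[OF _ gc gc] C(1)[OF that(1)] C(1)[OF that(2)])
  have \<gamma>0_scale: "\<gamma>0 (cscale c p) = (\<lambda>\<nu> b t. c * \<gamma>0 p \<nu> b t)" if "p \<in> polys_of_degree_le N d" for c p
    unfolding \<gamma>0_def C(3)[OF that] g_scale[OF C(1)[OF that]]
    by (intro ext) (simp add: h_scale[OF _ gc] C(1)[OF that])
  have \<gamma>0_act: "\<gamma>0 (act PV \<tau> p) \<nu> b t = \<gamma>0 p \<nu> b (t \<circ> \<tau>)" if "p \<in> polys_of_degree_le N d" "\<tau> \<in> perms N" for p \<tau> \<nu> b t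
    unfolding \<gamma>0_def C(4)[OF that] g_act[OF that(2) C(1)[OF that(1)]]
    by (simp add: h_act[OF _ that(2) gc] C(1)[OF that(1)])
  have \<gamma>0_eq: "\<gamma>0 p = \<gamma>0 q \<longleftrightarrow> orbit_fun X (p - q) \<in> pol_fun N X d"
    if p: "p \<in> polys_of_degree_le N d" and q: "q \<in> polys_of_degree_le N d" for p q
  proof -
    have "\<gamma>0 p = \<gamma>0 q \<longleftrightarrow> (\<forall>\<nu>\<in>partitions N. h \<nu> (g (cls d p) \<nu>) = h \<nu> (g (cls d q) \<nu>))"
    proof
      assume e: "\<gamma>0 p = \<gamma>0 q"
      show "\<forall>\<nu>\<in>partitions N. h \<nu> (g (cls d p) \<nu>) = h \<nu> (g (cls d q) \<nu>)"
      proof (intro ballI ext)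
        fix \<nu> b t assume "\<nu> \<in> partitions N"
        then show "h \<nu> (g (cls d p) \<nu>) b t = h \<nu> (g (cls d q) \<nu>) b t"
          using fun_cong[OF fun_cong[OF fun_cong[OF e, of \<nu>], of b], of t] by (simp add: \<gamma>0_def)
      qed
    qed (simp add: \<gamma>0_def cong: if_cong)
    also have "\<dots> \<longleftrightarrow> (\<forall>\<nu>\<in>partitions N. g (cls d p) \<nu> = g (cls d q) \<nu>)"
    proof (rule ball_cong[OF refl])
      fix \<nu> assume nu: "\<nu> \<in> partitions N"
      show "h \<nu> (g (cls d p) \<nu>) = h \<nu> (g (cls d q) \<nu>) \<longleftrightarrow> g (cls d p) \<nu> = g (cls d q) \<nu>"
        by (rule inj_on_eq_iff[OF bij_betw_imp_inj_on[OF h_bij[OF nu]] gc[OF C(1)[OF p] nu] gc[OF C(1)[OF q] nu]])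
    qed
    also have "\<dots> \<longleftrightarrow> g (cls d p) = g (cls d q)"
    proof
      assume e: "\<forall>\<nu>\<in>partitions N. g (cls d p) \<nu> = g (cls d q) \<nu>"
      show "g (cls d p) = g (cls d q)"
        by (rule PiE_ext[OF bij_betw_apply[OF g_bij C(1)[OF p]] bij_betw_apply[OF g_bij C(1)[OF q]]]) (use e in auto)
    qed simp
    also have "\<dots> \<longleftrightarrow> cls d p = cls d q"
      by (rule inj_on_eq_iff[OF bij_betw_imp_inj_on[OF g_bij] C(1)[OF p] C(1)[OF q]])
    also have "\<dots> \<longleftrightarrow> orbit_fun X (p - q) \<in> pol_fun N X d" by (rule C(5)[OF p q])
    finally show ?thesis .
  qed
  have \<gamma>0_im: "\<gamma>0 ` polys_of_degree_le N d = mult_family_space N B"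
  proof (intro equalityI subsetI)
    fix q assume "q \<in> \<gamma>0 ` polys_of_degree_le N d"
    then obtain p where p: "p \<in> polys_of_degree_le N d" "q = \<gamma>0 p" by auto
    have "q \<nu> = h \<nu> (g (cls d p) \<nu>)" if "\<nu> \<in> partitions N" for \<nu> using that p by (simp add: \<gamma>0_def)
    moreover have "h \<nu> (g (cls d p) \<nu>) \<in> coords_space (specht_fun \<nu>) (B \<nu>)" if "\<nu> \<in> partitions N" for \<nu>
      by (rule bij_betw_apply[OF h_bij[OF that] gc[OF C(1)[OF p(1)] that]])
    ultimately show "q \<in> mult_family_space N B" using p(2) by (simp add: mult_family_space_def \<gamma>0_def)
  next
    fix q assume q: "q \<in> mult_family_space N B"
    define x where "x = (\<lambda>\<nu>\<in>partitions N. inv_into (carrier (T \<nu>)) (h \<nu>) (q \<nu>))"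
    have qim: "q \<nu> \<in> h \<nu> ` carrier (T \<nu>)" if "\<nu> \<in> partitions N" for \<nu>
      using q that h_bij[OF that] by (simp add: mult_family_space_def bij_betw_def)
    have "x \<in> PiE (partitions N) (\<lambda>\<nu>. carrier (T \<nu>))"
      using inv_into_into[OF qim] by (simp add: x_def)
    then have "x \<in> g ` carrier (R_graded \<mu> a d)" using g_bij by (simp add: bij_betw_def)
    then obtain y where y: "y \<in> carrier (R_graded \<mu> a d)" "x = g y" by (rule imageE) simp
    obtain p where p: "p \<in> polys_of_degree_le N d" "cls d p = y" using cls_surj[OF y(1)] by blast
    have "\<gamma>0 p = q"
    proof (intro ext)
      fix \<nu> b t
      show "\<gamma>0 p \<nu> b t = q \<nu> b t"
      proof (cases "\<nu> \<in> partitions N")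
        case True
        have "h \<nu> (x \<nu>) = q \<nu>" using f_inv_into_f[OF qim[OF True]] True by (simp add: x_def)
        then show ?thesis using True p y by (simp add: \<gamma>0_def)
      next
        case False then show ?thesis using q by (simp add: \<gamma>0_def mult_family_space_def)
      qed
    qed
    then show "q \<in> \<gamma>0 ` polys_of_degree_le N d" using p(1) by blast
  qed
  \<comment> \<open>A polynomial representing \<open>F\<close> on the orbit. Two choices differ by a
    polynomial vanishing on the orbit, which \<open>\<gamma>0\<close> does not see;
    \<open>key\<close> records that any representative may be used.\<close>
  define lift where "lift F = (SOME p. p \<in> polys_of_degree_le N d \<and> (\<forall>\<sigma>\<in>perms N. F \<sigma> = orbit_fun X p \<sigma>))" for F
  have lift: "lift F \<in> polys_of_degree_le N d" "!!\<sigma>. \<sigma> \<in> perms N ==> F \<sigma> = orbit_fun X (lift F) \<sigma>"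
    if "F \<in> pol_fun N X (Suc d)" for F
  proof -
    have "\<exists>p. p \<in> polys_of_degree_le N d \<and> (\<forall>\<sigma>\<in>perms N. F \<sigma> = orbit_fun X p \<sigma>)"
      using pol_fun_is_orbit_fun[OF that] by (elim bexE) (intro exI conjI; assumption)
    from someI_ex[OF this] have "lift F \<in> polys_of_degree_le N d \<and> (\<forall>\<sigma>\<in>perms N. F \<sigma> = orbit_fun X (lift F) \<sigma>)"
      unfolding lift_def .
    then show "lift F \<in> polys_of_degree_le N d" "!!\<sigma>. \<sigma> \<in> perms N ==> F \<sigma> = orbit_fun X (lift F) \<sigma>"
      by simp_all
  qed
  define \<gamma> where "\<gamma> F = \<gamma>0 (lift F)" for F
  have key: "\<gamma> F = \<gamma>0 p" if "F \<in> pol_fun N X (Suc d)" "p \<in> polys_of_degree_le N d" "!!\<sigma>. \<sigma> \<in> perms N ==> F \<sigma> = orbit_fun X p \<sigma>" for F p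
  proof -
    have "orbit_fun X (lift F - p) \<in> pol_fun N X d"
      by (rule pol_fun_cong[OF pol_fun_zero]) (use lift(2)[OF that(1)] that(3) in \<open>simp add: orbit_fun_linear\<close>)
    then show ?thesis using \<gamma>0_eq[OF lift(1)[OF that(1)] that(2)] by (simp add: \<gamma>_def)
  qed
  show thesis
  proof (rule that[of B crd \<gamma>])
    show "is_coords (M \<nu> d) (B \<nu>) (crd \<nu>)" if "\<nu> \<in> partitions N" for \<nu> by (rule crd[OF that])
    show "\<gamma> (\<lambda>\<sigma>. F \<sigma> + F' \<sigma>) = (\<lambda>\<nu> b t. \<gamma> F \<nu> b t + \<gamma> F' \<nu> b t)"
      if F: "F \<in> pol_fun N X (Suc d)" "F' \<in> pol_fun N X (Suc d)" for F F'
    proof -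
      have "\<gamma> (\<lambda>\<sigma>. F \<sigma> + F' \<sigma>) = \<gamma>0 (lift F + lift F')"
        using lift(2)[OF F(1)] lift(2)[OF F(2)]
        by (intro key pol_fun_add F polys_add lift(1)) (simp add: orbit_fun_linear)
      then show ?thesis using \<gamma>0_add[OF lift(1)[OF F(1)] lift(1)[OF F(2)]] by (simp add: \<gamma>_def)
    qed
    show "\<gamma> (\<lambda>\<sigma>. c * F \<sigma>) = (\<lambda>\<nu> b t. c * \<gamma> F \<nu> b t)" if F: "F \<in> pol_fun N X (Suc d)" for c F
    proof -
      have "\<gamma> (\<lambda>\<sigma>. c * F \<sigma>) = \<gamma>0 (cscale c (lift F))"
        using lift(2)[OF F] by (intro key pol_fun_scale F polys_cscale lift(1)) (simp add: orbit_fun_linear)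
      then show ?thesis using \<gamma>0_scale[OF lift(1)[OF F]] by (simp add: \<gamma>_def)
    qed
    show "\<gamma> F = (\<lambda>\<nu> b t. 0) \<longleftrightarrow> F \<in> pol_fun N X d" if F: "F \<in> pol_fun N X (Suc d)" for F
    proof -
      have "\<gamma>0 0 = (\<lambda>\<nu> b t. 0)" using \<gamma>0_scale[OF polys_zero, of 0] by (simp add: cscale_simps)
      then have "\<gamma> F = (\<lambda>\<nu> b t. 0) \<longleftrightarrow> orbit_fun X (lift F - 0) \<in> pol_fun N X d"
        using \<gamma>0_eq[OF lift(1)[OF F] polys_zero] by (simp add: \<gamma>_def)
      also have "\<dots> \<longleftrightarrow> F \<in> pol_fun N X d"
        using pol_fun_cong[of F N X d "orbit_fun X (lift F)"] pol_fun_cong[of "orbit_fun X (lift F)" N X d F] lift(2)[OF F] by auto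
      finally show ?thesis .
    qed
    show "\<gamma> (\<lambda>\<sigma>. F (\<sigma> \<circ> \<tau>)) \<nu> b t = \<gamma> F \<nu> b (t \<circ> \<tau>)" if t: "\<tau> \<in> perms N" and F: "F \<in> pol_fun N X (Suc d)" for \<tau> F \<nu> b t
    proof -
      have "\<gamma> (\<lambda>\<sigma>. F (\<sigma> \<circ> \<tau>)) = \<gamma>0 (act PV \<tau> (lift F))"
        using lift(2)[OF F] t
        by (intro key pol_fun_comp t F polys_act lift(1)) (auto simp: orbit_fun_act[OF t polys_PV[OF lift(1)[OF F]]])
      then show ?thesis using \<gamma>0_act[OF lift(1)[OF F] t] by (simp add: \<gamma>_def)
    qed
    show "\<gamma> ` pol_fun N X (Suc d) = mult_family_space N B"
    proof (intro equalityI subsetI)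
      fix q assume "q \<in> \<gamma> ` pol_fun N X (Suc d)"
      then obtain F where F: "q = \<gamma> F" "F \<in> pol_fun N X (Suc d)" by (rule imageE)
      then have "q \<in> \<gamma>0 ` polys_of_degree_le N d" using lift(1)[OF F(2)] by (simp add: \<gamma>_def)
      then show "q \<in> mult_family_space N B" by (simp only: \<gamma>0_im)
    next
      fix q assume "q \<in> mult_family_space N B"
      then have "q \<in> \<gamma>0 ` polys_of_degree_le N d" by (simp only: \<gamma>0_im)
      then obtain p where p: "q = \<gamma>0 p" "p \<in> polys_of_degree_le N d" by (rule imageE)
      then have "q = \<gamma> (orbit_fun X p)" using key[OF orbit_fun_in_pol_fun[OF p(2)] p(2) refl] by simp
      then show "q \<in> \<gamma> ` pol_fun N X (Suc d)" using orbit_fun_in_pol_fun[OF p(2), of X] by (rule image_eqI)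
    qed
  qed
qed

section \<open>Tensor products as functions on words\<close>

definition offset :: "nat list => nat => nat" where
  "offset \<mu> j = sum_list (take j \<mu>)"

definition block :: "nat list => nat => (nat => nat) => nat => nat" where
  "block \<mu> j s = (\<lambda>i\<in>{..<\<mu> ! j}. s (offset \<mu> j + i))"

lemma offset_simps [simp]: "offset \<mu> 0 = 0" "offset (k # \<mu>) (Suc j) = k + offset \<mu> j"
  by (simp_all add: offset_def)

lemma offset_less: "j < length \<mu> ==> i < \<mu> ! j ==> offset \<mu> j + i < sum_list \<mu>"
proof (induction \<mu> arbitrary: j)
  case (Cons k \<mu>)
  show ?case
  proof (cases j)
    case 0 then show ?thesis using Cons.prems by simp
  next
    case (Suc j') then show ?thesis using Cons.IH[of j'] Cons.prems by simp
  qed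
qed simp

lemma sum_lessThan_add: "(\<Sum>i<k + S. g i) = (\<Sum>i<k. g i) + (\<Sum>i<S. g (k + i))"
  for g :: "nat => 'b::comm_monoid_add"
  by (induction S) (simp_all add: add.assoc)

lemma sum_blocks: "(\<Sum>i<sum_list \<mu>. g i) = (\<Sum>j<length \<mu>. \<Sum>i<\<mu> ! j. g (offset \<mu> j + i))"
  for g :: "nat => 'b::comm_monoid_add"
proof (induction \<mu> arbitrary: g)
  case (Cons k \<mu>)
  show ?case using Cons[of "\<lambda>i. g (k + i)"]
    by (simp add: sum_lessThan_add sum.lessThan_Suc_shift add.assoc del: sum.lessThan_Suc)
qed simp

lemma blocks_cover: "i < sum_list \<mu> ==> \<exists>j<length \<mu>. \<exists>i'<\<mu> ! j. i = offset \<mu> j + i'"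
proof (induction \<mu> arbitrary: i)
  case (Cons k \<mu>)
  show ?case
  proof (cases "i < k")
    case True then show ?thesis by (intro exI[of _ 0]) simp
  next
    case False
    then have "i - k < sum_list \<mu>" using Cons.prems by simp
    from Cons.IH[OF this] obtain j i' where "j < length \<mu>" "i' < \<mu> ! j" "i - k = offset \<mu> j + i'" by blast
    then show ?thesis using False by (intro exI[of _ "Suc j"]) (simp, intro exI[of _ i'], simp)
  qed
qed simp

lemma blocks_unique:
  "j < length \<mu> ==> i < \<mu> ! j ==> j' < length \<mu> ==> i' < \<mu> ! j' ==>
   offset \<mu> j + i = offset \<mu> j' + i' ==> j = j' \<and> i = i'"
proof (induction \<mu> arbitrary: j j')
  case (Cons k \<mu>)
  show ?case
  proof (cases j)
    case 0
    then show ?thesis using Cons.prems by (cases j') simp_all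
  next
    case (Suc l)
    then show ?thesis using Cons.prems Cons.IH[of l "j' - 1"] by (cases j') simp_all
  qed
qed simp

lemma concat_nth_offset:
  "length xss = length \<mu> ==> (!!j. j < length \<mu> ==> length (xss ! j) = \<mu> ! j) ==> j < length \<mu> ==> i < \<mu> ! j
   ==> concat xss ! (offset \<mu> j + i) = xss ! j ! i"
proof (induction \<mu> arbitrary: xss j)
  case (Cons k \<mu>)
  then obtain x xs where x: "xss = x # xs" by (cases xss) simp_all
  have lx: "length x = k" using Cons.prems(2)[of 0] x by simp
  have lxs: "length (xs ! j) = \<mu> ! j" if "j < length \<mu>" for j using Cons.prems(2)[of "Suc j"] x that by simp
  show ?case
  proof (cases j)
    case 0 then show ?thesis using Cons.prems x lx by (simp add: nth_append)
  next
    case (Suc l)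
    then show ?thesis using Cons.IH[of xs l] Cons.prems(1,3,4) lxs x lx by (simp add: nth_append add.assoc)
  qed
qed simp

lemma base_point_offset:
  "length a = length \<mu> ==> j < length \<mu> ==> i < \<mu> ! j ==> base_point \<mu> a (offset \<mu> j + i) = a ! j"
  unfolding base_point_def by (subst concat_nth_offset) simp_all

lemma block_words:
  assumes "s \<in> words n (sum_list \<mu>)" "j < length \<mu>" shows "block \<mu> j s \<in> words n (\<mu> ! j)"
  using words_less[OF assms(1) offset_less[OF assms(2)]] by (simp add: words_def block_def)

lemma block_upd:
  assumes "j < length \<mu>" "i < \<mu> ! j"
  shows "block \<mu> j (s(offset \<mu> j + i := c)) = (block \<mu> j s)(i := c)"
    and "j' < length \<mu> ==> j' \<noteq> j ==> block \<mu> j' (s(offset \<mu> j + i := c)) = block \<mu> j' s"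
proof -
  show "block \<mu> j (s(offset \<mu> j + i := c)) = (block \<mu> j s)(i := c)"
    using assms by (auto simp: block_def restrict_def fun_eq_iff)
  assume j: "j' < length \<mu>" "j' \<noteq> j"
  have "offset \<mu> j' + i' \<noteq> offset \<mu> j + i" if "i' < \<mu> ! j'" for i'
    using blocks_unique[OF j(1) that assms] j(2) by blast
  then show "block \<mu> j' (s(offset \<mu> j + i := c)) = block \<mu> j' s"
    by (auto simp: block_def restrict_def fun_eq_iff)
qed

lemma glue_blocks:
  assumes "length cs = length \<mu>" "!!j. j < length \<mu> ==> cs ! j \<in> words n (\<mu> ! j)"
  shows "\<exists>s\<in>words n (sum_list \<mu>). \<forall>j<length \<mu>. block \<mu> j s = cs ! j"
proof -
  define xss where "xss = map2 (\<lambda>c k. map c [0..<k]) cs \<mu>"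
  define s where "s = (\<lambda>i\<in>{..<sum_list \<mu>}. concat xss ! i)"
  have nth: "concat xss ! (offset \<mu> j + i) = (cs ! j) i" if "j < length \<mu>" "i < \<mu> ! j" for j i
    using concat_nth_offset[of xss \<mu> j i] assms(1) that by (simp add: xss_def)
  have "block \<mu> j s = cs ! j" if j: "j < length \<mu>" for j
  proof
    fix i
    show "block \<mu> j s i = (cs ! j) i"
      using nth[OF j, of i] offset_less[OF j, of i] assms(2)[OF j]
      by (cases "i < \<mu> ! j") (simp_all add: block_def s_def words_def PiE_def extensional_def)
  qed
  moreover have "s i < n" if il: "i < sum_list \<mu>" for i
  proof -
    obtain j i' where j: "j < length \<mu>" "i' < \<mu> ! j" "i = offset \<mu> j + i'" using blocks_cover[OF il] by blast
    then show ?thesis using nth[OF j(1,2)] words_less[OF assms(2)[OF j(1)] j(2)] il by (simp add: s_def)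
  qed
  then have "s \<in> words n (sum_list \<mu>)" by (simp add: words_def s_def)
  ultimately show ?thesis by blast
qed

text \<open>Choose a maximal set \<open>C\<close> of coordinates admitting dual vectors. A nonzero
  vector vanishing on \<open>C\<close> would have a nonzero coordinate outside \<open>C\<close>, and
  one elimination step would enlarge \<open>C\<close>.\<close>

lemma (in cspace) dual_basis:
  fixes \<theta> :: "'a => 'i => complex"
  assumes I: "finite I"
    and add: "!!x y. x \<in> carrier V ==> y \<in> carrier V ==> \<theta> (x \<oplus> y) = (\<lambda>i. \<theta> x i + \<theta> y i)"
    and scale: "!!c x. x \<in> carrier V ==> \<theta> (c \<odot> x) = (\<lambda>i. c * \<theta> x i)"
    and inj: "!!x. x \<in> carrier V ==> (!!i. i \<in> I ==> \<theta> x i = 0) ==> x = \<zero>"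
  obtains C e where "C \<subseteq> I" "!!c. c \<in> C ==> e c \<in> carrier V"
    "!!c c'. c \<in> C ==> c' \<in> C ==> \<theta> (e c) c' = (if c = c' then 1 else 0)"
    "!!x. x \<in> carrier V ==> (!!c. c \<in> C ==> \<theta> x c = 0) ==> x = \<zero>"
proof -
  define D where "D C \<longleftrightarrow> C \<subseteq> I \<and> (\<exists>e. (\<forall>c\<in>C. e c \<in> carrier V) \<and> (\<forall>c\<in>C. \<forall>c'\<in>C. \<theta> (e c) c' = (if c = c' then 1 else 0)))" for C
  have "finite {C. D C}" by (rule finite_subset[of _ "Pow I"]) (use I in \<open>auto simp: D_def\<close>)
  moreover have "D {}" by (simp add: D_def)
  ultimately have "\<exists>C\<in>{C. D C}. \<forall>C'\<in>{C. D C}. C \<le> C' --> C = C'" by (intro finite_has_maximal) auto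
  then obtain C where C: "D C" and max: "!!C'. D C' ==> C \<subseteq> C' ==> C = C'" by blast
  obtain e where e': "\<forall>c\<in>C. e c \<in> carrier V" "\<forall>c\<in>C. \<forall>c'\<in>C. \<theta> (e c) c' = (if c = c' then 1 else 0)"
    using C unfolding D_def by (elim conjE exE) (rule that)
  note e = bspec[OF e'(1)] bspec[OF bspec[OF e'(2)]]
  have tot: "x = \<zero>" if x: "x \<in> carrier V" "!!c. c \<in> C ==> \<theta> x c = 0" for x
  proof (rule ccontr)
    assume "x \<noteq> \<zero>"
    then obtain i where i: "i \<in> I" "\<theta> x i \<noteq> 0" using inj[OF x(1)] by blast
    have iC: "i \<notin> C" using i x(2) by auto
    define y where "y = inverse (\<theta> x i) \<odot> x"
    have y: "y \<in> carrier V" "\<theta> y i = 1" "!!c. c \<in> C ==> \<theta> y c = 0"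
      using x i by (simp_all add: y_def scale)
    \<comment> \<open>Subtracting a multiple of \<open>y\<close> clears the new coordinate
      \<open>i\<close> of the old dual vectors; their other coordinates survive because
      \<open>y\<close> vanishes on \<open>C\<close>.\<close>
    define e' where "e' c = (if c = i then y else e c \<oplus> (- \<theta> (e c) i) \<odot> y)" for c
    have e'i: "e' i = y" by (simp add: e'_def)
    have e'c: "e' c = e c \<oplus> (- \<theta> (e c) i) \<odot> y" if "c \<in> C" for c using iC that by (auto simp: e'_def)
    have th: "\<theta> (e' c) k = \<theta> (e c) k - \<theta> (e c) i * \<theta> y k" if "c \<in> C" for c k
      using e(1)[OF that] y(1) by (simp add: e'c[OF that] add scale)
    have "\<theta> (e' c) c' = (if c = c' then 1 else 0)" if "c \<in> insert i C" "c' \<in> insert i C" for c c'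
    proof (cases "c = i")
      case True then show ?thesis using y that(2) by (auto simp: e'i)
    next
      case False
      then have c: "c \<in> C" using that by simp
      show ?thesis
      proof (cases "c' = i")
        case True then show ?thesis using th[OF c] y(2) False by simp
      next
        case False
        then have "c' \<in> C" using that by simp
        then show ?thesis using th[OF c] y(3) e(2)[OF c] by simp
      qed
    qed
    moreover have "e' c \<in> carrier V" if "c \<in> insert i C" for c
    proof (cases "c = i")
      case True then show ?thesis using y(1) by (simp add: e'i)
    next
      case False
      then have c: "c \<in> C" using that by simp
      show ?thesis unfolding e'c[OF c] using e(1)[OF c] y(1) by simp
    qed
    moreover have "insert i C \<subseteq> I" using C i(1) by (simp add: D_def)
    ultimately have "D (insert i C)" unfolding D_def by blast
    then have "C = insert i C" by (rule max) blast
    then show False using iC by blast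
  qed
  show thesis
  proof (rule that[of C e])
    show "C \<subseteq> I" using C by (simp add: D_def)
    show "x = \<zero>" if "x \<in> carrier V" "!!c. c \<in> C ==> \<theta> x c = 0" for x by (rule tot[OF that])
  qed (fact e)+
qed

text \<open>Combining the dual vectors gives an element of \<open>H\<close> with the same
  coordinates on \<open>C\<close> as \<open>x\<close>, and these coordinates determine a
  vector.\<close>

lemma (in cspace) dual_basis_spans:
  fixes \<theta> :: "'a => 'i => complex"
  assumes C: "finite C"
    and add: "!!x y. x \<in> carrier V ==> y \<in> carrier V ==> \<theta> (x \<oplus> y) = (\<lambda>i. \<theta> x i + \<theta> y i)"
    and scale: "!!c x. x \<in> carrier V ==> \<theta> (c \<odot> x) = (\<lambda>i. c * \<theta> x i)"
    and inj: "!!x. x \<in> carrier V ==> (!!c. c \<in> C ==> \<theta> x c = 0) ==> x = \<zero>"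
    and e: "!!c c'. c \<in> C ==> c' \<in> C ==> \<theta> (e c) c' = (if c = c' then 1 else 0)"
    and H: "submodule H complex_field V" "!!c. c \<in> C ==> e c \<in> H" and x: "x \<in> carrier V"
  shows "x \<in> H"
proof -
  have HV: "u \<in> carrier V" if "u \<in> H" for u using subspaceD(1)[OF H(1)] that by (rule subsetD)
  have "\<exists>u\<in>H. \<forall>c\<in>C. \<theta> u c = (if c \<in> C' then \<theta> x c else 0)" if "finite C'" "C' \<subseteq> C" for C'
    using that
  proof (induction C')
    case empty
    have "\<theta> \<zero> = (\<lambda>i. 0)" using scale[of \<zero> 0] by simp
    then show ?case using subspaceD(2)[OF H(1)] by (intro bexI[of _ \<zero>]) simp_all
  next
    case (insert k C')
    then obtain u where u: "u \<in> H" "!!c. c \<in> C ==> \<theta> u c = (if c \<in> C' then \<theta> x c else 0)" by auto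
    have k: "k \<in> C" using insert by simp
    let ?u = "u \<oplus> \<theta> x k \<odot> e k"
    have "?u \<in> H" by (intro subspaceD(3)[OF H(1)] subspaceD(4)[OF H(1)] u(1) H(2) k)
    moreover have "\<theta> ?u c = (if c \<in> insert k C' then \<theta> x c else 0)" if "c \<in> C" for c
      using u(2)[OF that] e[OF k that] HV[OF u(1)] HV[OF H(2)[OF k]] insert(2) by (auto simp: add scale)
    ultimately show ?case by blast
  qed
  from this[OF C order_refl] obtain u where u: "u \<in> H" "!!c. c \<in> C ==> \<theta> u c = \<theta> x c" by auto
  have "x \<ominus> u = \<zero>"
  proof (rule inj)
    show "x \<ominus> u \<in> carrier V" using x HV[OF u(1)] by simp
    show "\<theta> (x \<ominus> u) c = 0" if "c \<in> C" for c
      using u(2)[OF that] x HV[OF u(1)] by (simp add: diff_eq_smult add scale)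
  qed
  then have "x = u" using diff_eq_zero_iff[OF x HV[OF u(1)]] by simp
  then show ?thesis using u(1) by simp
qed

text \<open>The element \<open>A \<otimes> f\<close> acting on a tensor power whose factor at place
  \<open>i\<close> is evaluated at \<open>X i\<close>.\<close>

definition loop_act :: "nat => nat => (nat => complex) => complex mat => complex poly => ((nat => nat) => complex)
    => (nat => nat) => complex" where
  "loop_act n N X A f \<psi> s = (\<Sum>i<N. poly f (X i) * (\<Sum>c<n. A $$ (s i, c) * \<psi> (s(i := c))))"

text \<open>Each factor is embedded by \<open>\<theta> j\<close> into functions on words of length
  \<open>\<mu> ! j\<close>. Cutting a word of length \<open>N\<close> into blocks and multiplying
  embeds the tensor product into functions on words, and all places of block \<open>j\<close> carry
  the parameter \<open>a ! j\<close>.\<close>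

locale word_tensor =
  fixes n :: nat and \<mu> :: "nat list" and a :: "complex list"
    and Vs :: "(complex mat \<times> complex poly, 'a) rep list" and \<theta> :: "nat => 'a => (nat => nat) => complex"
  assumes len_a: "length a = length \<mu>" and len_Vs: "length Vs = length \<mu>"
    and lin: "!!j. j < length \<mu> ==> linear_rep (sl n \<times> UNIV) (Vs ! j)"
    and theta_add: "!!j x y. j < length \<mu> ==> x \<in> carrier (Vs ! j) ==> y \<in> carrier (Vs ! j) ==>
       \<theta> j (x \<oplus>\<^bsub>Vs ! j\<^esub> y) = (\<lambda>u. \<theta> j x u + \<theta> j y u)"
    and theta_scale: "!!j c x. j < length \<mu> ==> x \<in> carrier (Vs ! j) ==> \<theta> j (c \<odot>\<^bsub>Vs ! j\<^esub> x) = (\<lambda>u. c * \<theta> j x u)"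
    and theta_inj: "!!j x. j < length \<mu> ==> x \<in> carrier (Vs ! j) ==> (!!u. u \<in> words n (\<mu> ! j) ==> \<theta> j x u = 0) ==> x = \<zero>\<^bsub>Vs ! j\<^esub>"
    and theta_act: "!!j A f x u. j < length \<mu> ==> A \<in> sl n ==> x \<in> carrier (Vs ! j) ==> u \<in> words n (\<mu> ! j) ==>
       \<theta> j (act (Vs ! j) (A, f) x) u = poly f (a ! j) * word_act n (\<mu> ! j) A (\<theta> j x) u"
begin

abbreviation "N \<equiv> sum_list \<mu>"
abbreviation "m \<equiv> length \<mu>"
abbreviation "X \<equiv> base_point \<mu> a"
abbreviation "TF \<equiv> tensor_free Vs"
abbreviation "TN \<equiv> tensor_null Vs"
abbreviation "G \<equiv> sl n \<times> (UNIV :: complex poly set)"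

lemma tuples_iff: "vs \<in> tuples Vs \<longleftrightarrow> length vs = m \<and> (\<forall>j<m. vs ! j \<in> carrier (Vs ! j))"
  by (simp add: tuples_def len_Vs)

lemma tuples_upd: "vs \<in> tuples Vs ==> j < m ==> v \<in> carrier (Vs ! j) ==> vs[j := v] \<in> tuples Vs"
  by (simp add: tuples_iff nth_list_update)

lemma act_Vs: "j < m ==> g \<in> G ==> v \<in> carrier (Vs ! j) ==> act (Vs ! j) g v \<in> carrier (Vs ! j)"
  by (rule linear_repD(1)[OF lin])

lemma TF_simps: "carrier TF = {p. keys p \<subseteq> tuples Vs}" "zero TF = 0" "add TF = (+)" "module.smult TF = cscale"
  by (simp_all add: tensor_free_def)

lemma TF_single: "vs \<in> tuples Vs ==> Poly_Mapping.single vs c \<in> carrier TF"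
  by (simp add: TF_simps)

lemma act_TF_single: "act TF g (Poly_Mapping.single vs c) = (\<Sum>j<m. Poly_Mapping.single (vs[j := act (Vs ! j) g (vs ! j)]) c)"
  by (cases "c = 0") (simp_all add: tensor_free_def act_free_rep len_Vs cscale_simps(7))

lemma linear_rep_TF: "linear_rep G TF"
  unfolding tensor_free_def
proof (rule linear_rep_free)
  fix g vs assume g: "g \<in> G" and vs: "vs \<in> tuples Vs"
  have "keys (\<Sum>j<length Vs. basis_vec (vs[j := act (Vs ! j) g (vs ! j)])) \<subseteq> (\<Union>j\<in>{..<length Vs}. keys (basis_vec (vs[j := act (Vs ! j) g (vs ! j)]) :: 'a list \<Rightarrow>\<^sub>0 complex))"
    by (rule Poly_Mapping.keys_sum)
  also have "\<dots> \<subseteq> tuples Vs"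
  proof (rule UN_least)
    fix j assume "j \<in> {..<length Vs}"
    then have j: "j < m" by (simp add: len_Vs)
    have "vs ! j \<in> carrier (Vs ! j)" using vs j by (simp add: tuples_iff)
    from tuples_upd[OF vs j act_Vs[OF j g this]]
    show "keys (basis_vec (vs[j := act (Vs ! j) g (vs ! j)]) :: 'a list \<Rightarrow>\<^sub>0 complex) \<subseteq> tuples Vs" by simp
  qed
  finally show "keys (\<Sum>j<length Vs. basis_vec (vs[j := act (Vs ! j) g (vs ! j)]) :: 'a list \<Rightarrow>\<^sub>0 complex) \<subseteq> tuples Vs" .
qed

sublocale TF: cspace TF by (rule linear_rep_cspace[OF linear_rep_TF])

lemma TF_diff: "p \<in> carrier TF ==> q \<in> carrier TF ==> p - q \<in> carrier TF"
  using TF.minus_closed[of p q] TF.diff_eq_smult[of p q] by (simp add: TF_simps cscale_minus_one)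

lemma TF_minus: "p \<in> carrier TF ==> q \<in> carrier TF ==> p \<ominus>\<^bsub>TF\<^esub> q = p - q"
  using TF.diff_eq_smult[of p q] by (simp add: TF_simps cscale_minus_one)

lemma act_TF_diff: "g \<in> G ==> p \<in> carrier TF ==> q \<in> carrier TF ==> act TF g (p - q) = act TF g p - act TF g q"
proof -
  assume a: "g \<in> G" "p \<in> carrier TF" "q \<in> carrier TF"
  have "act TF g (cscale (- 1) q) = cscale (- 1) (act TF g q)"
    using linear_repD(3)[OF linear_rep_TF a(1,3)] by (simp add: TF_simps)
  moreover have "cscale (- 1) q \<in> carrier TF" using TF.smult_in[OF a(3)] by (simp add: TF_simps)
  ultimately show ?thesis using linear_repD(2)[OF linear_rep_TF a(1,2), of "cscale (- 1) q"]
    by (simp add: TF_simps(3) cscale_minus_one)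
qed

definition rel_add :: "'a list => nat => 'a => 'a => 'a list \<Rightarrow>\<^sub>0 complex" where
  "rel_add vs j u v = basis_vec (vs[j := u \<oplus>\<^bsub>Vs ! j\<^esub> v]) - basis_vec (vs[j := u]) - basis_vec (vs[j := v])"

definition rel_scale :: "'a list => nat => complex => 'a => 'a list \<Rightarrow>\<^sub>0 complex" where
  "rel_scale vs j c v = basis_vec (vs[j := c \<odot>\<^bsub>Vs ! j\<^esub> v]) - Poly_Mapping.single (vs[j := v]) c"

lemma tensor_relations_eq: "tensor_relations Vs =
     {rel_add vs j u v | vs j u v. vs \<in> tuples Vs \<and> j < m \<and> u \<in> carrier (Vs ! j) \<and> v \<in> carrier (Vs ! j)}
   \<union> {rel_scale vs j c v | vs j c v. vs \<in> tuples Vs \<and> j < m \<and> v \<in> carrier (Vs ! j)}"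
  by (simp only: tensor_relations_def rel_add_def rel_scale_def len_Vs)

lemma Vj: "j < m ==> cspace (Vs ! j)"
  by (rule linear_rep_cspace[OF lin])

lemma Vj_closed: "j < m ==> u \<in> carrier (Vs ! j) ==> v \<in> carrier (Vs ! j) ==> u \<oplus>\<^bsub>Vs ! j\<^esub> v \<in> carrier (Vs ! j)"
  "j < m ==> u \<in> carrier (Vs ! j) ==> c \<odot>\<^bsub>Vs ! j\<^esub> u \<in> carrier (Vs ! j)"
proof -
  assume j: "j < m"
  interpret Vj: cspace "Vs ! j" by (rule Vj[OF j])
  show "u \<in> carrier (Vs ! j) ==> v \<in> carrier (Vs ! j) ==> u \<oplus>\<^bsub>Vs ! j\<^esub> v \<in> carrier (Vs ! j)"
    by (rule Vj.a_closed)
  show "u \<in> carrier (Vs ! j) ==> c \<odot>\<^bsub>Vs ! j\<^esub> u \<in> carrier (Vs ! j)" by (rule Vj.smult_in)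
qed

lemma rel_in_TF:
  "vs \<in> tuples Vs ==> j < m ==> u \<in> carrier (Vs ! j) ==> v \<in> carrier (Vs ! j) ==> rel_add vs j u v \<in> carrier TF"
  "vs \<in> tuples Vs ==> j < m ==> v \<in> carrier (Vs ! j) ==> rel_scale vs j c v \<in> carrier TF"
  unfolding rel_add_def rel_scale_def by (intro TF_diff TF_single tuples_upd Vj_closed; assumption)+

lemma relations_TF: "tensor_relations Vs \<subseteq> carrier TF"
proof
  fix x assume "x \<in> tensor_relations Vs"
  then show "x \<in> carrier TF" unfolding tensor_relations_eq
    by (elim UnE) (clarify, rule rel_in_TF, assumption+)+
qed

lemma TN_rel:
  "vs \<in> tuples Vs ==> j < m ==> u \<in> carrier (Vs ! j) ==> v \<in> carrier (Vs ! j) ==> rel_add vs j u v \<in> TN"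
  "vs \<in> tuples Vs ==> j < m ==> v \<in> carrier (Vs ! j) ==> rel_scale vs j c v \<in> TN"
proof -
  have s: "x \<in> TN" if "x \<in> tensor_relations Vs" for x
    unfolding tensor_null_def using TF.lin_span_superset that by (rule subsetD)
  show "rel_add vs j u v \<in> TN" if "vs \<in> tuples Vs" "j < m" "u \<in> carrier (Vs ! j)" "v \<in> carrier (Vs ! j)"
    by (rule s, unfold tensor_relations_eq, rule UnI1, rule CollectI) (use that in blast)
  show "rel_scale vs j c v \<in> TN" if "vs \<in> tuples Vs" "j < m" "v \<in> carrier (Vs ! j)"
    by (rule s, unfold tensor_relations_eq, rule UnI2, rule CollectI) (use that in blast)
qed

lemma TN_sub: "submodule TN complex_field TF"
  unfolding tensor_null_def by (rule TF.subspace_lin_span[OF relations_TF])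

lemma TN_zero: "0 \<in> TN" using TF.subspaceD(2)[OF TN_sub] by (simp add: TF_simps)
lemma TN_add: "p \<in> TN ==> q \<in> TN ==> p + q \<in> TN" using TF.subspaceD(3)[OF TN_sub, of p q] by (simp add: TF_simps)
lemma TN_scale: "p \<in> TN ==> cscale c p \<in> TN" using TF.subspaceD(4)[OF TN_sub, of p c] by (simp add: TF_simps)
lemma TN_sum: "(!!i. i \<in> I ==> f i \<in> TN) ==> (\<Sum>i\<in>I. f i) \<in> TN"
  by (induction I rule: infinite_finite_induct) (simp_all add: TN_zero TN_add)

text \<open>In the Leibniz sum the term for the slot \<open>j\<close> applies the operator inside
  the relation, while the term for another slot \<open>i\<close> only changes the surrounding tuple.
  Each term is again a relation, which gives stability of \<open>tensor_null\<close>.\<close>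

lemma act_rel:
  assumes g: "g \<in> G" and vs: "vs \<in> tuples Vs" and j: "j < m"
  shows "u \<in> carrier (Vs ! j) ==> v \<in> carrier (Vs ! j) ==> act TF g (rel_add vs j u v) =
    (\<Sum>i<m. if i = j then rel_add vs j (act (Vs ! j) g u) (act (Vs ! j) g v) else rel_add (vs[i := act (Vs ! i) g (vs ! i)]) j u v)"
    and "v \<in> carrier (Vs ! j) ==> act TF g (rel_scale vs j c v) =
    (\<Sum>i<m. if i = j then rel_scale vs j c (act (Vs ! j) g v) else rel_scale (vs[i := act (Vs ! i) g (vs ! i)]) j c v)"
proof -
  have lv: "length vs = m" using vs by (simp add: tuples_iff)
  have upd: "(vs[j := x])[i := act (Vs ! i) g ((vs[j := x]) ! i)] =
     (if i = j then vs[j := act (Vs ! j) g x] else (vs[i := act (Vs ! i) g (vs ! i)])[j := x])" for i x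
    using j lv by (simp add: list_update_swap)
  note V' = linear_repD[OF lin[OF j] g]
  show "act TF g (rel_add vs j u v) =
    (\<Sum>i<m. if i = j then rel_add vs j (act (Vs ! j) g u) (act (Vs ! j) g v) else rel_add (vs[i := act (Vs ! i) g (vs ! i)]) j u v)"
    if uv: "u \<in> carrier (Vs ! j)" "v \<in> carrier (Vs ! j)"
  proof -
    note t = TF_single[OF tuples_upd[OF vs j uv(1)]] TF_single[OF tuples_upd[OF vs j uv(2)]] TF_single[OF tuples_upd[OF vs j Vj_closed(1)[OF j uv]]]
    show ?thesis unfolding rel_add_def act_TF_diff[OF g TF_diff[OF t(3) t(1)] t(2)] act_TF_diff[OF g t(3) t(1)] act_TF_single sum_subtractf[symmetric]
      by (rule sum.cong[OF refl]) (simp add: upd V' uv)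
  qed
  show "act TF g (rel_scale vs j c v) =
    (\<Sum>i<m. if i = j then rel_scale vs j c (act (Vs ! j) g v) else rel_scale (vs[i := act (Vs ! i) g (vs ! i)]) j c v)"
    if v: "v \<in> carrier (Vs ! j)"
  proof -
    note t = TF_single[OF tuples_upd[OF vs j Vj_closed(2)[OF j v]]] TF_single[OF tuples_upd[OF vs j v]]
    show ?thesis unfolding rel_scale_def act_TF_diff[OF g t] act_TF_single sum_subtractf[symmetric]
      by (rule sum.cong[OF refl]) (simp add: upd V' v)
  qed
qed

lemma stable_TN: "stable_subspace G TF TN"
  unfolding tensor_null_def
proof (rule stable_subspace_lin_span[OF linear_rep_TF relations_TF])
  fix g x assume g: "g \<in> G" and x: "x \<in> tensor_relations Vs"
  have vi: "vs[i := act (Vs ! i) g (vs ! i)] \<in> tuples Vs" if "vs \<in> tuples Vs" "i < m" for vs i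
    by (rule tuples_upd[OF that act_Vs[OF that(2) g]]) (use that in \<open>simp add: tuples_iff\<close>)
  from x[unfolded tensor_relations_eq] have "act TF g x \<in> TN"
  proof (elim UnE)
    assume "x \<in> {rel_add vs j u v | vs j u v. vs \<in> tuples Vs \<and> j < m \<and> u \<in> carrier (Vs ! j) \<and> v \<in> carrier (Vs ! j)}"
    then obtain vs j u v where c: "x = rel_add vs j u v" "vs \<in> tuples Vs" "j < m" "u \<in> carrier (Vs ! j)" "v \<in> carrier (Vs ! j)" by blast
    show ?thesis unfolding c(1) act_rel(1)[OF g c(2-5)]
    proof (rule TN_sum)
      fix i assume "i \<in> {..<m}"
      then show "(if i = j then rel_add vs j (act (Vs ! j) g u) (act (Vs ! j) g v) else rel_add (vs[i := act (Vs ! i) g (vs ! i)]) j u v) \<in> TN"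
        using TN_rel(1)[OF c(2,3) act_Vs[OF c(3) g c(4)] act_Vs[OF c(3) g c(5)]] TN_rel(1)[OF vi[OF c(2)] c(3-5)] by simp
    qed
  next
    assume "x \<in> {rel_scale vs j c v | vs j c v. vs \<in> tuples Vs \<and> j < m \<and> v \<in> carrier (Vs ! j)}"
    then obtain vs j d v where c: "x = rel_scale vs j d v" "vs \<in> tuples Vs" "j < m" "v \<in> carrier (Vs ! j)" by blast
    show ?thesis unfolding c(1) act_rel(2)[OF g c(2-4)]
    proof (rule TN_sum)
      fix i assume "i \<in> {..<m}"
      then show "(if i = j then rel_scale vs j d (act (Vs ! j) g v) else rel_scale (vs[i := act (Vs ! i) g (vs ! i)]) j d v) \<in> TN"
        using TN_rel(2)[OF c(2,3) act_Vs[OF c(3) g c(4)]] TN_rel(2)[OF vi[OF c(2)] c(3,4)] by simp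
    qed
  qed
  then show "act TF g x \<in> lin_span TF (tensor_relations Vs)" by (simp add: tensor_null_def)
qed

sublocale Q: stable_quot G TF TN
  by unfold_locales (rule linear_rep_TF, rule stable_TN)

definition pt :: "'a list => (nat => nat) => complex" where
  "pt vs s = (\<Prod>j<m. \<theta> j (vs ! j) (block \<mu> j s))"

lemma pt_upd:
  assumes "length vs = m" "j < m"
  shows "pt (vs[j := v]) s = \<theta> j v (block \<mu> j s) * (\<Prod>i\<in>{..<m} - {j}. \<theta> i (vs ! i) (block \<mu> i s))"
proof -
  have "pt (vs[j := v]) s = \<theta> j ((vs[j := v]) ! j) (block \<mu> j s) * (\<Prod>i\<in>{..<m} - {j}. \<theta> i ((vs[j := v]) ! i) (block \<mu> i s))"
    unfolding pt_def by (rule prod.remove) (use assms in auto)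
  also have "(\<Prod>i\<in>{..<m} - {j}. \<theta> i ((vs[j := v]) ! i) (block \<mu> i s)) = (\<Prod>i\<in>{..<m} - {j}. \<theta> i (vs ! i) (block \<mu> i s))"
    by (rule prod.cong) (use assms in auto)
  finally show ?thesis using assms by simp
qed

definition word_fun :: "('a list \<Rightarrow>\<^sub>0 complex) => (nat => nat) => complex" where
  "word_fun p s = (if s \<in> words n N then lin_ext p (\<lambda>vs. pt vs s) else 0)"

lemma word_fun_linear: "word_fun (p + q) s = word_fun p s + word_fun q s" "word_fun (p - q) s = word_fun p s - word_fun q s"
  "word_fun (cscale c p) s = c * word_fun p s" "word_fun 0 s = 0" "word_fun (sum f I) s = (\<Sum>i\<in>I. word_fun (f i) s)"
  "word_fun (Poly_Mapping.single vs c) s = (if s \<in> words n N then c * pt vs s else 0)"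
  by (simp_all add: word_fun_def lin_ext_add lin_ext_diff lin_ext_cscale lin_ext_sum)

lemma word_fun_rel:
  "vs \<in> tuples Vs ==> j < m ==> u \<in> carrier (Vs ! j) ==> v \<in> carrier (Vs ! j) ==> word_fun (rel_add vs j u v) s = 0"
  "vs \<in> tuples Vs ==> j < m ==> v \<in> carrier (Vs ! j) ==> word_fun (rel_scale vs j c v) s = 0"
  by (simp_all add: rel_add_def rel_scale_def word_fun_linear pt_upd tuples_iff theta_add theta_scale distrib_right mult.assoc)

lemma word_fun_TN: assumes "p \<in> TN" shows "word_fun p s = 0"
proof -
  have "TN \<subseteq> {p \<in> carrier TF. word_fun p s = 0}" unfolding tensor_null_def
  proof (rule TF.lin_span_least)
    show "submodule {p \<in> carrier TF. word_fun p s = 0} complex_field TF"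
    proof (rule TF.subspaceI)
      show "\<zero>\<^bsub>TF\<^esub> \<in> {p \<in> carrier TF. word_fun p s = 0}" using TF.zero_closed by (simp add: TF_simps(2) word_fun_linear)
      show "p \<oplus>\<^bsub>TF\<^esub> q \<in> {p \<in> carrier TF. word_fun p s = 0}"
        if "p \<in> {p \<in> carrier TF. word_fun p s = 0}" "q \<in> {p \<in> carrier TF. word_fun p s = 0}" for p q
        using that TF.a_closed[of p q] by (simp add: TF_simps(3) word_fun_linear)
      show "c \<odot>\<^bsub>TF\<^esub> p \<in> {p \<in> carrier TF. word_fun p s = 0}" if "p \<in> {p \<in> carrier TF. word_fun p s = 0}" for c p
        using that TF.smult_in[of p c] by (simp add: TF_simps(4) word_fun_linear)
    qed simp
    show "tensor_relations Vs \<subseteq> {p \<in> carrier TF. word_fun p s = 0}"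
    proof
      fix x assume x: "x \<in> tensor_relations Vs"
      have "word_fun x s = 0" using x[unfolded tensor_relations_eq]
        by (elim UnE) (clarify, rule word_fun_rel, assumption+)+
      then show "x \<in> {p \<in> carrier TF. word_fun p s = 0}" using subsetD[OF relations_TF x] by simp
    qed
  qed
  then show ?thesis using assms by (auto dest: subsetD)
qed

text \<open>Choose dual bases in all factors. Modulo the relations every element is a combination of
  tensors of basis vectors; evaluating at the word glued from one dual coordinate per block isolates
  each coefficient, so all of them vanish.\<close>

lemma word_fun_kernel:
  assumes p: "p \<in> carrier TF" and z: "!!s. s \<in> words n N ==> word_fun p s = 0"
  shows "p \<in> TN"
proof -
  have "\<exists>C e. C \<subseteq> words n (\<mu> ! j) \<and> (\<forall>c\<in>C. e c \<in> carrier (Vs ! j)) \<and>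
      (\<forall>c\<in>C. \<forall>c'\<in>C. \<theta> j (e c) c' = (if c = c' then 1 else 0)) \<and>
      (\<forall>x\<in>carrier (Vs ! j). (\<forall>c\<in>C. \<theta> j x c = 0) --> x = \<zero>\<^bsub>Vs ! j\<^esub>)" if j: "j < m" for j
  proof -
    interpret Vj: cspace "Vs ! j" by (rule Vj[OF j])
    show ?thesis
    proof (rule Vj.dual_basis[of "words n (\<mu> ! j)" "\<theta> j"])
      fix C and e :: "(nat => nat) => 'a"
      assume "C \<subseteq> words n (\<mu> ! j)" "!!c. c \<in> C ==> e c \<in> carrier (Vs ! j)"
        "!!c c'. c \<in> C ==> c' \<in> C ==> \<theta> j (e c) c' = (if c = c' then 1 else 0)"
        "!!x. x \<in> carrier (Vs ! j) ==> (!!c. c \<in> C ==> \<theta> j x c = 0) ==> x = \<zero>\<^bsub>Vs ! j\<^esub>"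
      then show ?thesis by (intro exI[of _ C] exI[of _ e] conjI ballI impI; simp)
    next
      show "x = \<zero>\<^bsub>Vs ! j\<^esub>" if "x \<in> carrier (Vs ! j)" "!!u. u \<in> words n (\<mu> ! j) ==> \<theta> j x u = 0" for x
        by (rule theta_inj[OF j that])
    qed (simp_all add: theta_add[OF j] theta_scale[OF j])
  qed
  then have "\<forall>j\<in>{..<m}. \<exists>Ce. fst Ce \<subseteq> words n (\<mu> ! j) \<and> (\<forall>c\<in>fst Ce. snd Ce c \<in> carrier (Vs ! j)) \<and>
      (\<forall>c\<in>fst Ce. \<forall>c'\<in>fst Ce. \<theta> j (snd Ce c) c' = (if c = c' then 1 else 0)) \<and>
      (\<forall>x\<in>carrier (Vs ! j). (\<forall>c\<in>fst Ce. \<theta> j x c = 0) --> x = \<zero>\<^bsub>Vs ! j\<^esub>)" by simp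
  from bchoice[OF this] obtain Ce where "\<forall>j\<in>{..<m}. fst (Ce j) \<subseteq> words n (\<mu> ! j) \<and> (\<forall>c\<in>fst (Ce j). snd (Ce j) c \<in> carrier (Vs ! j)) \<and>
      (\<forall>c\<in>fst (Ce j). \<forall>c'\<in>fst (Ce j). \<theta> j (snd (Ce j) c) c' = (if c = c' then 1 else 0)) \<and>
      (\<forall>x\<in>carrier (Vs ! j). (\<forall>c\<in>fst (Ce j). \<theta> j x c = 0) --> x = \<zero>\<^bsub>Vs ! j\<^esub>)" by (rule exE)
  note Ce = bspec[OF this]
  define C where "C j = fst (Ce j)" for j
  define e where "e j = snd (Ce j)" for j
  have C: "C j \<subseteq> words n (\<mu> ! j)"
    and e: "!!c. c \<in> C j ==> e j c \<in> carrier (Vs ! j)"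
    and dual: "!!c c'. c \<in> C j ==> c' \<in> C j ==> \<theta> j (e j c) c' = (if c = c' then 1 else 0)"
    and tot: "!!x. x \<in> carrier (Vs ! j) ==> (!!c. c \<in> C j ==> \<theta> j x c = 0) ==> x = \<zero>\<^bsub>Vs ! j\<^esub>" if "j < m" for j
    using Ce[of j] that by (simp_all add: C_def e_def)
  have spans: "x \<in> H" if j: "j < m" and H: "submodule H complex_field (Vs ! j)" "!!c. c \<in> C j ==> e j c \<in> H"
    and x: "x \<in> carrier (Vs ! j)" for j H x
  proof -
    interpret Vj: cspace "Vs ! j" by (rule Vj[OF j])
    show ?thesis
    proof (rule Vj.dual_basis_spans[of "C j" "\<theta> j" "e j" H])
      show "finite (C j)" by (rule finite_subset[OF C[OF j] finite_words])
      show "u = \<zero>\<^bsub>Vs ! j\<^esub>" if "u \<in> carrier (Vs ! j)" "!!c. c \<in> C j ==> \<theta> j u c = 0" for u by (rule tot[OF j that])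
    qed (simp_all add: theta_add[OF j] theta_scale[OF j] dual[OF j] H x)
  qed
  define CS where "CS = {cs. length cs = m \<and> (\<forall>j<m. cs ! j \<in> C j)}"
  define E where "E cs = map (\<lambda>j. e j (cs ! j)) [0..<m]" for cs
  have fCS: "finite CS"
  proof -
    have "finite (\<Union>j<m. C j)" using finite_subset[OF C finite_words] by simp
    then have "finite {cs. set cs \<subseteq> (\<Union>j<m. C j) \<and> length cs = m}" by (rule finite_lists_length_eq)
    moreover have "CS \<subseteq> {cs. set cs \<subseteq> (\<Union>j<m. C j) \<and> length cs = m}"
      by (fastforce simp: CS_def in_set_conv_nth)
    ultimately show ?thesis by (rule rev_finite_subset)
  qed
  have E: "E cs \<in> tuples Vs" if "cs \<in> CS" for cs using that e by (simp add: CS_def E_def tuples_iff)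
  define comb :: "((nat => nat) list => complex) => 'a list \<Rightarrow>\<^sub>0 complex" where "comb \<alpha> = (\<Sum>cs\<in>CS. Poly_Mapping.single (E cs) (\<alpha> cs))" for \<alpha>
  define nf where "nf p \<longleftrightarrow> (\<exists>\<alpha>. p - comb \<alpha> \<in> TN)" for p
  have nf_cong: "nf p" if pq: "p - q \<in> TN" and q: "nf q" for p q
  proof -
    obtain \<alpha> where "q - comb \<alpha> \<in> TN" using q by (auto simp: nf_def)
    from TN_add[OF pq this] show ?thesis unfolding nf_def by (intro exI[of _ \<alpha>]) simp
  qed
  have nf_zero: "nf 0" unfolding nf_def by (intro exI[of _ "\<lambda>_. 0"]) (simp add: comb_def TN_zero)
  have nf_add: "nf (p + q)" if pq: "nf p" "nf q" for p q
  proof -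
    obtain \<alpha> \<beta> where ab: "p - comb \<alpha> \<in> TN" "q - comb \<beta> \<in> TN" using pq by (auto simp: nf_def)
    have "comb (\<lambda>cs. \<alpha> cs + \<beta> cs) = comb \<alpha> + comb \<beta>"
      by (simp add: comb_def Poly_Mapping.single_add sum.distrib)
    then have "p + q - comb (\<lambda>cs. \<alpha> cs + \<beta> cs) = (p - comb \<alpha>) + (q - comb \<beta>)" by simp
    then show ?thesis unfolding nf_def using TN_add[OF ab] by (intro exI[of _ "\<lambda>cs. \<alpha> cs + \<beta> cs"]) (simp only:)
  qed
  have nf_scale: "nf (cscale c p)" if np: "nf p" for c p
  proof -
    obtain \<alpha> where al: "p - comb \<alpha> \<in> TN" using np by (auto simp: nf_def)
    have "comb (\<lambda>cs. c * \<alpha> cs) = cscale c (comb \<alpha>)" by (simp add: comb_def cscale_simps)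
    moreover have "cscale c (p - comb \<alpha>) = cscale c p - cscale c (comb \<alpha>)"
      by (rule poly_mapping_eqI) (simp add: Poly_Mapping.lookup_minus right_diff_distrib)
    ultimately show ?thesis unfolding nf_def using TN_scale[OF al, of c] by (intro exI[of _ "\<lambda>cs. c * \<alpha> cs"]) simp
  qed
  \<comment> \<open>Slots from \<open>k\<close> on already contain dual basis vectors; the induction
    expands the slots before \<open>k\<close> one at a time, starting with the last.\<close>
  have nf_basis: "nf (basis_vec vs)" if "k \<le> m" "vs \<in> tuples Vs" "!!j. k \<le> j ==> j < m ==> vs ! j \<in> e j ` C j" for k vs
    using that
  proof (induction k arbitrary: vs)
    case 0
    have "\<forall>j<m. \<exists>c. c \<in> C j \<and> vs ! j = e j c" using 0 by auto
    then have "\<forall>j. \<exists>c. j < m --> c \<in> C j \<and> vs ! j = e j c" by blast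
    from choice[OF this] obtain f where "\<forall>j. j < m --> f j \<in> C j \<and> vs ! j = e j (f j)" by (rule exE)
    then have f: "!!j. j < m ==> f j \<in> C j" "!!j. j < m ==> vs ! j = e j (f j)" by simp_all
    define cs where "cs = map f [0..<m]"
    have cs: "cs \<in> CS" using f(1) by (simp add: cs_def CS_def)
    have "E cs = vs" using 0(2) f(2) by (intro nth_equalityI) (simp_all add: E_def cs_def tuples_iff)
    moreover have "comb (\<lambda>ds. if ds = cs then 1 else 0) = basis_vec (E cs)"
    proof -
      have "comb (\<lambda>ds. if ds = cs then 1 else 0) = (\<Sum>ds\<in>CS. if ds = cs then basis_vec (E cs) else 0)"
        unfolding comb_def by (rule sum.cong[OF refl]) simp
      then show ?thesis using cs fCS by simp
    qed
    ultimately show ?case unfolding nf_def by (intro exI[of _ "\<lambda>ds. if ds = cs then 1 else 0"]) (simp add: TN_zero)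
  next
    case (Suc k)
    have k: "k < m" using Suc.prems(1) by simp
    note lv = Suc.prems(2)[unfolded tuples_iff]
    interpret Vk: cspace "Vs ! k" by (rule Vj[OF k])
    let ?H = "{u \<in> carrier (Vs ! k). nf (basis_vec (vs[k := u]))}"
    have "vs ! k \<in> ?H"
    proof (rule spans[OF k])
      show "submodule ?H complex_field (Vs ! k)"
      proof (rule Vk.subspaceI)
        show "\<zero>\<^bsub>Vs ! k\<^esub> \<in> ?H"
          using nf_cong[OF TN_rel(2)[OF Suc.prems(2) k Vk.zero_closed, of 0, unfolded rel_scale_def]] nf_zero by simp
        show "u \<oplus>\<^bsub>Vs ! k\<^esub> v \<in> ?H" if "u \<in> ?H" "v \<in> ?H" for u v
        proof -
          have uv: "u \<in> carrier (Vs ! k)" "v \<in> carrier (Vs ! k)" "nf (basis_vec (vs[k := u]))" "nf (basis_vec (vs[k := v]))"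
            using that by simp_all
          have "nf (basis_vec (vs[k := u \<oplus>\<^bsub>Vs ! k\<^esub> v]))"
            by (rule nf_cong[OF _ nf_add[OF uv(3,4)]])
               (use TN_rel(1)[OF Suc.prems(2) k uv(1,2)] in \<open>simp add: rel_add_def diff_diff_eq\<close>)
          then show ?thesis using Vk.a_closed[OF uv(1,2)] by simp
        qed
        show "c \<odot>\<^bsub>Vs ! k\<^esub> u \<in> ?H" if "u \<in> ?H" for c u
        proof -
          have u: "u \<in> carrier (Vs ! k)" "nf (basis_vec (vs[k := u]))" using that by simp_all
          have "nf (basis_vec (vs[k := c \<odot>\<^bsub>Vs ! k\<^esub> u]))"
            by (rule nf_cong[OF _ nf_scale[OF u(2), of c]])
               (use TN_rel(2)[OF Suc.prems(2) k u(1), of c] in \<open>simp add: rel_scale_def\<close>)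
          then show ?thesis using Vk.smult_in[OF u(1)] by simp
        qed
      qed simp
      show "e k c \<in> ?H" if c: "c \<in> C k" for c
      proof -
        have "nf (basis_vec (vs[k := e k c]))"
        proof (rule Suc.IH)
          show "vs[k := e k c] \<in> tuples Vs" by (rule tuples_upd[OF Suc.prems(2) k e[OF k c]])
          show "(vs[k := e k c]) ! j \<in> e j ` C j" if "k \<le> j" "j < m" for j
            using that Suc.prems(3)[of j] c lv by (cases "j = k") simp_all
        qed (use k in simp)
        then show ?thesis using e[OF k c] by simp
      qed
      show "vs ! k \<in> carrier (Vs ! k)" using lv k by simp
    qed
    then show ?case by simp
  qed
  have "keys p \<subseteq> tuples Vs" using p by (simp add: TF_simps)
  then have "nf p"
  proof (induction p rule: free_induct)
    case (single vs c)
    have "nf (basis_vec vs)" by (rule nf_basis[of m vs]) (use single in simp_all)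
    from nf_scale[OF this, of c] show ?case by simp
  qed (simp_all add: nf_zero nf_add)
  then obtain \<alpha> where al: "p - comb \<alpha> \<in> TN" by (auto simp: nf_def)
  \<comment> \<open>At the glued word \<open>s\<close> the product of dual coordinates is
    \<open>1\<close> for \<open>cs\<close> itself and \<open>0\<close> for every other
    index.\<close>
  have "\<alpha> cs = 0" if cs: "cs \<in> CS" for cs
  proof -
    have "\<exists>s\<in>words n N. \<forall>j<m. block \<mu> j s = cs ! j"
      by (rule glue_blocks) (use cs C in \<open>auto simp: CS_def dest: subsetD\<close>)
    then obtain s where s: "s \<in> words n N" "!!j. j < m ==> block \<mu> j s = cs ! j" by blast
    have ptE: "pt (E ds) s = (if ds = cs then 1 else 0)" if ds: "ds \<in> CS" for ds
    proof -
      have "pt (E ds) s = (\<Prod>j<m. if ds ! j = cs ! j then 1 else 0)"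
        unfolding pt_def by (rule prod.cong[OF refl]) (use cs ds s(2) dual in \<open>simp add: E_def CS_def\<close>)
      also have "\<dots> = (if ds = cs then 1 else 0)"
      proof (cases "ds = cs")
        case False
        then obtain j where "j < m" "ds ! j \<noteq> cs ! j" using cs ds by (auto simp: CS_def list_eq_iff_nth_eq)
        then show ?thesis using False by (auto intro!: prod_zero)
      qed simp
      finally show ?thesis .
    qed
    have "word_fun (comb \<alpha>) s = (\<Sum>ds\<in>CS. if ds = cs then \<alpha> cs else 0)"
      unfolding comb_def word_fun_linear(5) by (rule sum.cong[OF refl]) (simp add: word_fun_linear s(1) ptE)
    also have "\<dots> = \<alpha> cs" using cs fCS by simp
    finally show ?thesis using word_fun_TN[OF al, of s] z[OF s(1)] by (simp add: word_fun_linear)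
  qed
  then have "comb \<alpha> = 0" by (simp add: comb_def)
  then show ?thesis using al by simp
qed

text \<open>The Leibniz sum over slots and the sum over places inside each block together form the
  sum over all places, with the block's evaluation scalar equal to \<open>poly f (X i)\<close> at
  each of them.\<close>

lemma word_fun_act:
  assumes A: "A \<in> sl n" and s: "s \<in> words n N" and p: "p \<in> carrier TF"
  shows "word_fun (act TF (A, f) p) s = loop_act n N X A f (word_fun p) s"
proof -
  have g: "(A, f) \<in> G" using A by simp
  have "keys p \<subseteq> tuples Vs" using p by (simp add: TF_simps)
  then show ?thesis
  proof (induction p rule: free_induct)
    case zero
    have "act TF (A, f) 0 = 0" by (simp add: tensor_free_def act_free_rep)
    then show ?case by (simp add: word_fun_linear loop_act_def)
  next
    case (add p q)
    have "act TF (A, f) (p + q) = act TF (A, f) p + act TF (A, f) q"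
      using linear_repD(2)[OF linear_rep_TF g, of p q] add.hyps by (simp add: TF_simps)
    then show ?case using add.IH by (simp add: word_fun_linear loop_act_def distrib_left sum.distrib)
  next
    case (single vs c)
    have lv: "length vs = m" "!!j. j < m ==> vs ! j \<in> carrier (Vs ! j)" using single by (simp_all add: tuples_iff)
    have up: "s(i := b) \<in> words n N" if "i < N" "b < n" for i b by (rule words_upd[OF s that])
    have "word_fun (act TF (A, f) (Poly_Mapping.single vs c)) s = (\<Sum>j<m. c * pt (vs[j := act (Vs ! j) (A, f) (vs ! j)]) s)"
      using s by (simp add: act_TF_single word_fun_linear)
    also have "\<dots> = (\<Sum>j<m. \<Sum>i<\<mu> ! j. poly f (X (offset \<mu> j + i)) *
        (\<Sum>b<n. A $$ (s (offset \<mu> j + i), b) * word_fun (Poly_Mapping.single vs c) (s(offset \<mu> j + i := b))))"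
    proof (rule sum.cong[OF refl])
      fix j assume "j \<in> {..<m}"
      then have j: "j < m" by simp
      let ?P = "\<Prod>i\<in>{..<m} - {j}. \<theta> i (vs ! i) (block \<mu> i s)"
      have bl: "block \<mu> j s i = s (offset \<mu> j + i)" if "i < \<mu> ! j" for i using that by (simp add: block_def)
      have ptu: "pt vs (s(offset \<mu> j + i := b)) = \<theta> j (vs ! j) ((block \<mu> j s)(i := b)) * ?P" if i: "i < \<mu> ! j" for i b
      proof -
        have "pt vs (s(offset \<mu> j + i := b)) = pt (vs[j := vs ! j]) (s(offset \<mu> j + i := b))" by simp
        also have "\<dots> = \<theta> j (vs ! j) (block \<mu> j (s(offset \<mu> j + i := b))) * (\<Prod>k\<in>{..<m} - {j}. \<theta> k (vs ! k) (block \<mu> k (s(offset \<mu> j + i := b))))"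
          by (rule pt_upd[OF lv(1) j])
        also have "(\<Prod>k\<in>{..<m} - {j}. \<theta> k (vs ! k) (block \<mu> k (s(offset \<mu> j + i := b)))) = ?P"
          by (rule prod.cong[OF refl]) (simp add: block_upd(2)[OF j i])
        finally show ?thesis by (simp only: block_upd(1)[OF j i])
      qed
      have "c * pt (vs[j := act (Vs ! j) (A, f) (vs ! j)]) s = c * (poly f (a ! j) * word_act n (\<mu> ! j) A (\<theta> j (vs ! j)) (block \<mu> j s) * ?P)"
        by (simp add: pt_upd[OF lv(1) j] theta_act[OF j A lv(2)[OF j] block_words[OF s j]])
      also have "\<dots> = (\<Sum>i<\<mu> ! j. poly f (a ! j) * (\<Sum>b<n. A $$ (s (offset \<mu> j + i), b) * (c * (\<theta> j (vs ! j) ((block \<mu> j s)(i := b)) * ?P))))"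
        unfolding word_act_def sum_distrib_left sum_distrib_right
        by (rule sum.cong[OF refl], rule sum.cong[OF refl]) (simp add: bl mult_ac)
      also have "\<dots> = (\<Sum>i<\<mu> ! j. poly f (X (offset \<mu> j + i)) *
        (\<Sum>b<n. A $$ (s (offset \<mu> j + i), b) * word_fun (Poly_Mapping.single vs c) (s(offset \<mu> j + i := b))))"
      proof (rule sum.cong[OF refl])
        fix i assume "i \<in> {..<\<mu> ! j}"
        then have i: "i < \<mu> ! j" by simp
        show "poly f (a ! j) * (\<Sum>b<n. A $$ (s (offset \<mu> j + i), b) * (c * (\<theta> j (vs ! j) ((block \<mu> j s)(i := b)) * ?P))) =
          poly f (X (offset \<mu> j + i)) * (\<Sum>b<n. A $$ (s (offset \<mu> j + i), b) * word_fun (Poly_Mapping.single vs c) (s(offset \<mu> j + i := b)))"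
          unfolding base_point_offset[OF len_a j i]
          by (rule arg_cong[where f = "\<lambda>x. _ * x"], rule sum.cong[OF refl])
             (simp add: word_fun_linear up[OF offset_less[OF j i]] ptu[OF i])
      qed
      finally show "c * pt (vs[j := act (Vs ! j) (A, f) (vs ! j)]) s = \<dots>" .
    qed
    also have "\<dots> = loop_act n N X A f (word_fun (Poly_Mapping.single vs c)) s"
      unfolding loop_act_def by (rule sum_blocks[symmetric])
    finally show ?case .
  qed
qed

lemma tensor_coordinates:
  obtains T where "linear_rep G (tensor_list Vs)"
    "!!x y. x \<in> carrier (tensor_list Vs) ==> y \<in> carrier (tensor_list Vs) ==> T x = T y ==> x = y"
    "!!x y s. x \<in> carrier (tensor_list Vs) ==> y \<in> carrier (tensor_list Vs) ==> T (x \<oplus>\<^bsub>tensor_list Vs\<^esub> y) s = T x s + T y s"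
    "!!c x s. x \<in> carrier (tensor_list Vs) ==> T (c \<odot>\<^bsub>tensor_list Vs\<^esub> x) s = c * T x s"
    "!!A f x s. A \<in> sl n ==> x \<in> carrier (tensor_list Vs) ==> s \<in> words n N ==>
       T (act (tensor_list Vs) (A, f) x) s = loop_act n N X A f (T x) s"
    "!!x s. x \<in> carrier (tensor_list Vs) ==> s \<notin> words n N ==> T x s = 0"
    "!!vs. vs \<in> tuples Vs ==> pure_tensor Vs vs \<in> carrier (tensor_list Vs)"
    "!!vs s. vs \<in> tuples Vs ==> s \<in> words n N ==> T (pure_tensor Vs vs) s = (\<Prod>j<m. \<theta> j (vs ! j) (block \<mu> j s))"
proof -
  have TL: "tensor_list Vs = quot_rep TF TN" by (simp add: tensor_list_def)
  have ker: "word_fun p = word_fun q \<longleftrightarrow> p \<ominus>\<^bsub>TF\<^esub> q \<in> TN" if "p \<in> carrier TF" "q \<in> carrier TF" for p q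
  proof
    assume "word_fun p = word_fun q"
    then show "p \<ominus>\<^bsub>TF\<^esub> q \<in> TN" unfolding TF_minus[OF that] by (intro word_fun_kernel TF_diff that) (simp add: word_fun_linear)
  next
    assume "p \<ominus>\<^bsub>TF\<^esub> q \<in> TN"
    then have "p - q \<in> TN" unfolding TF_minus[OF that] .
    from word_fun_TN[OF this] show "word_fun p = word_fun q" by (intro ext) (simp add: word_fun_linear)
  qed
  obtain T where T: "!!p. p \<in> carrier TF ==> T (Q.pr p) = word_fun p"
    and bij: "bij_betw T (carrier (quot_rep TF TN)) (word_fun ` carrier TF)"
  proof -
    have "\<exists>h. (\<forall>x\<in>carrier TF. h (Q.pr x) = word_fun x) \<and> bij_betw h (carrier (quot_rep TF TN)) (word_fun ` carrier TF)"
      by (rule Q.quot_map) (rule ker)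
    then show ?thesis by (elim exE conjE) (rule that; simp)
  qed
  have pt: "pure_tensor Vs vs = Q.pr (basis_vec vs)" for vs by (simp add: pure_tensor_def)
  show thesis
  proof (rule that[of T])
    show "linear_rep G (tensor_list Vs)" unfolding TL by (rule Q.linear_rep_quot)
    show "x = y" if "x \<in> carrier (tensor_list Vs)" "y \<in> carrier (tensor_list Vs)" "T x = T y" for x y
      using that inj_onD[OF bij_betw_imp_inj_on[OF bij]] unfolding TL by blast
    show "pure_tensor Vs vs \<in> carrier (tensor_list Vs)" if "vs \<in> tuples Vs" for vs
      unfolding TL pt by (rule Q.pr_in[OF TF_single[OF that]])
    show "T (pure_tensor Vs vs) s = (\<Prod>j<m. \<theta> j (vs ! j) (block \<mu> j s))" if "vs \<in> tuples Vs" "s \<in> words n N" for vs s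
      unfolding pt T[OF TF_single[OF that(1)]] using that(2) by (simp add: word_fun_linear pt_def)
    fix x assume "x \<in> carrier (tensor_list Vs)"
    then obtain p where p: "p \<in> carrier TF" "x = Q.pr p" unfolding TL by (rule Q.quot_cases)
    show "T (c \<odot>\<^bsub>tensor_list Vs\<^esub> x) s = c * T x s" for c s
      using T[OF TF.smult_in[OF p(1), of c]] unfolding TL p(2) Q.pr_smult[OF p(1)] T[OF p(1)]
      by (simp add: TF_simps word_fun_linear)
    show "T (act (tensor_list Vs) (A, f) x) s = loop_act n N X A f (T x) s" if "A \<in> sl n" "s \<in> words n N" for A f s
    proof -
      have g: "(A, f) \<in> G" using that by simp
      show ?thesis unfolding TL p(2) Q.pr_act[OF g p(1)] T[OF Q.act_in[OF g p(1)]] T[OF p(1)]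
        by (rule word_fun_act[OF that p(1)])
    qed
    show "T x s = 0" if "s \<notin> words n N" for s unfolding p(2) T[OF p(1)] using that by (simp add: word_fun_def)
    fix y assume "y \<in> carrier (tensor_list Vs)"
    then obtain q where q: "q \<in> carrier TF" "y = Q.pr q" unfolding TL by (rule Q.quot_cases)
    show "T (x \<oplus>\<^bsub>tensor_list Vs\<^esub> y) s = T x s + T y s" for s
      using T[OF TF.a_closed[OF p(1) q(1)]] unfolding TL p(2) q(2) Q.pr_add[OF p(1) q(1)] T[OF p(1)] T[OF q(1)]
      by (simp add: TF_simps word_fun_linear)
  qed
qed

end

section \<open>The filtration of the tensor product\<close>

text \<open>The inverse makes the letter \<open>s l\<close> sit at place \<open>\<sigma> l\<close>,
  whose parameter is \<open>X (\<sigma> l)\<close>. As in \<open>pol_fun\<close>, the index is a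
  strict degree bound.\<close>

definition word_fil :: "nat => nat => (nat => complex) => nat => ((nat => nat) => complex) set" where
  "word_fil n N X d = {\<psi>. \<forall>s\<in>words n N. (\<lambda>\<sigma>. \<psi> (s \<circ> pinv \<sigma>)) \<in> pol_fun N X d}"

lemma word_filD: "\<psi> \<in> word_fil n N X d ==> s \<in> words n N ==> (\<lambda>\<sigma>. \<psi> (s \<circ> pinv \<sigma>)) \<in> pol_fun N X d"
  by (simp add: word_fil_def)

lemma word_fil_cong:
  assumes "\<psi> \<in> word_fil n N X d" "!!s. s \<in> words n N ==> \<psi>' s = \<psi> s"
  shows "\<psi>' \<in> word_fil n N X d"
  unfolding word_fil_def
proof (intro CollectI ballI)
  fix s assume s: "s \<in> words n N"
  show "(\<lambda>\<sigma>. \<psi>' (s \<circ> pinv \<sigma>)) \<in> pol_fun N X d"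
    by (rule pol_fun_cong[OF word_filD[OF assms(1) s]]) (rule assms(2)[OF words_comp[OF s perms_inv]])
qed

lemma word_fil_zero: "(\<lambda>s. 0) \<in> word_fil n N X d"
  by (simp add: word_fil_def pol_fun_zero)

lemma word_fil_add: "\<psi> \<in> word_fil n N X d ==> \<psi>' \<in> word_fil n N X d ==> (\<lambda>s. \<psi> s + \<psi>' s) \<in> word_fil n N X d"
  by (simp add: word_fil_def pol_fun_add)

lemma word_fil_scale: "\<psi> \<in> word_fil n N X d ==> (\<lambda>s. c * \<psi> s) \<in> word_fil n N X d"
  by (simp add: word_fil_def pol_fun_scale)

lemma word_fil_mono: "d \<le> e ==> \<psi> \<in> word_fil n N X d ==> \<psi> \<in> word_fil n N X e"
  by (simp add: word_fil_def pol_fun_mono)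

lemma word_fil_0: "\<psi> \<in> word_fil n N X 0 \<longleftrightarrow> (\<forall>s\<in>words n N. \<psi> s = 0)"
proof
  assume p: "\<psi> \<in> word_fil n N X 0"
  show "\<forall>s\<in>words n N. \<psi> s = 0"
  proof
    fix s assume "s \<in> words n N"
    from word_filD[OF p this] have "\<psi> (s \<circ> pinv id) = 0" unfolding pol_fun_0 by (rule bspec) simp
    then show "\<psi> s = 0" by simp
  qed
next
  assume "\<forall>s\<in>words n N. \<psi> s = 0"
  then show "\<psi> \<in> word_fil n N X 0" by (intro word_fil_cong[OF word_fil_zero]) simp
qed

lemma mono_fun_shift:
  assumes "l < N" shows "mono_fun N X (m(l := m l + k)) \<sigma> = X (\<sigma> l) ^ k * mono_fun N X m \<sigma>"
proof -
  have "mono_fun N X m' \<sigma> = X (\<sigma> l) ^ m' l * (\<Prod>i\<in>{..<N} - {l}. X (\<sigma> i) ^ m' i)" for m'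
    unfolding mono_fun_def by (rule prod.remove) (use assms in auto)
  note e = this
  have "(\<Prod>i\<in>{..<N} - {l}. X (\<sigma> i) ^ (m(l := m l + k)) i) = (\<Prod>i\<in>{..<N} - {l}. X (\<sigma> i) ^ m i)"
    by (rule prod.cong) auto
  then show ?thesis unfolding e by (simp add: power_add)
qed

lemma sum_upd_exponent:
  fixes m :: "nat => nat"
  assumes "l < N" shows "(\<Sum>i<N. (m(l := b)) i) + m l = (\<Sum>i<N. m i) + b"
proof -
  have "sum m' {..<N} = m' l + sum m' ({..<N} - {l})" for m' :: "nat => nat"
    by (rule sum.remove) (use assms in auto)
  note e = this
  have "sum (m(l := b)) ({..<N} - {l}) = sum m ({..<N} - {l})" by (rule sum.cong) auto
  then show ?thesis using e[of m] e[of "m(l := b)"] by simp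
qed

lemma exponents_shift:
  assumes "m \<in> exponents N d" "l < N" shows "m(l := m l + k) \<in> exponents N (d + k)"
  using assms sum_upd_exponent[OF assms(2), of m "m l + k"] by (simp add: exponents_def)

lemma pol_fun_shift:
  assumes "F \<in> pol_fun N X d" "l < N" shows "(\<lambda>\<sigma>. X (\<sigma> l) ^ k * F \<sigma>) \<in> pol_fun N X (d + k)"
proof -
  obtain c where c: "\<forall>\<sigma>\<in>perms N. F \<sigma> = (\<Sum>m\<in>exponents N d. c m * mono_fun N X m \<sigma>)"
    using assms(1) by (auto simp: pol_fun_def)
  have "(\<lambda>\<sigma>. \<Sum>m\<in>exponents N d. c m * mono_fun N X (m(l := m l + k)) \<sigma>) \<in> pol_fun N X (d + k)"
    by (intro pol_fun_sum pol_fun_scale mono_fun_in exponents_shift assms(2))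
  then show ?thesis
    by (rule pol_fun_cong) (simp add: c mono_fun_shift[OF assms(2)] sum_distrib_left mult_ac)
qed

text \<open>Writing the place as \<open>\<sigma> l\<close> leaves the letters of the fixed word
  \<open>s\<close> as coefficients and makes the parameters \<open>X (\<sigma> l)\<close>, which are
  polynomial in the orbit point.\<close>

lemma loop_act_comp:
  assumes "\<sigma> \<in> perms N"
  shows "loop_act n N X A f \<psi> (s \<circ> pinv \<sigma>) = (\<Sum>l<N. poly f (X (\<sigma> l)) * (\<Sum>c<n. A $$ (s l, c) * \<psi> ((s(l := c)) \<circ> pinv \<sigma>)))"
  unfolding loop_act_def
  by (subst sum_perm[OF assms, symmetric]) (simp add: fun_upd_comp_perm[OF perms_inv[OF assms]] perms_comp_inv[OF assms])

text \<open>Each place contributes a factor \<open>X (\<sigma> l) ^ k\<close>, of degree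
  \<open>k\<close>, times functions attached to neighbouring words, which have the degree bound of
  \<open>\<psi>\<close>.\<close>

lemma word_fil_loop_act:
  assumes "\<psi> \<in> word_fil n N X d"
  shows "loop_act n N X A (monom 1 k) \<psi> \<in> word_fil n N X (d + k)"
  unfolding word_fil_def
proof (intro CollectI ballI)
  fix s assume s: "s \<in> words n N"
  have "(\<lambda>\<sigma>. \<Sum>l\<in>{..<N}. X (\<sigma> l) ^ k * (\<Sum>c\<in>{..<n}. A $$ (s l, c) * \<psi> ((s(l := c)) \<circ> pinv \<sigma>))) \<in> pol_fun N X (d + k)"
  proof (rule pol_fun_sum)
    fix l assume "l \<in> {..<N}"
    then have l: "l < N" by simp
    have "(\<lambda>\<sigma>. \<Sum>c\<in>{..<n}. A $$ (s l, c) * \<psi> ((s(l := c)) \<circ> pinv \<sigma>)) \<in> pol_fun N X d"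
      by (intro pol_fun_sum pol_fun_scale word_filD[OF assms] words_upd[OF s l]) simp
    then show "(\<lambda>\<sigma>. X (\<sigma> l) ^ k * (\<Sum>c\<in>{..<n}. A $$ (s l, c) * \<psi> ((s(l := c)) \<circ> pinv \<sigma>))) \<in> pol_fun N X (d + k)"
      by (rule pol_fun_shift[OF _ l])
  qed
  then show "(\<lambda>\<sigma>. loop_act n N X A (monom 1 k) \<psi> (s \<circ> pinv \<sigma>)) \<in> pol_fun N X (d + k)"
    by (rule pol_fun_cong) (simp add: loop_act_comp poly_monom)
qed

text \<open>The symmetrization over \<open>S_N\<close> of a decorated word: place
  \<open>\<sigma> l\<close> receives the letter \<open>s0 l\<close> and the weight
  \<open>X (\<sigma> l) ^ m l\<close>.\<close>

definition dfun :: "nat => (nat => complex) => (nat => nat) => (nat => nat) => (nat => nat) => complex" where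
  "dfun N X s0 m s = (\<Sum>\<sigma>\<in>perms N. if s \<circ> \<sigma> = s0 then mono_fun N X m \<sigma> else 0)"

lemma card_perms_nonzero: "of_nat (card (perms N)) \<noteq> (0 :: complex)"
proof -
  have "id \<in> perms N" by (rule perms_id)
  then have "card (perms N) \<noteq> 0" unfolding card_0_eq[OF finite_perms] by blast
  then show ?thesis by simp
qed

lemma comp_inv_cancel: "\<sigma> \<in> perms N ==> s \<circ> \<sigma> \<circ> pinv \<sigma> = s" "\<sigma> \<in> perms N ==> s \<circ> pinv \<sigma> \<circ> \<sigma> = s"
  by (simp_all add: comp_assoc)

text \<open>For every \<open>\<sigma>\<close>, the value \<open>\<psi> s\<close> is the polynomial
  function attached to the word \<open>s \<circ> \<sigma>\<close>, evaluated at
  \<open>\<sigma>\<close>. Summing these expansions over \<open>\<sigma>\<close> and collecting by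
  words produces the functions \<open>dfun\<close>.\<close>

lemma word_fil_expansion:
  assumes "\<psi> \<in> word_fil n N X d"
  shows "\<exists>c. \<forall>s\<in>words n N. of_nat (card (perms N)) * \<psi> s =
    (\<Sum>s0\<in>words n N. \<Sum>m\<in>exponents N d. c s0 m * dfun N X s0 m s)"
proof -
  have "\<forall>s0\<in>words n N. \<exists>c. \<forall>\<sigma>\<in>perms N. \<psi> (s0 \<circ> pinv \<sigma>) = (\<Sum>m\<in>exponents N d. c m * mono_fun N X m \<sigma>)"
    using assms by (simp add: word_fil_def pol_fun_def)
  from bchoice[OF this] obtain c where
    "\<forall>s0\<in>words n N. \<forall>\<sigma>\<in>perms N. \<psi> (s0 \<circ> pinv \<sigma>) = (\<Sum>m\<in>exponents N d. c s0 m * mono_fun N X m \<sigma>)" by (rule exE)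
  then have c: "\<psi> (s0 \<circ> pinv \<sigma>) = (\<Sum>m\<in>exponents N d. c s0 m * mono_fun N X m \<sigma>)"
    if "s0 \<in> words n N" "\<sigma> \<in> perms N" for s0 \<sigma> using that by simp
  show ?thesis
  proof (intro exI[of _ c] ballI)
    fix s assume s: "s \<in> words n N"
    have "(\<Sum>s0\<in>words n N. \<Sum>m\<in>exponents N d. c s0 m * dfun N X s0 m s)
      = (\<Sum>s0\<in>words n N. \<Sum>m\<in>exponents N d. \<Sum>\<sigma>\<in>perms N. if s \<circ> \<sigma> = s0 then c s0 m * mono_fun N X m \<sigma> else 0)"
      unfolding dfun_def sum_distrib_left
      by (rule sum.cong[OF refl], rule sum.cong[OF refl], rule sum.cong[OF refl]) simp
    also have "\<dots> = (\<Sum>\<sigma>\<in>perms N. \<Sum>s0\<in>words n N. \<Sum>m\<in>exponents N d. if s \<circ> \<sigma> = s0 then c s0 m * mono_fun N X m \<sigma> else 0)"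
      by (rule sum_swap3)
    also have "\<dots> = (\<Sum>\<sigma>\<in>perms N. \<psi> s)"
    proof (rule sum.cong[OF refl])
      fix \<sigma> assume p: "\<sigma> \<in> perms N"
      have "(\<Sum>s0\<in>words n N. \<Sum>m\<in>exponents N d. if s \<circ> \<sigma> = s0 then c s0 m * mono_fun N X m \<sigma> else 0)
        = (\<Sum>s0\<in>words n N. if s0 = s \<circ> \<sigma> then \<Sum>m\<in>exponents N d. c s0 m * mono_fun N X m \<sigma> else 0)"
        by (rule sum.cong[OF refl]) auto
      also have "\<dots> = (\<Sum>m\<in>exponents N d. c (s \<circ> \<sigma>) m * mono_fun N X m \<sigma>)"
        using words_comp[OF s p] by simp
      also have "\<dots> = \<psi> (s \<circ> \<sigma> \<circ> pinv \<sigma>)" by (rule c[OF words_comp[OF s p] p, symmetric])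
      finally show "(\<Sum>s0\<in>words n N. \<Sum>m\<in>exponents N d. if s \<circ> \<sigma> = s0 then c s0 m * mono_fun N X m \<sigma> else 0) = \<psi> s"
        by (simp only: comp_inv_cancel[OF p])
    qed
    finally show "of_nat (card (perms N)) * \<psi> s = (\<Sum>s0\<in>words n N. \<Sum>m\<in>exponents N d. c s0 m * dfun N X s0 m s)"
      by simp
  qed
qed

lemma loop_act_elem_mat:
  assumes "s \<in> words n N" "j < n"
  shows "loop_act n N X (elem_mat n c j) (monom 1 k) \<psi> s = (\<Sum>i<N. if s i = c then X i ^ k * \<psi> (s(i := j)) else 0)"
  unfolding loop_act_def
proof (rule sum.cong[OF refl])
  fix i assume "i \<in> {..<N}"
  then have "(\<Sum>b<n. elem_mat n c j $$ (s i, b) * \<psi> (s(i := b))) = (\<Sum>b<n. if b = j then (if s i = c then \<psi> (s(i := j)) else 0) else 0)"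
    using words_less[OF assms(1), of i] by (intro sum.cong[OF refl]) (simp add: elem_mat_index)
  then show "poly (monom 1 k) (X i) * (\<Sum>b<n. elem_mat n c j $$ (s i, b) * \<psi> (s(i := b))) =
      (if s i = c then X i ^ k * \<psi> (s(i := j)) else 0)"
    using assms(2) by (simp add: poly_monom)
qed

text \<open>The effect of \<open>E_{c 0} \<otimes> t^k\<close> on a symmetrized decorated word: each
  letter \<open>0\<close> in turn becomes \<open>c\<close> and its exponent grows by
  \<open>k\<close>.\<close>

lemma lower_dfun:
  "(\<Sum>i<N. if s i = c then X i ^ k * dfun N X s0 m (s(i := 0)) else 0) =
   (\<Sum>l<N. if s0 l = 0 then dfun N X (s0(l := c)) (m(l := m l + k)) s else 0)"
proof -
  have "(\<Sum>i<N. if s i = c then X i ^ k * dfun N X s0 m (s(i := 0)) else 0)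
    = (\<Sum>i<N. \<Sum>\<sigma>\<in>perms N. if s i = c \<and> s(i := 0) \<circ> \<sigma> = s0 then X i ^ k * mono_fun N X m \<sigma> else 0)"
    unfolding dfun_def sum_distrib_left by (rule sum.cong[OF refl]) (auto intro!: sum.cong)
  also have "\<dots> = (\<Sum>\<sigma>\<in>perms N. \<Sum>i<N. if s i = c \<and> s(i := 0) \<circ> \<sigma> = s0 then X i ^ k * mono_fun N X m \<sigma> else 0)"
    by (rule sum.swap)
  also have "\<dots> = (\<Sum>\<sigma>\<in>perms N. \<Sum>l<N. if s0 l = 0 \<and> s \<circ> \<sigma> = s0(l := c) then mono_fun N X (m(l := m l + k)) \<sigma> else 0)"
  proof (rule sum.cong[OF refl])
    fix \<sigma> assume p: "\<sigma> \<in> perms N"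
    have "(\<Sum>i<N. if s i = c \<and> s(i := 0) \<circ> \<sigma> = s0 then X i ^ k * mono_fun N X m \<sigma> else 0) =
      (\<Sum>l<N. if s (\<sigma> l) = c \<and> s(\<sigma> l := 0) \<circ> \<sigma> = s0 then X (\<sigma> l) ^ k * mono_fun N X m \<sigma> else 0)"
      by (rule sum_perm[OF p, symmetric])
    also have "\<dots> = (\<Sum>l<N. if s0 l = 0 \<and> s \<circ> \<sigma> = s0(l := c) then mono_fun N X (m(l := m l + k)) \<sigma> else 0)"
    proof (rule sum.cong[OF refl])
      fix l assume "l \<in> {..<N}"
      then have l: "l < N" by simp
      have "s (\<sigma> l) = c \<and> (s \<circ> \<sigma>)(l := 0) = s0 \<longleftrightarrow> s0 l = 0 \<and> s \<circ> \<sigma> = s0(l := c)"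
      proof
        assume a: "s (\<sigma> l) = c \<and> (s \<circ> \<sigma>)(l := 0) = s0"
        show "s0 l = 0 \<and> s \<circ> \<sigma> = s0(l := c)"
          unfolding conjunct2[OF a, symmetric] conjunct1[OF a, symmetric] by (simp add: fun_eq_iff)
      next
        assume a: "s0 l = 0 \<and> s \<circ> \<sigma> = s0(l := c)"
        then have "(s \<circ> \<sigma>) l = c" by simp
        moreover have "(s \<circ> \<sigma>)(l := 0) = s0" unfolding conjunct2[OF a] using a by (auto simp: fun_eq_iff)
        ultimately show "s (\<sigma> l) = c \<and> (s \<circ> \<sigma>)(l := 0) = s0" by simp
      qed
      then show "(if s (\<sigma> l) = c \<and> s(\<sigma> l := 0) \<circ> \<sigma> = s0 then X (\<sigma> l) ^ k * mono_fun N X m \<sigma> else 0) =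
        (if s0 l = 0 \<and> s \<circ> \<sigma> = s0(l := c) then mono_fun N X (m(l := m l + k)) \<sigma> else 0)"
        by (simp only: fun_upd_comp_perm[OF p, symmetric] mono_fun_shift[OF l])
    qed
    finally show "(\<Sum>i<N. if s i = c \<and> s(i := 0) \<circ> \<sigma> = s0 then X i ^ k * mono_fun N X m \<sigma> else 0) = \<dots>" .
  qed
  also have "\<dots> = (\<Sum>l<N. \<Sum>\<sigma>\<in>perms N. if s0 l = 0 \<and> s \<circ> \<sigma> = s0(l := c) then mono_fun N X (m(l := m l + k)) \<sigma> else 0)"
    by (rule sum.swap)
  also have "\<dots> = (\<Sum>l<N. if s0 l = 0 then dfun N X (s0(l := c)) (m(l := m l + k)) s else 0)"
    unfolding dfun_def by (rule sum.cong[OF refl]) simp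
  finally show ?thesis .
qed

text \<open>The power sum takes the same value at \<open>X\<close> and at
  \<open>X \<circ> \<sigma>\<close>, so under the sum over \<open>\<sigma>\<close> its terms can be
  distributed over the exponents.\<close>

lemma power_sum_dfun:
  "(\<Sum>j<N. X j ^ k) * dfun N X s0 m s = (\<Sum>l<N. dfun N X s0 (m(l := m l + k)) s)"
proof -
  have "(\<Sum>l<N. dfun N X s0 (m(l := m l + k)) s) =
      (\<Sum>\<sigma>\<in>perms N. \<Sum>l<N. if s \<circ> \<sigma> = s0 then mono_fun N X (m(l := m l + k)) \<sigma> else 0)"
    unfolding dfun_def by (rule sum.swap)
  also have "\<dots> = (\<Sum>\<sigma>\<in>perms N. (\<Sum>j<N. X j ^ k) * (if s \<circ> \<sigma> = s0 then mono_fun N X m \<sigma> else 0))"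
  proof (rule sum.cong[OF refl])
    fix \<sigma> assume p: "\<sigma> \<in> perms N"
    have "(\<Sum>l<N. mono_fun N X (m(l := m l + k)) \<sigma>) = (\<Sum>l<N. X (\<sigma> l) ^ k * mono_fun N X m \<sigma>)"
      by (rule sum.cong[OF refl]) (simp add: mono_fun_shift)
    also have "\<dots> = (\<Sum>j<N. X j ^ k) * mono_fun N X m \<sigma>"
      by (simp only: sum_distrib_right[symmetric] sum_perm[OF p, of "\<lambda>j. X j ^ k"])
    finally show "(\<Sum>l<N. if s \<circ> \<sigma> = s0 then mono_fun N X (m(l := m l + k)) \<sigma> else 0) =
      (\<Sum>j<N. X j ^ k) * (if s \<circ> \<sigma> = s0 then mono_fun N X m \<sigma> else 0)" by simp
  qed
  finally show ?thesis by (simp add: dfun_def sum_distrib_left)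
qed

text \<open>Only the multiset of pairs of a letter and its exponent matters, since the
  symmetrization absorbs a common permutation of both.\<close>

lemma dfun_comp:
  assumes t: "\<tau> \<in> perms N" shows "dfun N X (s0 \<circ> \<tau>) (m \<circ> \<tau>) = dfun N X s0 m"
proof
  fix s
  have "dfun N X (s0 \<circ> \<tau>) (m \<circ> \<tau>) s = (\<Sum>\<sigma>\<in>perms N. if s \<circ> (\<sigma> \<circ> \<tau>) = s0 \<circ> \<tau> then mono_fun N X (m \<circ> \<tau>) (\<sigma> \<circ> \<tau>) else 0)"
    unfolding dfun_def by (rule sum_perms_comp_right[OF t, symmetric])
  also have "\<dots> = dfun N X s0 m s" unfolding dfun_def
  proof (rule sum.cong[OF refl])
    fix \<sigma> assume "\<sigma> \<in> perms N"
    have "s \<circ> (\<sigma> \<circ> \<tau>) = s0 \<circ> \<tau> \<longleftrightarrow> s \<circ> \<sigma> = s0"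
    proof
      assume "s \<circ> (\<sigma> \<circ> \<tau>) = s0 \<circ> \<tau>"
      then have "(s \<circ> \<sigma>) \<circ> \<tau> \<circ> pinv \<tau> = s0 \<circ> \<tau> \<circ> pinv \<tau>" by (simp only: comp_assoc)
      then show "s \<circ> \<sigma> = s0" by (simp only: comp_inv_cancel[OF t])
    qed (simp add: comp_assoc[symmetric])
    then show "(if s \<circ> (\<sigma> \<circ> \<tau>) = s0 \<circ> \<tau> then mono_fun N X (m \<circ> \<tau>) (\<sigma> \<circ> \<tau>) else 0) = (if s \<circ> \<sigma> = s0 then mono_fun N X m \<sigma> else 0)"
      by (simp only: mono_fun_comp[OF t] comp_inv_cancel[OF t])
  qed
  finally show "dfun N X (s0 \<circ> \<tau>) (m \<circ> \<tau>) s = dfun N X s0 m s" .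
qed

lemma dfun_transpose:
  assumes "i < N" "l < N"
  shows "dfun N X (s0 \<circ> Transposition.transpose i l) (m \<circ> Transposition.transpose i l) = dfun N X s0 m"
  by (rule dfun_comp) (use assms in \<open>simp add: perms_def permutes_swap_id\<close>)

text \<open>\<open>\<G> d\<close> stands for the functions reached in degree at most
  \<open>d\<close>. The base function belongs to the highest weight vector, whose word is constantly
  \<open>0\<close>, and \<open>low\<close> is the action of \<open>E_{c 0} \<otimes> t^k\<close> for
  a letter \<open>c\<close> below the first.\<close>

locale generated_words =
  fixes n N :: nat and X :: "nat => complex" and \<G> :: "nat => ((nat => nat) => complex) set"
  assumes add: "!!\<psi> \<psi>' d. \<psi> \<in> \<G> d ==> \<psi>' \<in> \<G> d ==> (\<lambda>s. \<psi> s + \<psi>' s) \<in> \<G> d"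
    and scale: "!!c \<psi> d. \<psi> \<in> \<G> d ==> (\<lambda>s. c * \<psi> s) \<in> \<G> d"
    and mono: "!!\<psi> d e. \<psi> \<in> \<G> d ==> d \<le> e ==> \<psi> \<in> \<G> e"
    and cong: "!!\<psi> \<psi>' d. \<psi> \<in> \<G> d ==> (!!s. s \<in> words n N ==> \<psi>' s = \<psi> s) ==> \<psi>' \<in> \<G> d"
    and base: "(\<lambda>s. if s = (\<lambda>i\<in>{..<N}. 0) then 1 else 0) \<in> \<G> 0"
    and low: "!!\<psi> d c k. \<psi> \<in> \<G> d ==> 0 < c ==> c < n ==>
      (\<lambda>s. \<Sum>i<N. if s i = c then X i ^ k * \<psi> (s(i := 0)) else 0) \<in> \<G> (d + k)"
begin

lemma zero: "(\<lambda>s. 0) \<in> \<G> d"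
  using scale[OF mono[OF base], of d 0] by simp

lemma sum: "(!!i. i \<in> I ==> f i \<in> \<G> d) ==> (\<lambda>s. \<Sum>i\<in>I. f i s) \<in> \<G> d"
proof (induction I rule: infinite_finite_induct)
  case (insert i I)
  have "(\<lambda>s. f i s + (\<Sum>i\<in>I. f i s)) \<in> \<G> d" by (rule add) (use insert in auto)
  then show ?case using insert by simp
qed (simp_all add: zero)

lemma divide:
  assumes "(\<lambda>s. of_nat r * \<psi> s) \<in> \<G> d" "r \<noteq> 0" shows "\<psi> \<in> \<G> d"
  using scale[OF assms(1), of "inverse (of_nat r)"] assms(2) by (simp add: mult.assoc[symmetric])

lemma diff: "\<psi> \<in> \<G> d ==> \<psi>' \<in> \<G> d ==> (\<lambda>s. \<psi> s - \<psi>' s) \<in> \<G> d"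
  using add[of \<psi> d "\<lambda>s. (- 1) * \<psi>' s"] scale[of \<psi>' d "- 1"] by simp

text \<open>The induction removes the exponents at the positions carrying the letter \<open>0\<close> by means of
  power sums, and then lowers the remaining letters to \<open>0\<close>.\<close>

lemma dfun_in:
  "s0 \<in> words n N ==> m \<in> exponents N (Suc d) ==> dfun N X s0 m \<in> \<G> d"
\<comment> \<open>The measure counts the letters \<open>0\<close> with a positive exponent and the
  letters different from \<open>0\<close>. The degree bound \<open>d\<close> is generalized because
  lowering splits off the exponent \<open>k\<close>.\<close>
proof (induction "card {i. i < N \<and> s0 i = 0 \<and> 0 < m i} + card {i. i < N \<and> s0 i \<noteq> 0}" arbitrary: s0 m d rule: less_induct)
  case less
  note s0 = less.prems(1) and m = less.prems(2)
  have n0: "0 < n" if "i < N" for i using words_less[OF s0 that] by simp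
  show ?case
  proof (cases "\<exists>i<N. s0 i = 0 \<and> 0 < m i")
    case True
    then obtain i where i: "i < N" "s0 i = 0" "0 < m i" by blast
    define k where "k = m i"
    define m' where "m' = m(i := 0)"
    \<comment> \<open>The undecorated letters \<open>0\<close> after the exponent at
      \<open>i\<close> is removed: putting \<open>k\<close> on any of them gives \<open>m\<close> up
      to a transposition fixing \<open>s0\<close>.\<close>
    define L where "L = {l. l < N \<and> s0 l = 0 \<and> m' l = 0}"
    have Z: "card {j. j < N \<and> s0 j = 0 \<and> 0 < f j} < card {j. j < N \<and> s0 j = 0 \<and> 0 < m j}"
      if "!!j. s0 j = 0 ==> 0 < f j ==> 0 < m' j" for f
    proof (rule psubset_card_mono)
      have "j \<noteq> i \<and> 0 < m j" if "0 < m' j" for j using that by (simp add: m'_def split: if_splits)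
      then show "{j. j < N \<and> s0 j = 0 \<and> 0 < f j} \<subset> {j. j < N \<and> s0 j = 0 \<and> 0 < m j}"
        using that i by blast
    qed simp
    have sm: "(\<Sum>j<N. m' j) + k = (\<Sum>j<N. m j)"
      using sum_upd_exponent[OF i(1), of m 0] by (simp add: m'_def k_def)
    have m'0: "m' j = 0" if "N \<le> j" for j using m that by (simp add: m'_def exponents_def)
    have ex: "m'(l := m' l + k) \<in> exponents N (Suc d)" if "l < N" for l
      using sum_upd_exponent[OF that, of m' "m' l + k"] sm m m'0 that by (simp add: exponents_def)
    have ex': "m' \<in> exponents N (Suc d)" using sm m m'0 by (simp add: exponents_def)
    have 1: "dfun N X s0 m' \<in> \<G> d"
      by (rule less.hyps[OF _ s0 ex']) (use Z[of m'] in simp)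
    \<comment> \<open>Outside \<open>L\<close> the exponent \<open>k\<close> lands on a nonzero
      letter or on a letter \<open>0\<close> that is decorated already, so in both cases there is
      one decorated letter \<open>0\<close> fewer than in \<open>m\<close>.\<close>
    have 2: "dfun N X s0 (m'(l := m' l + k)) \<in> \<G> d" if "l \<in> {..<N} - L" for l
    proof (rule less.hyps[OF _ s0 ex])
      have "0 < m' j" if "s0 j = 0" "0 < (m'(l := m' l + k)) j" for j
        using that \<open>l \<in> {..<N} - L\<close> by (auto simp: L_def split: if_splits)
      then have "card {j. j < N \<and> s0 j = 0 \<and> 0 < (m'(l := m' l + k)) j} < card {j. j < N \<and> s0 j = 0 \<and> 0 < m j}"
        by (rule Z[of "m'(l := m' l + k)"])
      then show "card {j. j < N \<and> s0 j = 0 \<and> 0 < (m'(l := m' l + k)) j} + card {j. j < N \<and> s0 j \<noteq> 0} <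
        card {j. j < N \<and> s0 j = 0 \<and> 0 < m j} + card {j. j < N \<and> s0 j \<noteq> 0}" by (simp only: add_less_cancel_right)
      show "l < N" using that by simp
    qed
    have 3: "dfun N X s0 (m'(l := m' l + k)) = dfun N X s0 m" if "l \<in> L" for l
    proof -
      have l: "l < N" "s0 l = 0" "m' l = 0" using that by (simp_all add: L_def)
      have "s0 = s0 \<circ> Transposition.transpose i l" using i(2) l(2) by (auto simp: fun_eq_iff Transposition.transpose_def)
      moreover have "m'(l := m' l + k) = m \<circ> Transposition.transpose i l"
        using l(3) by (auto simp: fun_eq_iff Transposition.transpose_def m'_def k_def split: if_splits)
      ultimately show ?thesis using dfun_transpose[OF i(1) l(1), of X s0 m] by simp
    qed
    have LN: "L \<subseteq> {..<N}" "finite L" "i \<in> L" using i by (auto simp: L_def m'_def)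
    \<comment> \<open>The power sum identity solved for the terms in \<open>L\<close>, which all
      equal the wanted function; the power sum itself is a scalar and costs no degree.\<close>
    have "of_nat (card L) * dfun N X s0 m s = (\<Sum>j<N. X j ^ k) * dfun N X s0 m' s - (\<Sum>l\<in>{..<N} - L. dfun N X s0 (m'(l := m' l + k)) s)" for s
    proof -
      have "(\<Sum>l<N. dfun N X s0 (m'(l := m' l + k)) s) = (\<Sum>l\<in>{..<N} - L. dfun N X s0 (m'(l := m' l + k)) s) + (\<Sum>l\<in>L. dfun N X s0 (m'(l := m' l + k)) s)"
        by (rule sum.subset_diff[OF LN(1)]) simp
      also have "(\<Sum>l\<in>L. dfun N X s0 (m'(l := m' l + k)) s) = of_nat (card L) * dfun N X s0 m s"
        using 3 by simp
      finally show ?thesis unfolding power_sum_dfun by (simp only: add_diff_cancel_left')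
    qed
    moreover have "(\<lambda>s. (\<Sum>j<N. X j ^ k) * dfun N X s0 m' s - (\<Sum>l\<in>{..<N} - L. dfun N X s0 (m'(l := m' l + k)) s)) \<in> \<G> d"
      by (rule diff[OF scale[OF 1] sum[OF 2]])
    ultimately have "(\<lambda>s. of_nat (card L) * dfun N X s0 m s) \<in> \<G> d" by simp
    then show ?thesis by (rule divide) (use LN in \<open>auto simp: card_eq_0_iff\<close>)
  next
    case False
    have z: "m j = 0" if "j < N" "s0 j = 0" for j
    proof (rule ccontr)
      assume "m j \<noteq> 0"
      then have "\<exists>i<N. s0 i = 0 \<and> 0 < m i" using that by (intro exI[of _ j]) simp
      with False show False by (rule notE)
    qed
    show ?thesis
    proof (cases "\<exists>i<N. s0 i \<noteq> 0")
      case True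
      then obtain i where i: "i < N" "s0 i \<noteq> 0" by blast
      define c where "c = s0 i"
      have c: "0 < c" "c < n" using i words_less[OF s0 i(1)] by (simp_all add: c_def)
      define k where "k = m i"
      define m' where "m' = m(i := 0)"
      \<comment> \<open>The decorated word before lowering: the letter at \<open>i\<close> is reset
        to \<open>0\<close> and its exponent is removed. The lowering operator for \<open>c\<close>
        and \<open>k\<close> will restore both.\<close>
      define s' where "s' = s0(i := 0)"
      define L where "L = {l. l < N \<and> s' l = 0}"
      have s': "s' \<in> words n N" unfolding s'_def by (rule words_upd[OF s0 i(1) n0[OF i(1)]])
      have sm: "(\<Sum>j<N. m' j) + k = (\<Sum>j<N. m j)"
        using sum_upd_exponent[OF i(1), of m 0] by (simp add: m'_def k_def)
      have m': "m' \<in> exponents N (Suc (\<Sum>j<N. m' j))"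
        using m by (simp add: m'_def exponents_def)
      have "s' j \<noteq> 0" if "j < N" "0 < m' j" for j
        using z[of j] that by (cases "j = i"; cases "s0 j = 0") (simp_all add: s'_def m'_def)
      then have e: "{j. j < N \<and> s' j = 0 \<and> 0 < m' j} = {}" "{j. j < N \<and> s0 j = 0 \<and> 0 < m j} = {}"
        using z by fastforce+
      have W: "card {j. j < N \<and> s' j \<noteq> 0} < card {j. j < N \<and> s0 j \<noteq> 0}"
        by (rule psubset_card_mono) (use i in \<open>auto simp: s'_def split: if_splits\<close>)
      have "dfun N X s' m' \<in> \<G> (\<Sum>j<N. m' j)"
        by (rule less.hyps[OF _ s' m']) (use W in \<open>simp only: e card.empty\<close>)
      then have "(\<lambda>s. \<Sum>j<N. if s j = c then X j ^ k * dfun N X s' m' (s(j := 0)) else 0) \<in> \<G> ((\<Sum>j<N. m' j) + k)"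
        by (rule low[OF _ c])
      then have "(\<lambda>s. \<Sum>l<N. if s' l = 0 then dfun N X (s'(l := c)) (m'(l := m' l + k)) s else 0) \<in> \<G> (\<Sum>j<N. m j)"
        unfolding lower_dfun sm .
      \<comment> \<open>All letters \<open>0\<close> of \<open>s'\<close> carry exponent
        \<open>0\<close> here, so lowering any of them gives the same decorated word as lowering at
        \<open>i\<close>, up to a transposition.\<close>
      moreover have "(\<Sum>l<N. if s' l = 0 then dfun N X (s'(l := c)) (m'(l := m' l + k)) s else 0) = of_nat (card L) * dfun N X s0 m s" for s
      proof -
        have "dfun N X (s'(l := c)) (m'(l := m' l + k)) = dfun N X s0 m" if "l < N" "s' l = 0" for l
        proof -
          have ml: "m' l = 0" using z[OF that(1)] that(2) by (auto simp: s'_def m'_def split: if_splits)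
          have "s'(l := c) = s0 \<circ> Transposition.transpose i l"
            using that(2) by (auto simp: fun_eq_iff Transposition.transpose_def s'_def c_def split: if_splits)
          moreover have "m'(l := m' l + k) = m \<circ> Transposition.transpose i l"
            using ml by (auto simp: fun_eq_iff Transposition.transpose_def m'_def k_def split: if_splits)
          ultimately show ?thesis using dfun_transpose[OF i(1) that(1), of X s0 m] by simp
        qed
        then have "(\<Sum>l<N. if s' l = 0 then dfun N X (s'(l := c)) (m'(l := m' l + k)) s else 0) = (\<Sum>l<N. if s' l = 0 then dfun N X s0 m s else 0)"
          by (intro sum.cong[OF refl]) simp
        also have "\<dots> = (\<Sum>l\<in>L. dfun N X s0 m s)"
          by (simp add: L_def sum.If_cases Int_def)
        finally show ?thesis by simp
      qed
      ultimately have "(\<lambda>s. of_nat (card L) * dfun N X s0 m s) \<in> \<G> (\<Sum>j<N. m j)" by simp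
      then have "dfun N X s0 m \<in> \<G> (\<Sum>j<N. m j)"
      proof (rule divide)
        have "i \<in> L" "finite L" using i by (auto simp: L_def s'_def)
        then show "card L \<noteq> 0" by (auto simp: card_eq_0_iff)
      qed
      then show ?thesis by (rule mono) (use m in \<open>simp add: exponents_def\<close>)
    next
      case False
      then have s00: "s0 j = 0" if "j < N" for j using that by blast
      \<comment> \<open>Only the constant word \<open>0\<close> without exponents remains, whose
        symmetrization is a multiple of the base function.\<close>
      have s0z: "s0 = (\<lambda>i\<in>{..<N}. 0)" using s0 s00 by (auto simp: words_def PiE_def extensional_def fun_eq_iff)
      have "m = (\<lambda>j. 0)"
      proof
        fix j show "m j = 0" using m z s00 by (cases "j < N") (simp_all add: exponents_def)
      qed
      then have "dfun N X s0 m s = of_nat (card (perms N)) * (if s = (\<lambda>i\<in>{..<N}. 0) then 1 else 0)" if "s \<in> words n N" for s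
      proof -
        have "s \<circ> \<sigma> = s0 \<longleftrightarrow> s = s0" if "\<sigma> \<in> perms N" for \<sigma>
        proof -
          have c: "s0 \<circ> \<tau> = s0" if "\<tau> \<in> perms N" for \<tau>
            using perms_less_iff[OF that] by (auto simp: s0z fun_eq_iff restrict_def)
          show ?thesis
          proof
            assume "s \<circ> \<sigma> = s0"
            then have "s \<circ> \<sigma> \<circ> pinv \<sigma> = s0 \<circ> pinv \<sigma>" by simp
            then show "s = s0" by (simp only: comp_inv_cancel[OF that] c[OF perms_inv[OF that]])
          qed (simp add: c[OF that])
        qed
        then have "dfun N X s0 m s = (\<Sum>\<sigma>\<in>perms N. if s = s0 then mono_fun N X m \<sigma> else 0)"
          unfolding dfun_def by (intro sum.cong[OF refl]) simp
        then show ?thesis using \<open>m = (\<lambda>j. 0)\<close> s0z by (simp add: mono_fun_def)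
      qed
      then have "dfun N X s0 m \<in> \<G> 0" by (rule cong[OF scale[OF base]])
      then show ?thesis by (rule mono) simp
    qed
  qed
qed

lemma word_fil_in:
  assumes "\<psi> \<in> word_fil n N X (Suc d)" shows "\<psi> \<in> \<G> d"
proof -
  obtain c where c: "\<forall>s\<in>words n N. of_nat (card (perms N)) * \<psi> s =
    (\<Sum>s0\<in>words n N. \<Sum>m\<in>exponents N (Suc d). c s0 m * dfun N X s0 m s)"
    using word_fil_expansion[OF assms] by (rule exE)
  have "(\<lambda>s. \<Sum>s0\<in>words n N. \<Sum>m\<in>exponents N (Suc d). c s0 m * dfun N X s0 m s) \<in> \<G> d"
    by (intro sum scale dfun_in)
  then have "(\<lambda>s. of_nat (card (perms N)) * \<psi> s) \<in> \<G> d" by (rule cong) (use c in simp)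
  then show ?thesis by (rule divide) (use card_perms_nonzero[of N] in simp)
qed

end

section \<open>The filtration of a representation embedded in functions on words\<close>

lemma n_minus_sl: "A \<in> n_minus n ==> A \<in> sl n"
  by (simp add: n_minus_def sl_def)

lemma elem_mat_n_minus: "0 < c ==> elem_mat n c 0 \<in> n_minus n"
  by (simp add: n_minus_def elem_mat_index)

text \<open>What is used of the tensor product: an injective map \<open>T\<close> to functions on
  words compatible with the action, and the image of \<open>w\<close>. The scalar
  \<open>\<kappa>\<close> allows for highest weight vectors that are not normalized in the chosen
  models.\<close>

locale word_model =
  fixes n N :: nat and X :: "nat => complex" and V :: "(complex mat \<times> complex poly, 'a) rep"
    and T :: "'a => (nat => nat) => complex" and w :: 'a and \<kappa> :: complex
  assumes n: "0 < n" and lin: "linear_rep (sl n \<times> UNIV) V"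
    and T_inj: "!!x y. x \<in> carrier V ==> y \<in> carrier V ==> T x = T y ==> x = y"
    and T_add: "!!x y s. x \<in> carrier V ==> y \<in> carrier V ==> T (x \<oplus>\<^bsub>V\<^esub> y) s = T x s + T y s"
    and T_scale: "!!c x s. x \<in> carrier V ==> T (c \<odot>\<^bsub>V\<^esub> x) s = c * T x s"
    and T_act: "!!A f x s. A \<in> sl n ==> x \<in> carrier V ==> s \<in> words n N ==>
       T (act V (A, f) x) s = loop_act n N X A f (T x) s"
    and T_outside: "!!x s. x \<in> carrier V ==> s \<notin> words n N ==> T x s = 0"
    and w: "w \<in> carrier V" and kappa: "\<kappa> \<noteq> 0"
    and T_w: "!!s. s \<in> words n N ==> T w s = (if s = (\<lambda>i\<in>{..<N}. 0) then \<kappa> else 0)"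
begin

sublocale V: cspace V by (rule linear_rep_cspace[OF lin])

abbreviation "Fil \<equiv> U_filtration n V w"

definition mons :: "nat => 'a set" where
  "mons d = {foldr (\<lambda>(x, k). act V (x, monom 1 k)) xs w | xs. set xs \<subseteq> n_minus n \<times> UNIV \<and> sum_list (map snd xs) = d}"

lemma T_ext: "x \<in> carrier V ==> y \<in> carrier V ==> (!!s. s \<in> words n N ==> T x s = T y s) ==> x = y"
proof (rule T_inj)
  assume a: "x \<in> carrier V" "y \<in> carrier V" "!!s. s \<in> words n N ==> T x s = T y s"
  show "T x = T y"
  proof
    fix s show "T x s = T y s" using a T_outside by (cases "s \<in> words n N") simp_all
  qed
qed

lemma T_zero: "T \<zero>\<^bsub>V\<^esub> s = 0"
  using T_scale[OF V.zero_closed, of 0 s] by simp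

lemma zero_word_comp:
  assumes "\<sigma> \<in> perms N" shows "s \<circ> \<sigma> = (\<lambda>i\<in>{..<N}. 0 :: nat) \<longleftrightarrow> s = (\<lambda>i\<in>{..<N}. 0)"
proof -
  have c: "(\<lambda>i\<in>{..<N}. 0 :: nat) \<circ> \<tau> = (\<lambda>i\<in>{..<N}. 0)" if "\<tau> \<in> perms N" for \<tau>
    using perms_less_iff[OF that] by (auto simp: fun_eq_iff restrict_def perms_not_less[OF that])
  show ?thesis
  proof
    assume "s \<circ> \<sigma> = (\<lambda>i\<in>{..<N}. 0)"
    then have "s \<circ> \<sigma> \<circ> pinv \<sigma> = (\<lambda>i\<in>{..<N}. 0) \<circ> pinv \<sigma>" by simp
    then show "s = (\<lambda>i\<in>{..<N}. 0)" by (simp only: comp_inv_cancel[OF assms] c[OF perms_inv[OF assms]])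
  qed (simp add: c[OF assms])
qed

lemma T_w_fil: "T w \<in> word_fil n N X (Suc 0)"
  unfolding word_fil_def
proof (intro CollectI ballI)
  fix s assume s: "s \<in> words n N"
  have "(\<lambda>i. 0) \<in> exponents N (Suc 0)" by (simp add: exponents_def)
  from pol_fun_scale[OF mono_fun_in[OF this], of "if s = (\<lambda>i\<in>{..<N}. 0) then \<kappa> else 0" X]
  show "(\<lambda>\<sigma>. T w (s \<circ> pinv \<sigma>)) \<in> pol_fun N X (Suc 0)"
  proof (rule pol_fun_cong)
    fix \<sigma> assume p: "\<sigma> \<in> perms N"
    show "T w (s \<circ> pinv \<sigma>) = (if s = (\<lambda>i\<in>{..<N}. 0) then \<kappa> else 0) * mono_fun N X (\<lambda>i. 0) \<sigma>"
      unfolding T_w[OF words_comp[OF s perms_inv[OF p]]] zero_word_comp[OF perms_inv[OF p]] by (simp add: mono_fun_def)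
  qed
qed

definition K :: "nat => 'a set" where "K d = {x \<in> carrier V. T x \<in> word_fil n N X d}"

lemma subspace_K: "submodule (K d) complex_field V"
proof (rule V.subspaceI)
  show "\<zero>\<^bsub>V\<^esub> \<in> K d" using word_fil_cong[OF word_fil_zero, of n N "T \<zero>\<^bsub>V\<^esub>" X d] T_zero by (simp add: K_def)
  show "x \<oplus>\<^bsub>V\<^esub> y \<in> K d" if "x \<in> K d" "y \<in> K d" for x y
  proof -
    have x: "x \<in> carrier V" "T x \<in> word_fil n N X d" and y: "y \<in> carrier V" "T y \<in> word_fil n N X d"
      using that by (simp_all add: K_def)
    have "T (x \<oplus>\<^bsub>V\<^esub> y) \<in> word_fil n N X d"
      by (rule word_fil_cong[OF word_fil_add[OF x(2) y(2)] T_add[OF x(1) y(1)]])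
    then show ?thesis using V.a_closed[OF x(1) y(1)] by (simp add: K_def)
  qed
  show "c \<odot>\<^bsub>V\<^esub> x \<in> K d" if "x \<in> K d" for c x
  proof -
    have x: "x \<in> carrier V" "T x \<in> word_fil n N X d" using that by (simp_all add: K_def)
    have "T (c \<odot>\<^bsub>V\<^esub> x) \<in> word_fil n N X d"
      by (rule word_fil_cong[OF word_fil_scale[OF x(2)] T_scale[OF x(1)]])
    then show ?thesis using V.smult_in[OF x(1)] by (simp add: K_def)
  qed
qed (auto simp: K_def)

lemma K_mono: "d \<le> e ==> K d \<subseteq> K e"
  by (auto simp: K_def intro: word_fil_mono)

lemma act_V: "A \<in> sl n ==> x \<in> carrier V ==> act V (A, f) x \<in> carrier V"
  by (rule linear_repD(1)[OF lin]) simp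

lemma act_K:
  assumes "A \<in> sl n" "x \<in> K d" shows "act V (A, monom 1 k) x \<in> K (d + k)"
proof -
  have x: "x \<in> carrier V" "T x \<in> word_fil n N X d" using assms(2) by (simp_all add: K_def)
  have "T (act V (A, monom 1 k) x) \<in> word_fil n N X (d + k)"
    by (rule word_fil_cong[OF word_fil_loop_act[OF x(2)] T_act[OF assms(1) x(1)]])
  then show ?thesis using act_V[OF assms(1) x(1)] by (simp add: K_def)
qed

lemma mons_K: "mons d \<subseteq> K (Suc d)"
proof
  fix y assume "y \<in> mons d"
  then obtain xs where xs: "y = foldr (\<lambda>(x, k). act V (x, monom 1 k)) xs w" "set xs \<subseteq> n_minus n \<times> UNIV" "sum_list (map snd xs) = d"
    unfolding mons_def by (elim CollectE exE conjE) (rule that; assumption)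
  have "foldr (\<lambda>(x, k). act V (x, monom 1 k)) xs w \<in> K (Suc (sum_list (map snd xs)))" using xs(2)
  proof (induction xs)
    case Nil show ?case using w T_w_fil by (simp add: K_def)
  next
    case (Cons p xs)
    obtain A k where p: "p = (A, k)" by (cases p)
    have "A \<in> sl n" using Cons.prems p by (simp add: n_minus_sl)
    from act_K[OF this Cons.IH, of k] show ?case using Cons.prems p by (simp add: add.commute)
  qed
  then show "y \<in> K (Suc d)" using xs by simp
qed

lemma mons_V: "mons d \<subseteq> carrier V"
  using mons_K by (auto simp: K_def)

lemma U_orbit_eq: "U_orbit n V w d = lin_span V (mons d)"
  by (simp add: U_orbit_def mons_def)

lemma U_orbit_K: "U_orbit n V w d \<subseteq> K (Suc d)"
  unfolding U_orbit_eq by (rule V.lin_span_least[OF subspace_K mons_K])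

lemma orbits_K: "(\<Union>d'\<le>d. U_orbit n V w d') \<subseteq> K (Suc d)"
proof (rule UN_least)
  fix d' assume "d' \<in> {..d}"
  then show "U_orbit n V w d' \<subseteq> K (Suc d)" using U_orbit_K[of d'] K_mono[of "Suc d'" "Suc d"] by simp
qed

lemma Fil_K: "Fil d \<subseteq> K (Suc d)"
  unfolding U_filtration_def by (rule V.lin_span_least[OF subspace_K orbits_K])

lemma subspace_Fil: "submodule (Fil d) complex_field V"
  unfolding U_filtration_def
proof (rule V.subspace_lin_span)
  show "(\<Union>d'\<le>d. U_orbit n V w d') \<subseteq> carrier V" using orbits_K[of d] unfolding K_def by blast
qed

lemma U_orbit_Fil: "d' \<le> d ==> U_orbit n V w d' \<subseteq> Fil d"
proof -
  assume "d' \<le> d"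
  then have "U_orbit n V w d' \<subseteq> (\<Union>d'\<le>d. U_orbit n V w d')" by blast
  also have "\<dots> \<subseteq> Fil d" unfolding U_filtration_def by (rule V.lin_span_superset)
  finally show ?thesis .
qed

lemma Fil_mono: "d \<le> e ==> Fil d \<subseteq> Fil e"
proof -
  assume de: "d \<le> e"
  have "(\<Union>d'\<le>d. U_orbit n V w d') \<subseteq> Fil e"
    by (rule UN_least, rule U_orbit_Fil) (use de in simp)
  from V.lin_span_least[OF subspace_Fil this] show ?thesis by (simp only: U_filtration_def)
qed

text \<open>The source and target subspaces may differ, as the operators shift the filtration; it
  suffices to check the spanning set.\<close>

lemma act_lin_span:
  assumes g: "g \<in> sl n \<times> UNIV" and H: "submodule H complex_field V" and S: "S \<subseteq> carrier V" "!!x. x \<in> S ==> act V g x \<in> H"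
    and x: "x \<in> lin_span V S"
  shows "act V g x \<in> H"
proof -
  note L = linear_repD[OF lin g] and D = V.subspaceD[OF H]
  have "lin_span V S \<subseteq> {x \<in> carrier V. act V g x \<in> H}"
  proof (rule V.lin_span_least)
    show "submodule {x \<in> carrier V. act V g x \<in> H} complex_field V"
    proof (rule V.subspaceI)
      have "act V g \<zero>\<^bsub>V\<^esub> = \<zero>\<^bsub>V\<^esub>"
        using L(3)[OF V.zero_closed, of 0] L(1)[OF V.zero_closed] by simp
      then show "\<zero>\<^bsub>V\<^esub> \<in> {x \<in> carrier V. act V g x \<in> H}" using D(2) by simp
      show "x \<oplus>\<^bsub>V\<^esub> y \<in> {x \<in> carrier V. act V g x \<in> H}"
        if "x \<in> {x \<in> carrier V. act V g x \<in> H}" "y \<in> {x \<in> carrier V. act V g x \<in> H}" for x y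
        using that D(3)[of "act V g x" "act V g y"] by (simp add: L(2))
      show "c \<odot>\<^bsub>V\<^esub> x \<in> {x \<in> carrier V. act V g x \<in> H}" if "x \<in> {x \<in> carrier V. act V g x \<in> H}" for c x
        using that D(4)[of "act V g x" c] by (simp add: L(3))
    qed auto
    show "S \<subseteq> {x \<in> carrier V. act V g x \<in> H}" using S by auto
  qed
  then show ?thesis using x by auto
qed

lemma act_Fil:
  assumes A: "A \<in> n_minus n" and x: "x \<in> Fil d" shows "act V (A, monom 1 k) x \<in> Fil (d + k)"
proof -
  have g: "(A, monom 1 k) \<in> sl n \<times> UNIV" using n_minus_sl[OF A] by simp
  have orb: "act V (A, monom 1 k) y \<in> Fil (d + k)" if d': "d' \<le> d" and y: "y \<in> U_orbit n V w d'" for d' y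
  proof -
    have "act V (A, monom 1 k) y \<in> U_orbit n V w (d' + k)" unfolding U_orbit_eq
    proof (rule act_lin_span[OF g V.subspace_lin_span[OF mons_V] mons_V _ y[unfolded U_orbit_eq]])
      fix z assume "z \<in> mons d'"
      then obtain xs where xs: "z = foldr (\<lambda>(x, k). act V (x, monom 1 k)) xs w" "set xs \<subseteq> n_minus n \<times> UNIV" "sum_list (map snd xs) = d'"
        unfolding mons_def by (elim CollectE exE conjE) (rule that; assumption)
      have "act V (A, monom 1 k) z = foldr (\<lambda>(x, k). act V (x, monom 1 k)) ((A, k) # xs) w" by (simp add: xs(1))
      then have "act V (A, monom 1 k) z \<in> mons (d' + k)" unfolding mons_def
        using xs(2,3) A by (intro CollectI exI[of _ "(A, k) # xs"]) simp
      then show "act V (A, monom 1 k) z \<in> lin_span V (mons (d' + k))" using V.lin_span_superset by (rule subsetD[rotated])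
    qed
    then show ?thesis using U_orbit_Fil[of "d' + k" "d + k"] d' by auto
  qed
  show ?thesis
  proof (rule act_lin_span[OF g subspace_Fil _ _ x[unfolded U_filtration_def]])
    show "(\<Union>d'\<le>d. U_orbit n V w d') \<subseteq> carrier V" using orbits_K[of d] unfolding K_def by blast
    fix y assume "y \<in> (\<Union>d'\<le>d. U_orbit n V w d')"
    then obtain d' where "d' \<le> d" "y \<in> U_orbit n V w d'" by blast
    then show "act V (A, monom 1 k) y \<in> Fil (d + k)" by (rule orb)
  qed
qed

text \<open>Agreement is required on words only, which makes the set closed under changing a
  function elsewhere, as \<open>generated_words\<close> demands.\<close>

definition \<G> :: "nat => ((nat => nat) => complex) set" where
  "\<G> d = {\<psi>. \<exists>x\<in>Fil d. \<forall>s\<in>words n N. \<psi> s = T x s}"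

lemma \<G>I: "x \<in> Fil d ==> (!!s. s \<in> words n N ==> \<psi> s = T x s) ==> \<psi> \<in> \<G> d"
  unfolding \<G>_def by blast

lemma \<G>E: assumes "\<psi> \<in> \<G> d" obtains x where "x \<in> Fil d" "x \<in> carrier V" "\<forall>s\<in>words n N. \<psi> s = T x s"
proof -
  obtain x where x: "x \<in> Fil d" "\<forall>s\<in>words n N. \<psi> s = T x s" using assms unfolding \<G>_def by blast
  show thesis by (rule that[OF x(1) subsetD[OF V.subspaceD(1)[OF subspace_Fil] x(1)] x(2)])
qed

sublocale gen: generated_words n N X \<G>
proof
  note D = V.subspaceD[OF subspace_Fil]
  show "(\<lambda>s. \<psi> s + \<psi>' s) \<in> \<G> d" if p: "\<psi> \<in> \<G> d" "\<psi>' \<in> \<G> d" for \<psi> \<psi>' d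
  proof -
    obtain x where x: "x \<in> Fil d" "x \<in> carrier V" "\<forall>s\<in>words n N. \<psi> s = T x s" by (rule \<G>E[OF p(1)])
    obtain y where y: "y \<in> Fil d" "y \<in> carrier V" "\<forall>s\<in>words n N. \<psi>' s = T y s" by (rule \<G>E[OF p(2)])
    show ?thesis by (rule \<G>I[OF D(3)[OF x(1) y(1)]]) (simp add: x(3) y(3) T_add[OF x(2) y(2)])
  qed
  show "(\<lambda>s. c * \<psi> s) \<in> \<G> d" if p: "\<psi> \<in> \<G> d" for c \<psi> d
  proof -
    obtain x where x: "x \<in> Fil d" "x \<in> carrier V" "\<forall>s\<in>words n N. \<psi> s = T x s" by (rule \<G>E[OF p])
    show ?thesis by (rule \<G>I[OF D(4)[OF x(1), of c]]) (simp add: x(3) T_scale[OF x(2)])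
  qed
  show "\<psi> \<in> \<G> e" if p: "\<psi> \<in> \<G> d" and de: "d \<le> e" for \<psi> d e
  proof -
    obtain x where x: "x \<in> Fil d" "x \<in> carrier V" "\<forall>s\<in>words n N. \<psi> s = T x s" by (rule \<G>E[OF p])
    show ?thesis by (rule \<G>I[OF subsetD[OF Fil_mono[OF de] x(1)]]) (simp add: x(3))
  qed
  show "\<psi>' \<in> \<G> d" if p: "\<psi> \<in> \<G> d" and e: "!!s. s \<in> words n N ==> \<psi>' s = \<psi> s" for \<psi> \<psi>' d
  proof -
    obtain x where x: "x \<in> Fil d" "x \<in> carrier V" "\<forall>s\<in>words n N. \<psi> s = T x s" by (rule \<G>E[OF p])
    show ?thesis by (rule \<G>I[OF x(1)]) (simp add: e x(3))
  qed
  show "(\<lambda>s. if s = (\<lambda>i\<in>{..<N}. 0) then 1 else 0) \<in> \<G> 0"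
  proof -
    have "w \<in> mons 0" unfolding mons_def by (intro CollectI exI[of _ "[]"]) simp
    then have "w \<in> U_orbit n V w 0" unfolding U_orbit_eq using V.lin_span_superset by (rule subsetD[rotated])
    then have "w \<in> Fil 0" using U_orbit_Fil[OF order_refl] by (rule subsetD[rotated])
    from D(4)[OF this, of "inverse \<kappa>"] show ?thesis
      by (rule \<G>I) (simp add: T_scale[OF w] T_w kappa)
  qed
  show "(\<lambda>s. \<Sum>i<N. if s i = c then X i ^ k * \<psi> (s(i := 0)) else 0) \<in> \<G> (d + k)" if p: "\<psi> \<in> \<G> d" and c: "0 < c" "c < n" for \<psi> d c k
  proof -
    obtain x where x: "x \<in> Fil d" "x \<in> carrier V" "\<forall>s\<in>words n N. \<psi> s = T x s" by (rule \<G>E[OF p])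
    note E = elem_mat_n_minus[OF c(1), of n]
    show ?thesis
    proof (rule \<G>I[OF act_Fil[OF E x(1), of k]])
      fix s assume s: "s \<in> words n N"
      show "(\<Sum>i<N. if s i = c then X i ^ k * \<psi> (s(i := 0)) else 0) = T (act V (elem_mat n c 0, monom 1 k) x) s"
        unfolding T_act[OF n_minus_sl[OF E] x(2) s] loop_act_elem_mat[OF s n]
        by (rule sum.cong[OF refl]) (simp add: x(3) words_upd[OF s _ n])
    qed
  qed
qed

text \<open>The inclusion into \<open>K\<close> counts degrees. Conversely the generation argument
  finds an element of the filtration with the same values on words, and injectivity of
  \<open>T\<close> identifies it with \<open>x\<close>.\<close>

lemma Fil_eq: "Fil d = K (Suc d)"
proof (rule equalityI[OF Fil_K subsetI])
  fix x assume x: "x \<in> K (Suc d)"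
  then have "T x \<in> \<G> d" by (intro gen.word_fil_in) (simp add: K_def)
  then obtain y where y: "y \<in> Fil d" "y \<in> carrier V" "\<forall>s\<in>words n N. T x s = T y s" by (rule \<G>E)
  have "x = y" by (rule T_ext) (use x y in \<open>simp_all add: K_def\<close>)
  then show "x \<in> Fil d" using y(1) by simp
qed

lemma K_0: "K 0 = {\<zero>\<^bsub>V\<^esub>}"
proof (intro equalityI subsetI)
  fix x assume "x \<in> K 0"
  then have x: "x \<in> carrier V" "\<forall>s\<in>words n N. T x s = 0" unfolding K_def word_fil_0 by auto
  have "x = \<zero>\<^bsub>V\<^esub>" by (rule T_ext) (use x in \<open>simp_all add: T_zero\<close>)
  then show "x \<in> {\<zero>\<^bsub>V\<^esub>}" by simp
next
  fix x assume "x \<in> {\<zero>\<^bsub>V\<^esub>}"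
  then show "x \<in> K 0" using V.subspaceD(2)[OF subspace_K] by simp
qed

text \<open>The strict degree bound in \<open>K\<close> absorbs the separate convention for degree
  \<open>0\<close>.\<close>

lemma lower_eq: "(case d of 0 => {\<zero>\<^bsub>V\<^esub>} | Suc e => Fil e) = K d"
  by (cases d) (simp_all add: K_0 Fil_eq)

end

section \<open>Irreducible modules and evaluation modules\<close>

definition schur_iso :: "nat => (complex mat, 'v) rep => 'v => nat list =>
    ('v => (nat => nat) => (nat => nat) => complex) => bool" where
  "schur_iso n V v \<nu> f \<longleftrightarrow> bij_betw f (carrier V) (schur_space n \<nu>)
     \<and> (\<forall>x\<in>carrier V. \<forall>y\<in>carrier V. f (x \<oplus>\<^bsub>V\<^esub> y) = (\<lambda>s t. f x s t + f y s t))
     \<and> (\<forall>c. \<forall>x\<in>carrier V. f (c \<odot>\<^bsub>V\<^esub> x) = (\<lambda>s t. c * f x s t))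
     \<and> (\<forall>A\<in>sl n. \<forall>x\<in>carrier V. f (act V A x) = schur_act n (sum_list \<nu>) A (f x))
     \<and> f v = schur_hwv n \<nu>"

lemma exists_schur_iso:
  assumes "irreducible_sl_module n V" "highest_weight_vector n (partition_weight n \<nu>) V v"
    and "sorted_wrt (\<ge>) \<nu>" "length \<nu> \<le> n" "1 \<le> n"
  shows "\<exists>f. schur_iso n V v \<nu> f"
proof (rule irreducible_highest_weight_unique[OF assms(1) irreducible_schur_rep[OF assms(3-5)] assms(2) schur_highest_weight_vector[OF assms(3-5)]], goal_cases)
  case (1 f)
  then show ?thesis
    unfolding schur_iso_def by (intro exI[of _ f]) (simp add: schur_rep_def)
qed

lemma schur_isoD:
  assumes "schur_iso n V v \<nu> f"
  shows "bij_betw f (carrier V) (schur_space n \<nu>)"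
    and "x \<in> carrier V ==> y \<in> carrier V ==> f (x \<oplus>\<^bsub>V\<^esub> y) = (\<lambda>s t. f x s t + f y s t)"
    and "x \<in> carrier V ==> f (c \<odot>\<^bsub>V\<^esub> x) = (\<lambda>s t. c * f x s t)"
    and "A \<in> sl n ==> x \<in> carrier V ==> f (act V A x) = schur_act n (sum_list \<nu>) A (f x)"
    and "f v = schur_hwv n \<nu>"
  using assms by (simp_all add: schur_iso_def)

lemma schur_iso_zero:
  assumes V: "module complex_field V" and f: "schur_iso n V v \<nu> f" and x: "x \<in> carrier V" "f x = (\<lambda>s t. 0)"
  shows "x = \<zero>\<^bsub>V\<^esub>"
proof -
  interpret cspace V by (rule cspaceI[OF V])
  have "f \<zero>\<^bsub>V\<^esub> = (\<lambda>s t. 0)" using schur_isoD(3)[OF f zero_closed, of 0] by simp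
  then show ?thesis using inj_onD[OF bij_betw_imp_inj_on[OF schur_isoD(1)[OF f]], of x "\<zero>\<^bsub>V\<^esub>"] x by simp
qed

lemma module_with_act:
  assumes "module complex_field V" shows "module complex_field (with_act V \<alpha>)"
proof -
  interpret cspace V by (rule cspaceI[OF assms])
  have "abelian_group (with_act V \<alpha>)"
  proof (rule abelian_groupI)
    fix x assume "x \<in> carrier (with_act V \<alpha>)"
    then show "\<exists>y\<in>carrier (with_act V \<alpha>). y \<oplus>\<^bsub>with_act V \<alpha>\<^esub> x = \<zero>\<^bsub>with_act V \<alpha>\<^esub>"
      by (intro bexI[of _ "\<ominus>\<^bsub>V\<^esub> x"]) (simp_all add: with_act_def l_neg)
  next
    fix x y assume "x \<in> carrier (with_act V \<alpha>)" "y \<in> carrier (with_act V \<alpha>)"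
    then show "x \<oplus>\<^bsub>with_act V \<alpha>\<^esub> y = y \<oplus>\<^bsub>with_act V \<alpha>\<^esub> x" by (simp add: with_act_def a_comm)
  qed (simp_all add: with_act_def a_assoc)
  then show ?thesis
    by (rule moduleI[OF domain.axioms(1)[OF field.axioms(1)[OF field_complex_field]]])
       (simp_all add: with_act_def smult_add_left smult_add_right smult_smult)
qed

lemma linear_rep_sl_module: "sl_module n V ==> linear_rep (sl n) V"
  by (simp add: sl_module_def linear_rep_def)

lemma linear_rep_restrict_to_sl:
  "linear_rep (sl n \<times> UNIV) V ==> linear_rep (sl n) (restrict_to_sl V)"
  using module_with_act[of V "\<lambda>x. act V (x, 1)"]
  by (simp add: linear_rep_def restrict_to_sl_def) (simp add: with_act_def)

lemma linear_rep_eval_module: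
  assumes "linear_rep (sl n) V" shows "linear_rep (sl n \<times> UNIV) (eval_module V a)"
proof -
  interpret cspace V by (rule linear_rep_cspace[OF assms])
  note L = linear_repD[OF assms]
  have "module complex_field (eval_module V a)" unfolding eval_module_def
    by (rule module_with_act) (rule module_axioms)
  moreover have "poly f a \<odot>\<^bsub>V\<^esub> (c \<odot>\<^bsub>V\<^esub> x) = c \<odot>\<^bsub>V\<^esub> (poly f a \<odot>\<^bsub>V\<^esub> x)" if "x \<in> carrier V" for f c x
    using that by (simp add: smult_smult mult.commute)
  ultimately show ?thesis unfolding linear_rep_def
    by (simp add: eval_module_def with_act_def L smult_add_right)
qed

abbreviation row_word :: "nat => nat => nat" where "row_word k \<equiv> (\<lambda>i\<in>{..<k}. 0)"

text \<open>A single row has only one tabloid. Its Specht module is thus trivial, and an element of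
  the corresponding Schur space is determined by its values at \<open>row_word\<close>: a symmetric
  function on words.\<close>

lemma tabloid_row: assumes "T \<in> tableaux [k]" shows "tabloid [k] T = row_word k"
proof -
  have "fst (T i) = 0" if "i < k" for i
  proof -
    have "T i \<in> T ` {..<sum_list [k]}" using that by simp
    then have "T i \<in> cells [k]" using assms by (simp only: tableaux_def bij_betw_def mem_Collect_eq)
    then show ?thesis by (cases "T i") (simp add: cells_def)
  qed
  then show ?thesis by (simp add: tabloid_def fun_eq_iff restrict_def)
qed

lemma specht_row: "u \<in> specht_fun [k] ==> t \<noteq> row_word k ==> u t = 0"
proof -
  assume u: "u \<in> specht_fun [k]" and t: "t \<noteq> row_word k"
  have "t \<notin> tabloid [k] ` tableaux [k]"
  proof
    assume "t \<in> tabloid [k] ` tableaux [k]"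
    then obtain T where "t = tabloid [k] T" "T \<in> tableaux [k]" by (rule imageE)
    then show False using t tabloid_row[of T k] by simp
  qed
  then show "u t = 0" by (rule specht_fun_outside[OF u])
qed

text \<open>Every one-row polytabloid is the indicator of the only tabloid, so the defining sum
  counts the tableaux.\<close>

lemma schur_hwv_row:
  assumes "s \<in> words n k"
  shows "schur_hwv n [k] s (row_word k) = (if s = row_word k then of_nat (card (ext_tableaux [k])) else 0)"
proof -
  have "polytab [k] T s * polytab [k] T (row_word k) = (if s = row_word k then 1 else 0)" if "T \<in> ext_tableaux [k]" for T
  proof -
    have T: "T \<in> tableaux [k]" using that by (simp add: ext_tableaux_def)
    show ?thesis using polytab_self[OF T] specht_row[OF polytab_in_specht_fun[OF that], of s]
      by (simp add: tabloid_row[OF T])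
  qed
  then have "(\<Sum>T\<in>ext_tableaux [k]. polytab [k] T s * polytab [k] T (row_word k)) = (\<Sum>T\<in>ext_tableaux [k]. if s = row_word k then 1 else 0)"
    by (rule sum.cong[OF refl])
  then show ?thesis using assms by (simp add: schur_hwv_def)
qed

lemma tensor_word_model:
  fixes \<pi> :: "nat list => (complex mat, 'v) rep"
  assumes n: "1 \<le> n" and pos: "\<forall>k\<in>set \<mu>. 0 < k" and len: "length a = length \<mu>"
    and irr: "!!k. k \<in> set \<mu> ==> irreducible_sl_module n (\<pi> [k]) \<and>
           highest_weight_vector n (partition_weight n [k]) (\<pi> [k]) (v [k])"
  shows "\<exists>T \<kappa>. word_model n (sum_list \<mu>) (base_point \<mu> a) (tensor_list (eval_factors \<pi> \<mu> a)) T
     (pure_tensor (eval_factors \<pi> \<mu> a) (map (\<lambda>k. v [k]) \<mu>)) \<kappa>"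
proof -
  let ?Vs = "eval_factors \<pi> \<mu> a" and ?m = "length \<mu>"
  define F where "F k = (SOME f. schur_iso n (\<pi> [k]) (v [k]) [k] f)" for k
  have F: "schur_iso n (\<pi> [k]) (v [k]) [k] (F k)" if "k \<in> set \<mu>" for k
    unfolding F_def
    by (rule someI_ex[OF exists_schur_iso]) (use irr[OF that] n in simp_all)
  have mem: "\<mu> ! j \<in> set \<mu>" if "j < ?m" for j using that by simp
  have Vsj: "?Vs ! j = eval_module (\<pi> [\<mu> ! j]) (a ! j)" if "j < ?m" for j
    using that len by (simp add: eval_factors_def)
  have ev: "carrier (eval_module V b) = carrier V" "add (eval_module V b) = add V" "module.smult (eval_module V b) = module.smult V"
    "zero (eval_module V b) = zero V" "act (eval_module V b) (A, f) x = poly f b \<odot>\<^bsub>V\<^esub> act V A x"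
    for V :: "(complex mat, 'v) rep" and b A f x by (simp_all add: eval_module_def with_act_def)
  have slm: "sl_module n (\<pi> [\<mu> ! j])" if "j < ?m" for j
    using irr[OF mem[OF that]] by (simp add: irreducible_sl_module_def)
  \<comment> \<open>Evaluating at the only tabloid of a row realizes the factor as symmetric
    functions on words of length \<open>\<mu> ! j\<close>, the symmetric power inside the tensor
    power.\<close>
  define \<theta> where "\<theta> j x u = F (\<mu> ! j) x u (row_word (\<mu> ! j))" for j x u
  interpret word_tensor n \<mu> a ?Vs \<theta>
  proof
    show "length a = ?m" by (rule len)
    show "length ?Vs = ?m" using len by (simp add: eval_factors_def)
    fix j assume j: "j < ?m"
    note Fj = schur_isoD[OF F[OF mem[OF j]]]
    show "linear_rep (sl n \<times> UNIV) (?Vs ! j)"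
      unfolding Vsj[OF j] by (rule linear_rep_eval_module[OF linear_rep_sl_module[OF slm[OF j]]])
    show "\<theta> j (x \<oplus>\<^bsub>?Vs ! j\<^esub> y) = (\<lambda>u. \<theta> j x u + \<theta> j y u)" if "x \<in> carrier (?Vs ! j)" "y \<in> carrier (?Vs ! j)" for x y
      using that by (simp add: Vsj[OF j] ev \<theta>_def Fj fun_eq_iff)
    show "\<theta> j (c \<odot>\<^bsub>?Vs ! j\<^esub> x) = (\<lambda>u. c * \<theta> j x u)" if "x \<in> carrier (?Vs ! j)" for c x
      using that by (simp add: Vsj[OF j] ev \<theta>_def Fj fun_eq_iff)
    show "x = \<zero>\<^bsub>?Vs ! j\<^esub>" if x: "x \<in> carrier (?Vs ! j)" and z: "!!u. u \<in> words n (\<mu> ! j) ==> \<theta> j x u = 0" for x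
    proof -
      have xc: "x \<in> carrier (\<pi> [\<mu> ! j])" using x by (simp add: Vsj[OF j] ev)
      then have S: "F (\<mu> ! j) x \<in> schur_space n [\<mu> ! j]" by (rule bij_betw_apply[OF Fj(1)])
      have sp: "F (\<mu> ! j) x s = (\<lambda>t. 0)" if "s \<notin> words n (\<mu> ! j)" for s
        using S that by (simp add: schur_space_def)
      have sp': "F (\<mu> ! j) x s \<in> specht_fun [\<mu> ! j]" if "s \<in> words n (\<mu> ! j)" for s
        using S that by (simp add: schur_space_def)
      have "F (\<mu> ! j) x = (\<lambda>s t. 0)"
      proof (intro ext)
        fix s t
        show "F (\<mu> ! j) x s t = 0"
        proof (cases "s \<in> words n (\<mu> ! j)")
          case True
          then show ?thesis using z[OF True] specht_row[OF sp'[OF True], of t] by (cases "t = row_word (\<mu> ! j)") (simp_all add: \<theta>_def)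
        qed (simp add: sp)
      qed
      moreover have "module complex_field (\<pi> [\<mu> ! j])" using slm[OF j] by (simp add: sl_module_def)
      ultimately have "x = \<zero>\<^bsub>\<pi> [\<mu> ! j]\<^esub>" using schur_iso_zero[OF _ F[OF mem[OF j]] xc] by simp
      then show ?thesis by (simp add: Vsj[OF j] ev)
    qed
    show "\<theta> j (act (?Vs ! j) (A, f) x) u = poly f (a ! j) * word_act n (\<mu> ! j) A (\<theta> j x) u"
      if A: "A \<in> sl n" and x: "x \<in> carrier (?Vs ! j)" and u: "u \<in> words n (\<mu> ! j)" for A f x u
    proof -
      have xc: "x \<in> carrier (\<pi> [\<mu> ! j])" using x by (simp add: Vsj[OF j] ev)
      have "act (\<pi> [\<mu> ! j]) A x \<in> carrier (\<pi> [\<mu> ! j])" by (rule linear_repD(1)[OF linear_rep_sl_module[OF slm[OF j]] A xc])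
      then show ?thesis using u by (simp add: Vsj[OF j] ev \<theta>_def[abs_def] Fj(3) Fj(4)[OF A xc] schur_act_def)
    qed
  qed
  have tup: "map (\<lambda>k. v [k]) \<mu> \<in> tuples ?Vs" unfolding tuples_iff
  proof (intro conjI allI impI)
    fix j assume j: "j < ?m"
    have "v [\<mu> ! j] \<in> carrier (\<pi> [\<mu> ! j])" using irr[OF mem[OF j]] by (simp add: highest_weight_vector_def)
    then show "map (\<lambda>k. v [k]) \<mu> ! j \<in> carrier (?Vs ! j)" using j by (simp add: Vsj[OF j] ev)
  qed simp
  have zero: "s = row_word N \<longleftrightarrow> (\<forall>j<?m. block \<mu> j s = row_word (\<mu> ! j))" if s: "s \<in> words n N" for s
  proof
    assume e: "s = row_word N"
    show "\<forall>j<?m. block \<mu> j s = row_word (\<mu> ! j)"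
    proof (intro allI impI ext)
      fix j i assume "j < ?m"
      then show "block \<mu> j s i = row_word (\<mu> ! j) i" using offset_less[of j \<mu> i] by (simp add: block_def e)
    qed
  next
    assume e: "\<forall>j<?m. block \<mu> j s = row_word (\<mu> ! j)"
    have "s i = 0" if i: "i < N" for i
    proof -
      obtain j i' where j: "j < ?m" "i' < \<mu> ! j" "i = offset \<mu> j + i'" using blocks_cover[OF i] by blast
      have "block \<mu> j s i' = 0" using e j by simp
      then show ?thesis using j by (simp add: block_def)
    qed
    then show "s = row_word N" using s by (auto simp: words_def PiE_def extensional_def fun_eq_iff)
  qed
  \<comment> \<open>Each highest weight vector takes the value
    \<open>card (ext_tableaux [k])\<close> at the zero word, and these values multiply over the
    factors.\<close>
  define \<kappa> where "\<kappa> = (\<Prod>j<?m. of_nat (card (ext_tableaux [\<mu> ! j])) :: complex)"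
  have k0: "\<kappa> \<noteq> 0"
  proof -
    have "card (ext_tableaux \<nu>) \<noteq> 0" for \<nu> using exists_ext_tableau[of \<nu>] finite_ext_tableaux[of \<nu>] by auto
    then show ?thesis by (simp add: \<kappa>_def)
  qed
  have pt: "(\<Prod>j<?m. \<theta> j (map (\<lambda>k. v [k]) \<mu> ! j) (block \<mu> j s)) = (if s = row_word N then \<kappa> else 0)"
    if s: "s \<in> words n N" for s
  proof -
    have f: "\<theta> j (map (\<lambda>k. v [k]) \<mu> ! j) (block \<mu> j s) =
        (if block \<mu> j s = row_word (\<mu> ! j) then of_nat (card (ext_tableaux [\<mu> ! j])) else 0)" if j: "j < ?m" for j
      using schur_hwv_row[OF block_words[OF s j]] j by (simp add: \<theta>_def schur_isoD(5)[OF F[OF mem[OF j]]])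
    show ?thesis
    proof (cases "s = row_word N")
      case True
      then have "block \<mu> j s = row_word (\<mu> ! j)" if "j < ?m" for j using zero[OF s] that by simp
      then show ?thesis using f True by (simp add: \<kappa>_def)
    next
      case False
      then have "\<not> (\<forall>j<?m. block \<mu> j s = row_word (\<mu> ! j))" by (simp only: zero[OF s] not_False_eq_True)
      then obtain j where j: "j < ?m" "block \<mu> j s \<noteq> row_word (\<mu> ! j)" by auto
      have "\<theta> j (map (\<lambda>k. v [k]) \<mu> ! j) (block \<mu> j s) = 0" using f[OF j(1)] j(2) by simp
      then show ?thesis using False j(1) by (auto intro!: prod_zero)
    qed
  qed
  show ?thesis
  proof (rule tensor_coordinates, goal_cases)
    case T: (1 T)
    show ?thesis
    proof (intro exI[of _ T] exI[of _ \<kappa>], rule word_model.intro)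
      show "0 < n" using n by simp
      show "T (pure_tensor ?Vs (map (\<lambda>k. v [k]) \<mu>)) s = (if s = row_word N then \<kappa> else 0)" if "s \<in> words n N" for s
        by (simp only: T(8)[OF tup that] pt[OF that])
    qed (fact T(1-6) T(7)[OF tup] k0)+
  qed
qed

section \<open>The components of the graded tensor product\<close>

lemma schur_spaceI:
  assumes "!!s. s \<notin> words n (sum_list \<nu>) ==> \<phi> s = (\<lambda>t. 0)" "!!s. s \<in> words n (sum_list \<nu>) ==> \<phi> s \<in> specht_fun \<nu>"
    "!!\<sigma> s t. \<sigma> \<in> perms (sum_list \<nu>) ==> s \<in> words n (sum_list \<nu>) ==> \<phi> (s \<circ> \<sigma>) (t \<circ> \<sigma>) = \<phi> s t"
  shows "\<phi> \<in> schur_space n \<nu>"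
  using assms by (simp add: schur_space_def)

text \<open>The data in a fixed degree: \<open>\<gamma>\<close> gives coordinates on the component
  of the orbit ring, \<open>f\<close> identifies the irreducible modules with Schur spaces, and
  \<open>h\<close> gives coordinates on their tensor products with the multiplicity spaces.\<close>

locale graded_component = word_model n N X V T w \<kappa>
  for n N X and V :: "(complex mat \<times> complex poly, 'a) rep" and T w \<kappa> +
  fixes d :: nat and P :: "nat list => (complex mat, 'v) rep" and hw :: "nat list => 'v"
    and M :: "nat list => (complex, 'm) module" and B :: "nat list => 'm set"
    and \<gamma> :: "((nat => nat) => complex) => nat list => 'm => (nat => nat) => complex"
    and f :: "nat list => 'v => (nat => nat) => (nat => nat) => complex"
    and h :: "nat list => ('v \<times> 'm \<Rightarrow>\<^sub>0 complex) set => 'm => (nat => nat) \<times> (nat => nat) => complex"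
  assumes gamma_add: "!!F F'. F \<in> pol_fun N X (Suc d) ==> F' \<in> pol_fun N X (Suc d) ==>
       \<gamma> (\<lambda>\<sigma>. F \<sigma> + F' \<sigma>) = (\<lambda>\<nu> b t. \<gamma> F \<nu> b t + \<gamma> F' \<nu> b t)"
    and gamma_scale: "!!c F. F \<in> pol_fun N X (Suc d) ==> \<gamma> (\<lambda>\<sigma>. c * F \<sigma>) = (\<lambda>\<nu> b t. c * \<gamma> F \<nu> b t)"
    and gamma_kernel: "!!F. F \<in> pol_fun N X (Suc d) ==> \<gamma> F = (\<lambda>\<nu> b t. 0) \<longleftrightarrow> F \<in> pol_fun N X d"
    and gamma_comp: "!!\<tau> F \<nu> b t. \<tau> \<in> perms N ==> F \<in> pol_fun N X (Suc d) ==> \<gamma> (\<lambda>\<sigma>. F (\<sigma> \<circ> \<tau>)) \<nu> b t = \<gamma> F \<nu> b (t \<circ> \<tau>)"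
    and gamma_image: "\<gamma> ` pol_fun N X (Suc d) = mult_family_space N B"
    and f: "!!\<nu>. \<nu> \<in> partitions N ==> length \<nu> \<le> n ==> schur_iso n (P \<nu>) (hw \<nu>) \<nu> (f \<nu>)"
    and h: "!!\<nu>. \<nu> \<in> partitions N ==> length \<nu> \<le> n ==>
       mult_iso (sl n) (P \<nu>) (M \<nu>) (\<lambda>x (s, t). f \<nu> x s t) (B \<nu>) (h \<nu>)"
begin

abbreviation "\<Lambda> \<equiv> {\<nu> \<in> partitions N. length \<nu> \<le> n}"
abbreviation "PF \<equiv> pol_fun N X (Suc d)"
abbreviation "R \<equiv> (restrict_to_sl V)\<lparr>carrier := Fil d\<rparr>"
abbreviation "MT \<nu> \<equiv> mult_tensor (P \<nu>) (M \<nu>)"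

definition slice :: "'a => (nat => nat) => (nat => nat) => complex" where
  "slice x s \<sigma> = T x (s \<circ> pinv \<sigma>)"

text \<open>For a fixed partition and basis vector of its multiplicity space, this is the function
  from words to the Specht module obtained from the symbol of \<open>x\<close>, that is, from its
  slices modulo lower degree.\<close>

definition \<phi> :: "'a => nat list => 'm => (nat => nat) => (nat => nat) => complex" where
  "\<phi> x \<nu> b s t = (if s \<in> words n N then \<gamma> (slice x s) \<nu> b t else 0)"

lemma Fil_V: "x \<in> Fil d ==> x \<in> carrier V"
  by (simp add: Fil_eq K_def)

lemma slice_in: "x \<in> Fil d ==> s \<in> words n N ==> slice x s \<in> PF"
  unfolding Fil_eq K_def slice_def[abs_def] by (simp add: word_fil_def)

lemma gamma_eq:
  assumes "F \<in> PF" "F' \<in> PF" shows "\<gamma> F = \<gamma> F' \<longleftrightarrow> (\<lambda>\<sigma>. F \<sigma> - F' \<sigma>) \<in> pol_fun N X d"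
proof -
  have "\<gamma> (\<lambda>\<sigma>. F \<sigma> + (- 1) * F' \<sigma>) = (\<lambda>\<nu> b t. \<gamma> F \<nu> b t + (- 1) * \<gamma> F' \<nu> b t)"
    by (simp only: gamma_add[OF assms(1) pol_fun_scale[OF assms(2)]] gamma_scale[OF assms(2)])
  then have "\<gamma> (\<lambda>\<sigma>. F \<sigma> - F' \<sigma>) = (\<lambda>\<nu> b t. \<gamma> F \<nu> b t - \<gamma> F' \<nu> b t)" by simp
  then show ?thesis using gamma_kernel[OF pol_fun_diff[OF assms]] by (simp add: fun_eq_iff)
qed

lemma gamma_cong:
  assumes "F \<in> PF" "!!\<sigma>. \<sigma> \<in> perms N ==> F' \<sigma> = F \<sigma>" shows "\<gamma> F' = \<gamma> F"
proof -
  have "F' \<in> PF" by (rule pol_fun_cong[OF assms])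
  moreover have "(\<lambda>\<sigma>. F' \<sigma> - F \<sigma>) \<in> pol_fun N X d" by (rule pol_fun_cong[OF pol_fun_zero]) (simp add: assms(2))
  ultimately show ?thesis using gamma_eq assms(1) by simp
qed

lemma gamma_sum:
  assumes "finite I" "!!i. i \<in> I ==> F i \<in> PF"
  shows "\<gamma> (\<lambda>\<sigma>. \<Sum>i\<in>I. c i * F i \<sigma>) = (\<lambda>\<nu> b t. \<Sum>i\<in>I. c i * \<gamma> (F i) \<nu> b t)"
  using assms
proof (induction I)
  case empty
  show ?case using gamma_kernel[OF pol_fun_zero] pol_fun_zero by simp
next
  case (insert i I)
  have "(\<lambda>\<sigma>. \<Sum>i\<in>I. c i * F i \<sigma>) \<in> PF" by (intro pol_fun_sum pol_fun_scale insert.prems) simp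
  from gamma_add[OF pol_fun_scale[OF insert.prems[OF insertI1], of "c i"] this] show ?case
    using insert by (simp add: gamma_scale)
qed

lemma gamma_family: "F \<in> PF ==> \<gamma> F \<in> mult_family_space N B"
  using gamma_image by blast

lemma gamma_specht: "F \<in> PF ==> \<nu> \<in> partitions N ==> \<gamma> F \<nu> \<in> coords_space (specht_fun \<nu>) (B \<nu>)"
  using gamma_family by (simp add: mult_family_space_def)

lemma partitionsD: "\<nu> \<in> partitions N ==> sum_list \<nu> = N" "\<nu> \<in> partitions N ==> sorted_wrt (\<ge>) \<nu>" "\<nu> \<in> partitions N ==> 0 \<notin> set \<nu>"
  by (simp_all add: partitions_def)

lemma slice_comp:
  assumes "\<tau> \<in> perms N" "\<sigma> \<in> perms N"
  shows "slice x (s \<circ> \<tau>) \<sigma> = slice x s (\<sigma> \<circ> pinv \<tau>)"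
  using assms by (simp add: slice_def inv_comp_perms[OF assms(2) perms_inv[OF assms(1)]] comp_assoc)

text \<open>Passing from \<open>s\<close> to \<open>s \<circ> \<tau>\<close> translates the slice by
  the inverse of \<open>\<tau>\<close>, and \<open>\<gamma>\<close> converts translation into
  composition of the tabloid.\<close>

lemma phi_in:
  assumes x: "x \<in> Fil d" and nu: "\<nu> \<in> partitions N" shows "\<phi> x \<nu> b \<in> schur_space n \<nu>"
proof (rule schur_spaceI, unfold partitionsD(1)[OF nu])
  show "\<phi> x \<nu> b s = (\<lambda>t. 0)" if "s \<notin> words n N" for s using that by (simp add: \<phi>_def[abs_def] fun_eq_iff)
  show "\<phi> x \<nu> b s \<in> specht_fun \<nu>" if "s \<in> words n N" for s
    using gamma_specht[OF slice_in[OF x that] nu] that by (simp add: \<phi>_def[abs_def] coords_space_def)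
  show "\<phi> x \<nu> b (s \<circ> \<tau>) (t \<circ> \<tau>) = \<phi> x \<nu> b s t" if t: "\<tau> \<in> perms N" and s: "s \<in> words n N" for \<tau> s t
  proof -
    note F = slice_in[OF x s]
    have "\<gamma> (slice x (s \<circ> \<tau>)) = \<gamma> (\<lambda>\<sigma>. slice x s (\<sigma> \<circ> pinv \<tau>))"
      by (rule gamma_cong[OF pol_fun_comp[OF perms_inv[OF t] F] slice_comp[OF t]])
    then have "\<gamma> (slice x (s \<circ> \<tau>)) \<nu> b (t \<circ> \<tau>) = \<gamma> (slice x s) \<nu> b (t \<circ> \<tau> \<circ> pinv \<tau>)"
      by (simp only: gamma_comp[OF perms_inv[OF t] F])
    then show ?thesis using s words_comp[OF s t] by (simp only: \<phi>_def if_True comp_inv_cancel[OF t])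
  qed
qed

lemma h_props:
  assumes "\<nu> \<in> \<Lambda>"
  shows "bij_betw (h \<nu>) (carrier (MT \<nu>)) (coords_space ((\<lambda>x (s, t). f \<nu> x s t) ` carrier (P \<nu>)) (B \<nu>))"
    and "y \<in> carrier (MT \<nu>) ==> y' \<in> carrier (MT \<nu>) ==>
      y \<oplus>\<^bsub>MT \<nu>\<^esub> y' \<in> carrier (MT \<nu>) \<and> h \<nu> (y \<oplus>\<^bsub>MT \<nu>\<^esub> y') = (\<lambda>b j. h \<nu> y b j + h \<nu> y' b j)"
    and "y \<in> carrier (MT \<nu>) ==> c \<odot>\<^bsub>MT \<nu>\<^esub> y \<in> carrier (MT \<nu>) \<and> h \<nu> (c \<odot>\<^bsub>MT \<nu>\<^esub> y) = (\<lambda>b j. c * h \<nu> y b j)"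
    and "A \<in> sl n ==> y \<in> carrier (MT \<nu>) ==> act (MT \<nu>) A y \<in> carrier (MT \<nu>)"
    and "A \<in> sl n ==> y \<in> carrier (MT \<nu>) ==> v \<in> carrier (P \<nu>) ==> h \<nu> y b = (\<lambda>(s, t). f \<nu> v s t) ==>
      h \<nu> (act (MT \<nu>) A y) b = (\<lambda>(s, t). f \<nu> (act (P \<nu>) A v) s t)"
  using h[of \<nu>] assms unfolding mult_iso_def Let_def by simp_all

lemma schur_lift:
  assumes "\<nu> \<in> \<Lambda>" "g \<in> schur_space n \<nu>" shows "\<exists>v\<in>carrier (P \<nu>). f \<nu> v = g"
proof -
  have "f \<nu> ` carrier (P \<nu>) = schur_space n \<nu>"
    using schur_isoD(1)[OF f[of \<nu>]] assms(1) by (simp add: bij_betw_def)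
  then have "g \<in> f \<nu> ` carrier (P \<nu>)" using assms(2) by simp
  then obtain v where "g = f \<nu> v" "v \<in> carrier (P \<nu>)" by (rule imageE)
  then show ?thesis by (intro bexI[of _ v]) simp_all
qed

definition \<Phi> :: "'a => nat list => 'm => (nat => nat) \<times> (nat => nat) => complex" where
  "\<Phi> x \<nu> b = (\<lambda>(s, t). \<phi> x \<nu> b s t)"

text \<open>For each word finitely many basis vectors occur, and there are finitely many words, so
  the family has finite support.\<close>

lemma Phi_in:
  assumes x: "x \<in> Fil d" and nu: "\<nu> \<in> \<Lambda>"
  shows "\<Phi> x \<nu> \<in> coords_space ((\<lambda>x (s, t). f \<nu> x s t) ` carrier (P \<nu>)) (B \<nu>)"
proof -
  have p: "\<nu> \<in> partitions N" using nu by simp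
  note C = gamma_specht[OF slice_in[OF x] p, unfolded coords_space_def]
  have "{b. \<Phi> x \<nu> b \<noteq> (\<lambda>j. 0)} \<subseteq> (\<Union>s\<in>words n N. {b. \<gamma> (slice x s) \<nu> b \<noteq> (\<lambda>t. 0)})"
  proof
    fix b assume b: "b \<in> {b. \<Phi> x \<nu> b \<noteq> (\<lambda>j. 0)}"
    show "b \<in> (\<Union>s\<in>words n N. {b. \<gamma> (slice x s) \<nu> b \<noteq> (\<lambda>t. 0)})"
    proof (rule ccontr)
      assume "b \<notin> (\<Union>s\<in>words n N. {b. \<gamma> (slice x s) \<nu> b \<noteq> (\<lambda>t. 0)})"
      then have "\<phi> x \<nu> b s t = 0" for s t by (simp add: \<phi>_def)
      then have "\<Phi> x \<nu> b = (\<lambda>j. 0)" by (simp add: \<Phi>_def fun_eq_iff)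
      then show False using b by simp
    qed
  qed
  moreover have "finite (\<Union>s\<in>words n N. {b. \<gamma> (slice x s) \<nu> b \<noteq> (\<lambda>t. 0)})"
    by (rule finite_UN_I[OF finite_words]) (use C in simp)
  ultimately have fin: "finite {b. \<Phi> x \<nu> b \<noteq> (\<lambda>j. 0)}" by (rule finite_subset)
  have "\<Phi> x \<nu> b \<in> (\<lambda>x (s, t). f \<nu> x s t) ` carrier (P \<nu>)" for b
  proof -
    obtain v where "v \<in> carrier (P \<nu>)" "f \<nu> v = \<phi> x \<nu> b" using schur_lift[OF nu phi_in[OF x p]] by (rule bexE)
    then show ?thesis by (intro rev_image_eqI[of v]) (simp_all add: \<Phi>_def)
  qed
  moreover have "\<Phi> x \<nu> b = (\<lambda>j. 0)" if "b \<notin> B \<nu>" for b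
    using C that by (simp add: \<Phi>_def \<phi>_def fun_eq_iff)
  ultimately show ?thesis using fin by (simp add: coords_space_def)
qed

lemma R_simps: "carrier R = Fil d" "add R = add V" "module.smult R = module.smult V" "zero R = zero V"
  "act R A x = act V (A, 1) x" "act (restrict_to_sl V) A x = act V (A, 1) x"
  by (simp_all add: restrict_to_sl_def with_act_def)

lemma act_one_K: "A \<in> sl n ==> x \<in> K e ==> act V (A, 1) x \<in> K e"
  using act_K[of A x e 0] by (simp add: monom_0 flip: one_pCons)

lemma linear_rep_RV: "linear_rep (sl n) (restrict_to_sl V)"
  by (rule linear_rep_restrict_to_sl[OF lin])

lemma stable_K_RV: "stable_subspace (sl n) (restrict_to_sl V) (K e)"
proof -
  interpret RV: cspace "restrict_to_sl V" by (rule linear_rep_cspace[OF linear_rep_RV])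
  note D = V.subspaceD[OF subspace_K[of e]]
  have "submodule (K e) complex_field (restrict_to_sl V)"
    by (rule RV.subspaceI) (use D in \<open>simp_all add: restrict_to_sl_def with_act_def\<close>)
  then show ?thesis unfolding stable_subspace_def
    using act_one_K by (simp add: restrict_to_sl_def with_act_def)
qed

lemma linear_rep_R: "linear_rep (sl n) R"
  unfolding Fil_eq by (rule linear_rep_restrict[OF linear_rep_RV stable_K_RV])

sublocale R: stable_quot "sl n" R "K d"
proof
  interpret R: cspace R by (rule linear_rep_cspace[OF linear_rep_R])
  show "linear_rep (sl n) R" by (rule linear_rep_R)
  note D = V.subspaceD[OF subspace_K[of d]]
  have "K d \<subseteq> Fil d" unfolding Fil_eq by (rule K_mono) simp
  then have "submodule (K d) complex_field R"
    by (intro R.subspaceI) (use D in \<open>simp_all add: R_simps\<close>)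
  then show "stable_subspace (sl n) R (K d)" unfolding stable_subspace_def R_simps using act_one_K by simp
qed

lemma phi_add: "x \<in> Fil d ==> y \<in> Fil d ==> \<phi> (x \<oplus>\<^bsub>V\<^esub> y) \<nu> b s t = \<phi> x \<nu> b s t + \<phi> y \<nu> b s t"
proof -
  assume x: "x \<in> Fil d" and y: "y \<in> Fil d"
  have "slice (x \<oplus>\<^bsub>V\<^esub> y) s = (\<lambda>\<sigma>. slice x s \<sigma> + slice y s \<sigma>)"
    by (simp add: slice_def fun_eq_iff T_add[OF Fil_V[OF x] Fil_V[OF y]])
  then show ?thesis using gamma_add[OF slice_in[OF x] slice_in[OF y]] by (simp add: \<phi>_def)
qed

lemma phi_scale: "x \<in> Fil d ==> \<phi> (c \<odot>\<^bsub>V\<^esub> x) \<nu> b s t = c * \<phi> x \<nu> b s t"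
proof -
  assume x: "x \<in> Fil d"
  have "slice (c \<odot>\<^bsub>V\<^esub> x) s = (\<lambda>\<sigma>. c * slice x s \<sigma>)"
    by (simp add: slice_def fun_eq_iff T_scale[OF Fil_V[OF x]])
  then show ?thesis using gamma_scale[OF slice_in[OF x]] by (simp add: \<phi>_def)
qed

text \<open>For \<open>f = 1\<close> the coefficients of the action on slices do not involve
  \<open>X\<close>, so the linear map \<open>\<gamma>\<close> commutes with it.\<close>

lemma phi_act:
  assumes A: "A \<in> sl n" and x: "x \<in> Fil d"
  shows "\<phi> (act V (A, 1) x) \<nu> b = schur_act n N A (\<phi> x \<nu> b)"
proof (intro ext)
  fix s t
  show "\<phi> (act V (A, 1) x) \<nu> b s t = schur_act n N A (\<phi> x \<nu> b) s t"
  proof (cases "s \<in> words n N")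
    case s: True
    have up: "s(l := c) \<in> words n N" if "l \<in> {..<N}" "c \<in> {..<n}" for l c using words_upd[OF s, of l c] that by simp
    have inner: "(\<lambda>\<sigma>. \<Sum>c\<in>{..<n}. A $$ (s l, c) * slice x (s(l := c)) \<sigma>) \<in> PF" if "l \<in> {..<N}" for l
      by (intro pol_fun_sum pol_fun_scale slice_in[OF x up[OF that]])
    have "\<gamma> (slice (act V (A, 1) x) s) = \<gamma> (\<lambda>\<sigma>. \<Sum>l\<in>{..<N}. 1 * (\<Sum>c\<in>{..<n}. A $$ (s l, c) * slice x (s(l := c)) \<sigma>))"
    proof (rule gamma_cong)
      show "(\<lambda>\<sigma>. \<Sum>l\<in>{..<N}. 1 * (\<Sum>c\<in>{..<n}. A $$ (s l, c) * slice x (s(l := c)) \<sigma>)) \<in> PF"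
        by (intro pol_fun_sum pol_fun_scale inner)
      fix \<sigma> assume p: "\<sigma> \<in> perms N"
      show "slice (act V (A, 1) x) s \<sigma> = (\<Sum>l\<in>{..<N}. 1 * (\<Sum>c\<in>{..<n}. A $$ (s l, c) * slice x (s(l := c)) \<sigma>))"
        unfolding slice_def T_act[OF A Fil_V[OF x] words_comp[OF s perms_inv[OF p]]] loop_act_comp[OF p] by simp
    qed
    also have "\<dots> = (\<lambda>\<nu> b t. \<Sum>l\<in>{..<N}. 1 * \<gamma> (\<lambda>\<sigma>. \<Sum>c\<in>{..<n}. A $$ (s l, c) * slice x (s(l := c)) \<sigma>) \<nu> b t)"
      by (rule gamma_sum[OF finite_lessThan inner])
    also have "\<dots> = (\<lambda>\<nu> b t. \<Sum>l\<in>{..<N}. \<Sum>c\<in>{..<n}. A $$ (s l, c) * \<gamma> (slice x (s(l := c))) \<nu> b t)"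
    proof (intro ext sum.cong[OF refl])
      fix \<nu> b t l assume l: "l \<in> {..<N}"
      have "\<gamma> (\<lambda>\<sigma>. \<Sum>c\<in>{..<n}. A $$ (s l, c) * slice x (s(l := c)) \<sigma>) = (\<lambda>\<nu> b t. \<Sum>c\<in>{..<n}. A $$ (s l, c) * \<gamma> (slice x (s(l := c))) \<nu> b t)"
        by (rule gamma_sum[OF finite_lessThan slice_in[OF x up[OF l]]])
      then show "1 * \<gamma> (\<lambda>\<sigma>. \<Sum>c\<in>{..<n}. A $$ (s l, c) * slice x (s(l := c)) \<sigma>) \<nu> b t = (\<Sum>c\<in>{..<n}. A $$ (s l, c) * \<gamma> (slice x (s(l := c))) \<nu> b t)"
        by simp
    qed
    finally have e: "\<gamma> (slice (act V (A, 1) x) s) = (\<lambda>\<nu> b t. \<Sum>l\<in>{..<N}. \<Sum>c\<in>{..<n}. A $$ (s l, c) * \<gamma> (slice x (s(l := c))) \<nu> b t)" .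
    have "\<phi> (act V (A, 1) x) \<nu> b s t = (\<Sum>l\<in>{..<N}. \<Sum>c\<in>{..<n}. A $$ (s l, c) * \<gamma> (slice x (s(l := c))) \<nu> b t)"
      by (simp add: \<phi>_def s e)
    also have "\<dots> = word_act n N A (\<lambda>s. \<phi> x \<nu> b s t) s"
      unfolding word_act_def by (rule sum.cong[OF refl], rule sum.cong[OF refl]) (simp add: \<phi>_def up)
    finally show ?thesis by (simp add: schur_act_def s)
  qed (simp add: \<phi>_def schur_act_def)
qed

text \<open>Components for partitions with more than \<open>n\<close> parts vanish by
  \<open>schur_space_long\<close>, so equality on the remaining ones is equality of all classes of
  slices, and this is congruence modulo functions of smaller degree.\<close>

lemma phi_eq:
  assumes x: "x \<in> Fil d" and y: "y \<in> Fil d"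
  shows "(\<forall>\<nu>\<in>\<Lambda>. \<Phi> x \<nu> = \<Phi> y \<nu>) \<longleftrightarrow> x \<ominus>\<^bsub>R\<^esub> y \<in> K d"
proof -
  have "(\<forall>\<nu>\<in>\<Lambda>. \<Phi> x \<nu> = \<Phi> y \<nu>) \<longleftrightarrow> (\<forall>s\<in>words n N. \<gamma> (slice x s) = \<gamma> (slice y s))"
  proof
    assume e: "\<forall>\<nu>\<in>\<Lambda>. \<Phi> x \<nu> = \<Phi> y \<nu>"
    show "\<forall>s\<in>words n N. \<gamma> (slice x s) = \<gamma> (slice y s)"
    proof (intro ballI ext)
      fix s \<nu> b t assume s: "s \<in> words n N"
      show "\<gamma> (slice x s) \<nu> b t = \<gamma> (slice y s) \<nu> b t"
      proof (cases "\<nu> \<in> partitions N")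
        case p: True
        have "\<phi> x \<nu> b = \<phi> y \<nu> b"
        proof (cases "length \<nu> \<le> n")
          case True
          then have "\<Phi> x \<nu> = \<Phi> y \<nu>" using e p by simp
          then show ?thesis unfolding \<Phi>_def by (intro ext) (simp add: fun_eq_iff)
        next
          case False
          have "\<phi> z \<nu> b = (\<lambda>s t. 0)" if "z \<in> Fil d" for z
            by (rule schur_space_long[OF partitionsD(2,3)[OF p] _ phi_in[OF that p]]) (use False in simp)
          then show ?thesis using x y by simp
        qed
        then have "\<phi> x \<nu> b s t = \<phi> y \<nu> b s t" by simp
        then show ?thesis using s by (simp add: \<phi>_def)
      next
        case False
        then show ?thesis using gamma_family[OF slice_in[OF x s]] gamma_family[OF slice_in[OF y s]]
          by (simp add: mult_family_space_def)
      qed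
    qed
  next
    assume e: "\<forall>s\<in>words n N. \<gamma> (slice x s) = \<gamma> (slice y s)"
    then have "\<phi> x \<nu> b s t = \<phi> y \<nu> b s t" for \<nu> b s t by (simp add: \<phi>_def)
    then show "\<forall>\<nu>\<in>\<Lambda>. \<Phi> x \<nu> = \<Phi> y \<nu>" by (simp add: \<Phi>_def fun_eq_iff)
  qed
  also have "\<dots> \<longleftrightarrow> (\<forall>s\<in>words n N. (\<lambda>\<sigma>. slice x s \<sigma> - slice y s \<sigma>) \<in> pol_fun N X d)"
    by (rule ball_cong[OF refl]) (rule gamma_eq[OF slice_in[OF x] slice_in[OF y]])
  also have "\<dots> \<longleftrightarrow> x \<ominus>\<^bsub>R\<^esub> y \<in> K d"
  proof -
    have xy: "x \<in> carrier V" "y \<in> carrier V" using x y Fil_V by simp_all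
    have d: "x \<ominus>\<^bsub>R\<^esub> y = x \<oplus>\<^bsub>V\<^esub> (- 1) \<odot>\<^bsub>V\<^esub> y" using R.diff_eq_smult[of x y] x y by (simp add: R_simps)
    have "T (x \<ominus>\<^bsub>R\<^esub> y) s = T x s - T y s" for s
      unfolding d using xy by (simp add: T_add T_scale)
    moreover have "x \<ominus>\<^bsub>R\<^esub> y \<in> carrier V" unfolding d using xy by simp
    ultimately show ?thesis by (simp add: K_def word_fil_def slice_def)
  qed
  finally show ?thesis .
qed

text \<open>For every word choose a polynomial function with the prescribed coordinates. The choices
  need not fit together to one function on words; their average over \<open>S_N\<close> does, and
  equivariance of \<open>q\<close> shows that averaging leaves the coordinates unchanged.\<close>

lemma phi_surj:
  assumes q: "!!\<nu>. \<nu> \<in> \<Lambda> ==> q \<nu> \<in> coords_space ((\<lambda>x (s, t). f \<nu> x s t) ` carrier (P \<nu>)) (B \<nu>)"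
  shows "\<exists>x\<in>Fil d. \<forall>\<nu>\<in>\<Lambda>. \<Phi> x \<nu> = q \<nu>"
proof -
  have sch: "(\<lambda>s t. q \<nu> b (s, t)) \<in> schur_space n \<nu>" if nu: "\<nu> \<in> \<Lambda>" for \<nu> b
  proof -
    have "q \<nu> b \<in> (\<lambda>x (s, t). f \<nu> x s t) ` carrier (P \<nu>)" using q[OF nu] by (simp add: coords_space_def)
    then obtain v where v: "q \<nu> b = (\<lambda>(s, t). f \<nu> v s t)" "v \<in> carrier (P \<nu>)" by (rule imageE)
    have "f \<nu> v \<in> schur_space n \<nu>" using nu by (intro bij_betw_apply[OF schur_isoD(1)[OF f] v(2)]) simp_all
    then show ?thesis by (simp add: v(1))
  qed
  have qs: "q \<nu> b (s, t) = 0" if "\<nu> \<in> \<Lambda>" "s \<notin> words n N" for \<nu> b s t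
  proof -
    have "(\<lambda>t. q \<nu> b (s, t)) = (\<lambda>t. 0)" using sch[OF that(1), of b] that partitionsD(1)[of \<nu>] by (simp add: schur_space_def)
    then show ?thesis by (rule fun_cong)
  qed
  have qc: "q \<nu> b (s \<circ> \<rho>, t \<circ> \<rho>) = q \<nu> b (s, t)" if "\<nu> \<in> \<Lambda>" "s \<in> words n N" "\<rho> \<in> perms N" for \<nu> b s t \<rho>
    using sch[OF that(1), of b] that partitionsD(1)[of \<nu>] by (simp add: schur_space_def)
  \<comment> \<open>Extended by zero to the partitions with more than \<open>n\<close> parts, so
    that the full family lies in the image of \<open>\<gamma>\<close>.\<close>
  define Q where "Q s = (\<lambda>\<nu> b t. if \<nu> \<in> \<Lambda> then q \<nu> b (s, t) else 0)" for s
  have Qin: "Q s \<in> mult_family_space N B" if s: "s \<in> words n N" for s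
    unfolding mult_family_space_def
  proof (intro CollectI conjI ballI allI impI)
    fix \<nu> assume p: "\<nu> \<in> partitions N"
    show "Q s \<nu> \<in> coords_space (specht_fun \<nu>) (B \<nu>)"
    proof (cases "\<nu> \<in> \<Lambda>")
      case True
      note c = q[OF True, unfolded coords_space_def]
      have e: "Q s \<nu> = (\<lambda>b t. q \<nu> b (s, t))" unfolding Q_def using True by (simp only: if_True)
      have "{b. (\<lambda>t. q \<nu> b (s, t)) \<noteq> (\<lambda>t. 0)} \<subseteq> {b. q \<nu> b \<noteq> (\<lambda>j. 0)}" by auto
      then have "finite {b. (\<lambda>t. q \<nu> b (s, t)) \<noteq> (\<lambda>t. 0)}" by (rule finite_subset) (use c in simp)
      moreover have "(\<lambda>t. q \<nu> b (s, t)) \<in> specht_fun \<nu>" for b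
        using sch[OF True, of b] s partitionsD(1)[OF p] by (simp add: schur_space_def)
      moreover have "(\<lambda>t. q \<nu> b (s, t)) = (\<lambda>t. 0)" if "b \<notin> B \<nu>" for b using c that by simp
      ultimately show ?thesis unfolding e coords_space_def by simp
    next
      case False
      then have e: "Q s \<nu> = (\<lambda>b t. 0)" unfolding Q_def by (simp only: if_False)
      show ?thesis unfolding e coords_space_def by (simp add: specht_fun_zero)
    qed
  next
    fix \<nu> assume "\<nu> \<notin> partitions N"
    then show "Q s \<nu> = (\<lambda>b t. 0)" by (simp add: Q_def)
  qed
  have "\<forall>s\<in>words n N. \<exists>F. F \<in> PF \<and> \<gamma> F = Q s"
  proof
    fix s assume s: "s \<in> words n N"
    have "Q s \<in> \<gamma> ` PF" unfolding gamma_image by (rule Qin[OF s])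
    then obtain F where "Q s = \<gamma> F" "F \<in> PF" by (rule imageE)
    then show "\<exists>F. F \<in> PF \<and> \<gamma> F = Q s" by (intro exI[of _ F]) simp
  qed
  from bchoice[OF this] obtain F where "\<forall>s\<in>words n N. F s \<in> PF \<and> \<gamma> (F s) = Q s" by (rule exE)
  then have F: "!!s. s \<in> words n N ==> F s \<in> PF" "!!s. s \<in> words n N ==> \<gamma> (F s) = Q s" by simp_all
  define i where "i = inverse (of_nat (card (perms N)) :: complex)"
  \<comment> \<open>The slice of \<open>\<psi>\<close> at \<open>s\<close> is the average of the
    translates of the chosen functions along the orbit of \<open>s\<close>, each still of degree at
    most \<open>d\<close>.\<close>
  define \<psi> where "\<psi> r = (\<Sum>\<tau>\<in>perms N. i * F (r \<circ> \<tau>) \<tau>)" for r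
  have psi: "\<psi> (s \<circ> pinv \<sigma>) = (\<Sum>\<rho>\<in>perms N. i * F (s \<circ> \<rho>) (\<sigma> \<circ> \<rho>))" if "\<sigma> \<in> perms N" for s \<sigma>
  proof -
    have "\<psi> (s \<circ> pinv \<sigma>) = (\<Sum>\<rho>\<in>perms N. i * F (s \<circ> pinv \<sigma> \<circ> (\<sigma> \<circ> \<rho>)) (\<sigma> \<circ> \<rho>))"
      unfolding \<psi>_def by (rule sum_perms_comp_left[OF that, symmetric])
    also have "\<dots> = (\<Sum>\<rho>\<in>perms N. i * F (s \<circ> \<rho>) (\<sigma> \<circ> \<rho>))"
      by (simp only: comp_assoc[symmetric] comp_inv_cancel[OF that])
    finally show ?thesis .
  qed
  have PFr: "(\<lambda>\<sigma>. F (s \<circ> \<rho>) (\<sigma> \<circ> \<rho>)) \<in> PF" if "s \<in> words n N" "\<rho> \<in> perms N" for s \<rho>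
    by (rule pol_fun_comp[OF that(2) F(1)[OF words_comp[OF that]]])
  have sumPF: "(\<lambda>\<sigma>. \<Sum>\<rho>\<in>perms N. i * F (s \<circ> \<rho>) (\<sigma> \<circ> \<rho>)) \<in> PF" if "s \<in> words n N" for s
    by (rule pol_fun_sum, rule pol_fun_scale, rule PFr[OF that])
  have "\<psi> \<in> word_fil n N X (Suc d)" unfolding word_fil_def
    by (intro CollectI ballI) (rule pol_fun_cong[OF sumPF psi])
  then obtain x where x: "x \<in> Fil d" "x \<in> carrier V" "\<forall>s\<in>words n N. \<psi> s = T x s"
    by (rule \<G>E[OF gen.word_fil_in])
  have "\<Phi> x \<nu> = q \<nu>" if nu: "\<nu> \<in> \<Lambda>" for \<nu>
  proof (intro ext)
    fix b and st :: "(nat => nat) \<times> (nat => nat)"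
    obtain s t where st: "st = (s, t)" by (rule prod.exhaust)
    show "\<Phi> x \<nu> b st = q \<nu> b st"
    proof (cases "s \<in> words n N")
      case s: True
      have "\<gamma> (slice x s) = \<gamma> (\<lambda>\<sigma>. \<Sum>\<rho>\<in>perms N. i * F (s \<circ> \<rho>) (\<sigma> \<circ> \<rho>))"
      proof (rule gamma_cong[OF sumPF[OF s]])
        fix \<sigma> assume p: "\<sigma> \<in> perms N"
        show "slice x s \<sigma> = (\<Sum>\<rho>\<in>perms N. i * F (s \<circ> \<rho>) (\<sigma> \<circ> \<rho>))"
          using x(3) words_comp[OF s perms_inv[OF p]] by (simp add: slice_def flip: psi[OF p])
      qed
      also have "\<dots> = (\<lambda>\<nu> b t. \<Sum>\<rho>\<in>perms N. i * \<gamma> (\<lambda>\<sigma>. F (s \<circ> \<rho>) (\<sigma> \<circ> \<rho>)) \<nu> b t)"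
        by (rule gamma_sum[OF finite_perms PFr[OF s]])
      finally have "\<gamma> (slice x s) \<nu> b t = (\<Sum>\<rho>\<in>perms N. i * \<gamma> (\<lambda>\<sigma>. F (s \<circ> \<rho>) (\<sigma> \<circ> \<rho>)) \<nu> b t)" by simp
      also have "\<dots> = (\<Sum>\<rho>\<in>perms N. i * q \<nu> b (s, t))"
      proof (rule sum.cong[OF refl])
        fix \<rho> assume r: "\<rho> \<in> perms N"
        have "\<gamma> (\<lambda>\<sigma>. F (s \<circ> \<rho>) (\<sigma> \<circ> \<rho>)) \<nu> b t = Q (s \<circ> \<rho>) \<nu> b (t \<circ> \<rho>)"
          by (simp only: gamma_comp[OF r F(1)[OF words_comp[OF s r]]] F(2)[OF words_comp[OF s r]])
        also have "\<dots> = q \<nu> b (s \<circ> \<rho>, t \<circ> \<rho>)" unfolding Q_def using nu by (simp only: if_True)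
        also have "\<dots> = q \<nu> b (s, t)" by (rule qc[OF nu s r])
        finally show "i * \<gamma> (\<lambda>\<sigma>. F (s \<circ> \<rho>) (\<sigma> \<circ> \<rho>)) \<nu> b t = i * q \<nu> b (s, t)" by simp
      qed
      also have "\<dots> = q \<nu> b (s, t)" using card_perms_nonzero[of N] by (simp add: i_def)
      finally show ?thesis by (simp add: \<Phi>_def \<phi>_def s st)
    next
      case False
      then show ?thesis using qs[OF nu False] by (simp add: \<Phi>_def \<phi>_def st)
    qed
  qed
  then show ?thesis using x(1) by blast
qed

lemma rep_iso_graded_component:
  "rep_iso (sl n) (gr_piece (restrict_to_sl V) Fil d) (direct_sum \<Lambda> MT)"
proof -
  let ?W = "direct_sum \<Lambda> MT"
  have W: "carrier ?W = PiE \<Lambda> (\<lambda>\<nu>. carrier (MT \<nu>))" by (simp add: direct_sum_def)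
  have comp: "y \<nu> \<in> carrier (MT \<nu>)" if "y \<in> carrier ?W" "\<nu> \<in> \<Lambda>" for y \<nu>
    using that(1) unfolding W by (rule PiE_mem) (rule that(2))
  have "gr_piece (restrict_to_sl V) Fil d = quot_rep R (K d)"
  proof -
    have "zero (restrict_to_sl V) = zero V" by (simp add: restrict_to_sl_def with_act_def)
    then show ?thesis by (simp only: gr_piece_def lower_eq)
  qed
  moreover have "rep_iso (sl n) (quot_rep R (K d)) ?W"
  \<comment> \<open>An element of the filtered piece corresponds to the tuple of tensors with the
    same coordinates.\<close>
  proof (rule R.quot_iso_of_relation[where R = "\<lambda>x y. \<forall>\<nu>\<in>\<Lambda>. h \<nu> (y \<nu>) = \<Phi> x \<nu>"])
    fix x assume "x \<in> carrier R"
    then have x: "x \<in> Fil d" by (simp add: R_simps)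
    define y where "y = (\<lambda>\<nu>\<in>\<Lambda>. inv_into (carrier (MT \<nu>)) (h \<nu>) (\<Phi> x \<nu>))"
    have im: "\<Phi> x \<nu> \<in> h \<nu> ` carrier (MT \<nu>)" if "\<nu> \<in> \<Lambda>" for \<nu>
      using Phi_in[OF x that] h_props(1)[OF that] by (simp add: bij_betw_def)
    have "y \<in> carrier ?W" unfolding W y_def using inv_into_into[OF im] by simp
    moreover have "h \<nu> (y \<nu>) = \<Phi> x \<nu>" if "\<nu> \<in> \<Lambda>" for \<nu>
      using f_inv_into_f[OF im[OF that]] that by (simp add: y_def)
    ultimately show "\<exists>y\<in>carrier ?W. \<forall>\<nu>\<in>\<Lambda>. h \<nu> (y \<nu>) = \<Phi> x \<nu>" by (intro bexI[of _ y]) simp_all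
  next
    fix y assume y: "y \<in> carrier ?W"
    have "\<exists>x\<in>Fil d. \<forall>\<nu>\<in>\<Lambda>. \<Phi> x \<nu> = h \<nu> (y \<nu>)"
      by (rule phi_surj) (rule bij_betw_apply[OF h_props(1) comp[OF y]])
    then obtain x where "x \<in> Fil d" "\<forall>\<nu>\<in>\<Lambda>. \<Phi> x \<nu> = h \<nu> (y \<nu>)" by (rule bexE)
    then show "\<exists>x\<in>carrier R. \<forall>\<nu>\<in>\<Lambda>. h \<nu> (y \<nu>) = \<Phi> x \<nu>" by (intro bexI[of _ x]) (simp_all add: R_simps)
  next
    fix x x' y y'
    assume x: "x \<in> carrier R" "x' \<in> carrier R" and y: "y \<in> carrier ?W" "y' \<in> carrier ?W"
      and e: "\<forall>\<nu>\<in>\<Lambda>. h \<nu> (y \<nu>) = \<Phi> x \<nu>" "\<forall>\<nu>\<in>\<Lambda>. h \<nu> (y' \<nu>) = \<Phi> x' \<nu>"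
    have xx: "x \<in> Fil d" "x' \<in> Fil d" using x by (simp_all add: R_simps)
    have "y = y' \<longleftrightarrow> (\<forall>\<nu>\<in>\<Lambda>. y \<nu> = y' \<nu>)"
    proof
      assume e: "\<forall>\<nu>\<in>\<Lambda>. y \<nu> = y' \<nu>"
      show "y = y'" by (rule PiE_ext[OF y[unfolded W]]) (rule bspec[OF e])
    qed simp
    also have "\<dots> \<longleftrightarrow> (\<forall>\<nu>\<in>\<Lambda>. \<Phi> x \<nu> = \<Phi> x' \<nu>)"
    proof (rule ball_cong[OF refl])
      fix \<nu> assume nu: "\<nu> \<in> \<Lambda>"
      have "h \<nu> (y \<nu>) = h \<nu> (y' \<nu>) \<longleftrightarrow> y \<nu> = y' \<nu>"
        by (rule inj_on_eq_iff[OF bij_betw_imp_inj_on[OF h_props(1)[OF nu]] comp[OF y(1) nu] comp[OF y(2) nu]])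
      then show "y \<nu> = y' \<nu> \<longleftrightarrow> \<Phi> x \<nu> = \<Phi> x' \<nu>" using e nu by simp
    qed
    finally show "y = y' \<longleftrightarrow> x \<ominus>\<^bsub>R\<^esub> x' \<in> K d" by (simp only: phi_eq[OF xx])
    have "y \<oplus>\<^bsub>?W\<^esub> y' = (\<lambda>\<nu>\<in>\<Lambda>. y \<nu> \<oplus>\<^bsub>MT \<nu>\<^esub> y' \<nu>)" by (simp add: direct_sum_def)
    moreover have "(\<lambda>\<nu>\<in>\<Lambda>. y \<nu> \<oplus>\<^bsub>MT \<nu>\<^esub> y' \<nu>) \<in> carrier ?W"
      unfolding W using h_props(2)[OF _ comp[OF y(1)] comp[OF y(2)]] by (intro restrict_PiE_iff[THEN iffD2] ballI) simp
    moreover have "h \<nu> (y \<nu> \<oplus>\<^bsub>MT \<nu>\<^esub> y' \<nu>) = \<Phi> (x \<oplus>\<^bsub>V\<^esub> x') \<nu>" if nu: "\<nu> \<in> \<Lambda>" for \<nu>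
      using h_props(2)[OF nu comp[OF y(1) nu] comp[OF y(2) nu]] e nu
      by (simp add: \<Phi>_def phi_add[OF xx] fun_eq_iff)
    ultimately show "y \<oplus>\<^bsub>?W\<^esub> y' \<in> carrier ?W \<and> (\<forall>\<nu>\<in>\<Lambda>. h \<nu> ((y \<oplus>\<^bsub>?W\<^esub> y') \<nu>) = \<Phi> (x \<oplus>\<^bsub>R\<^esub> x') \<nu>)"
      by (simp add: R_simps)
  next
    fix c x y assume "x \<in> carrier R" and y: "y \<in> carrier ?W" and e: "\<forall>\<nu>\<in>\<Lambda>. h \<nu> (y \<nu>) = \<Phi> x \<nu>"
    then have x: "x \<in> Fil d" by (simp add: R_simps)
    have "c \<odot>\<^bsub>?W\<^esub> y = (\<lambda>\<nu>\<in>\<Lambda>. c \<odot>\<^bsub>MT \<nu>\<^esub> y \<nu>)" by (simp add: direct_sum_def)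
    moreover have "(\<lambda>\<nu>\<in>\<Lambda>. c \<odot>\<^bsub>MT \<nu>\<^esub> y \<nu>) \<in> carrier ?W"
      unfolding W using h_props(3)[OF _ comp[OF y]] by (intro restrict_PiE_iff[THEN iffD2] ballI) simp
    moreover have "h \<nu> (c \<odot>\<^bsub>MT \<nu>\<^esub> y \<nu>) = \<Phi> (c \<odot>\<^bsub>V\<^esub> x) \<nu>" if nu: "\<nu> \<in> \<Lambda>" for \<nu>
      using h_props(3)[OF nu comp[OF y nu]] e nu by (simp add: \<Phi>_def phi_scale[OF x] fun_eq_iff)
    ultimately show "c \<odot>\<^bsub>?W\<^esub> y \<in> carrier ?W \<and> (\<forall>\<nu>\<in>\<Lambda>. h \<nu> ((c \<odot>\<^bsub>?W\<^esub> y) \<nu>) = \<Phi> (c \<odot>\<^bsub>R\<^esub> x) \<nu>)"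
      by (simp add: R_simps)
  next
    fix A x y assume A: "A \<in> sl n" and "x \<in> carrier R" and y: "y \<in> carrier ?W" and e: "\<forall>\<nu>\<in>\<Lambda>. h \<nu> (y \<nu>) = \<Phi> x \<nu>"
    then have x: "x \<in> Fil d" by (simp add: R_simps)
    have "act ?W A y = (\<lambda>\<nu>\<in>\<Lambda>. act (MT \<nu>) A (y \<nu>))" by (simp add: direct_sum_def)
    moreover have "(\<lambda>\<nu>\<in>\<Lambda>. act (MT \<nu>) A (y \<nu>)) \<in> carrier ?W"
      unfolding W using h_props(4)[OF _ A comp[OF y]] by (intro restrict_PiE_iff[THEN iffD2] ballI) simp
    moreover have "h \<nu> (act (MT \<nu>) A (y \<nu>)) = \<Phi> (act V (A, 1) x) \<nu>" if nu: "\<nu> \<in> \<Lambda>" for \<nu>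
    proof
      fix b
      have p: "\<nu> \<in> partitions N" "length \<nu> \<le> n" using nu by simp_all
      \<comment> \<open>The action on the tensor product is known on coordinates of the form
        \<open>f \<nu> u\<close>, so the equivariant function is first lifted to the irreducible
        module.\<close>
      obtain u where u: "u \<in> carrier (P \<nu>)" "f \<nu> u = \<phi> x \<nu> b" using schur_lift[OF nu phi_in[OF x p(1)]] by (rule bexE)
      have "h \<nu> (y \<nu>) b = (\<lambda>(s, t). f \<nu> u s t)" using e nu by (simp add: \<Phi>_def u(2))
      from h_props(5)[OF nu A comp[OF y nu] u(1) this]
      show "h \<nu> (act (MT \<nu>) A (y \<nu>)) b = \<Phi> (act V (A, 1) x) \<nu> b"
        unfolding schur_isoD(4)[OF f[OF p] A u(1)] u(2) partitionsD(1)[OF p(1)] \<Phi>_def phi_act[OF A x] .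
    qed
    ultimately show "act ?W A y \<in> carrier ?W \<and> (\<forall>\<nu>\<in>\<Lambda>. h \<nu> ((act ?W A y) \<nu>) = \<Phi> (act R A x) \<nu>)"
      by (simp add: R_simps)
  qed
  ultimately show ?thesis by simp
qed

end

theorem corollary7p5:
  fixes n N :: nat
    and \<mu> :: "nat list"
    and a :: "complex list"
    and \<pi> :: "nat list \<Rightarrow> (complex mat, 'v) rep"
    and v :: "nat list \<Rightarrow> 'v"
    and M :: "nat list \<Rightarrow> nat \<Rightarrow> (complex, 'm) module"
  assumes "n \<ge> 2"
    and "\<forall>k\<in>set \<mu>. 0 < k" and "sum_list \<mu> = N"
    and "length a = length \<mu>" and "distinct a"
    and "\<And>k \<nu>. \<nu> \<in> partitions k \<Longrightarrow> length \<nu> \<le> n \<Longrightarrow>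
           irreducible_sl_module n (\<pi> \<nu>) \<and>
           highest_weight_vector n (partition_weight n \<nu>) (\<pi> \<nu>) (v \<nu>)"
    and "graded_multiplicity_spaces N (R_graded \<mu> a) M"
  shows "graded_iso (sl n) (graded_tensor_product n \<pi> v \<mu> a)
           (\<lambda>d. direct_sum {\<nu> \<in> partitions N. length \<nu> \<le> n}
                  (\<lambda>\<nu>. mult_tensor (\<pi> \<nu>) (M \<nu> d)))"
  unfolding graded_iso_def
proof
  fix d
  let ?Vs = "eval_factors \<pi> \<mu> a" and ?X = "base_point \<mu> a"
  let ?V = "tensor_list ?Vs" and ?w = "pure_tensor ?Vs (map (\<lambda>k. v [k]) \<mu>)"
  have n1: "1 \<le> n" using assms(1) by simp
  \<comment> \<open>Since \<open>k\<close> is positive, \<open>[k]\<close> is a partition of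
    \<open>k\<close>, and one row is within the length bound.\<close>
  have row: "irreducible_sl_module n (\<pi> [k]) \<and> highest_weight_vector n (partition_weight n [k]) (\<pi> [k]) (v [k])"
    if "k \<in> set \<mu>" for k
    by (rule assms(6)[of "[k]" k]) (use that assms(2) n1 in \<open>simp_all add: partitions_def\<close>)
  obtain T \<kappa> where "word_model n (sum_list \<mu>) ?X ?V T ?w \<kappa>"
  proof -
    have "\<exists>T \<kappa>. word_model n (sum_list \<mu>) ?X ?V T ?w \<kappa>" by (rule tensor_word_model[OF n1 assms(2,4)]) (rule row)
    then show ?thesis by (elim exE) (rule that)
  qed
  then interpret word_model n N ?X ?V T ?w \<kappa> by (simp only: assms(3))
  interpret O: orbit_ring \<mu> a .
  have modM: "module complex_field (M \<nu> d)" if "\<nu> \<in> partitions N" for \<nu>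
    using assms(7) that by (simp add: graded_multiplicity_spaces_def)
  have irr: "irreducible_sl_module n (\<pi> \<nu>)" "highest_weight_vector n (partition_weight n \<nu>) (\<pi> \<nu>) (v \<nu>)"
    if "\<nu> \<in> partitions N" "length \<nu> \<le> n" for \<nu> using assms(6)[OF that] by simp_all
  define f where "f \<nu> = (SOME f. schur_iso n (\<pi> \<nu>) (v \<nu>) \<nu> f)" for \<nu>
  have f: "schur_iso n (\<pi> \<nu>) (v \<nu>) \<nu> (f \<nu>)" if "\<nu> \<in> partitions N" "length \<nu> \<le> n" for \<nu>
    unfolding f_def
    by (rule someI_ex[OF exists_schur_iso[OF irr[OF that] _ that(2) n1]]) (use that(1) in \<open>simp add: partitions_def\<close>)
  show "rep_iso (sl n) (graded_tensor_product n \<pi> v \<mu> a d)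
     (direct_sum {\<nu> \<in> partitions N. length \<nu> \<le> n} (\<lambda>\<nu>. mult_tensor (\<pi> \<nu>) (M \<nu> d)))"
  proof (rule O.multiplicity_coordinates[of M d, unfolded assms(3), OF assms(7)], goal_cases)
    case g: (1 B crd \<gamma>)
    define h where "h \<nu> = (SOME h. mult_iso (sl n) (\<pi> \<nu>) (M \<nu> d) (\<lambda>x (s, t). f \<nu> x s t) (B \<nu>) h)" for \<nu>
    have ex: "\<exists>h. mult_iso (sl n) (\<pi> \<nu>) (M \<nu> d) (\<lambda>x (s, t). f \<nu> x s t) (B \<nu>) h"
      if nu: "\<nu> \<in> partitions N" "length \<nu> \<le> n" for \<nu>
    proof (rule exists_mult_iso[OF _ modM[OF nu(1)] g(1)[OF nu(1)]])
      have sl: "sl_module n (\<pi> \<nu>)" using irr(1)[OF nu] by (simp add: irreducible_sl_module_def)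
      then show "linear_rep (sl n) (\<pi> \<nu>)" by (rule linear_rep_sl_module)
      note F = schur_isoD[OF f[OF nu]]
      show "(\<lambda>(s, t). f \<nu> (x \<oplus>\<^bsub>\<pi> \<nu>\<^esub> y) s t) = (\<lambda>j. (case j of (s, t) => f \<nu> x s t) + (case j of (s, t) => f \<nu> y s t))"
        if "x \<in> carrier (\<pi> \<nu>)" "y \<in> carrier (\<pi> \<nu>)" for x y
        by (simp add: F(2)[OF that] fun_eq_iff)
      show "(\<lambda>(s, t). f \<nu> (c \<odot>\<^bsub>\<pi> \<nu>\<^esub> x) s t) = (\<lambda>j. c * (case j of (s, t) => f \<nu> x s t))"
        if "x \<in> carrier (\<pi> \<nu>)" for c x
        by (simp add: F(3)[OF that] fun_eq_iff)
      show "x = \<zero>\<^bsub>\<pi> \<nu>\<^esub>" if "x \<in> carrier (\<pi> \<nu>)" "(\<lambda>(s, t). f \<nu> x s t) = (\<lambda>j. 0)" for x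
      proof (rule schur_iso_zero[OF _ f[OF nu] that(1)])
        show "module complex_field (\<pi> \<nu>)" using sl by (simp add: sl_module_def)
        show "f \<nu> x = (\<lambda>s t. 0)" using that(2) by (simp add: fun_eq_iff)
      qed
    qed
    have h: "mult_iso (sl n) (\<pi> \<nu>) (M \<nu> d) (\<lambda>x (s, t). f \<nu> x s t) (B \<nu>) (h \<nu>)"
      if "\<nu> \<in> partitions N" "length \<nu> \<le> n" for \<nu>
      unfolding h_def by (rule someI_ex[OF ex[OF that]])
    interpret graded_component n N ?X ?V T ?w \<kappa> d \<pi> v "\<lambda>\<nu>. M \<nu> d" B \<gamma> f h
      by unfold_locales (fact g(2-) f h)+
    show ?thesis
      unfolding graded_tensor_product_def Let_def by (rule rep_iso_graded_component)
  qed
qed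

end
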